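(* Let $\mathrm{E2CE}\colon\mathbf{Esys}\to\mathbf{CEsys}$ and $\mathrm{CE2E}\colon\mathbf{CEsys}\to\mathbf{Esys}$ be the functors between the category of E-systems and the category of CE-systems described in the context. (1) The functor $\mathrm{E2CE}$ is left adjoint to the functor $\mathrm{CE2E}$. (2) The unit of the adjunction is invertible. In particular, the left adjoint $\mathrm{E2CE}$ is full and faithful and the right adjoint $\mathrm{CE2E}$ is essentially surjective on objects. (3) The counit component at a CE-system $\mathbb A$ is invertible if and only if $\mathbb A$ is rooted.
   Context: **Slice notation.** A strict category is a (small) category regarded as an algebraic structure, so that equality of objects is meaningful. For a strict category $\mathcal F$ and object $\Gamma$, $A\in\mathcal F/\Gamma$ means $A$ is an object of the slice, i.e. an arrow $A\colon\Gamma.A\to\Gamma$. For $P\in\mathcal F/\Gamma.A$, $A.P:=A\circ P\in\mathcal F/\Gamma$. We identify $(\mathcal F/\Gamma)/A$ with $\mathcal F/\Gamma.A$. **CE-systems.** A CE-system consists of two strict categories $\mathcal F,\mathcal C$ with the same objects, an identity-on-objects functor $I\colon\mathcal F\to\mathcal C$, a chosen object $1$ terminal in $\mathcal F$, and, for every $f\colon\Delta\to\Gamma$ in $\mathcal C$ and $A\in\mathcal F/\Gamma$, a choice of $f^*A\in\mathcal F/\Delta$ and of an arrow $\pi_2(f,A)\colon\Delta.f^*A\to\Gamma.A$ in $\mathcal C$ such that $I(A)\circ\pi_2(f,A)=f\circ I(f^*A)$ is a pullback square in $\mathcal C$, functorially: (a) $f^*\mathrm{id}_\Gamma=\mathrm{id}_\Delta$,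 $\pi_2(f,\mathrm{id}_\Gamma)=f$; (b) $\mathrm{id}_\Gamma^*A=A$, $\pi_2(\mathrm{id}_\Gamma,A)=\mathrm{id}_{\Gamma.A}$; (c) $(f\circ g)^*A=g^*(f^*A)$, $\pi_2(f\circ g,A)=\pi_2(f,A)\circ\pi_2(g,f^*A)$; (d) for $P\in\mathcal F/\Gamma.A$, $f^*(A.P)=f^*A\circ\pi_2(f,A)^*P$, $\pi_2(f,A.P)=\pi_2(\pi_2(f,A),P)$. Each $f$ induces a functor $f^*\colon\mathcal F/\Gamma\to\mathcal F/\Delta$. The CE-system is rooted if $1$ is terminal in $\mathcal C$. A CE-homomorphism is a pair of functors $(F_{\mathcal F},F_{\mathcal C})$ commuting with the functors $I$, with $F_{\mathcal F}(1)=1$, $F_{\mathcal F}(f^*A)=(F_{\mathcal C}f)^*(F_{\mathcal F}A)$ and $F_{\mathcal C}(\pi_2(f,A))=\pi_2(F_{\mathcal C}f,F_{\mathcal F}A)$. $\mathbf{CEsys}$ is the category of CE-systems and CE-homomorphisms. **E-systems.** A term structure on a strict category $\mathcal F$ is a family of sets $T(A)$ indexed by all arrows $A$ of $\mathcal F$; a functor with term structure is a functor $G$ with functions $T(A)\to T(G(A))$ for all arrows $A$. Slices $\mathcal F/\Gamma$ inherit the term structure (the terms of an arrow of $\mathcal F/\Gamma$ are those of the underlying arrow of $\mathcal F$); $G$ induces $G/\Gamma\colon\mathcal F/\Gamma\to\mathcal D/G(\Gamma)$. Equalities between functors with term structure are on objects, arrows and terms. A pre-E-system $\mathbb E$ is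 a strict category $\mathcal F$ with term structure $T$, a chosen terminal object $[\,]$, and: for each $A\in\mathcal F/\Gamma$ and $x\in T(A)$ a functor with term structure $S_x\colon\mathcal F/\Gamma.A\to\mathcal F/\Gamma$ with $S_x(\mathrm{id}_{\Gamma.A})=\mathrm{id}_\Gamma$; for each $A\in\mathcal F/\Gamma$ a functor with term structure $W_A\colon\mathcal F/\Gamma\to\mathcal F/\Gamma.A$ with $W_{\mathrm{id}_\Gamma}=\mathrm{id}$, $W_{A.P}=W_P\circ W_A$, $W_A(\mathrm{id}_\Gamma)=\mathrm{id}_{\Gamma.A}$; for each $A\in\mathcal F/\Gamma$ an element $\mathsf{idtm}_A\in T(W_A(A))$. A pre-E-homomorphism is a functor with term structure $H$ with $H([\,])=[\,]$, $(H/\Gamma)\circ S_x=S_{H(x)}\circ(H/\Gamma.A)$, $(H/\Gamma.A)\circ W_A=W_{H(A)}\circ(H/\Gamma)$, $H(\mathsf{idtm}_A)=\mathsf{idtm}_{H(A)}$. The slice $\mathbb E/\Gamma$ is $\mathcal F/\Gamma$ with chosen terminal object $\mathrm{id}_\Gamma$ and the structure inherited from $\mathbb E$. An E-system is a pre-E-system in which (1) each $S_x$ and (2) each $W_A$ is a pre-E-homomorphism (between slices), (3) $S_x\circ W_A=\mathrm{id}_{\mathbb E/\Gamma}$, (4) $S_x(\mathsf{idtm}_A)=x$ for $x\in T(A)$, (5) $S_{\mathsf{idtm}_A}\circ(W_A/A)=\mathrm{id}_{\mathbb E/\Gamma.A}$. E-homomorphisms are pre-E-homomorphisms between E-systems.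 $\mathbf{Esys}$ is the category of E-systems and E-homomorphisms. **The functor $\mathrm{CE2E}$.** For a CE-system on $I\colon\mathcal F\to\mathcal C$: the underlying category is $\mathcal F$ with its chosen terminal object, $T(A)=\{x\colon\Gamma\to\Gamma.A\text{ in }\mathcal C\mid I(A)\circ x=\mathrm{id}_\Gamma\}$ for $A\in\mathcal F/\Gamma$, $W_A=I(A)^*$, $S_x=x^*$, where $f^*$ acts on terms by pulling back sections (for $B\in\mathcal F/\Gamma$, $Q\in\mathcal F/\Gamma.B$, $y\in T(Q)$, $f^*y$ is the section of $I(\pi_2(f,B)^*Q)$ with $\pi_2(f,B.Q)\circ f^*y=y\circ\pi_2(f,B)$), and $\mathsf{idtm}_A$ is the unique section of $I(W_A(A))$ with $\pi_2(I(A),A)\circ\mathsf{idtm}_A=\mathrm{id}_{\Gamma.A}$. A homomorphism $F$ is sent to $F_{\mathcal F}$ with action on terms given by $F_{\mathcal C}$. **The functor $\mathrm{E2CE}$.** In an E-system, for $A,B\in\mathcal F/\Gamma$ let $\mathrm{thom}(A,B)=T(W_A(B))$; for $f\in\mathrm{thom}(A,B)$ let $f^*=S_f\circ(W_A/B)\colon\mathbb E/\Gamma.B\to\mathbb E/\Gamma.A$; for $g\in\mathrm{thom}(B,C)$ let $g\cdot f=f^*(g)\in\mathrm{thom}(A,C)$. These are the arrows and composition of a strict category $\mathcal C_{\mathbb E}(\Gamma)$ with the objects of $\mathcal F/\Gamma$ and identities $\mathsf{idtm}_A$. For $x\in T(A)$, $u\in T(S_x(P))$ let $x.u=S_u(S_x(\mathsf{idtm}_{A.P}))\in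 T(A.P)$. $\mathrm{E2CE}(\mathbb E)$ has category of families $\mathcal F/[\,]$ with chosen terminal object $\mathrm{id}_{[\,]}$, second category $\mathcal C_{\mathbb E}([\,])$, identity-on-objects functor sending an arrow $Q\colon A.Q\to A$ to $W_Q(\mathsf{idtm}_A)\in\mathrm{thom}(A.Q,A)$, and, for $f\in\mathrm{thom}(A,B)$ and $R\in\mathcal F/[\,].B$, chosen pullback given by $f^*R=f^*(R)$ and $\pi_2(f,R)=(W_{f^*R}(f)).\mathsf{idtm}_{f^*R}\in\mathrm{thom}(A.f^*R,B.R)$. An E-homomorphism $H$ is sent to the pair consisting of $H/[\,]$ and the functor acting as $H/[\,]$ on objects and by the action of $H$ on terms on arrows. *)

theory Defs
  imports Main "HOL-Library.FuncSet"
begin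

section \<open>Strict categories, functors and adjunctions\<close>

record ('o, 'm) scat =
  Obj :: "'o set"
  Arr :: "'m set"
  src :: "'m \<Rightarrow> 'o"
  tgt :: "'m \<Rightarrow> 'o"
  idm :: "'o \<Rightarrow> 'm"
  cmp :: "'m \<Rightarrow> 'm \<Rightarrow> 'm"  (infixl "\<cdot>\<index>" 70)

definition Hom :: "('o, 'm, 'z) scat_scheme \<Rightarrow> 'o \<Rightarrow> 'o \<Rightarrow> 'm set" where
  "Hom C a b = {f \<in> Arr C. src C f = a \<and> tgt C f = b}"

locale strict_category =
  fixes C :: "('o, 'm, 'z) scat_scheme" (structure)
  assumes src_obj: "f \<in> Arr C \<Longrightarrow> src C f \<in> Obj C"
    and tgt_obj: "f \<in> Arr C \<Longrightarrow> tgt C f \<in> Obj C"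
    and idm_hom: "a \<in> Obj C \<Longrightarrow> idm C a \<in> Hom C a a"
    and cmp_hom: "\<lbrakk>f \<in> Hom C a b; g \<in> Hom C b c\<rbrakk> \<Longrightarrow> g \<cdot> f \<in> Hom C a c"
    and cmp_idm_right: "f \<in> Arr C \<Longrightarrow> f \<cdot> idm C (src C f) = f"
    and cmp_idm_left: "f \<in> Arr C \<Longrightarrow> idm C (tgt C f) \<cdot> f = f"
    and cmp_assoc: "\<lbrakk>f \<in> Hom C a b; g \<in> Hom C b c; h \<in> Hom C c d\<rbrakk>
                    \<Longrightarrow> (h \<cdot> g) \<cdot> f = h \<cdot> (g \<cdot> f)"

definition terminal :: "('o, 'm, 'z) scat_scheme \<Rightarrow> 'o \<Rightarrow> bool" where
  "terminal C t \<longleftrightarrow> t \<in> Obj C \<and> (\<forall>a\<in>Obj C. \<exists>!f. f \<in> Hom C a t)"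

definition is_iso :: "('o, 'm, 'z) scat_scheme \<Rightarrow> 'm \<Rightarrow> bool" where
  "is_iso C f \<longleftrightarrow> f \<in> Arr C \<and>
     (\<exists>g \<in> Hom C (tgt C f) (src C f).
        g \<cdot>\<^bsub>C\<^esub> f = idm C (src C f) \<and> f \<cdot>\<^bsub>C\<^esub> g = idm C (tgt C f))"

definition is_pullback ::
    "('o, 'm, 'z) scat_scheme \<Rightarrow> 'm \<Rightarrow> 'm \<Rightarrow> 'm \<Rightarrow> 'm \<Rightarrow> bool" where
  "is_pullback C p q f g \<longleftrightarrow>
     {p, q, f, g} \<subseteq> Arr C \<and>
     src C p = src C q \<and> tgt C p = src C f \<and> tgt C q = src C g \<and> tgt C f = tgt C g \<and>
     f \<cdot>\<^bsub>C\<^esub> p = g \<cdot>\<^bsub>C\<^esub> q \<and>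
     (\<forall>x u v. u \<in> Hom C x (src C f) \<and> v \<in> Hom C x (src C g) \<and>
        f \<cdot>\<^bsub>C\<^esub> u = g \<cdot>\<^bsub>C\<^esub> v \<longrightarrow>
        (\<exists>!w. w \<in> Hom C x (src C p) \<and> p \<cdot>\<^bsub>C\<^esub> w = u \<and> q \<cdot>\<^bsub>C\<^esub> w = v))"

record ('o, 'm, 'p, 'n) func =
  oMap :: "'o \<Rightarrow> 'p"
  aMap :: "'m \<Rightarrow> 'n"

locale strict_functor = dom: strict_category C + cod: strict_category D
  for C :: "('o, 'm, 'z) scat_scheme" and D :: "('p, 'n, 'y) scat_scheme" +
  fixes F :: "('o, 'm, 'p, 'n, 'x) func_scheme"
  assumes oMap_obj: "a \<in> Obj C \<Longrightarrow> oMap F a \<in> Obj D"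
    and aMap_hom: "f \<in> Arr C \<Longrightarrow> aMap F f \<in> Hom D (oMap F (src C f)) (oMap F (tgt C f))"
    and aMap_idm: "a \<in> Obj C \<Longrightarrow> aMap F (idm C a) = idm D (oMap F a)"
    and aMap_cmp: "\<lbrakk>f \<in> Hom C a b; g \<in> Hom C b c\<rbrakk>
                   \<Longrightarrow> aMap F (g \<cdot>\<^bsub>C\<^esub> f) = aMap F g \<cdot>\<^bsub>D\<^esub> aMap F f"

definition func_id :: "('o, 'm, 'o, 'm) func" where
  "func_id = \<lparr>oMap = (\<lambda>a. a), aMap = (\<lambda>f. f)\<rparr>"

definition func_comp ::
    "('p, 'n, 'q, 'k) func \<Rightarrow> ('o, 'm, 'p, 'n) func \<Rightarrow> ('o, 'm, 'q, 'k) func" where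
  "func_comp G F = \<lparr>oMap = oMap G \<circ> oMap F, aMap = aMap G \<circ> aMap F\<rparr>"

locale natural_transformation = F: strict_functor C D F + G: strict_functor C D G
  for C :: "('o, 'm, 'z) scat_scheme" and D :: "('p, 'n, 'y) scat_scheme"
    and F :: "('o, 'm, 'p, 'n) func" and G :: "('o, 'm, 'p, 'n) func" +
  fixes \<tau> :: "'o \<Rightarrow> 'n"
  assumes component: "a \<in> Obj C \<Longrightarrow> \<tau> a \<in> Hom D (oMap F a) (oMap G a)"
    and naturality: "f \<in> Hom C a b \<Longrightarrow> aMap G f \<cdot>\<^bsub>D\<^esub> \<tau> a = \<tau> b \<cdot>\<^bsub>D\<^esub> aMap F f"

locale adjunction =
  unit: natural_transformation C C func_id "func_comp G F" \<eta> +
  counit: natural_transformation D D "func_comp F G" func_id \<epsilon> +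
  left: strict_functor C D F + right: strict_functor D C G
  for C :: "('o, 'm, 'z) scat_scheme" and D :: "('p, 'n, 'y) scat_scheme"
    and F :: "('o, 'm, 'p, 'n) func" and G :: "('p, 'n, 'o, 'm) func"
    and \<eta> :: "'o \<Rightarrow> 'm" and \<epsilon> :: "'p \<Rightarrow> 'n" +
  assumes triangle_left: "a \<in> Obj C \<Longrightarrow> \<epsilon> (oMap F a) \<cdot>\<^bsub>D\<^esub> aMap F (\<eta> a) = idm D (oMap F a)"
    and triangle_right: "b \<in> Obj D \<Longrightarrow> aMap G (\<epsilon> b) \<cdot>\<^bsub>C\<^esub> \<eta> (oMap G b) = idm C (oMap G b)"

definition left_adjoint_to ::
    "('o, 'm, 'z) scat_scheme \<Rightarrow> ('p, 'n, 'y) scat_scheme \<Rightarrow>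
     ('o, 'm, 'p, 'n) func \<Rightarrow> ('p, 'n, 'o, 'm) func \<Rightarrow> bool" where
  "left_adjoint_to C D F G \<longleftrightarrow> (\<exists>\<eta> \<epsilon>. adjunction C D F G \<eta> \<epsilon>)"

definition full_functor ::
    "('o, 'm, 'z) scat_scheme \<Rightarrow> ('p, 'n, 'y) scat_scheme \<Rightarrow> ('o, 'm, 'p, 'n) func \<Rightarrow> bool" where
  "full_functor C D F \<longleftrightarrow>
     (\<forall>a\<in>Obj C. \<forall>b\<in>Obj C. \<forall>g \<in> Hom D (oMap F a) (oMap F b). \<exists>f \<in> Hom C a b. aMap F f = g)"

definition faithful_functor ::
    "('o, 'm, 'z) scat_scheme \<Rightarrow> ('p, 'n, 'y) scat_scheme \<Rightarrow> ('o, 'm, 'p, 'n) func \<Rightarrow> bool" where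
  "faithful_functor C D F \<longleftrightarrow> (\<forall>a\<in>Obj C. \<forall>b\<in>Obj C. inj_on (aMap F) (Hom C a b))"

definition essentially_surjective ::
    "('o, 'm, 'z) scat_scheme \<Rightarrow> ('p, 'n, 'y) scat_scheme \<Rightarrow> ('o, 'm, 'p, 'n) func \<Rightarrow> bool" where
  "essentially_surjective C D F \<longleftrightarrow>
     (\<forall>b\<in>Obj D. \<exists>a\<in>Obj C. \<exists>f \<in> Hom D (oMap F a) b. is_iso D f)"


section \<open>The universe of small sets and slices\<close>

text \<open>
  The objects, arrows and terms of the small categories below are elements of a universe
  \<open>'u el\<close>, freely generated from an arbitrary type \<open>'u\<close> by pairing. Closure under pairing lets
  slices live in the same universe, so that E-systems and CE-systems over it form two genuine
  categories with functors in both directions between them.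
\<close>

datatype 'u el = Atom 'u | Pr (pfst: "'u el") (psnd: "'u el")

type_synonym 'u small_cat = "('u el, 'u el) scat"

text \<open>
  The arrow \<open>Pr A P\<close> of a slice is the arrow \<open>P\<close> regarded as going from \<open>A \<cdot> P\<close> to \<open>A\<close>.
\<close>

definition slice :: "('u el, 'u el, 'z) scat_scheme \<Rightarrow> 'u el \<Rightarrow> 'u small_cat" where
  "slice C \<Gamma> =
     \<lparr>Obj = {A \<in> Arr C. tgt C A = \<Gamma>},
      Arr = {Pr A P | A P. A \<in> Arr C \<and> tgt C A = \<Gamma> \<and> P \<in> Arr C \<and> tgt C P = src C A},
      src = (\<lambda>X. pfst X \<cdot>\<^bsub>C\<^esub> psnd X),
      tgt = pfst,
      idm = (\<lambda>A. Pr A (idm C (src C A))),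
      cmp = (\<lambda>Y X. Pr (pfst Y) (psnd Y \<cdot>\<^bsub>C\<^esub> psnd X))\<rparr>"


section \<open>Term structures\<close>

record ('o, 'm, 't) tcat = "('o, 'm) scat" +
  Tm :: "'m \<Rightarrow> 't set"

record 'u tfunc = "('u el, 'u el, 'u el, 'u el) func" +
  tMap :: "'u el \<Rightarrow> 'u el \<Rightarrow> 'u el"

definition tfunctor ::
    "('u el, 'u el, 'u el, 'z) tcat_scheme \<Rightarrow> ('u el, 'u el, 'u el, 'y) tcat_scheme
     \<Rightarrow> 'u tfunc \<Rightarrow> bool" where
  "tfunctor C D G \<longleftrightarrow> strict_functor C D G \<and>
     (\<forall>A\<in>Arr C. \<forall>x\<in>Tm C A. tMap G A x \<in> Tm D (aMap G A))"

definition tfunc_eq ::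
    "('u el, 'u el, 'u el, 'z) tcat_scheme \<Rightarrow> 'u tfunc \<Rightarrow> 'u tfunc \<Rightarrow> bool" where
  "tfunc_eq C G H \<longleftrightarrow>
     (\<forall>a\<in>Obj C. oMap G a = oMap H a) \<and>
     (\<forall>A\<in>Arr C. aMap G A = aMap H A \<and> (\<forall>x\<in>Tm C A. tMap G A x = tMap H A x))"

definition tid :: "'u tfunc" where
  "tid = \<lparr>oMap = (\<lambda>a. a), aMap = (\<lambda>A. A), tMap = (\<lambda>A x. x)\<rparr>"

definition tcomp :: "'u tfunc \<Rightarrow> 'u tfunc \<Rightarrow> 'u tfunc" where
  "tcomp G H =
     \<lparr>oMap = oMap G \<circ> oMap H, aMap = aMap G \<circ> aMap H,
      tMap = (\<lambda>A x. tMap G (aMap H A) (tMap H A x))\<rparr>"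

text \<open>
  The functor \<open>G/\<Gamma>\<close> induced by \<open>G\<close> on the slice over \<open>\<Gamma>\<close>; its formula does not mention \<open>\<Gamma>\<close>.
\<close>

definition over :: "'u tfunc \<Rightarrow> 'u tfunc" where
  "over G =
     \<lparr>oMap = aMap G, aMap = (\<lambda>X. Pr (aMap G (pfst X)) (aMap G (psnd X))),
      tMap = (\<lambda>X. tMap G (psnd X))\<rparr>"

text \<open>
  The identification of the slice of \<open>\<F>/\<Gamma>\<close> over \<open>A\<close> with \<open>\<F>/\<Gamma>.A\<close>: \<open>flat\<close> goes from the former to
  the latter, \<open>unflat C A\<close> is its inverse.
\<close>

definition flat :: "'u tfunc" where
  "flat =
     \<lparr>oMap = psnd, aMap = (\<lambda>X. Pr (psnd (pfst X)) (psnd (psnd X))), tMap = (\<lambda>X y. y)\<rparr>"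

definition unflat :: "('u el, 'u el, 'z) scat_scheme \<Rightarrow> 'u el \<Rightarrow> 'u tfunc" where
  "unflat C A =
     \<lparr>oMap = Pr A,
      aMap = (\<lambda>X. Pr (Pr A (pfst X)) (Pr (A \<cdot>\<^bsub>C\<^esub> pfst X) (psnd X))),
      tMap = (\<lambda>X y. y)\<rparr>"

text \<open>
  For a functor \<open>G\<close> from \<open>\<F>/\<Gamma>\<close> to \<open>\<D>/\<Delta>\<close> and \<open>A\<close> over \<open>\<Gamma>\<close>, the functor \<open>G/A\<close> regarded as going from
  \<open>\<F>/\<Gamma>.A\<close> to \<open>\<D>/\<Delta>.G(A)\<close>; here \<open>C\<close> is \<open>\<F>\<close>.
\<close>

definition slice_over :: "('u el, 'u el, 'z) scat_scheme \<Rightarrow> 'u tfunc \<Rightarrow> 'u el \<Rightarrow> 'u tfunc" where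
  "slice_over C G A = tcomp flat (tcomp (over G) (unflat C A))"


section \<open>E-systems\<close>

text \<open>
  \<open>Sub E A x\<close>, \<open>Wk E A\<close> and \<open>idtm E A\<close> are \<open>S\<^sub>x\<close> (for \<open>x \<in> T(A)\<close>), \<open>W\<^sub>A\<close> and \<open>idtm\<^sub>A\<close>. The sets \<open>T(A)\<close> need
  not be disjoint, so that \<open>Sub\<close> depends on \<open>A\<close> as well as on \<open>x\<close>.
\<close>

record 'u esys = "('u el, 'u el, 'u el) tcat" +
  root :: "'u el"
  Sub :: "'u el \<Rightarrow> 'u el \<Rightarrow> 'u tfunc"
  Wk :: "'u el \<Rightarrow> 'u tfunc"
  idtm :: "'u el \<Rightarrow> 'u el"

definition eslice :: "'u esys \<Rightarrow> 'u el \<Rightarrow> 'u esys" where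
  "eslice E \<Gamma> =
     \<lparr>Obj = Obj (slice E \<Gamma>), Arr = Arr (slice E \<Gamma>), src = src (slice E \<Gamma>),
      tgt = tgt (slice E \<Gamma>), idm = idm (slice E \<Gamma>), cmp = cmp (slice E \<Gamma>),
      Tm = (\<lambda>X. Tm E (psnd X)),
      root = idm E \<Gamma>,
      Sub = (\<lambda>X x. tcomp (unflat E (pfst X)) (tcomp (Sub E (psnd X) x) flat)),
      Wk = (\<lambda>X. tcomp (unflat E (pfst X \<cdot>\<^bsub>E\<^esub> psnd X)) (tcomp (Wk E (psnd X)) flat)),
      idtm = (\<lambda>X. idtm E (psnd X))\<rparr>"

locale pre_E_system = strict_category E for E :: "'u esys" +
  assumes root_terminal: "terminal E (root E)"
    and Sub_tfunctor: "\<lbrakk>A \<in> Arr E; x \<in> Tm E A\<rbrakk>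
          \<Longrightarrow> tfunctor (eslice E (src E A)) (eslice E (tgt E A)) (Sub E A x)"
    and Sub_idm: "\<lbrakk>A \<in> Arr E; x \<in> Tm E A\<rbrakk>
          \<Longrightarrow> oMap (Sub E A x) (idm E (src E A)) = idm E (tgt E A)"
    and Wk_tfunctor: "A \<in> Arr E
          \<Longrightarrow> tfunctor (eslice E (tgt E A)) (eslice E (src E A)) (Wk E A)"
    and Wk_of_idm: "\<Gamma> \<in> Obj E \<Longrightarrow> tfunc_eq (eslice E \<Gamma>) (Wk E (idm E \<Gamma>)) tid"
    and Wk_of_cmp: "\<lbrakk>A \<in> Arr E; P \<in> Arr E; tgt E P = src E A\<rbrakk>
          \<Longrightarrow> tfunc_eq (eslice E (tgt E A)) (Wk E (A \<cdot>\<^bsub>E\<^esub> P)) (tcomp (Wk E P) (Wk E A))"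
    and Wk_idm: "A \<in> Arr E \<Longrightarrow> oMap (Wk E A) (idm E (tgt E A)) = idm E (src E A)"
    and idtm_Tm: "A \<in> Arr E \<Longrightarrow> idtm E A \<in> Tm E (oMap (Wk E A) A)"

definition pre_E_hom :: "'u esys \<Rightarrow> 'u esys \<Rightarrow> 'u tfunc \<Rightarrow> bool" where
  "pre_E_hom E D H \<longleftrightarrow>
     tfunctor E D H \<and> oMap H (root E) = root D \<and>
     (\<forall>A\<in>Arr E. \<forall>x\<in>Tm E A. tfunc_eq (eslice E (src E A))
        (tcomp (over H) (Sub E A x)) (tcomp (Sub D (aMap H A) (tMap H A x)) (over H))) \<and>
     (\<forall>A\<in>Arr E. tfunc_eq (eslice E (tgt E A))
        (tcomp (over H) (Wk E A)) (tcomp (Wk D (aMap H A)) (over H))) \<and>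
     (\<forall>A\<in>Arr E. tMap H (oMap (Wk E A) A) (idtm E A) = idtm D (aMap H A))"

text \<open>
  An arrow \<open>A\<close> with target \<open>\<Gamma>\<close> is an object of \<open>\<F>/\<Gamma>\<close>; a functor with term structure on \<open>\<F>/\<Gamma>\<close> acts on a
  term of \<open>A\<close> through the arrow \<open>Pr (idm E \<Gamma>) A\<close> of \<open>\<F>/\<Gamma>\<close>, whose underlying arrow is \<open>A\<close>.
\<close>

locale E_system = pre_E_system E for E :: "'u esys" +
  assumes Sub_hom: "\<lbrakk>A \<in> Arr E; x \<in> Tm E A\<rbrakk>
          \<Longrightarrow> pre_E_hom (eslice E (src E A)) (eslice E (tgt E A)) (Sub E A x)"
    and Wk_hom: "A \<in> Arr E
          \<Longrightarrow> pre_E_hom (eslice E (tgt E A)) (eslice E (src E A)) (Wk E A)"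
    and Sub_Wk: "\<lbrakk>A \<in> Arr E; x \<in> Tm E A\<rbrakk>
          \<Longrightarrow> tfunc_eq (eslice E (tgt E A)) (tcomp (Sub E A x) (Wk E A)) tid"
    and Sub_idtm: "\<lbrakk>A \<in> Arr E; x \<in> Tm E A\<rbrakk>
          \<Longrightarrow> tMap (Sub E A x) (Pr (idm E (src E A)) (oMap (Wk E A) A)) (idtm E A) = x"
    and Sub_idtm_Wk: "A \<in> Arr E
          \<Longrightarrow> tfunc_eq (eslice E (src E A))
                (tcomp (Sub E (oMap (Wk E A) A) (idtm E A)) (slice_over E (Wk E A) A)) tid"

text \<open>
  Arrows of large categories carry their source and target, and homomorphisms are extensional:
  they are undefined outside the carriers of their source. The structures themselves are not
  required to be extensional; two that differ only outside their carriers are distinct objects,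
  isomorphic via the identity.
\<close>

definition trestrict ::
    "('u el, 'u el, 'u el, 'z) tcat_scheme \<Rightarrow> 'u tfunc \<Rightarrow> 'u tfunc" where
  "trestrict C G =
     \<lparr>oMap = restrict (oMap G) (Obj C), aMap = restrict (aMap G) (Arr C),
      tMap = restrict (\<lambda>A. restrict (tMap G A) (Tm C A)) (Arr C)\<rparr>"

type_synonym 'u esys_arr = "'u esys \<times> 'u tfunc \<times> 'u esys"

definition Esys :: "('u esys, 'u esys_arr) scat" where
  "Esys =
     \<lparr>Obj = {E. E_system E},
      Arr = {(E, H, D). E_system E \<and> E_system D \<and> pre_E_hom E D H \<and> trestrict E H = H},
      src = (\<lambda>(E, H, D). E),
      tgt = (\<lambda>(E, H, D). D),
      idm = (\<lambda>E. (E, trestrict E tid, E)),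
      cmp = (\<lambda>(E', K, D) (E, H, D'). (E, trestrict E (tcomp K H), D))\<rparr>"


section \<open>CE-systems\<close>

text \<open>
  \<open>fam\<close> and \<open>ctx\<close> are \<open>\<F>\<close> and \<open>\<C>\<close>; \<open>incl\<close> is the action of \<open>I\<close> on arrows; \<open>pb A f B\<close> is \<open>f\<^sup>*B\<close> and
  \<open>pi2 A f B\<close> is \<open>\<pi>\<^sub>2(f, B)\<close> in the CE-system \<open>A\<close>.
\<close>

record 'u cesys =
  fam :: "'u small_cat"
  ctx :: "'u small_cat"
  incl :: "'u el \<Rightarrow> 'u el"
  one :: "'u el"
  pb :: "'u el \<Rightarrow> 'u el \<Rightarrow> 'u el"
  pi2 :: "'u el \<Rightarrow> 'u el \<Rightarrow> 'u el"

locale CE_system =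
  fixes X :: "'u cesys"
  assumes same_objects: "Obj (fam X) = Obj (ctx X)"
    and incl_functor: "strict_functor (fam X) (ctx X) \<lparr>oMap = (\<lambda>\<Gamma>. \<Gamma>), aMap = incl X\<rparr>"
    and one_terminal: "terminal (fam X) (one X)"
    and pb_arr: "\<lbrakk>f \<in> Arr (ctx X); A \<in> Arr (fam X); tgt (fam X) A = tgt (ctx X) f\<rbrakk>
          \<Longrightarrow> pb X f A \<in> Arr (fam X) \<and> tgt (fam X) (pb X f A) = src (ctx X) f"
    and pi2_hom: "\<lbrakk>f \<in> Arr (ctx X); A \<in> Arr (fam X); tgt (fam X) A = tgt (ctx X) f\<rbrakk>
          \<Longrightarrow> pi2 X f A \<in> Hom (ctx X) (src (fam X) (pb X f A)) (src (fam X) A)"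
    and pullback: "\<lbrakk>f \<in> Arr (ctx X); A \<in> Arr (fam X); tgt (fam X) A = tgt (ctx X) f\<rbrakk>
          \<Longrightarrow> is_pullback (ctx X) (pi2 X f A) (incl X (pb X f A)) (incl X A) f"
    and pb_idm: "f \<in> Arr (ctx X)
          \<Longrightarrow> pb X f (idm (fam X) (tgt (ctx X) f)) = idm (fam X) (src (ctx X) f)"
    and pi2_idm: "f \<in> Arr (ctx X) \<Longrightarrow> pi2 X f (idm (fam X) (tgt (ctx X) f)) = f"
    and pb_along_idm: "A \<in> Arr (fam X)
          \<Longrightarrow> pb X (idm (ctx X) (tgt (fam X) A)) A = A"
    and pi2_along_idm: "A \<in> Arr (fam X)
          \<Longrightarrow> pi2 X (idm (ctx X) (tgt (fam X) A)) A = idm (ctx X) (src (fam X) A)"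
    and pb_along_cmp: "\<lbrakk>f \<in> Arr (ctx X); g \<in> Arr (ctx X); tgt (ctx X) g = src (ctx X) f;
            A \<in> Arr (fam X); tgt (fam X) A = tgt (ctx X) f\<rbrakk>
          \<Longrightarrow> pb X (f \<cdot>\<^bsub>ctx X\<^esub> g) A = pb X g (pb X f A)"
    and pi2_along_cmp: "\<lbrakk>f \<in> Arr (ctx X); g \<in> Arr (ctx X); tgt (ctx X) g = src (ctx X) f;
            A \<in> Arr (fam X); tgt (fam X) A = tgt (ctx X) f\<rbrakk>
          \<Longrightarrow> pi2 X (f \<cdot>\<^bsub>ctx X\<^esub> g) A = pi2 X f A \<cdot>\<^bsub>ctx X\<^esub> pi2 X g (pb X f A)"
    and pb_cmp: "\<lbrakk>f \<in> Arr (ctx X); A \<in> Arr (fam X); tgt (fam X) A = tgt (ctx X) f;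
            P \<in> Arr (fam X); tgt (fam X) P = src (fam X) A\<rbrakk>
          \<Longrightarrow> pb X f (A \<cdot>\<^bsub>fam X\<^esub> P) = pb X f A \<cdot>\<^bsub>fam X\<^esub> pb X (pi2 X f A) P"
    and pi2_cmp: "\<lbrakk>f \<in> Arr (ctx X); A \<in> Arr (fam X); tgt (fam X) A = tgt (ctx X) f;
            P \<in> Arr (fam X); tgt (fam X) P = src (fam X) A\<rbrakk>
          \<Longrightarrow> pi2 X f (A \<cdot>\<^bsub>fam X\<^esub> P) = pi2 X (pi2 X f A) P"

definition rooted :: "'u cesys \<Rightarrow> bool" where
  "rooted X \<longleftrightarrow> terminal (ctx X) (one X)"

record 'u cefunc =
  famF :: "('u el, 'u el, 'u el, 'u el) func"
  ctxF :: "('u el, 'u el, 'u el, 'u el) func"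

definition CE_hom :: "'u cesys \<Rightarrow> 'u cesys \<Rightarrow> 'u cefunc \<Rightarrow> bool" where
  "CE_hom X Y F \<longleftrightarrow>
     strict_functor (fam X) (fam Y) (famF F) \<and> strict_functor (ctx X) (ctx Y) (ctxF F) \<and>
     (\<forall>\<Gamma>\<in>Obj (fam X). oMap (ctxF F) \<Gamma> = oMap (famF F) \<Gamma>) \<and>
     (\<forall>A\<in>Arr (fam X). aMap (ctxF F) (incl X A) = incl Y (aMap (famF F) A)) \<and>
     oMap (famF F) (one X) = one Y \<and>
     (\<forall>f\<in>Arr (ctx X). \<forall>A\<in>Arr (fam X). tgt (fam X) A = tgt (ctx X) f \<longrightarrow>
        aMap (famF F) (pb X f A) = pb Y (aMap (ctxF F) f) (aMap (famF F) A) \<and>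
        aMap (ctxF F) (pi2 X f A) = pi2 Y (aMap (ctxF F) f) (aMap (famF F) A))"

definition frestrict ::
    "('o, 'm, 'z) scat_scheme \<Rightarrow> ('o, 'm, 'p, 'n, 'x) func_scheme \<Rightarrow> ('o, 'm, 'p, 'n) func" where
  "frestrict C F = \<lparr>oMap = restrict (oMap F) (Obj C), aMap = restrict (aMap F) (Arr C)\<rparr>"

definition cerestrict :: "'u cesys \<Rightarrow> 'u cefunc \<Rightarrow> 'u cefunc" where
  "cerestrict X F = \<lparr>famF = frestrict (fam X) (famF F), ctxF = frestrict (ctx X) (ctxF F)\<rparr>"

type_synonym 'u cesys_arr = "'u cesys \<times> 'u cefunc \<times> 'u cesys"

definition CEsys :: "('u cesys, 'u cesys_arr) scat" where
  "CEsys =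
     \<lparr>Obj = {X. CE_system X},
      Arr = {(X, F, Y). CE_system X \<and> CE_system Y \<and> CE_hom X Y F \<and> cerestrict X F = F},
      src = (\<lambda>(X, F, Y). X),
      tgt = (\<lambda>(X, F, Y). Y),
      idm = (\<lambda>X. (X, cerestrict X \<lparr>famF = func_id, ctxF = func_id\<rparr>, X)),
      cmp = (\<lambda>(Y', G, Z) (X, F, Y).
        (X, cerestrict X \<lparr>famF = func_comp (famF G) (famF F), ctxF = func_comp (ctxF G) (ctxF F)\<rparr>,
         Z))\<rparr>"


section \<open>From CE-systems to E-systems\<close>

definition sections :: "'u cesys \<Rightarrow> 'u el \<Rightarrow> 'u el set" where
  "sections X A =
     {x \<in> Hom (ctx X) (tgt (fam X) A) (src (fam X) A).
        incl X A \<cdot>\<^bsub>ctx X\<^esub> x = idm (ctx X) (tgt (fam X) A)}"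

definition pb_functor :: "'u cesys \<Rightarrow> 'u el \<Rightarrow> 'u tfunc" where
  "pb_functor X f =
     \<lparr>oMap = pb X f,
      aMap = (\<lambda>Z. Pr (pb X f (pfst Z)) (pb X (pi2 X f (pfst Z)) (psnd Z))),
      tMap = (\<lambda>Z y. let B = pfst Z; Q = psnd Z in
        THE z. z \<in> sections X (pb X (pi2 X f B) Q) \<and>
               pi2 X f (B \<cdot>\<^bsub>fam X\<^esub> Q) \<cdot>\<^bsub>ctx X\<^esub> z = y \<cdot>\<^bsub>ctx X\<^esub> pi2 X f B)\<rparr>"

definition CE2E_obj :: "'u cesys \<Rightarrow> 'u esys" where
  "CE2E_obj X =
     \<lparr>Obj = Obj (fam X), Arr = Arr (fam X), src = src (fam X), tgt = tgt (fam X),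
      idm = idm (fam X), cmp = cmp (fam X),
      Tm = sections X,
      root = one X,
      Sub = (\<lambda>A x. pb_functor X x),
      Wk = (\<lambda>A. pb_functor X (incl X A)),
      idtm = (\<lambda>A. THE z. z \<in> sections X (pb X (incl X A) A) \<and>
        pi2 X (incl X A) A \<cdot>\<^bsub>ctx X\<^esub> z = idm (ctx X) (src (fam X) A))\<rparr>"

definition CE2E_hom :: "'u cesys \<Rightarrow> 'u cefunc \<Rightarrow> 'u tfunc" where
  "CE2E_hom X F = trestrict (CE2E_obj X)
     \<lparr>oMap = oMap (famF F), aMap = aMap (famF F), tMap = (\<lambda>A. aMap (ctxF F))\<rparr>"

definition CE2E :: "('u cesys, 'u cesys_arr, 'u esys, 'u esys_arr) func" where
  "CE2E = \<lparr>oMap = CE2E_obj,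
           aMap = (\<lambda>(X, F, Y). (CE2E_obj X, CE2E_hom X F, CE2E_obj Y))\<rparr>"


section \<open>From E-systems to CE-systems\<close>

definition thom :: "'u esys \<Rightarrow> 'u el \<Rightarrow> 'u el \<Rightarrow> 'u el set" where
  "thom E A B = Tm E (oMap (Wk E A) B)"

text \<open>\<open>reindex E A B f\<close> is \<open>f\<^sup>*\<close> for \<open>f \<in> thom E A B\<close>, a functor from \<open>\<E>/\<Gamma>.B\<close> to \<open>\<E>/\<Gamma>.A\<close>.\<close>

definition reindex :: "'u esys \<Rightarrow> 'u el \<Rightarrow> 'u el \<Rightarrow> 'u el \<Rightarrow> 'u tfunc" where
  "reindex E A B f = tcomp (Sub E (oMap (Wk E A) B) f) (slice_over E (Wk E A) B)"

text \<open>\<open>tcompose E A B C g f\<close> is \<open>g \<cdot> f \<in> thom E A C\<close> for \<open>f \<in> thom E A B\<close> and \<open>g \<in> thom E B C\<close>.\<close>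

definition tcompose ::
    "'u esys \<Rightarrow> 'u el \<Rightarrow> 'u el \<Rightarrow> 'u el \<Rightarrow> 'u el \<Rightarrow> 'u el \<Rightarrow> 'u el" where
  "tcompose E A B C g f =
     tMap (reindex E A B f) (Pr (idm E (src E B)) (oMap (Wk E B) C)) g"

text \<open>
  The category \<open>\<C>\<^sub>\<E>(\<Gamma>)\<close>. The sets \<open>thom E A B\<close> need not be disjoint; the arrow given by
  \<open>f \<in> thom E A B\<close> is \<open>tarr A B f\<close>, with projections \<open>tsrc\<close>, \<open>ttgt\<close> and \<open>tterm\<close>.
\<close>

definition tarr :: "'u el \<Rightarrow> 'u el \<Rightarrow> 'u el \<Rightarrow> 'u el" where
  "tarr A B f = Pr A (Pr B f)"

definition tsrc :: "'u el \<Rightarrow> 'u el" where "tsrc k = pfst k"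
definition ttgt :: "'u el \<Rightarrow> 'u el" where "ttgt k = pfst (psnd k)"
definition tterm :: "'u el \<Rightarrow> 'u el" where "tterm k = psnd (psnd k)"

definition term_cat :: "'u esys \<Rightarrow> 'u el \<Rightarrow> 'u small_cat" where
  "term_cat E \<Gamma> =
     \<lparr>Obj = Obj (slice E \<Gamma>),
      Arr = {tarr A B f | A B f. A \<in> Obj (slice E \<Gamma>) \<and> B \<in> Obj (slice E \<Gamma>) \<and> f \<in> thom E A B},
      src = tsrc,
      tgt = ttgt,
      idm = (\<lambda>A. tarr A A (idtm E A)),
      cmp = (\<lambda>k l. tarr (tsrc l) (ttgt k)
               (tcompose E (tsrc l) (ttgt l) (ttgt k) (tterm k) (tterm l)))\<rparr>"

text \<open>\<open>tpair E A P x u\<close> is the term \<open>x.u \<in> T(A.P)\<close> for \<open>x \<in> T(A)\<close> and \<open>u \<in> T(S\<^sub>x(P))\<close>.\<close>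

definition tpair ::
    "'u esys \<Rightarrow> 'u el \<Rightarrow> 'u el \<Rightarrow> 'u el \<Rightarrow> 'u el \<Rightarrow> 'u el" where
  "tpair E A P x u =
     (let AP = A \<cdot>\<^bsub>E\<^esub> P;
          Z = Pr P (oMap (Wk E AP) AP);
          SP = oMap (Sub E A x) P
      in tMap (Sub E SP u) (Pr (idm E (src E SP)) (psnd (aMap (Sub E A x) Z)))
           (tMap (Sub E A x) Z (idtm E AP)))"

text \<open>
  In \<open>E2CE_pi2\<close>, with \<open>X = f\<^sup>*R\<close>, the first component \<open>W\<^sub>X(f)\<close> is a term of \<open>W\<^sub>X(W\<^sub>A(B)) = W\<^bsub>A.X\<^esub>(B)\<close>
  and the pair is a term of \<open>W\<^bsub>A.X\<^esub>(B.R)\<close>, which is the composite of \<open>W\<^bsub>A.X\<^esub>(B)\<close> with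
  \<open>(W\<^bsub>A.X\<^esub>/B)(R)\<close>.
\<close>

definition E2CE_pi2 :: "'u esys \<Rightarrow> 'u el \<Rightarrow> 'u el \<Rightarrow> 'u el \<Rightarrow> 'u el \<Rightarrow> 'u el" where
  "E2CE_pi2 E A B f R =
     (let X = oMap (reindex E A B f) R;
          W = Wk E (A \<cdot>\<^bsub>E\<^esub> X)
      in tpair E (oMap W B) (oMap (slice_over E W B) R)
           (tMap (Wk E X) (Pr (idm E (src E A)) (oMap (Wk E A) B)) f) (idtm E X))"

definition E2CE_obj :: "'u esys \<Rightarrow> 'u cesys" where
  "E2CE_obj E =
     \<lparr>fam = slice E (root E),
      ctx = term_cat E (root E),
      incl = (\<lambda>Z. let A = pfst Z; Q = psnd Z in
        tarr (A \<cdot>\<^bsub>E\<^esub> Q) A (tMap (Wk E Q) (Pr (idm E (src E A)) (oMap (Wk E A) A)) (idtm E A))),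
      one = idm E (root E),
      pb = (\<lambda>k Z. Pr (tsrc k) (oMap (reindex E (tsrc k) (ttgt k) (tterm k)) (psnd Z))),
      pi2 = (\<lambda>k Z. let A = tsrc k; B = ttgt k; f = tterm k; R = psnd Z in
        tarr (A \<cdot>\<^bsub>E\<^esub> oMap (reindex E A B f) R) (B \<cdot>\<^bsub>E\<^esub> R) (E2CE_pi2 E A B f R))\<rparr>"

definition E2CE_hom :: "'u esys \<Rightarrow> 'u tfunc \<Rightarrow> 'u cefunc" where
  "E2CE_hom E H = cerestrict (E2CE_obj E)
     \<lparr>famF = func.truncate (over H),
      ctxF = \<lparr>oMap = aMap H,
              aMap = (\<lambda>k. tarr (aMap H (tsrc k)) (aMap H (ttgt k))
                (tMap H (oMap (Wk E (tsrc k)) (ttgt k)) (tterm k)))\<rparr>\<rparr>"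

definition E2CE :: "('u esys, 'u esys_arr, 'u cesys, 'u cesys_arr) func" where
  "E2CE = \<lparr>oMap = E2CE_obj,
           aMap = (\<lambda>(E, H, D). (E2CE_obj E, E2CE_hom E H, E2CE_obj D))\<rparr>"

end

theory Submission
  imports Defs
begin

text \<open>
  A term \<open>f \<in> thom(A, B)\<close> is recovered from its pullback functor \<open>f\<^sup>*\<close>, from the slice over \<open>B\<close> to the
  slice over \<open>A\<close>, as \<open>f = f\<^sup>*(idtm\<^sub>B)\<close>. Since the slice over \<open>\<Gamma>.B\<close> is the slice over \<open>\<Gamma>\<close> with a term of
  \<open>B\<close> freely adjoined, the functors \<open>f\<^sup>*\<close> are precisely the homomorphisms \<open>w\<close> with \<open>w \<circ> W\<^sub>B = W\<^sub>A\<close>.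
  Under this correspondence composition of arrows is composition of functors, the inclusion of \<open>Q\<close>
  is \<open>W\<^sub>Q\<close>, the arrow \<open>\<pi>\<^sub>2(f, R)\<close> is \<open>f\<^sup>*/R\<close>, and the sections of the inclusion of \<open>A\<close> are the functors
  \<open>S\<^sub>x\<close> for \<open>x \<in> T(A)\<close>. Hence the axioms of a CE-system for \<open>E2CE\<close> are identities between
  functors, and the unit, sending \<open>x\<close> to the arrow of \<open>S\<^sub>x\<close>, is bijective.

  The counit sends \<open>z \<in> thom(A, B)\<close> to \<open>\<pi>\<^sub>2(I(A), B) \<circ> z\<close>, a bijection onto the arrows of \<open>\<C>\<close> that
  commute with the maps to \<open>1\<close>; all arrows do so if and only if \<open>1\<close> is terminal in \<open>\<C>\<close>. Any two
  adjunctions between the same functors differ by an automorphism of the left adjoint, so that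
  invertibility of units and counits need be checked for one of them only.
\<close>

section \<open>Adjunctions\<close>

text \<open>Two choices of form shape the proof. A slice of a slice is only isomorphic to a slice,
  and its arrows are nested pairs, so functors between slices are curried: \<open>sar h P\<close> is
  the action of \<open>h/P\<close> on objects, and passing to \<open>h/A\<close> becomes a mere
  shift of arguments. Composition of curried functors is associative as a plain equation, and side
  conditions arise only where agreement on carriers, \<open>sf_eq\<close>, is involved.

  E-homomorphisms are brought into the same form by \<open>sf_lift\<close>, so that one calculus
  covers \<open>S\<^sub>x\<close>, \<open>W\<^sub>A\<close>, \<open>f\<^sup>*\<close> and
  E-homomorphisms: compose, slice, commute with \<open>S\<close> and \<open>W\<close>, cancel by the
  axioms.

  The unit is an isomorphism rather than an identity because an object of \<open>E2CE_obj E\<close>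
  is an arrow into the root: \<open>\<Gamma>\<close> is replaced by its unique arrow to the root.
  The arrows of \<open>E2CE_obj E\<close> are by construction maps over the root, and
  \<open>incl_eps\<close> records that the counit keeps them over \<open>1\<close>; an arrow of a
  CE-system that does not commute with the maps to \<open>1\<close> is therefore never
  reached.\<close>

lemma mem_Hom_iff: "f \<in> Hom C a b \<longleftrightarrow> f \<in> Arr C \<and> src C f = a \<and> tgt C f = b"
  by (simp add: Hom_def)

context strict_category
begin

lemma idm_simps [simp]:
  assumes "a \<in> Obj C"
  shows "idm C a \<in> Arr C" "src C (idm C a) = a" "tgt C (idm C a) = a"
  using idm_hom[OF assms] by (auto simp: Hom_def)

lemma cmp_simps [simp]:
  assumes "g \<in> Arr C" "f \<in> Arr C" "tgt C f = src C g"
  shows "g \<cdot> f \<in> Arr C" "src C (g \<cdot> f) = src C f" "tgt C (g \<cdot> f) = tgt C g"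
  using cmp_hom[of f "src C f" "src C g" g "tgt C g"] assms by (auto simp: Hom_def)

lemma idm_right [simp]: "\<lbrakk>f \<in> Arr C; a = src C f\<rbrakk> \<Longrightarrow> f \<cdot> idm C a = f"
  using cmp_idm_right by simp

lemma idm_left [simp]: "\<lbrakk>f \<in> Arr C; a = tgt C f\<rbrakk> \<Longrightarrow> idm C a \<cdot> f = f"
  using cmp_idm_left by simp

lemma assoc [simp]:
  "\<lbrakk>f \<in> Arr C; g \<in> Arr C; h \<in> Arr C; tgt C f = src C g; tgt C g = src C h\<rbrakk>
   \<Longrightarrow> (h \<cdot> g) \<cdot> f = h \<cdot> (g \<cdot> f)"
  using cmp_assoc[of f "src C f" "src C g" g "src C h" h "tgt C h"] by (auto simp: Hom_def)

declare src_obj [simp] tgt_obj [simp]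

end

context strict_functor
begin

lemma aMap_simps [simp]:
  assumes "f \<in> Arr C"
  shows "aMap F f \<in> Arr D" "src D (aMap F f) = oMap F (src C f)"
    "tgt D (aMap F f) = oMap F (tgt C f)"
  using aMap_hom[OF assms] by (auto simp: Hom_def)

lemma aMap_comp [simp]:
  "\<lbrakk>f \<in> Arr C; g \<in> Arr C; tgt C f = src C g\<rbrakk> \<Longrightarrow> aMap F (g \<cdot>\<^bsub>C\<^esub> f) = aMap F g \<cdot>\<^bsub>D\<^esub> aMap F f"
  using aMap_cmp[of f "src C f" "src C g" g "tgt C g"] by (auto simp: Hom_def)

declare oMap_obj [simp] aMap_idm [simp]

lemma preserves_iso:
  assumes "is_iso C f"
  shows "is_iso D (aMap F f)"
proof -
  obtain g where "f \<in> Arr C" "g \<in> Arr C" "src C g = tgt C f" "tgt C g = src C f"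
    and "g \<cdot>\<^bsub>C\<^esub> f = idm C (src C f)" "f \<cdot>\<^bsub>C\<^esub> g = idm C (tgt C f)"
    using assms by (auto simp: is_iso_def Hom_def)
  then show ?thesis
    unfolding is_iso_def
    by (intro conjI bexI[of _ "aMap F g"]) (auto simp: Hom_def simp flip: aMap_comp)
qed

end

lemma (in strict_category) iso_comp:
  assumes "is_iso C f" "is_iso C g" "tgt C f = src C g"
  shows "is_iso C (g \<cdot> f)"
proof -
  obtain f' where f: "f \<in> Arr C" "f' \<in> Arr C" "src C f' = tgt C f" "tgt C f' = src C f"
    "f' \<cdot> f = idm C (src C f)" "f \<cdot> f' = idm C (tgt C f)"
    using assms by (auto simp: is_iso_def Hom_def)
  obtain g' where g: "g \<in> Arr C" "g' \<in> Arr C" "src C g' = tgt C g" "tgt C g' = src C g"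
    "g' \<cdot> g = idm C (src C g)" "g \<cdot> g' = idm C (tgt C g)"
    using assms by (auto simp: is_iso_def Hom_def)
  have "(f' \<cdot> g') \<cdot> (g \<cdot> f) = f' \<cdot> ((g' \<cdot> g) \<cdot> f)"
    using f(1-4) g(1-4) assms(3) by simp
  then have 1: "(f' \<cdot> g') \<cdot> (g \<cdot> f) = idm C (src C f)"
    using f g assms(3) by (simp del: assoc)
  have "(g \<cdot> f) \<cdot> (f' \<cdot> g') = g \<cdot> ((f \<cdot> f') \<cdot> g')"
    using f(1-4) g(1-4) assms(3) by simp
  then have "(g \<cdot> f) \<cdot> (f' \<cdot> g') = idm C (tgt C g)"
    using f g assms(3) by (simp del: assoc)
  then show ?thesis
    unfolding is_iso_def using f(1-4) g(1-4) assms(3) 1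
    by (intro conjI bexI[of _ "f' \<cdot> g'"]) (auto simp: Hom_def simp del: assoc)
qed

lemma strict_functor_cong:
  assumes "strict_functor C D F"
    and "\<And>a. a \<in> Obj C \<Longrightarrow> oMap F a = oMap F' a" "\<And>f. f \<in> Arr C \<Longrightarrow> aMap F f = aMap F' f"
  shows "strict_functor C D F'"
proof -
  interpret strict_functor C D F by fact
  have *: "oMap F' a = oMap F a" if "a \<in> Obj C" for a using assms(2) that by simp
  have **: "aMap F' f = aMap F f" if "f \<in> Arr C" for f using assms(3) that by simp
  show ?thesis
    by unfold_locales (auto simp: * ** Hom_def)
qed

lemma strict_functor_comp:
  assumes "strict_functor C D F" "strict_functor D K G"
    and "\<And>a. a \<in> Obj C \<Longrightarrow> oMap H a = oMap G (oMap F a)"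
    "\<And>f. f \<in> Arr C \<Longrightarrow> aMap H f = aMap G (aMap F f)"
  shows "strict_functor C K H"
proof -
  interpret F: strict_functor C D F by fact
  interpret G: strict_functor D K G by fact
  show ?thesis
    by unfold_locales (auto simp: assms(3,4) Hom_def)
qed

lemma strict_functor_id:
  assumes "strict_category C"
    and "\<And>a. a \<in> Obj C \<Longrightarrow> oMap H a = a" "\<And>f. f \<in> Arr C \<Longrightarrow> aMap H f = f"
  shows "strict_functor C C H"
proof -
  interpret strict_category C by fact
  show ?thesis
    by unfold_locales (auto simp: assms(2,3) Hom_def)
qed

text \<open>Laws for \<open>G\<close> are checked after applying \<open>F\<close>, which is
  injective on objects and on arrows. \<open>G\<close> is prescribed only on the carriers, where
  \<open>inv_into\<close> is a genuine inverse.\<close>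

lemma strict_functor_inverse:
  assumes "strict_functor C D F"
    and "bij_betw (oMap F) (Obj C) (Obj D)" "bij_betw (aMap F) (Arr C) (Arr D)"
    and "\<And>a. a \<in> Obj D \<Longrightarrow> oMap G a = inv_into (Obj C) (oMap F) a"
    "\<And>f. f \<in> Arr D \<Longrightarrow> aMap G f = inv_into (Arr C) (aMap F) f"
  shows "strict_functor D C G"
proof -
  interpret F: strict_functor C D F by fact
  have o: "oMap G a \<in> Obj C" "oMap F (oMap G a) = a" if "a \<in> Obj D" for a
    using that assms(2,4) by (auto simp: bij_betw_inv_into_right bij_betwE[OF bij_betw_inv_into])
  have a: "aMap G f \<in> Arr C" "aMap F (aMap G f) = f" if "f \<in> Arr D" for f
    using that assms(3,5) by (auto simp: bij_betw_inv_into_right bij_betwE[OF bij_betw_inv_into])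
  have oi: "x = y" if "oMap F x = oMap F y" "x \<in> Obj C" "y \<in> Obj C" for x y
    using assms(2) that by (auto simp: bij_betw_def inj_on_def)
  have ai: "x = y" if "aMap F x = aMap F y" "x \<in> Arr C" "y \<in> Arr C" for x y
    using assms(3) that by (auto simp: bij_betw_def inj_on_def)
  have st: "src C (aMap G f) = oMap G (src D f)" "tgt C (aMap G f) = oMap G (tgt D f)"
    if "f \<in> Arr D" for f
    using that F.aMap_simps[of "aMap G f"] a[OF that] by (auto simp: o intro!: oi)
  show ?thesis
  proof
    fix f g x y z assume "f \<in> Hom D x y" "g \<in> Hom D y z"
    then show "aMap G (g \<cdot>\<^bsub>D\<^esub> f) = aMap G g \<cdot>\<^bsub>C\<^esub> aMap G f"
      by (intro ai) (auto simp: Hom_def a st)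
  qed (auto simp: o a st Hom_def intro!: ai)
qed

context adjunction
begin

lemma unit_at [simp]:
  assumes "a \<in> Obj C"
  shows "\<eta> a \<in> Arr C" "src C (\<eta> a) = a" "tgt C (\<eta> a) = oMap G (oMap F a)"
  using unit.component[OF assms] by (auto simp: func_comp_def func_id_def Hom_def)

lemma counit_at [simp]:
  assumes "b \<in> Obj D"
  shows "\<epsilon> b \<in> Arr D" "src D (\<epsilon> b) = oMap F (oMap G b)" "tgt D (\<epsilon> b) = b"
  using counit.component[OF assms] by (auto simp: func_comp_def func_id_def Hom_def)

lemma unit_nat: "f \<in> Hom C a b \<Longrightarrow> aMap G (aMap F f) \<cdot>\<^bsub>C\<^esub> \<eta> a = \<eta> b \<cdot>\<^bsub>C\<^esub> f"
  using unit.naturality by (auto simp: func_comp_def func_id_def)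

lemma counit_nat: "f \<in> Hom D a b \<Longrightarrow> f \<cdot>\<^bsub>D\<^esub> \<epsilon> a = \<epsilon> b \<cdot>\<^bsub>D\<^esub> aMap F (aMap G f)"
  using counit.naturality by (auto simp: func_comp_def func_id_def)

end

text \<open>The transpose of an arrow from \<open>F a\<close> to \<open>F b\<close> is an arrow from
  \<open>a\<close> to \<open>G (F b)\<close>, and the inverse of the unit at \<open>b\<close>
  carries it back to an arrow from \<open>a\<close> to \<open>b\<close>. For essential surjectivity,
  \<open>b\<close> is isomorphic to \<open>G (F b)\<close>.\<close>

lemma adjunction_unit_iso_imp_full_faithful:
  assumes "adjunction C D F G \<eta> \<epsilon>" "\<And>a. a \<in> Obj C \<Longrightarrow> is_iso C (\<eta> a)"
  shows "full_functor C D F" "faithful_functor C D F" "essentially_surjective D C G"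
proof -
  interpret adjunction C D F G \<eta> \<epsilon> by fact
  have \<theta>: "\<exists>\<theta>. \<theta> \<in> Arr C \<and> src C \<theta> = oMap G (oMap F a) \<and> tgt C \<theta> = a \<and>
    \<theta> \<cdot>\<^bsub>C\<^esub> \<eta> a = idm C a \<and> \<eta> a \<cdot>\<^bsub>C\<^esub> \<theta> = idm C (oMap G (oMap F a))" if "a \<in> Obj C" for a
    using assms(2)[OF that] that by (auto simp: is_iso_def Hom_def)
  \<comment> \<open>The triangle identity makes the counit at \<open>F a\<close> a left inverse of
    \<open>F (\<eta> a)\<close>, hence equal to \<open>F\<close> of any right inverse of
    \<open>\<eta> a\<close>.\<close>
  have eps: "\<epsilon> (oMap F a) = aMap F \<theta>"
    if "a \<in> Obj C" "\<theta> \<in> Arr C" "src C \<theta> = oMap G (oMap F a)" "tgt C \<theta> = a"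
      "\<eta> a \<cdot>\<^bsub>C\<^esub> \<theta> = idm C (oMap G (oMap F a))" for a \<theta>
  proof -
    have \<theta>': "\<theta> \<in> Arr C" "src C \<theta> = oMap G (oMap F a)" "tgt C \<theta> = a" using that by auto
    have "aMap F \<theta> = (\<epsilon> (oMap F a) \<cdot>\<^bsub>D\<^esub> aMap F (\<eta> a)) \<cdot>\<^bsub>D\<^esub> aMap F \<theta>"
      using that(1) \<theta>' triangle_left[of a] by simp
    also have "\<dots> = \<epsilon> (oMap F a) \<cdot>\<^bsub>D\<^esub> aMap F (\<eta> a \<cdot>\<^bsub>C\<^esub> \<theta>)"
      using that(1) \<theta>' by simp
    also have "\<dots> = \<epsilon> (oMap F a)"
      using that(1,5) by simp
    finally show ?thesis ..
  qed
  show "full_functor C D F"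
    unfolding full_functor_def
  proof (intro ballI)
    fix a b g assume a: "a \<in> Obj C" and b: "b \<in> Obj C" and g: "g \<in> Hom D (oMap F a) (oMap F b)"
    note g' = g[unfolded mem_Hom_iff]
    obtain \<theta> where th: "\<theta> \<in> Arr C" "src C \<theta> = oMap G (oMap F b)" "tgt C \<theta> = b"
      "\<theta> \<cdot>\<^bsub>C\<^esub> \<eta> b = idm C b" "\<eta> b \<cdot>\<^bsub>C\<^esub> \<theta> = idm C (oMap G (oMap F b))" using \<theta>[OF b] by blast
    \<comment> \<open>The transpose of \<open>g\<close>, followed by the inverse
      \<open>\<theta>\<close> of the unit at \<open>b\<close>.\<close>
    let ?f = "\<theta> \<cdot>\<^bsub>C\<^esub> (aMap G g \<cdot>\<^bsub>C\<^esub> \<eta> a)"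
    have "aMap F ?f = \<epsilon> (oMap F b) \<cdot>\<^bsub>D\<^esub> (aMap F (aMap G g) \<cdot>\<^bsub>D\<^esub> aMap F (\<eta> a))"
      using a b g' th eps[OF b th(1-3,5)] by simp
    also have "\<dots> = g \<cdot>\<^bsub>D\<^esub> (\<epsilon> (oMap F a) \<cdot>\<^bsub>D\<^esub> aMap F (\<eta> a))"
      using a b g' counit_nat[OF g] by (simp flip: counit.F.dom.assoc)
    also have "\<dots> = g" using triangle_left[OF a] g' by simp
    finally show "\<exists>f\<in>Hom C a b. aMap F f = g"
      using a b g' th by (intro bexI[of _ ?f]) (auto simp: Hom_def)
  qed
  show "faithful_functor C D F"
    unfolding faithful_functor_def
  proof (intro ballI inj_onI)
    fix a b f f' assume a: "a \<in> Obj C" and b: "b \<in> Obj C" and f: "f \<in> Hom C a b"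
      and f': "f' \<in> Hom C a b" and eq: "aMap F f = aMap F f'"
    obtain \<theta> where th: "\<theta> \<in> Arr C" "src C \<theta> = oMap G (oMap F b)" "tgt C \<theta> = b"
      "\<theta> \<cdot>\<^bsub>C\<^esub> \<eta> b = idm C b" using \<theta>[OF b] by blast
    \<comment> \<open>Naturality of the unit moves \<open>f\<close> to the right of
      \<open>\<eta>\<close>, where \<open>\<theta>\<close> cancels; so \<open>f\<close> is computed
      from \<open>F f\<close> alone.\<close>
    have *: "\<theta> \<cdot>\<^bsub>C\<^esub> (aMap G (aMap F f) \<cdot>\<^bsub>C\<^esub> \<eta> a) = f" if "f \<in> Hom C a b" for f
      using unit_nat[OF that] that th b by (simp add: mem_Hom_iff flip: unit.F.dom.assoc)
    show "f = f'" by (rule trans[OF *[OF f, unfolded eq, symmetric] *[OF f']])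
  qed
  show "essentially_surjective D C G"
    unfolding essentially_surjective_def
  proof (intro ballI)
    fix b assume b: "b \<in> Obj C"
    obtain \<theta> where th: "\<theta> \<in> Arr C" "src C \<theta> = oMap G (oMap F b)" "tgt C \<theta> = b"
      "\<theta> \<cdot>\<^bsub>C\<^esub> \<eta> b = idm C b" "\<eta> b \<cdot>\<^bsub>C\<^esub> \<theta> = idm C (oMap G (oMap F b))" using \<theta>[OF b] by blast
    have "is_iso C \<theta>" unfolding is_iso_def
      using th b by (intro conjI bexI[of _ "\<eta> b"]) (auto simp: Hom_def)
    then show "\<exists>a\<in>Obj D. \<exists>f\<in>Hom C (oMap G a) b. is_iso C f"
      using b th by (intro bexI[of _ "oMap F b"] bexI[of _ \<theta>]) (auto simp: Hom_def)
  qed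
qed

text \<open>
  Two adjunctions between the same functors differ by an automorphism \<open>\<theta>\<close> of the left adjoint:
  \<open>\<theta>\<close> is the transpose of the second unit along the first adjunction.
\<close>

lemma adjunction_comparison:
  assumes "adjunction C D F G \<eta> \<epsilon>" "adjunction C D F G \<eta>' \<epsilon>'" "a \<in> Obj C"
  shows "(\<epsilon> (oMap F a) \<cdot>\<^bsub>D\<^esub> aMap F (\<eta>' a)) \<cdot>\<^bsub>D\<^esub> (\<epsilon>' (oMap F a) \<cdot>\<^bsub>D\<^esub> aMap F (\<eta> a)) =
    idm D (oMap F a)"
    and "\<eta>' a = aMap G (\<epsilon> (oMap F a) \<cdot>\<^bsub>D\<^esub> aMap F (\<eta>' a)) \<cdot>\<^bsub>C\<^esub> \<eta> a"
proof -
  interpret A: adjunction C D F G \<eta> \<epsilon> by fact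
  interpret B: adjunction C D F G \<eta>' \<epsilon>' by fact
  let ?Fa = "oMap F a"
  let ?GFa = "oMap G ?Fa"
  note [simp] = \<open>a \<in> Obj C\<close>
  \<comment> \<open>Naturality of \<open>\<epsilon>'\<close> and of \<open>\<eta>\<close> reorders
    the four factors, after which one triangle identity of each adjunction remains.\<close>
  have n1: "aMap F (\<eta>' a) \<cdot>\<^bsub>D\<^esub> \<epsilon>' ?Fa = \<epsilon>' (oMap F ?GFa) \<cdot>\<^bsub>D\<^esub> aMap F (aMap G (aMap F (\<eta>' a)))"
    by (rule B.counit_nat) (simp add: Hom_def)
  have n2: "aMap G (aMap F (\<eta>' a)) \<cdot>\<^bsub>C\<^esub> \<eta> a = \<eta> ?GFa \<cdot>\<^bsub>C\<^esub> \<eta>' a"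
    by (rule A.unit_nat) (simp add: Hom_def)
  have n3: "\<epsilon> ?Fa \<cdot>\<^bsub>D\<^esub> \<epsilon>' (oMap F ?GFa) = \<epsilon>' ?Fa \<cdot>\<^bsub>D\<^esub> aMap F (aMap G (\<epsilon> ?Fa))"
    by (rule B.counit_nat) (simp add: Hom_def)
  have "(\<epsilon> ?Fa \<cdot>\<^bsub>D\<^esub> aMap F (\<eta>' a)) \<cdot>\<^bsub>D\<^esub> (\<epsilon>' ?Fa \<cdot>\<^bsub>D\<^esub> aMap F (\<eta> a)) =
    \<epsilon> ?Fa \<cdot>\<^bsub>D\<^esub> ((aMap F (\<eta>' a) \<cdot>\<^bsub>D\<^esub> \<epsilon>' ?Fa) \<cdot>\<^bsub>D\<^esub> aMap F (\<eta> a))"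
    by simp
  also have "\<dots> = \<epsilon> ?Fa \<cdot>\<^bsub>D\<^esub> (\<epsilon>' (oMap F ?GFa) \<cdot>\<^bsub>D\<^esub> aMap F (aMap G (aMap F (\<eta>' a)) \<cdot>\<^bsub>C\<^esub> \<eta> a))"
    unfolding n1 by simp
  also have "\<dots> = (\<epsilon> ?Fa \<cdot>\<^bsub>D\<^esub> \<epsilon>' (oMap F ?GFa)) \<cdot>\<^bsub>D\<^esub> aMap F (\<eta> ?GFa \<cdot>\<^bsub>C\<^esub> \<eta>' a)"
    unfolding n2 by simp
  also have "\<dots> = \<epsilon>' ?Fa \<cdot>\<^bsub>D\<^esub> (aMap F (aMap G (\<epsilon> ?Fa) \<cdot>\<^bsub>C\<^esub> \<eta> ?GFa) \<cdot>\<^bsub>D\<^esub> aMap F (\<eta>' a))"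
    unfolding n3 by simp
  also have "\<dots> = \<epsilon>' ?Fa \<cdot>\<^bsub>D\<^esub> aMap F (\<eta>' a)"
    using A.triangle_right[of ?Fa] by simp
  also have "\<dots> = idm D ?Fa" by (rule B.triangle_left) simp
  finally show "(\<epsilon> ?Fa \<cdot>\<^bsub>D\<^esub> aMap F (\<eta>' a)) \<cdot>\<^bsub>D\<^esub> (\<epsilon>' ?Fa \<cdot>\<^bsub>D\<^esub> aMap F (\<eta> a)) = idm D ?Fa" .
  have "aMap G (\<epsilon> ?Fa \<cdot>\<^bsub>D\<^esub> aMap F (\<eta>' a)) \<cdot>\<^bsub>C\<^esub> \<eta> a =
      aMap G (\<epsilon> ?Fa) \<cdot>\<^bsub>C\<^esub> (aMap G (aMap F (\<eta>' a)) \<cdot>\<^bsub>C\<^esub> \<eta> a)"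
    by simp
  also have "\<dots> = (aMap G (\<epsilon> ?Fa) \<cdot>\<^bsub>C\<^esub> \<eta> ?GFa) \<cdot>\<^bsub>C\<^esub> \<eta>' a"
    unfolding n2 by simp
  also have "\<dots> = \<eta>' a" using A.triangle_right[of ?Fa] by simp
  finally show "\<eta>' a = aMap G (\<epsilon> ?Fa \<cdot>\<^bsub>D\<^esub> aMap F (\<eta>' a)) \<cdot>\<^bsub>C\<^esub> \<eta> a" ..
qed

text \<open>The second unit is the first one followed by \<open>G\<close> of
  \<open>\<theta>\<close>. The comparison applied to the two adjunctions in both orders gives the
  two composites of \<open>\<theta>\<close> and \<open>\<theta>'\<close>, so \<open>\<theta>\<close>
  is invertible.\<close>

lemma adjunction_unit_iso_transfer:
  assumes "adjunction C D F G \<eta> \<epsilon>" "adjunction C D F G \<eta>' \<epsilon>'" "a \<in> Obj C" "is_iso C (\<eta> a)"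
  shows "is_iso C (\<eta>' a)"
proof -
  interpret A: adjunction C D F G \<eta> \<epsilon> by fact
  interpret B: adjunction C D F G \<eta>' \<epsilon>' by fact
  let ?\<theta> = "\<epsilon> (oMap F a) \<cdot>\<^bsub>D\<^esub> aMap F (\<eta>' a)" and ?\<theta>' = "\<epsilon>' (oMap F a) \<cdot>\<^bsub>D\<^esub> aMap F (\<eta> a)"
  have "is_iso D ?\<theta>"
    unfolding is_iso_def
    using adjunction_comparison(1)[OF assms(1,2,3)] adjunction_comparison(1)[OF assms(2,1,3)]
      assms(3)
    by (intro conjI bexI[of _ ?\<theta>']) (auto simp: Hom_def simp del: A.counit.F.dom.assoc)
  then have "is_iso C (aMap G ?\<theta> \<cdot>\<^bsub>C\<^esub> \<eta> a)"
    using A.right.preserves_iso assms(3,4)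
    by (intro A.unit.F.dom.iso_comp) (auto simp del: A.right.aMap_comp)
  then show ?thesis using adjunction_comparison(2)[OF assms(1,2,3)] by simp
qed

text \<open>Dually, the second counit is the first one preceded by the automorphism
  \<open>\<theta>'\<close> at \<open>G b\<close>.\<close>

lemma adjunction_counit_iso_transfer:
  assumes "adjunction C D F G \<eta> \<epsilon>" "adjunction C D F G \<eta>' \<epsilon>'" "b \<in> Obj D" "is_iso D (\<epsilon> b)"
  shows "is_iso D (\<epsilon>' b)"
proof -
  interpret A: adjunction C D F G \<eta> \<epsilon> by fact
  interpret B: adjunction C D F G \<eta>' \<epsilon>' by fact
  let ?a = "oMap G b"
  let ?\<theta> = "\<epsilon> (oMap F ?a) \<cdot>\<^bsub>D\<^esub> aMap F (\<eta>' ?a)" and ?\<theta>' = "\<epsilon>' (oMap F ?a) \<cdot>\<^bsub>D\<^esub> aMap F (\<eta> ?a)"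
  have a: "?a \<in> Obj C" using assms(3) by simp
  note [simp] = \<open>b \<in> Obj D\<close>
  have "is_iso D ?\<theta>'"
    unfolding is_iso_def
    using adjunction_comparison(1)[OF assms(1,2) a] adjunction_comparison(1)[OF assms(2,1) a]
    by (intro conjI bexI[of _ ?\<theta>]) (auto simp: Hom_def simp del: A.counit.F.dom.assoc)
  then have "is_iso D (\<epsilon> b \<cdot>\<^bsub>D\<^esub> ?\<theta>')"
    by (rule A.counit.F.dom.iso_comp[OF _ assms(4)]) simp
  moreover have "\<epsilon> b \<cdot>\<^bsub>D\<^esub> ?\<theta>' = \<epsilon>' b"
  proof -
    \<comment> \<open>The second counit is natural with respect to the first one, and what is left
      is the right triangle identity of the first adjunction under \<open>F\<close>.\<close>
    have n: "\<epsilon> b \<cdot>\<^bsub>D\<^esub> \<epsilon>' (oMap F ?a) = \<epsilon>' b \<cdot>\<^bsub>D\<^esub> aMap F (aMap G (\<epsilon> b))"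
      by (rule B.counit_nat) (simp add: Hom_def)
    have "\<epsilon> b \<cdot>\<^bsub>D\<^esub> ?\<theta>' = (\<epsilon> b \<cdot>\<^bsub>D\<^esub> \<epsilon>' (oMap F ?a)) \<cdot>\<^bsub>D\<^esub> aMap F (\<eta> ?a)" by simp
    also have "\<dots> = \<epsilon>' b \<cdot>\<^bsub>D\<^esub> aMap F (aMap G (\<epsilon> b) \<cdot>\<^bsub>C\<^esub> \<eta> ?a)" unfolding n by simp
    also have "\<dots> = \<epsilon>' b" using A.triangle_right[of b] by simp
    finally show ?thesis .
  qed
  ultimately show ?thesis by simp
qed


section \<open>Functors between slices\<close>

definition into :: "('o, 'm, 'z) scat_scheme \<Rightarrow> 'o \<Rightarrow> 'm set" where
  "into C \<Gamma> = {A \<in> Arr C. tgt C A = \<Gamma>}"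

lemma into_iff [simp]: "A \<in> into C \<Gamma> \<longleftrightarrow> A \<in> Arr C \<and> tgt C A = \<Gamma>"
  by (simp add: into_def)

text \<open>
  A functor \<open>h\<close> with term structure between slices, in curried form: \<open>sob h P\<close> is \<open>h(P)\<close>, while
  \<open>sar h P Q\<close> is \<open>(h/P)(Q)\<close>, so that \<open>h(P.Q) = h(P).(h/P)(Q)\<close>.
\<close>

record 'u sfun =
  sob :: "'u el \<Rightarrow> 'u el"
  sar :: "'u el \<Rightarrow> 'u el \<Rightarrow> 'u el"
  stm :: "'u el \<Rightarrow> 'u el \<Rightarrow> 'u el \<Rightarrow> 'u el"

definition sf_id :: "'u sfun" where
  "sf_id = \<lparr>sob = (\<lambda>P. P), sar = (\<lambda>P Q. Q), stm = (\<lambda>P Q y. y)\<rparr>"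

definition sf_comp :: "'u sfun \<Rightarrow> 'u sfun \<Rightarrow> 'u sfun"  (infixr "\<odot>" 75) where
  "k \<odot> h =
     \<lparr>sob = (\<lambda>P. sob k (sob h P)), sar = (\<lambda>P Q. sar k (sob h P) (sar h P Q)),
      stm = (\<lambda>P Q y. stm k (sob h P) (sar h P Q) (stm h P Q y))\<rparr>"

text \<open>This is \<open>h/A\<close> with the slice over \<open>A\<close> already identified with
  the slice over its source: since \<open>sar h A\<close> is the action of \<open>h/A\<close> on
  objects, no flattening of nested pairs remains.\<close>

definition sliced :: "('u el, 'u el, 'z) scat_scheme \<Rightarrow> 'u sfun \<Rightarrow> 'u el \<Rightarrow> 'u sfun" where
  "sliced C h A =
     \<lparr>sob = sar h A, sar = (\<lambda>P. sar h (A \<cdot>\<^bsub>C\<^esub> P)), stm = (\<lambda>P. stm h (A \<cdot>\<^bsub>C\<^esub> P))\<rparr>"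

lemma sf_id_simps [simp]: "sob sf_id P = P" "sar sf_id P Q = Q" "stm sf_id P Q y = y"
  by (simp_all add: sf_id_def)

lemma sf_comp_simps [simp]:
  "sob (k \<odot> h) P = sob k (sob h P)" "sar (k \<odot> h) P Q = sar k (sob h P) (sar h P Q)"
  "stm (k \<odot> h) P Q y = stm k (sob h P) (sar h P Q) (stm h P Q y)"
  by (simp_all add: sf_comp_def)

lemma sliced_simps [simp]:
  "sob (sliced C h A) P = sar h A P" "sar (sliced C h A) P Q = sar h (A \<cdot>\<^bsub>C\<^esub> P) Q"
  "stm (sliced C h A) P Q y = stm h (A \<cdot>\<^bsub>C\<^esub> P) Q y"
  by (simp_all add: sliced_def)

lemma sf_comp_assoc: "(k \<odot> h) \<odot> g = k \<odot> h \<odot> g"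
  by (simp add: sf_comp_def)

lemma sf_comp_id [simp]: "sf_id \<odot> h = h" "h \<odot> sf_id = h"
  by (simp_all add: sf_comp_def)

lemma sliced_id [simp]: "sliced C sf_id A = sf_id"
  by (simp add: sliced_def sf_id_def)

text \<open>Values outside the carriers are arbitrary, so two functors can only be compared on the
  slice over \<open>\<Gamma>\<close>.\<close>

definition sf_eq :: "('u el, 'u el, 'u el, 'z) tcat_scheme \<Rightarrow> 'u el \<Rightarrow> 'u sfun \<Rightarrow> 'u sfun \<Rightarrow> bool" where
  "sf_eq E \<Gamma> h k \<longleftrightarrow> (\<forall>P\<in>into E \<Gamma>. sob h P = sob k P \<and>
     (\<forall>Q\<in>into E (src E P). sar h P Q = sar k P Q \<and> (\<forall>y\<in>Tm E Q. stm h P Q y = stm k P Q y)))"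

text \<open>Functor laws in curried form: the last clause is preservation of composites,
  \<open>(h/P)(Q.R) = (h/P)(Q).(h/P.Q)(R)\<close>. Preservation of the terminal object of the slice
  is included, because every \<open>S\<^sub>x\<close> and \<open>W\<^sub>A\<close> has it.\<close>

definition sf_functor ::
    "('u el, 'u el, 'u el, 'z) tcat_scheme \<Rightarrow> 'u el \<Rightarrow> ('u el, 'u el, 'u el, 'y) tcat_scheme
     \<Rightarrow> 'u el \<Rightarrow> 'u sfun \<Rightarrow> bool" where
  "sf_functor E \<Gamma> D \<Delta> h \<longleftrightarrow>
     \<Gamma> \<in> Obj E \<and> \<Delta> \<in> Obj D \<and> sob h (idm E \<Gamma>) = idm D \<Delta> \<and>
     (\<forall>P\<in>into E \<Gamma>. sob h P \<in> into D \<Delta> \<and> sar h P (idm E (src E P)) = idm D (src D (sob h P)) \<and>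
       (\<forall>Q\<in>into E (src E P). sar h P Q \<in> into D (src D (sob h P)) \<and>
         sob h (P \<cdot>\<^bsub>E\<^esub> Q) = sob h P \<cdot>\<^bsub>D\<^esub> sar h P Q \<and>
         (\<forall>y\<in>Tm E Q. stm h P Q y \<in> Tm D (sar h P Q)) \<and>
         (\<forall>R\<in>into E (src E Q). sar h P (Q \<cdot>\<^bsub>E\<^esub> R) = sar h P Q \<cdot>\<^bsub>D\<^esub> sar h (P \<cdot>\<^bsub>E\<^esub> Q) R)))"

lemma sf_eq_refl [simp]: "sf_eq E \<Gamma> h h"
  by (simp add: sf_eq_def)

lemma sf_eq_sym: "sf_eq E \<Gamma> h k \<Longrightarrow> sf_eq E \<Gamma> k h"
  by (simp add: sf_eq_def)

lemma sf_eq_trans [trans]: "\<lbrakk>sf_eq E \<Gamma> h k; sf_eq E \<Gamma> k l\<rbrakk> \<Longrightarrow> sf_eq E \<Gamma> h l"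
  by (simp add: sf_eq_def)

text \<open>Calculations mix \<open>sf_eq\<close> with plain equations such as
  \<open>sf_comp_assoc\<close>.\<close>

lemma sf_eq_trans_rules [trans]:
  "\<lbrakk>h = k; sf_eq E \<Gamma> k l\<rbrakk> \<Longrightarrow> sf_eq E \<Gamma> h l"
  "\<lbrakk>sf_eq E \<Gamma> h k; k = l\<rbrakk> \<Longrightarrow> sf_eq E \<Gamma> h l"
  by simp_all

lemma sf_eqD:
  assumes "sf_eq E \<Gamma> h k" "P \<in> Arr E" "tgt E P = \<Gamma>"
  shows "sob h P = sob k P"
    and "\<lbrakk>Q \<in> Arr E; tgt E Q = src E P\<rbrakk> \<Longrightarrow> sar h P Q = sar k P Q"
    and "\<lbrakk>Q \<in> Arr E; tgt E Q = src E P; y \<in> Tm E Q\<rbrakk> \<Longrightarrow> stm h P Q y = stm k P Q y"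
  using assms by (auto simp: sf_eq_def)

lemma sf_functorD:
  assumes "sf_functor E \<Gamma> D \<Delta> h"
  shows "\<Gamma> \<in> Obj E" "\<Delta> \<in> Obj D" "sob h (idm E \<Gamma>) = idm D \<Delta>"
    and "\<And>P. \<lbrakk>P \<in> Arr E; tgt E P = \<Gamma>\<rbrakk> \<Longrightarrow> sob h P \<in> Arr D"
    and "\<And>P. \<lbrakk>P \<in> Arr E; tgt E P = \<Gamma>\<rbrakk> \<Longrightarrow> tgt D (sob h P) = \<Delta>"
    and "\<And>P X. \<lbrakk>P \<in> Arr E; tgt E P = \<Gamma>; X = src E P\<rbrakk> \<Longrightarrow> sar h P (idm E X) = idm D (src D (sob h P))"
    and "\<And>P Q. \<lbrakk>P \<in> Arr E; tgt E P = \<Gamma>; Q \<in> Arr E; tgt E Q = src E P\<rbrakk> \<Longrightarrow> sar h P Q \<in> Arr D"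
    and "\<And>P Q. \<lbrakk>P \<in> Arr E; tgt E P = \<Gamma>; Q \<in> Arr E; tgt E Q = src E P\<rbrakk>
           \<Longrightarrow> tgt D (sar h P Q) = src D (sob h P)"
    and "\<And>P Q. \<lbrakk>P \<in> Arr E; tgt E P = \<Gamma>; Q \<in> Arr E; tgt E Q = src E P\<rbrakk>
           \<Longrightarrow> sob h (P \<cdot>\<^bsub>E\<^esub> Q) = sob h P \<cdot>\<^bsub>D\<^esub> sar h P Q"
    and "\<And>P Q y. \<lbrakk>P \<in> Arr E; tgt E P = \<Gamma>; Q \<in> Arr E; tgt E Q = src E P; y \<in> Tm E Q\<rbrakk>
           \<Longrightarrow> stm h P Q y \<in> Tm D (sar h P Q)"
    and "\<And>P Q R. \<lbrakk>P \<in> Arr E; tgt E P = \<Gamma>; Q \<in> Arr E; tgt E Q = src E P; R \<in> Arr E;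
           tgt E R = src E Q\<rbrakk>
           \<Longrightarrow> sar h P (Q \<cdot>\<^bsub>E\<^esub> R) = sar h P Q \<cdot>\<^bsub>D\<^esub> sar h (P \<cdot>\<^bsub>E\<^esub> Q) R"
  using assms by (auto simp: sf_functor_def)

text \<open>As \<open>h\<close> preserves the identity object,
  \<open>h(id.P) = h(id).(h/id)(P)\<close> collapses. A term of an object \<open>P\<close> is acted
  on through the arrow \<open>Pr (idm E \<Gamma>) P\<close>, so this is what places its image among
  the terms of \<open>h(P)\<close>.\<close>

lemma sf_functor_sob:
  assumes "sf_functor E \<Gamma> D \<Delta> h" "strict_category E" "strict_category D" "P \<in> Arr E" "tgt E P = \<Gamma>"
  shows "sar h (idm E \<Gamma>) P = sob h P"
proof -
  interpret E: strict_category E by fact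
  interpret D: strict_category D by fact
  note h = sf_functorD[OF assms(1)]
  have id: "idm E \<Gamma> \<in> Arr E" "tgt E (idm E \<Gamma>) = \<Gamma>" "tgt E P = src E (idm E \<Gamma>)"
    using assms(5) h(1) by simp_all
  have "sob h P = idm D \<Delta> \<cdot>\<^bsub>D\<^esub> sar h (idm E \<Gamma>) P"
    using h(9)[OF id(1,2) assms(4) id(3)] assms(4,5) by (simp add: h(3))
  moreover have "sar h (idm E \<Gamma>) P \<in> Arr D" "tgt D (sar h (idm E \<Gamma>) P) = \<Delta>"
    using h(7)[OF id(1,2) assms(4) id(3)] h(8)[OF id(1,2) assms(4) id(3)] h(2)
    by (simp_all add: h(3))
  ultimately show ?thesis by simp
qed

lemma sf_functor_cong:
  assumes "sf_functor E \<Gamma> D \<Delta> h" "sf_eq E \<Gamma> h k" "strict_category E"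
  shows "sf_functor E \<Gamma> D \<Delta> k"
proof -
  interpret E: strict_category E by fact
  note h = sf_functorD[OF assms(1)]
  note hk = sf_eqD[OF assms(2), symmetric]
  show ?thesis
    unfolding sf_functor_def by (auto simp: hk h)
qed

lemma sf_functor_id: "\<lbrakk>strict_category E; \<Gamma> \<in> Obj E\<rbrakk> \<Longrightarrow> sf_functor E \<Gamma> E \<Gamma> sf_id"
  by (auto simp: sf_functor_def)

lemma sf_functor_comp:
  assumes "sf_functor E \<Gamma> D \<Delta> h" "sf_functor D \<Delta> K \<Theta> k"
    and "strict_category E" "strict_category D"
  shows "sf_functor E \<Gamma> K \<Theta> (k \<odot> h)"
proof -
  interpret E: strict_category E by fact
  interpret D: strict_category D by fact
  note h = sf_functorD[OF assms(1)]
  note k = sf_functorD[OF assms(2)]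
  show ?thesis
    unfolding sf_functor_def by (auto simp: h k)
qed

lemma sf_functor_sliced:
  assumes "sf_functor E \<Gamma> D \<Delta> h" "strict_category E" "strict_category D"
    and "A \<in> Arr E" "tgt E A = \<Gamma>"
  shows "sf_functor E (src E A) D (src D (sob h A)) (sliced E h A)"
proof -
  interpret E: strict_category E by fact
  interpret D: strict_category D by fact
  note h = sf_functorD[OF assms(1)]
  show ?thesis
    unfolding sf_functor_def using assms(4,5) by (auto simp: h)
qed

lemma sf_eq_comp:
  assumes "sf_eq E \<Gamma> h h'" "sf_eq D \<Delta> k k'" "sf_functor E \<Gamma> D \<Delta> h"
  shows "sf_eq E \<Gamma> (k \<odot> h) (k' \<odot> h')"
  using sf_eqD[OF assms(1)] sf_eqD[OF assms(2)] sf_functorD[OF assms(3)]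
  by (simp add: sf_eq_def)

text \<open>The functor \<open>h\<close> has to land where the outer functors are known to
  agree.\<close>

lemma sf_eq_comp_left:
  "\<lbrakk>sf_eq D \<Delta> k k'; sf_functor E \<Gamma> D \<Delta> h\<rbrakk> \<Longrightarrow> sf_eq E \<Gamma> (k \<odot> h) (k' \<odot> h)"
  by (simp add: sf_eq_comp)

lemma sf_eq_comp_right: "sf_eq E \<Gamma> h h' \<Longrightarrow> sf_eq E \<Gamma> (k \<odot> h) (k \<odot> h')"
  by (simp add: sf_eq_def)

lemma sf_eq_sliced:
  assumes "sf_eq E \<Gamma> h k" "strict_category E" "A \<in> Arr E" "tgt E A = \<Gamma>"
  shows "sf_eq E (src E A) (sliced E h A) (sliced E k A)"
proof -
  interpret strict_category E by fact
  show ?thesis using assms by (simp add: sf_eq_def)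
qed

text \<open>A chain rule, \<open>(k \<circ> h)/A = (k/h(A)) \<circ> (h/A)\<close>, which rests on
  \<open>h(A.P) = h(A).(h/A)(P)\<close>.\<close>

lemma sliced_comp:
  assumes "sf_functor E \<Gamma> D \<Delta> h" "A \<in> Arr E" "tgt E A = \<Gamma>"
  shows "sf_eq E (src E A) (sliced E (k \<odot> h) A) (sliced D k (sob h A) \<odot> sliced E h A)"
  using assms(2,3) by (simp add: sf_eq_def sf_functorD[OF assms(1)])

text \<open>Slicing twice shifts the argument first by \<open>P\<close> and then by
  \<open>A\<close>, which is one shift by \<open>A.P\<close> up to associativity.\<close>

lemma sliced_sliced:
  assumes "strict_category E" "A \<in> Arr E" "P \<in> Arr E" "tgt E P = src E A"
  shows "sf_eq E (src E P) (sliced E (sliced E h A) P) (sliced E h (A \<cdot>\<^bsub>E\<^esub> P))"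
proof -
  interpret strict_category E by fact
  show ?thesis using assms by (simp add: sf_eq_def)
qed

lemma sliced_idm:
  assumes "sf_functor E \<Gamma> D \<Delta> h" "strict_category E" "strict_category D"
  shows "sf_eq E \<Gamma> (sliced E h (idm E \<Gamma>)) h"
proof -
  interpret strict_category E by fact
  show ?thesis using sf_functor_sob[OF assms] by (simp add: sf_eq_def)
qed

text \<open>
  Every functor between slices is \<open>sf_coherent\<close>, as its value on \<open>Pr P Q\<close> has target \<open>h(P)\<close>; only
  then does \<open>sf_of\<close> lose no information.
\<close>

definition sf_of :: "'u tfunc \<Rightarrow> 'u sfun" where
  "sf_of h =
     \<lparr>sob = oMap h, sar = (\<lambda>P Q. psnd (aMap h (Pr P Q))), stm = (\<lambda>P Q. tMap h (Pr P Q))\<rparr>"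

definition sf_coherent :: "('u el, 'u el, 'z) scat_scheme \<Rightarrow> 'u el \<Rightarrow> 'u tfunc \<Rightarrow> bool" where
  "sf_coherent C \<Gamma> h \<longleftrightarrow>
     (\<forall>P\<in>into C \<Gamma>. \<forall>Q\<in>into C (src C P). aMap h (Pr P Q) = Pr (oMap h P) (psnd (aMap h (Pr P Q))))"

text \<open>The functor \<open>H/\<Gamma>\<close> for a functor \<open>H\<close> between whole
  categories. It acts on underlying arrows and terms, so neither \<open>\<Gamma>\<close> nor the
  base \<open>P\<close> enters, and slicing it changes nothing.\<close>

definition sf_lift :: "'u tfunc \<Rightarrow> 'u sfun" where
  "sf_lift H = \<lparr>sob = aMap H, sar = (\<lambda>P. aMap H), stm = (\<lambda>P. tMap H)\<rparr>"

abbreviation SubF :: "'u esys \<Rightarrow> 'u el \<Rightarrow> 'u el \<Rightarrow> 'u sfun" where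
  "SubF E A x \<equiv> sf_of (Sub E A x)"

abbreviation WkF :: "'u esys \<Rightarrow> 'u el \<Rightarrow> 'u sfun" where
  "WkF E A \<equiv> sf_of (Wk E A)"

lemma sf_lift_simps [simp]:
  "sob (sf_lift H) P = aMap H P" "sar (sf_lift H) P Q = aMap H Q" "stm (sf_lift H) P Q y = tMap H Q y"
  by (simp_all add: sf_lift_def)

lemma sliced_sf_lift [simp]: "sliced C (sf_lift H) A = sf_lift H"
  by (simp add: sliced_def sf_lift_def)

lemma sf_lift_tcomp: "sf_lift (tcomp G H) = sf_lift G \<odot> sf_lift H"
  by (simp add: sf_lift_def sf_comp_def tcomp_def fun_eq_iff)

lemma sf_lift_tid: "sf_lift tid = sf_id"
  by (simp add: sf_lift_def sf_id_def tid_def)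

lemma sf_of_over: "sf_of (over H) = sf_lift H"
  by (simp add: sf_of_def sf_lift_def over_def)

lemma sf_of_tid: "sf_of tid = sf_id"
  by (simp add: sf_of_def sf_id_def tid_def)

lemma sf_of_slice_over: "sf_of (slice_over C G A) = sliced C (sf_of G) A"
  by (simp add: sf_of_def sliced_def slice_over_def tcomp_def flat_def over_def unflat_def
      fun_eq_iff)

lemma sf_coherentD: 
  assumes "sf_coherent C \<Gamma> h" "P \<in> Arr C" "tgt C P = \<Gamma>" "Q \<in> Arr C" "tgt C Q = src C P"
  shows "aMap h (Pr P Q) = Pr (sob (sf_of h) P) (sar (sf_of h) P Q)"
  using assms by (simp add: sf_coherent_def sf_of_def)

lemma sf_coherent_over: "sf_coherent C \<Gamma> (over H)"
  by (simp add: sf_coherent_def over_def)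

lemma sf_coherent_tid: "sf_coherent C \<Gamma> tid"
  by (simp add: sf_coherent_def tid_def)

lemma sf_coherent_slice_over: "sf_coherent C \<Gamma> (slice_over E G A)"
  by (simp add: sf_coherent_def slice_over_def tcomp_def flat_def over_def unflat_def)

lemma sf_coherent_tcomp:
  assumes "sf_coherent E \<Gamma> h" "sf_functor E \<Gamma> D \<Delta> (sf_of h)" "sf_coherent D \<Delta> k"
  shows "sf_coherent E \<Gamma> (tcomp k h)"
  by (simp add: sf_coherent_def tcomp_def sf_coherentD[OF assms(1)] sf_coherentD[OF assms(3)]
      sf_functorD[OF assms(2)]) (simp add: sf_of_def)

text \<open>The outer functor is evaluated at the pair \<open>aMap h (Pr P Q)\<close>, whose first
  component is \<open>h(P)\<close> only by coherence of \<open>h\<close>.\<close>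

lemma sf_of_tcomp:
  assumes "sf_coherent E \<Gamma> h"
  shows "sf_eq E \<Gamma> (sf_of (tcomp k h)) (sf_of k \<odot> sf_of h)"
  using sf_coherentD[OF assms] by (simp add: sf_eq_def) (simp add: sf_of_def tcomp_def)

section \<open>Slices as strict categories, and their functors in curried form\<close>

lemma eslice_simps [simp]:
  "Obj (eslice E \<Gamma>) = into E \<Gamma>"
  "Pr P Q \<in> Arr (eslice E \<Gamma>) \<longleftrightarrow> P \<in> into E \<Gamma> \<and> Q \<in> into E (src E P)"
  "src (eslice E \<Gamma>) X = pfst X \<cdot>\<^bsub>E\<^esub> psnd X"
  "tgt (eslice E \<Gamma>) X = pfst X"
  "idm (eslice E \<Gamma>) P = Pr P (idm E (src E P))"
  "cmp (eslice E \<Gamma>) Y X = Pr (pfst Y) (psnd Y \<cdot>\<^bsub>E\<^esub> psnd X)"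
  "Tm (eslice E \<Gamma>) X = Tm E (psnd X)"
  "root (eslice E \<Gamma>) = idm E \<Gamma>"
  "Sub (eslice E \<Gamma>) X x = tcomp (unflat E (pfst X)) (tcomp (Sub E (psnd X) x) flat)"
  "Wk (eslice E \<Gamma>) X = tcomp (unflat E (pfst X \<cdot>\<^bsub>E\<^esub> psnd X)) (tcomp (Wk E (psnd X)) flat)"
  "idtm (eslice E \<Gamma>) X = idtm E (psnd X)"
  by (auto simp: eslice_def slice_def into_def)

lemma Arr_eslice: "Arr (eslice E \<Gamma>) = {Pr P Q | P Q. P \<in> into E \<Gamma> \<and> Q \<in> into E (src E P)}"
  by (auto simp: eslice_def slice_def)

lemma ball_Arr_eslice: "(\<forall>X\<in>Arr (eslice E \<Gamma>). \<phi> X) \<longleftrightarrow> (\<forall>P\<in>into E \<Gamma>. \<forall>Q\<in>into E (src E P). \<phi> (Pr P Q))"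
  unfolding Arr_eslice by blast

lemma slice_simps [simp]:
  "Obj (slice E \<Gamma>) = into E \<Gamma>"
  "Pr P Q \<in> Arr (slice E \<Gamma>) \<longleftrightarrow> P \<in> into E \<Gamma> \<and> Q \<in> into E (src E P)"
  "src (slice E \<Gamma>) X = pfst X \<cdot>\<^bsub>E\<^esub> psnd X"
  "tgt (slice E \<Gamma>) X = pfst X"
  "idm (slice E \<Gamma>) P = Pr P (idm E (src E P))"
  "cmp (slice E \<Gamma>) Y X = Pr (pfst Y) (psnd Y \<cdot>\<^bsub>E\<^esub> psnd X)"
  by (auto simp: slice_def into_def)

lemma Arr_slice: "Arr (slice E \<Gamma>) = {Pr P Q | P Q. P \<in> into E \<Gamma> \<and> Q \<in> into E (src E P)}"
  by (auto simp: slice_def)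

lemma ball_Arr_slice: "(\<forall>X\<in>Arr (slice E \<Gamma>). \<phi> X) \<longleftrightarrow> (\<forall>P\<in>into E \<Gamma>. \<forall>Q\<in>into E (src E P). \<phi> (Pr P Q))"
  unfolding Arr_slice by blast

lemma Hom_slice:
  "X \<in> Hom (slice C \<Gamma>) a b \<longleftrightarrow>
    (\<exists>Q. X = Pr b Q \<and> b \<in> into C \<Gamma> \<and> Q \<in> into C (src C b) \<and> a = b \<cdot>\<^bsub>C\<^esub> Q)"
  by (auto simp: Hom_def Arr_slice)

lemma strict_category_slice:
  assumes "strict_category C"
  shows "strict_category (slice C \<Gamma>)"
proof -
  interpret strict_category C by fact
  show ?thesis
  proof (rule strict_category.intro)
    fix f g h a b c d
    assume "f \<in> Hom (slice C \<Gamma>) a b" "g \<in> Hom (slice C \<Gamma>) b c" "h \<in> Hom (slice C \<Gamma>) c d"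
    then obtain Q R S where *: "f = Pr b Q" "g = Pr c R" "h = Pr d S" "d \<in> into C \<Gamma>"
      "S \<in> into C (src C d)" "R \<in> into C (src C c)" "Q \<in> into C (src C b)"
      and c: "c = d \<cdot>\<^bsub>C\<^esub> S" and b: "b = c \<cdot>\<^bsub>C\<^esub> R"
      unfolding Hom_slice by blast
    have "src C c = src C S" "src C b = src C R" using * by (simp_all add: c b)
    then have "S \<cdot>\<^bsub>C\<^esub> R \<cdot>\<^bsub>C\<^esub> Q = S \<cdot>\<^bsub>C\<^esub> (R \<cdot>\<^bsub>C\<^esub> Q)" using * by simp
    then show "h \<cdot>\<^bsub>slice C \<Gamma>\<^esub> g \<cdot>\<^bsub>slice C \<Gamma>\<^esub> f = h \<cdot>\<^bsub>slice C \<Gamma>\<^esub> (g \<cdot>\<^bsub>slice C \<Gamma>\<^esub> f)"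
      using *(1-3) by simp
  next
    fix f g a b c assume "f \<in> Hom (slice C \<Gamma>) a b" "g \<in> Hom (slice C \<Gamma>) b c"
    then obtain Q R where *: "f = Pr b Q" "g = Pr c R" "c \<in> into C \<Gamma>"
      "R \<in> into C (src C c)" "Q \<in> into C (src C b)"
      and b: "b = c \<cdot>\<^bsub>C\<^esub> R" and a: "a = b \<cdot>\<^bsub>C\<^esub> Q"
      unfolding Hom_slice by blast
    have "src C b = src C R" using * by (simp add: b)
    then have "R \<cdot>\<^bsub>C\<^esub> Q \<in> into C (src C c)" "a = c \<cdot>\<^bsub>C\<^esub> (R \<cdot>\<^bsub>C\<^esub> Q)"
      using * by (simp_all add: a b)
    then show "g \<cdot>\<^bsub>slice C \<Gamma>\<^esub> f \<in> Hom (slice C \<Gamma>) a c"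
      unfolding Hom_slice using *(1-3) by simp
  next
    fix a assume "a \<in> Obj (slice C \<Gamma>)"
    then show "idm (slice C \<Gamma>) a \<in> Hom (slice C \<Gamma>) a a"
      by (simp add: Hom_def)
  qed (auto simp: Arr_slice)
qed

lemma Hom_eslice:
  "X \<in> Hom (eslice E \<Gamma>) a b \<longleftrightarrow>
    (\<exists>Q. X = Pr b Q \<and> b \<in> into E \<Gamma> \<and> Q \<in> into E (src E b) \<and> a = b \<cdot>\<^bsub>E\<^esub> Q)"
  by (auto simp: Hom_def Arr_eslice)

lemma strict_category_eslice: "strict_category E \<Longrightarrow> strict_category (eslice E \<Gamma>)"
  using strict_category_slice[of E \<Gamma>] by (simp add: strict_category_def Hom_def eslice_def)

text \<open>A functor preserves targets, so the first component of its value at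
  \<open>Pr P Q\<close> is forced and the curried form loses nothing. Preservation of composites in
  the slice then becomes the last clause of \<open>sf_functor\<close>.\<close>

lemma tfunctor_slice_iff:
  assumes "strict_category E" "strict_category D" "\<Gamma> \<in> Obj E" "\<Delta> \<in> Obj D"
  shows "tfunctor (eslice E \<Gamma>) (eslice D \<Delta>) h \<and> oMap h (idm E \<Gamma>) = idm D \<Delta> \<longleftrightarrow>
    sf_coherent E \<Gamma> h \<and> sf_functor E \<Gamma> D \<Delta> (sf_of h)" (is "?L \<longleftrightarrow> ?R")
proof -
  interpret E: strict_category E by fact
  interpret D: strict_category D by fact
  interpret E': strict_category "eslice E \<Gamma>" by (rule strict_category_eslice) fact
  interpret D': strict_category "eslice D \<Delta>" by (rule strict_category_eslice) fact
  show ?thesis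
  proof
    assume L: ?L
    then interpret h: strict_functor "eslice E \<Gamma>" "eslice D \<Delta>" h by (simp add: tfunctor_def)
    \<comment> \<open>The target gives the first component of the image and the source gives the
      equation for \<open>h(P.Q)\<close>.\<close>
    have a: "\<exists>R. aMap h (Pr P Q) = Pr (oMap h P) R \<and> oMap h P \<in> into D \<Delta> \<and>
        R \<in> into D (src D (oMap h P)) \<and> oMap h (P \<cdot>\<^bsub>E\<^esub> Q) = oMap h P \<cdot>\<^bsub>D\<^esub> R"
      if "P \<in> into E \<Gamma>" "Q \<in> into E (src E P)" for P Q
      using that h.aMap_simps[of "Pr P Q"] by (auto simp: Arr_eslice)
    have coh: "sf_coherent E \<Gamma> h"
      unfolding sf_coherent_def using a by fastforce
    note ar = sf_coherentD[OF coh]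
    have b: "sob (sf_of h) P \<in> into D \<Delta> \<and> sar (sf_of h) P Q \<in> into D (src D (sob (sf_of h) P)) \<and>
        sob (sf_of h) (P \<cdot>\<^bsub>E\<^esub> Q) = sob (sf_of h) P \<cdot>\<^bsub>D\<^esub> sar (sf_of h) P Q"
      if "P \<in> into E \<Gamma>" "Q \<in> into E (src E P)" for P Q
      using a[OF that] by (auto simp: sf_of_def)
    have c: "sar (sf_of h) P (idm E (src E P)) = idm D (src D (sob (sf_of h) P))"
      if "P \<in> into E \<Gamma>" for P
      using h.aMap_idm[of P] that by (simp add: sf_of_def)
    have d: "sar (sf_of h) P (Q \<cdot>\<^bsub>E\<^esub> R) = sar (sf_of h) P Q \<cdot>\<^bsub>D\<^esub> sar (sf_of h) (P \<cdot>\<^bsub>E\<^esub> Q) R"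
      if "P \<in> into E \<Gamma>" "Q \<in> into E (src E P)" "R \<in> into E (src E Q)" for P Q R
      using h.aMap_comp[of "Pr (P \<cdot>\<^bsub>E\<^esub> Q) R" "Pr P Q"] that by (simp add: ar)
    have e: "stm (sf_of h) P Q y \<in> Tm D (sar (sf_of h) P Q)"
      if "P \<in> into E \<Gamma>" "Q \<in> into E (src E P)" "y \<in> Tm E Q" for P Q y
    proof -
      have "tMap h (Pr P Q) y \<in> Tm (eslice D \<Delta>) (aMap h (Pr P Q))"
        using L that unfolding tfunctor_def by fastforce
      then show ?thesis using that by (simp add: ar) (simp add: sf_of_def)
    qed
    have f: "sob (sf_of h) (idm E \<Gamma>) = idm D \<Delta>" using L by (simp add: sf_of_def)
    have g: "sob (sf_of h) P \<in> into D \<Delta>" if "P \<in> into E \<Gamma>" for P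
      using b[OF that, of "idm E (src E P)"] that by simp
    note b1 = b[THEN conjunct2, THEN conjunct1] and b2 = b[THEN conjunct2, THEN conjunct2]
    show ?R
      unfolding sf_functor_def
      by (intro conjI ballI; (assumption | rule coh assms(3,4) f g c b1 b2 e d))
  next
    assume R: ?R
    note ar = sf_coherentD[OF conjunct1[OF R]] and h = sf_functorD[OF conjunct2[OF R]]
    have [simp]: "oMap h = sob (sf_of h)" "tMap h (Pr P Q) = stm (sf_of h) P Q" for P Q
      by (simp_all add: sf_of_def)
    have "strict_functor (eslice E \<Gamma>) (eslice D \<Delta>) h"
    proof
      fix f g a b c assume "f \<in> Hom (eslice E \<Gamma>) a b" "g \<in> Hom (eslice E \<Gamma>) b c"
      then obtain Q R where *: "f = Pr b Q" "g = Pr c R" "c \<in> into E \<Gamma>" "R \<in> into E (src E c)"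
        "Q \<in> into E (src E b)" and b: "b = c \<cdot>\<^bsub>E\<^esub> R"
        unfolding Hom_eslice by blast
      then have "src E b = src E R" by simp
      with * have "aMap h (Pr c (R \<cdot>\<^bsub>E\<^esub> Q)) = aMap h (Pr c R) \<cdot>\<^bsub>eslice D \<Delta>\<^esub> aMap h (Pr b Q)"
        by (simp add: ar h) (simp add: ar h b)
      then show "aMap h (g \<cdot>\<^bsub>eslice E \<Gamma>\<^esub> f) = aMap h g \<cdot>\<^bsub>eslice D \<Delta>\<^esub> aMap h f"
        using * by simp
    qed (auto simp: Hom_def Arr_eslice ar h)
    moreover have "\<forall>X\<in>Arr (eslice E \<Gamma>). \<forall>x\<in>Tm (eslice E \<Gamma>) X. tMap h X x \<in> Tm (eslice D \<Delta>) (aMap h X)"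
      unfolding ball_Arr_eslice by (simp add: ar h)
    ultimately show ?L
      by (simp add: tfunctor_def h)
  qed
qed

lemma tfunc_eq_iff_sf_eq:
  assumes "sf_coherent E \<Gamma> h" "sf_coherent E \<Gamma> k"
  shows "tfunc_eq (eslice E \<Gamma>) h k \<longleftrightarrow> sf_eq E \<Gamma> (sf_of h) (sf_of k)"
  unfolding tfunc_eq_def ball_Arr_eslice
  using sf_coherentD[OF assms(1)] sf_coherentD[OF assms(2)]
  by (simp add: sf_eq_def) (auto simp: sf_of_def)

section \<open>Homomorphisms between slices of E-systems\<close>

text \<open>An arrow of the slice over \<open>\<Gamma>\<close> is \<open>Pr P Q\<close>, and the
  operations of the slice at it are those of \<open>Q\<close>. With slices of slices flattened,
  \<open>h\<close> over the source and over the target of this arrow becomes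
  \<open>sliced E h\<close> at \<open>P.Q\<close> and at \<open>P\<close>; the clauses are those of
  a pre-E-homomorphism between slices.\<close>

definition sf_hom :: "'u esys \<Rightarrow> 'u el \<Rightarrow> 'u esys \<Rightarrow> 'u el \<Rightarrow> 'u sfun \<Rightarrow> bool" where
  "sf_hom E \<Gamma> D \<Delta> h \<longleftrightarrow> sf_functor E \<Gamma> D \<Delta> h \<and>
     (\<forall>P\<in>into E \<Gamma>. \<forall>Q\<in>into E (src E P).
       (\<forall>x\<in>Tm E Q. sf_eq E (src E Q) (sliced E h P \<odot> SubF E Q x)
          (SubF D (sar h P Q) (stm h P Q x) \<odot> sliced E h (P \<cdot>\<^bsub>E\<^esub> Q))) \<and>
       sf_eq E (src E P) (sliced E h (P \<cdot>\<^bsub>E\<^esub> Q) \<odot> WkF E Q)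
         (WkF D (sar h P Q) \<odot> sliced E h P) \<and>
       stm h (P \<cdot>\<^bsub>E\<^esub> Q) (sob (WkF E Q) Q) (idtm E Q) = idtm D (sar h P Q))"

lemma sf_homD:
  assumes "sf_hom E \<Gamma> D \<Delta> h" 
  shows "sf_functor E \<Gamma> D \<Delta> h"
    and "\<And>P Q x. \<lbrakk>P \<in> Arr E; tgt E P = \<Gamma>; Q \<in> Arr E; tgt E Q = src E P; x \<in> Tm E Q\<rbrakk>
      \<Longrightarrow> sf_eq E (src E Q) (sliced E h P \<odot> SubF E Q x)
          (SubF D (sar h P Q) (stm h P Q x) \<odot> sliced E h (P \<cdot>\<^bsub>E\<^esub> Q))"
    and "\<And>P Q. \<lbrakk>P \<in> Arr E; tgt E P = \<Gamma>; Q \<in> Arr E; tgt E Q = src E P\<rbrakk>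
      \<Longrightarrow> sf_eq E (src E P) (sliced E h (P \<cdot>\<^bsub>E\<^esub> Q) \<odot> WkF E Q)
         (WkF D (sar h P Q) \<odot> sliced E h P)"
    and "\<And>P Q. \<lbrakk>P \<in> Arr E; tgt E P = \<Gamma>; Q \<in> Arr E; tgt E Q = src E P\<rbrakk>
      \<Longrightarrow> stm h (P \<cdot>\<^bsub>E\<^esub> Q) (sob (WkF E Q) Q) (idtm E Q) = idtm D (sar h P Q)"
  using assms by (auto simp: sf_hom_def)

text \<open>The curried form of \<open>pre_E_system\<close>. Coherence is listed separately, as
  \<open>sf_of\<close> would otherwise forget part of the underlying functors; preservation of
  identities is contained in \<open>sf_functor\<close>.\<close>

locale sf_pre_E_system = strict_category E for E :: "'u esys" +
  assumes root: "terminal E (root E)"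
    and Sub_coherent: "\<lbrakk>A \<in> Arr E; x \<in> Tm E A\<rbrakk> \<Longrightarrow> sf_coherent E (src E A) (Sub E A x)"
    and Wk_coherent: "A \<in> Arr E \<Longrightarrow> sf_coherent E (tgt E A) (Wk E A)"
    and SubF_functor: "\<lbrakk>A \<in> Arr E; x \<in> Tm E A\<rbrakk> \<Longrightarrow> sf_functor E (src E A) E (tgt E A) (SubF E A x)"
    and WkF_functor: "A \<in> Arr E \<Longrightarrow> sf_functor E (tgt E A) E (src E A) (WkF E A)"
    and WkF_idm: "\<Gamma> \<in> Obj E \<Longrightarrow> sf_eq E \<Gamma> (WkF E (idm E \<Gamma>)) sf_id"
    and WkF_cmp: "\<lbrakk>A \<in> Arr E; P \<in> Arr E; tgt E P = src E A\<rbrakk>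
          \<Longrightarrow> sf_eq E (tgt E A) (WkF E (A \<cdot>\<^bsub>E\<^esub> P)) (WkF E P \<odot> WkF E A)"
    and idtm: "A \<in> Arr E \<Longrightarrow> idtm E A \<in> Tm E (sob (WkF E A) A)"

locale sf_E_system = sf_pre_E_system E for E :: "'u esys" +
  assumes SubF_hom: "\<lbrakk>A \<in> Arr E; x \<in> Tm E A\<rbrakk> \<Longrightarrow> sf_hom E (src E A) E (tgt E A) (SubF E A x)"
    and WkF_hom: "A \<in> Arr E \<Longrightarrow> sf_hom E (tgt E A) E (src E A) (WkF E A)"
    and SubF_WkF: "\<lbrakk>A \<in> Arr E; x \<in> Tm E A\<rbrakk> \<Longrightarrow> sf_eq E (tgt E A) (SubF E A x \<odot> WkF E A) sf_id"
    and SubF_idtm: "\<lbrakk>A \<in> Arr E; x \<in> Tm E A\<rbrakk>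
          \<Longrightarrow> stm (SubF E A x) (idm E (src E A)) (sob (WkF E A) A) (idtm E A) = x"
    and SubF_idtm_WkF: "A \<in> Arr E
          \<Longrightarrow> sf_eq E (src E A) (SubF E (sob (WkF E A) A) (idtm E A) \<odot> sliced E (WkF E A) A) sf_id"

text \<open>Coherence and functoriality of \<open>S\<close> and \<open>W\<close> have to be
  translated first, because equations between composites can be curried only for coherent
  functors.\<close>

lemma pre_E_system_iff: "pre_E_system E \<longleftrightarrow> sf_pre_E_system E"
proof (cases "strict_category E")
  case True
  then interpret strict_category E .
  have S: "tfunctor (eslice E (src E A)) (eslice E (tgt E A)) (Sub E A x) \<and>
      oMap (Sub E A x) (idm E (src E A)) = idm E (tgt E A) \<longleftrightarrow>
      sf_coherent E (src E A) (Sub E A x) \<and> sf_functor E (src E A) E (tgt E A) (SubF E A x)"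
    if "A \<in> Arr E" for A x
    using True that by (intro tfunctor_slice_iff) simp_all
  have W: "tfunctor (eslice E (tgt E A)) (eslice E (src E A)) (Wk E A) \<and>
      oMap (Wk E A) (idm E (tgt E A)) = idm E (src E A) \<longleftrightarrow>
      sf_coherent E (tgt E A) (Wk E A) \<and> sf_functor E (tgt E A) E (src E A) (WkF E A)"
    if "A \<in> Arr E" for A
    using True that by (intro tfunctor_slice_iff) simp_all
  have WI: "tfunc_eq (eslice E \<Gamma>) (Wk E (idm E \<Gamma>)) tid \<longleftrightarrow> sf_eq E \<Gamma> (WkF E (idm E \<Gamma>)) sf_id"
    if "sf_coherent E \<Gamma> (Wk E (idm E \<Gamma>))" for \<Gamma>
    using that tfunc_eq_iff_sf_eq[OF that sf_coherent_tid] by (simp add: sf_of_tid)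
  have WC: "tfunc_eq (eslice E (tgt E A)) (Wk E (A \<cdot>\<^bsub>E\<^esub> P)) (tcomp (Wk E P) (Wk E A)) \<longleftrightarrow>
      sf_eq E (tgt E A) (WkF E (A \<cdot>\<^bsub>E\<^esub> P)) (WkF E P \<odot> WkF E A)"
    if "A \<in> Arr E" "P \<in> Arr E" "tgt E P = src E A"
      "\<And>A. A \<in> Arr E \<Longrightarrow> sf_coherent E (tgt E A) (Wk E A)"
      "\<And>A. A \<in> Arr E \<Longrightarrow> sf_functor E (tgt E A) E (src E A) (WkF E A)" for A P
  proof -
    have c: "sf_coherent E (tgt E A) (tcomp (Wk E P) (Wk E A))"
      using that(1-3) that(4)[of P] by (intro sf_coherent_tcomp[OF that(4,5)]) simp_all
    have "sf_coherent E (tgt E A) (Wk E (A \<cdot>\<^bsub>E\<^esub> P))"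
      using that(1-3) that(4)[of "A \<cdot>\<^bsub>E\<^esub> P"] by simp
    from tfunc_eq_iff_sf_eq[OF this c] sf_of_tcomp[OF that(4)[OF that(1)], of "Wk E P"]
    show ?thesis by (meson sf_eq_sym sf_eq_trans)
  qed
  have sob: "sob (WkF E A) A = oMap (Wk E A) A" for A by (simp add: sf_of_def)
  show ?thesis
  proof
    assume "pre_E_system E"
    then interpret E: pre_E_system E .
    have W': "sf_coherent E (tgt E A) (Wk E A)" "sf_functor E (tgt E A) E (src E A) (WkF E A)"
      if "A \<in> Arr E" for A
      using E.Wk_tfunctor E.Wk_idm W that by blast+
    have S': "sf_coherent E (src E A) (Sub E A x)" "sf_functor E (src E A) E (tgt E A) (SubF E A x)"
      if "A \<in> Arr E" "x \<in> Tm E A" for A x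
      using E.Sub_tfunctor E.Sub_idm S that by blast+
    show "sf_pre_E_system E"
    proof
      fix \<Gamma> assume "\<Gamma> \<in> Obj E"
      then show "sf_eq E \<Gamma> (WkF E (idm E \<Gamma>)) sf_id"
        using WI[of \<Gamma>] W'(1)[of "idm E \<Gamma>"] E.Wk_of_idm by simp
    next
      fix A P assume "A \<in> Arr E" "P \<in> Arr E" "tgt E P = src E A"
      then show "sf_eq E (tgt E A) (WkF E (A \<cdot>\<^bsub>E\<^esub> P)) (WkF E P \<odot> WkF E A)"
        using WC[of A P] W' E.Wk_of_cmp by blast
    qed (use S' W' E.root_terminal E.idtm_Tm in \<open>auto simp: sob\<close>)
  next
    assume "sf_pre_E_system E"
    then interpret E: sf_pre_E_system E .
    have S': "tfunctor (eslice E (src E A)) (eslice E (tgt E A)) (Sub E A x)"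
      "oMap (Sub E A x) (idm E (src E A)) = idm E (tgt E A)" if "A \<in> Arr E" "x \<in> Tm E A" for A x
      using E.Sub_coherent E.SubF_functor S that by blast+
    show "pre_E_system E"
    proof
      fix \<Gamma> assume "\<Gamma> \<in> Obj E"
      then show "tfunc_eq (eslice E \<Gamma>) (Wk E (idm E \<Gamma>)) tid"
        using WI[of \<Gamma>] E.Wk_coherent[of "idm E \<Gamma>"] E.WkF_idm by simp
    next
      fix A P assume "A \<in> Arr E" "P \<in> Arr E" "tgt E P = src E A"
      then show "tfunc_eq (eslice E (tgt E A)) (Wk E (A \<cdot>\<^bsub>E\<^esub> P)) (tcomp (Wk E P) (Wk E A))"
        using WC[of A P] E.Wk_coherent E.WkF_functor E.WkF_cmp by blast
    qed (use S' W E.Wk_coherent E.WkF_functor E.root E.idtm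
        in \<open>auto simp: sob\<close>)
  qed
next
  case False
  then show ?thesis
    by (auto simp: pre_E_system_def sf_pre_E_system_def)
qed

lemma into_eslice:
  assumes "B \<in> Arr E" "tgt E B = \<Gamma>"
  shows "into (eslice E \<Gamma>) B = Pr B ` into E (src E B)"
proof (rule set_eqI)
  fix X show "X \<in> into (eslice E \<Gamma>) B \<longleftrightarrow> X \<in> Pr B ` into E (src E B)"
    using assms by (cases X) (auto simp: Arr_eslice image_iff)
qed

text \<open>Both composites send \<open>Pr B P\<close> to a pair with first component
  \<open>C'\<close>, so only the second components are left to compare, and these are the values of
  the curried composites. The square for \<open>S\<close> at \<open>Pr P Q\<close> has
  \<open>B = P.Q\<close> and \<open>C = P\<close>; the one for \<open>W\<close> has these
  exchanged.\<close>

lemma tfunc_eq_slice_commute: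
  assumes "strict_category E" "strict_category D"
    and h: "sf_coherent E \<Gamma> (h :: 'u tfunc)" "sf_functor E \<Gamma> D \<Delta> (sf_of h)"
    and g: "sf_coherent E (src E B) g" "sf_functor E (src E B) E (src E C) (sf_of g)"
    and g': "sf_coherent D (src D (oMap h B)) g'"
    and B: "B \<in> Arr E" "tgt E B = \<Gamma>" and C: "C \<in> Arr E" "tgt E C = \<Gamma>"
    and C': "C' = oMap h C"
    and g'': "sf_functor D (src D (oMap h B)) D (src D (oMap h C)) (sf_of g')"
  shows "tfunc_eq (eslice (eslice E \<Gamma>) B) (tcomp (over h) (tcomp (unflat E C) (tcomp g flat)))
      (tcomp (tcomp (unflat D C') (tcomp g' flat)) (over h)) \<longleftrightarrow>
    sf_eq E (src E B) (sliced E (sf_of h) C \<odot> sf_of g) (sf_of g' \<odot> sliced E (sf_of h) B)"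
proof -
  interpret E: strict_category E by fact
  interpret D: strict_category D by fact
  have o: "oMap f = sob (sf_of f)" and t: "tMap f (Pr P Q) = stm (sf_of f) P Q"
    for f :: "'u tfunc" and P Q
    by (simp_all add: sf_of_def)
  note H = sf_functorD[OF h(2)] and G = sf_functorD[OF g(2)] and G' = sf_functorD[OF g'']
  note coh = sf_coherentD[OF h(1)] sf_coherentD[OF g(1)] sf_coherentD[OF g']
  let ?L = "tcomp (over h) (tcomp (unflat E C) (tcomp g flat))"
  let ?R = "tcomp (tcomp (unflat D C') (tcomp g' flat)) (over h)"
  let ?l = "sliced E (sf_of h) C \<odot> sf_of g" and ?r = "sf_of g' \<odot> sliced E (sf_of h) B"
  have "into (eslice E \<Gamma>) B = Pr B ` into E (src E B)"
    using B by (rule into_eslice)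
  moreover have "into (eslice E \<Gamma>) (src (eslice E \<Gamma>) (Pr B P)) = Pr (B \<cdot>\<^bsub>E\<^esub> P) ` into E (src E P)"
    if "P \<in> into E (src E B)" for P
    using B that into_eslice[of "B \<cdot>\<^bsub>E\<^esub> P" E \<Gamma>] by simp
  moreover have "oMap ?L (Pr B P) = Pr C' (sob ?l P)" "oMap ?R (Pr B P) = Pr C' (sob ?r P)"
    if "P \<in> into E (src E B)" for P
    using that B C
    by (simp_all add: tcomp_def over_def flat_def unflat_def coh o[of h] o[of g] o[of g'] H G G' C')
  moreover have "aMap ?L (Pr (Pr B P) (Pr (B \<cdot>\<^bsub>E\<^esub> P) Q)) =
      Pr (Pr C' (sob ?l P)) (Pr (C' \<cdot>\<^bsub>D\<^esub> sob ?l P) (sar ?l P Q))"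
    "aMap ?R (Pr (Pr B P) (Pr (B \<cdot>\<^bsub>E\<^esub> P) Q)) =
      Pr (Pr C' (sob ?r P)) (Pr (C' \<cdot>\<^bsub>D\<^esub> sob ?r P) (sar ?r P Q))"
    "tMap ?L (Pr (Pr B P) (Pr (B \<cdot>\<^bsub>E\<^esub> P) Q)) y = stm ?l P Q y"
    "tMap ?R (Pr (Pr B P) (Pr (B \<cdot>\<^bsub>E\<^esub> P) Q)) y = stm ?r P Q y"
    if "P \<in> into E (src E B)" "Q \<in> into E (src E P)" for P Q y
    using that B C
    by (simp_all add: tcomp_def over_def flat_def unflat_def coh o[of h] o[of g] o[of g'] t[of h] t[of g] t[of g'] H G G' C')
  ultimately show ?thesis
    unfolding tfunc_eq_def ball_Arr_eslice eslice_simps(1,7) sf_eq_def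
    by auto
qed


lemma slice_hom_iff:
  assumes "sf_pre_E_system E" "sf_pre_E_system D" "\<Gamma> \<in> Obj E" "\<Delta> \<in> Obj D"
  shows "pre_E_hom (eslice E \<Gamma>) (eslice D \<Delta>) h \<longleftrightarrow>
    sf_coherent E \<Gamma> h \<and> sf_hom E \<Gamma> D \<Delta> (sf_of h)"
proof -
  interpret E: sf_pre_E_system E by fact
  interpret D: sf_pre_E_system D by fact
  have E: "strict_category E" and D: "strict_category D" by unfold_locales
  have o: "oMap f = sob (sf_of f)" and t: "tMap f (Pr P Q) = stm (sf_of f) P Q"
    for f :: "'a tfunc" and P Q
    by (simp_all add: sf_of_def)
  have tf: "tfunctor (eslice E \<Gamma>) (eslice D \<Delta>) h \<and> oMap h (root (eslice E \<Gamma>)) = root (eslice D \<Delta>) \<longleftrightarrow>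
      sf_coherent E \<Gamma> h \<and> sf_functor E \<Gamma> D \<Delta> (sf_of h)"
    unfolding eslice_simps using tfunctor_slice_iff[OF E D assms(3,4)] .
  show ?thesis
  \<comment> \<open>Both sides contain coherence and functoriality, and the translation of the
    remaining clauses presupposes them.\<close>
  proof (cases "sf_coherent E \<Gamma> h \<and> sf_functor E \<Gamma> D \<Delta> (sf_of h)")
    case False
    then show ?thesis using tf by (auto simp: pre_E_hom_def sf_hom_def)
  next
    case True
    then have c: "sf_coherent E \<Gamma> h" and f: "sf_functor E \<Gamma> D \<Delta> (sf_of h)" by auto
    note h = sf_functorD[OF f]
    have S: "tfunc_eq (eslice (eslice E \<Gamma>) (src (eslice E \<Gamma>) (Pr P Q)))
        (tcomp (over h) (Sub (eslice E \<Gamma>) (Pr P Q) x))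
        (tcomp (Sub (eslice D \<Delta>) (aMap h (Pr P Q)) (tMap h (Pr P Q) x)) (over h)) \<longleftrightarrow>
      sf_eq E (src E Q) (sliced E (sf_of h) P \<odot> SubF E Q x)
        (SubF D (sar (sf_of h) P Q) (stm (sf_of h) P Q x) \<odot> sliced E (sf_of h) (P \<cdot>\<^bsub>E\<^esub> Q))"
      if P: "P \<in> into E \<Gamma>" and Q: "Q \<in> into E (src E P)" and x: "x \<in> Tm E Q" for P Q x
    proof -
      have 1: "src D (oMap h (P \<cdot>\<^bsub>E\<^esub> Q)) = src D (sar (sf_of h) P Q)"
        "src D (oMap h P) = tgt D (sar (sf_of h) P Q)"
        "sar (sf_of h) P Q \<in> Arr D" "stm (sf_of h) P Q x \<in> Tm D (sar (sf_of h) P Q)"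
        using P Q x by (auto simp: o h)
      have 2: "src E (P \<cdot>\<^bsub>E\<^esub> Q) = src E Q" "src E P = tgt E Q" using P Q by auto
      show ?thesis
        using P Q x E.Sub_coherent[of Q x] E.SubF_functor[of Q x] D.Sub_coherent[OF 1(3,4)]
          D.SubF_functor[OF 1(3,4)]
          tfunc_eq_slice_commute[OF E D c f, of "P \<cdot>\<^bsub>E\<^esub> Q" "Sub E Q x" P
            "Sub D (sar (sf_of h) P Q) (stm (sf_of h) P Q x)" "oMap h P", unfolded 1(1,2) 2]
        by (simp add: sf_coherentD[OF c] t o)
    qed
    have W: "tfunc_eq (eslice (eslice E \<Gamma>) (tgt (eslice E \<Gamma>) (Pr P Q)))
        (tcomp (over h) (Wk (eslice E \<Gamma>) (Pr P Q)))
        (tcomp (Wk (eslice D \<Delta>) (aMap h (Pr P Q))) (over h)) \<longleftrightarrow>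
      sf_eq E (src E P) (sliced E (sf_of h) (P \<cdot>\<^bsub>E\<^esub> Q) \<odot> WkF E Q)
        (WkF D (sar (sf_of h) P Q) \<odot> sliced E (sf_of h) P)"
      if P: "P \<in> into E \<Gamma>" and Q: "Q \<in> into E (src E P)" for P Q
    proof -
      have 1: "src D (oMap h (P \<cdot>\<^bsub>E\<^esub> Q)) = src D (sar (sf_of h) P Q)"
        "src D (oMap h P) = tgt D (sar (sf_of h) P Q)"
        "sar (sf_of h) P Q \<in> Arr D"
        using P Q by (auto simp: o h)
      have 2: "src E (P \<cdot>\<^bsub>E\<^esub> Q) = src E Q" "src E P = tgt E Q" using P Q by auto
      show ?thesis
        using P Q E.Wk_coherent[of Q] E.WkF_functor[of Q] D.Wk_coherent[OF 1(3)]
          D.WkF_functor[OF 1(3)]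
          tfunc_eq_slice_commute[OF E D c f, of P "Wk E Q" "P \<cdot>\<^bsub>E\<^esub> Q"
            "Wk D (sar (sf_of h) P Q)" "oMap h (P \<cdot>\<^bsub>E\<^esub> Q)", unfolded 1(1,2) 2]
        by (simp add: sf_coherentD[OF c] t o h)
    qed
    have I: "tMap h (oMap (Wk (eslice E \<Gamma>) (Pr P Q)) (Pr P Q)) (idtm (eslice E \<Gamma>) (Pr P Q)) =
        idtm (eslice D \<Delta>) (aMap h (Pr P Q)) \<longleftrightarrow>
      stm (sf_of h) (P \<cdot>\<^bsub>E\<^esub> Q) (sob (WkF E Q) Q) (idtm E Q) = idtm D (sar (sf_of h) P Q)"
      if P: "P \<in> into E \<Gamma>" and Q: "Q \<in> into E (src E P)" for P Q
      using P Q by (simp add: sf_coherentD[OF c] t tcomp_def unflat_def flat_def o[of "Wk E Q"])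
    have "pre_E_hom (eslice E \<Gamma>) (eslice D \<Delta>) h \<longleftrightarrow>
      (\<forall>P\<in>into E \<Gamma>. \<forall>Q\<in>into E (src E P). \<forall>x\<in>Tm E Q.
        sf_eq E (src E Q) (sliced E (sf_of h) P \<odot> SubF E Q x)
        (SubF D (sar (sf_of h) P Q) (stm (sf_of h) P Q x) \<odot> sliced E (sf_of h) (P \<cdot>\<^bsub>E\<^esub> Q))) \<and>
      (\<forall>P\<in>into E \<Gamma>. \<forall>Q\<in>into E (src E P).
        sf_eq E (src E P) (sliced E (sf_of h) (P \<cdot>\<^bsub>E\<^esub> Q) \<odot> WkF E Q)
        (WkF D (sar (sf_of h) P Q) \<odot> sliced E (sf_of h) P)) \<and>
      (\<forall>P\<in>into E \<Gamma>. \<forall>Q\<in>into E (src E P).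
        stm (sf_of h) (P \<cdot>\<^bsub>E\<^esub> Q) (sob (WkF E Q) Q) (idtm E Q) = idtm D (sar (sf_of h) P Q))"
      using tf[THEN iffD2, OF True]
      by (simp only: pre_E_hom_def ball_Arr_eslice eslice_simps(7) el.sel S W I simp_thms
          cong: ball_cong)
    then show ?thesis
      using True unfolding sf_hom_def by blast
  qed
qed

lemma sf_hom_cong:
  assumes "sf_hom E \<Gamma> D \<Delta> h" "sf_eq E \<Gamma> h k" "sf_pre_E_system E" "sf_pre_E_system D"
  shows "sf_hom E \<Gamma> D \<Delta> k"
proof -
  interpret E: sf_pre_E_system E by fact
  note h = sf_homD[OF assms(1)]
  note hk = sf_eqD[OF assms(2), symmetric]
  have "sf_eq E (src E Q) (sliced E k P \<odot> SubF E Q x)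
      (SubF D (sar k P Q) (stm k P Q x) \<odot> sliced E k (P \<cdot>\<^bsub>E\<^esub> Q))"
    if "P \<in> Arr E" "tgt E P = \<Gamma>" "Q \<in> Arr E" "tgt E Q = src E P" "x \<in> Tm E Q" for P Q x
    using h(2)[OF that] that sf_functorD[OF E.SubF_functor[OF that(3,5)]] by (simp add: sf_eq_def hk)
  moreover have "sf_eq E (src E P) (sliced E k (P \<cdot>\<^bsub>E\<^esub> Q) \<odot> WkF E Q) (WkF D (sar k P Q) \<odot> sliced E k P)"
    if "P \<in> Arr E" "tgt E P = \<Gamma>" "Q \<in> Arr E" "tgt E Q = src E P" for P Q
    using h(3)[OF that] that sf_functorD[OF E.WkF_functor[OF that(3)]] by (simp add: sf_eq_def hk)
  moreover have "stm k (P \<cdot>\<^bsub>E\<^esub> Q) (sob (WkF E Q) Q) (idtm E Q) = idtm D (sar k P Q)"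
    if "P \<in> Arr E" "tgt E P = \<Gamma>" "Q \<in> Arr E" "tgt E Q = src E P" for P Q
    using that h(4)[OF that] E.idtm[of Q] sf_functorD[OF E.WkF_functor[of Q]] by (simp add: hk)
  ultimately show ?thesis
    unfolding sf_hom_def
    using sf_functor_cong[OF h(1) assms(2) E.strict_category_axioms] by simp
qed

lemma sf_hom_id:
  assumes "sf_pre_E_system E" "\<Gamma> \<in> Obj E"
  shows "sf_hom E \<Gamma> E \<Gamma> sf_id"
proof -
  interpret E: sf_pre_E_system E by fact
  show ?thesis
    unfolding sf_hom_def using assms(2) by (simp add: sf_functor_id E.strict_category_axioms)
qed

lemma sf_hom_comp:
  assumes "sf_hom E \<Gamma> D \<Delta> h" "sf_hom D \<Delta> K \<Theta> k"
    and "sf_pre_E_system E" "sf_pre_E_system D"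
  shows "sf_hom E \<Gamma> K \<Theta> (k \<odot> h)"
proof -
  interpret E: sf_pre_E_system E by fact
  interpret D: sf_pre_E_system D by fact
  note h = sf_homD[OF assms(1)] and k = sf_homD[OF assms(2)]
  note fh = sf_functorD[OF h(1)]
  have S: "sf_eq E (src E Q) (sliced E (k \<odot> h) P \<odot> SubF E Q x)
      (SubF K (sar (k \<odot> h) P Q) (stm (k \<odot> h) P Q x) \<odot> sliced E (k \<odot> h) (P \<cdot>\<^bsub>E\<^esub> Q))"
    if PQ: "P \<in> Arr E" "tgt E P = \<Gamma>" "Q \<in> Arr E" "tgt E Q = src E P" "x \<in> Tm E Q" for P Q x
    using h(2)[OF PQ] k(2)[of "sob h P" "sar h P Q" "stm h P Q x"] PQ
      sf_functorD[OF E.SubF_functor[OF PQ(3,5)]]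
    by (simp add: sf_eq_def fh)
  have W: "sf_eq E (src E P) (sliced E (k \<odot> h) (P \<cdot>\<^bsub>E\<^esub> Q) \<odot> WkF E Q)
      (WkF K (sar (k \<odot> h) P Q) \<odot> sliced E (k \<odot> h) P)"
    if PQ: "P \<in> Arr E" "tgt E P = \<Gamma>" "Q \<in> Arr E" "tgt E Q = src E P" for P Q
    using h(3)[OF PQ] k(3)[of "sob h P" "sar h P Q"] PQ sf_functorD[OF E.WkF_functor[OF PQ(3)]]
      sf_functorD[OF D.WkF_functor[of "sar h P Q"]]
    by (simp add: sf_eq_def fh)
  have I: "stm (k \<odot> h) (P \<cdot>\<^bsub>E\<^esub> Q) (sob (WkF E Q) Q) (idtm E Q) = idtm K (sar (k \<odot> h) P Q)"
    if PQ: "P \<in> Arr E" "tgt E P = \<Gamma>" "Q \<in> Arr E" "tgt E Q = src E P" for P Q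
    using h(3,4)[OF PQ] k(4)[of "sob h P" "sar h P Q"] PQ by (simp add: sf_eq_def fh)
  show ?thesis
    unfolding sf_hom_def
    using sf_functor_comp[OF h(1) k(1) E.strict_category_axioms D.strict_category_axioms] S W I by simp
qed

text \<open>The conditions on \<open>h/A\<close> at \<open>Pr P Q\<close> are those on
  \<open>h\<close> at the arrow given by \<open>A.P\<close> and \<open>Q\<close>.\<close>

lemma sf_hom_sliced:
  assumes "sf_hom E \<Gamma> D \<Delta> h" "sf_pre_E_system E" "sf_pre_E_system D" "A \<in> Arr E" "tgt E A = \<Gamma>"
  shows "sf_hom E (src E A) D (src D (sob h A)) (sliced E h A)"
proof -
  interpret E: sf_pre_E_system E by fact
  interpret D: sf_pre_E_system D by fact
  note h = sf_homD[OF assms(1)]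
  have S: "sf_eq E (src E Q) (sliced E (sliced E h A) P \<odot> SubF E Q x)
      (SubF D (sar (sliced E h A) P Q) (stm (sliced E h A) P Q x) \<odot> sliced E (sliced E h A) (P \<cdot>\<^bsub>E\<^esub> Q))"
    if P: "P \<in> Arr E" "tgt E P = src E A" "Q \<in> Arr E" "tgt E Q = src E P" and x: "x \<in> Tm E Q" for P Q x
    using h(2)[of "A \<cdot>\<^bsub>E\<^esub> P" Q x] P x assms(4,5) sf_functorD[OF E.SubF_functor[OF P(3) x]]
    by (simp add: sf_eq_def)
  have W: "sf_eq E (src E P) (sliced E (sliced E h A) (P \<cdot>\<^bsub>E\<^esub> Q) \<odot> WkF E Q)
      (WkF D (sar (sliced E h A) P Q) \<odot> sliced E (sliced E h A) P)"
    if P: "P \<in> Arr E" "tgt E P = src E A" "Q \<in> Arr E" "tgt E Q = src E P" for P Q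
    using h(3)[of "A \<cdot>\<^bsub>E\<^esub> P" Q] P assms(4,5) sf_functorD[OF E.WkF_functor[OF P(3)]]
    by (simp add: sf_eq_def)
  have I: "stm (sliced E h A) (P \<cdot>\<^bsub>E\<^esub> Q) (sob (WkF E Q) Q) (idtm E Q) = idtm D (sar (sliced E h A) P Q)"
    if P: "P \<in> Arr E" "tgt E P = src E A" "Q \<in> Arr E" "tgt E Q = src E P" for P Q
    using h(4)[of "A \<cdot>\<^bsub>E\<^esub> P" Q] assms(4,5) P by simp
  show ?thesis
    unfolding sf_hom_def
    using sf_functor_sliced[OF h(1) E.strict_category_axioms D.strict_category_axioms assms(4,5)] S W I
    by simp
qed

lemma E_system_iff: "E_system E \<longleftrightarrow> sf_E_system E"
proof (cases "sf_pre_E_system E")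
  case True
  then interpret sf_pre_E_system E .
  have S: "pre_E_hom (eslice E (src E A)) (eslice E (tgt E A)) (Sub E A x) \<longleftrightarrow>
      sf_hom E (src E A) E (tgt E A) (SubF E A x)" if "A \<in> Arr E" "x \<in> Tm E A" for A x
    using slice_hom_iff[OF True True] Sub_coherent that by simp
  have W: "pre_E_hom (eslice E (tgt E A)) (eslice E (src E A)) (Wk E A) \<longleftrightarrow>
      sf_hom E (tgt E A) E (src E A) (WkF E A)" if "A \<in> Arr E" for A
    using slice_hom_iff[OF True True] Wk_coherent that by simp
  have SW: "tfunc_eq (eslice E (tgt E A)) (tcomp (Sub E A x) (Wk E A)) tid \<longleftrightarrow>
      sf_eq E (tgt E A) (SubF E A x \<odot> WkF E A) sf_id" if "A \<in> Arr E" "x \<in> Tm E A" for A x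
  proof -
    have "sf_coherent E (tgt E A) (tcomp (Sub E A x) (Wk E A))"
      using that by (intro sf_coherent_tcomp[OF Wk_coherent WkF_functor Sub_coherent])
    from tfunc_eq_iff_sf_eq[OF this sf_coherent_tid]
    have "tfunc_eq (eslice E (tgt E A)) (tcomp (Sub E A x) (Wk E A)) tid \<longleftrightarrow>
      sf_eq E (tgt E A) (sf_of (tcomp (Sub E A x) (Wk E A))) sf_id" by (simp add: sf_of_tid)
    moreover have "sf_eq E (tgt E A) (sf_of (tcomp (Sub E A x) (Wk E A))) (SubF E A x \<odot> WkF E A)"
      using that by (intro sf_of_tcomp Wk_coherent)
    ultimately show ?thesis by (meson sf_eq_sym sf_eq_trans)
  qed
  have SI: "tMap (Sub E A x) (Pr (idm E (src E A)) (oMap (Wk E A) A)) (idtm E A) =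
      stm (SubF E A x) (idm E (src E A)) (sob (WkF E A) A) (idtm E A)" for A x
    by (simp add: sf_of_def)
  have SIW: "tfunc_eq (eslice E (src E A))
        (tcomp (Sub E (oMap (Wk E A) A) (idtm E A)) (slice_over E (Wk E A) A)) tid \<longleftrightarrow>
      sf_eq E (src E A) (SubF E (sob (WkF E A) A) (idtm E A) \<odot> sliced E (WkF E A) A) sf_id"
    if "A \<in> Arr E" for A
  proof -
    have o: "oMap (Wk E A) A = sob (WkF E A) A" by (simp add: sf_of_def)
    note W = sf_functorD[OF WkF_functor[OF that]]
    have WA: "sob (WkF E A) A \<in> Arr E" "tgt E (sob (WkF E A) A) = src E A" using W that by auto
    have f: "sf_functor E (src E A) E (src E (sob (WkF E A) A)) (sf_of (slice_over E (Wk E A) A))"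
      unfolding sf_of_slice_over
      using sf_functor_sliced[OF WkF_functor[OF that]] that strict_category_axioms by blast
    have "sf_coherent E (src E A) (tcomp (Sub E (sob (WkF E A) A) (idtm E A)) (slice_over E (Wk E A) A))"
      by (rule sf_coherent_tcomp[OF sf_coherent_slice_over f Sub_coherent[OF WA(1) idtm[OF that]]])
    from tfunc_eq_iff_sf_eq[OF this sf_coherent_tid]
    have "tfunc_eq (eslice E (src E A))
        (tcomp (Sub E (sob (WkF E A) A) (idtm E A)) (slice_over E (Wk E A) A)) tid \<longleftrightarrow>
      sf_eq E (src E A) (sf_of (tcomp (Sub E (sob (WkF E A) A) (idtm E A)) (slice_over E (Wk E A) A))) sf_id"
      by (simp add: sf_of_tid)
    moreover have "sf_eq E (src E A)
        (sf_of (tcomp (Sub E (sob (WkF E A) A) (idtm E A)) (slice_over E (Wk E A) A)))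
        (SubF E (sob (WkF E A) A) (idtm E A) \<odot> sliced E (WkF E A) A)"
      unfolding sf_of_slice_over[symmetric] by (intro sf_of_tcomp sf_coherent_slice_over)
    ultimately show ?thesis unfolding o by (meson sf_eq_sym sf_eq_trans)
  qed
  show ?thesis
    unfolding E_system_def sf_E_system_def E_system_axioms_def sf_E_system_axioms_def pre_E_system_iff
    using S W SW SI SIW by auto
next
  case False
  then show ?thesis
    by (auto simp: E_system_def sf_E_system_def pre_E_system_iff)
qed

text \<open>This puts homomorphisms of whole systems and homomorphisms between slices under one
  calculus: the conditions on \<open>H\<close> are exactly the slice conditions for
  \<open>sf_lift H\<close> on all slices.\<close>

lemma pre_E_hom_iff:
  assumes "sf_pre_E_system E" "sf_pre_E_system D"
  shows "pre_E_hom E D H \<longleftrightarrow> tfunctor E D H \<and> oMap H (root E) = root D \<and>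
    (\<forall>\<Gamma>\<in>Obj E. sf_hom E \<Gamma> D (oMap H \<Gamma>) (sf_lift H))"
proof (cases "tfunctor E D H")
  case True
  interpret E: sf_pre_E_system E by fact
  interpret D: sf_pre_E_system D by fact
  interpret H: strict_functor E D H using True by (simp add: tfunctor_def)
  have t: "tMap H A x \<in> Tm D (aMap H A)" if "A \<in> Arr E" "x \<in> Tm E A" for A x
    using True that by (simp add: tfunctor_def)
  have f: "sf_functor E \<Gamma> D (oMap H \<Gamma>) (sf_lift H)" if "\<Gamma> \<in> Obj E" for \<Gamma>
    using that by (auto simp: sf_functor_def t)
  have S: "tfunc_eq (eslice E (src E A)) (tcomp (over H) (Sub E A x))
        (tcomp (Sub D (aMap H A) (tMap H A x)) (over H)) \<longleftrightarrow>
      sf_eq E (src E A) (sf_lift H \<odot> SubF E A x) (SubF D (aMap H A) (tMap H A x) \<odot> sf_lift H)"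
    if "A \<in> Arr E" "x \<in> Tm E A" for A x
  proof -
    have 1: "sf_coherent E (src E A) (tcomp (over H) (Sub E A x))"
      using that by (intro sf_coherent_tcomp[OF E.Sub_coherent E.SubF_functor sf_coherent_over])
    have 2: "sf_functor E (src E A) D (src D (aMap H A)) (sf_of (over H))"
      using f[of "src E A"] that by (simp add: sf_of_over)
    have 3: "sf_coherent E (src E A) (tcomp (Sub D (aMap H A) (tMap H A x)) (over H))"
      using that by (intro sf_coherent_tcomp[OF sf_coherent_over 2 D.Sub_coherent]) (simp_all add: t)
    have "sf_eq E (src E A) (sf_of (tcomp (over H) (Sub E A x))) (sf_lift H \<odot> SubF E A x)"
      using that unfolding sf_of_over[symmetric] by (intro sf_of_tcomp E.Sub_coherent)
    moreover have "sf_eq E (src E A) (sf_of (tcomp (Sub D (aMap H A) (tMap H A x)) (over H)))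
        (SubF D (aMap H A) (tMap H A x) \<odot> sf_lift H)"
      unfolding sf_of_over[symmetric] by (intro sf_of_tcomp sf_coherent_over)
    ultimately show ?thesis
      unfolding tfunc_eq_iff_sf_eq[OF 1 3] by (meson sf_eq_sym sf_eq_trans)
  qed
  have W: "tfunc_eq (eslice E (tgt E A)) (tcomp (over H) (Wk E A))
        (tcomp (Wk D (aMap H A)) (over H)) \<longleftrightarrow>
      sf_eq E (tgt E A) (sf_lift H \<odot> WkF E A) (WkF D (aMap H A) \<odot> sf_lift H)"
    if "A \<in> Arr E" for A
  proof -
    have 1: "sf_coherent E (tgt E A) (tcomp (over H) (Wk E A))"
      using that by (intro sf_coherent_tcomp[OF E.Wk_coherent E.WkF_functor sf_coherent_over])
    have 2: "sf_functor E (tgt E A) D (tgt D (aMap H A)) (sf_of (over H))"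
      using f[of "tgt E A"] that by (simp add: sf_of_over)
    have 3: "sf_coherent E (tgt E A) (tcomp (Wk D (aMap H A)) (over H))"
      using that by (intro sf_coherent_tcomp[OF sf_coherent_over 2 D.Wk_coherent]) simp_all
    have "sf_eq E (tgt E A) (sf_of (tcomp (over H) (Wk E A))) (sf_lift H \<odot> WkF E A)"
      using that unfolding sf_of_over[symmetric] by (intro sf_of_tcomp E.Wk_coherent)
    moreover have "sf_eq E (tgt E A) (sf_of (tcomp (Wk D (aMap H A)) (over H)))
        (WkF D (aMap H A) \<odot> sf_lift H)"
      unfolding sf_of_over[symmetric] by (intro sf_of_tcomp sf_coherent_over)
    ultimately show ?thesis
      unfolding tfunc_eq_iff_sf_eq[OF 1 3] by (meson sf_eq_sym sf_eq_trans)
  qed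
  have o: "oMap (Wk E A) A = sob (WkF E A) A" for A by (simp add: sf_of_def)
  \<comment> \<open>The lifted conditions do not mention the base \<open>P\<close>, and every arrow
    \<open>Q\<close> occurs over some base, namely the identity of its target.\<close>
  have *: "(\<forall>\<Gamma>\<in>Obj E. \<forall>P\<in>into E \<Gamma>. \<forall>Q\<in>into E (src E P). \<phi> Q) \<longleftrightarrow> (\<forall>Q\<in>Arr E. \<phi> Q)" (is "?l \<longleftrightarrow> ?r") for \<phi>
  proof
    assume l: ?l
    show ?r
    proof
      fix Q assume "Q \<in> Arr E"
      then show "\<phi> Q" using l[THEN bspec, of "tgt E Q", THEN bspec, of "idm E (tgt E Q)"] by simp
    qed
  qed simp
  have **: "(\<forall>\<Gamma>\<in>Obj E. sf_hom E \<Gamma> D (oMap H \<Gamma>) (sf_lift H)) \<longleftrightarrow>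
    (\<forall>Q\<in>Arr E. (\<forall>x\<in>Tm E Q. sf_eq E (src E Q) (sf_lift H \<odot> SubF E Q x) (SubF D (aMap H Q) (tMap H Q x) \<odot> sf_lift H)) \<and>
      sf_eq E (tgt E Q) (sf_lift H \<odot> WkF E Q) (WkF D (aMap H Q) \<odot> sf_lift H) \<and>
      tMap H (sob (WkF E Q) Q) (idtm E Q) = idtm D (aMap H Q))"
    unfolding sf_hom_def *[symmetric] using f by (simp cong: ball_cong) (auto simp: sf_hom_def)
  show ?thesis
    unfolding pre_E_hom_def ** o using S W True by auto
qed (simp add: pre_E_hom_def)


section \<open>The CE-system of an E-system\<close>

text \<open>The slice condition at \<open>P = id\<close>, where \<open>sliced_idm\<close> and
  \<open>sf_functor_sob\<close> remove the identity. The next two lemmas specialise the conditions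
  on \<open>S\<close> and \<open>idtm\<close> in the same way.\<close>

lemma sf_hom_Wk:
  assumes "sf_hom E \<Gamma> D \<Delta> h" "sf_pre_E_system E" "sf_pre_E_system D" "A \<in> Arr E" "tgt E A = \<Gamma>"
  shows "sf_eq E \<Gamma> (sliced E h A \<odot> WkF E A) (WkF D (sob h A) \<odot> h)"
proof -
  interpret E: sf_pre_E_system E by fact
  interpret D: sf_pre_E_system D by fact
  have E: "strict_category E" and D: "strict_category D" by unfold_locales
  note h = sf_homD[OF assms(1)]
  have \<Gamma>: "\<Gamma> \<in> Obj E" using assms(4,5) by auto
  have "sf_eq E \<Gamma> (sliced E h (idm E \<Gamma> \<cdot>\<^bsub>E\<^esub> A) \<odot> WkF E A) (WkF D (sar h (idm E \<Gamma>) A) \<odot> sliced E h (idm E \<Gamma>))"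
    using h(3)[of "idm E \<Gamma>" A] assms(4,5) \<Gamma> by simp
  also have "sf_eq E \<Gamma> \<dots> (WkF D (sob h A) \<odot> h)"
    using sf_eq_comp_right[OF sliced_idm[OF h(1) E D]] sf_functor_sob[OF h(1) E D assms(4,5)] by simp
  finally show ?thesis using assms(4,5) by simp
qed

lemma sf_hom_Sub:
  assumes "sf_hom E \<Gamma> D \<Delta> h" "sf_pre_E_system E" "sf_pre_E_system D"
    and "A \<in> Arr E" "tgt E A = \<Gamma>" "x \<in> Tm E A"
  shows "sf_eq E (src E A) (h \<odot> SubF E A x) (SubF D (sob h A) (stm h (idm E \<Gamma>) A x) \<odot> sliced E h A)"
proof -
  interpret E: sf_pre_E_system E by fact
  interpret D: sf_pre_E_system D by fact
  have E: "strict_category E" and D: "strict_category D" by unfold_locales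
  note h = sf_homD[OF assms(1)]
  have \<Gamma>: "\<Gamma> \<in> Obj E" using assms(4,5) by auto
  have "sf_eq E (src E A) (h \<odot> SubF E A x) (sliced E h (idm E \<Gamma>) \<odot> SubF E A x)"
    using E.SubF_functor[OF assms(4,6)] assms(5)
    by (intro sf_eq_comp_left[OF sf_eq_sym[OF sliced_idm[OF h(1) E D]]]) simp
  also have "sf_eq E (src E A) \<dots> (SubF D (sob h A) (stm h (idm E \<Gamma>) A x) \<odot> sliced E h A)"
    using h(2)[of "idm E \<Gamma>" A x] assms(4-) \<Gamma> sf_functor_sob[OF h(1) E D assms(4,5)] by simp
  finally show ?thesis .
qed

lemma sf_hom_idtm:
  assumes "sf_hom E \<Gamma> D \<Delta> h" "sf_pre_E_system E" "sf_pre_E_system D" "A \<in> Arr E" "tgt E A = \<Gamma>"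
  shows "stm h A (sob (WkF E A) A) (idtm E A) = idtm D (sob h A)"
proof -
  interpret E: sf_pre_E_system E by fact
  interpret D: sf_pre_E_system D by fact
  have E: "strict_category E" and D: "strict_category D" by unfold_locales
  note h = sf_homD[OF assms(1)]
  have \<Gamma>: "\<Gamma> \<in> Obj E" using assms(4,5) by auto
  show ?thesis
    using h(4)[of "idm E \<Gamma>" A] assms(4-) \<Gamma> sf_functor_sob[OF h(1) E D assms(4,5)] by simp
qed

lemma sf_hom_Wk_self:
  assumes "sf_hom E \<Gamma> D \<Delta> h" "sf_pre_E_system E" "sf_pre_E_system D" "A \<in> Arr E" "tgt E A = \<Gamma>"
  shows "sar h A (sob (WkF E A) A) = sob (WkF D (sob h A)) (sob h A)"
  using sf_eqD(1)[OF sf_hom_Wk[OF assms] assms(4,5)] by simp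

context sf_E_system
begin

lemma strict: "strict_category E" and pre: "sf_pre_E_system E"
  by unfold_locales

lemma Wk_self:
  assumes "A \<in> Arr E"
  shows "sob (WkF E A) A \<in> Arr E" "tgt E (sob (WkF E A) A) = src E A"
  using sf_functorD[OF WkF_functor[OF assms]] assms by auto

text \<open>
  The slice over \<open>\<Gamma>.A\<close> is the slice over \<open>\<Gamma>\<close> with a term of \<open>A\<close> freely adjoined: a homomorphism out
  of it is determined by its restriction along \<open>W\<^sub>A\<close> and the image of \<open>idtm\<^sub>A\<close>, and these may be
  prescribed arbitrarily.
\<close>

lemma extension_unique:
  assumes "sf_hom E (src E A) D \<Delta> w" "sf_pre_E_system D" "A \<in> Arr E"
  shows "sf_eq E (src E A) w
    (SubF D (sob w (sob (WkF E A) A)) (stm w (idm E (src E A)) (sob (WkF E A) A) (idtm E A)) \<odot>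
     sliced E (w \<odot> WkF E A) A)"
proof -
  interpret D: sf_pre_E_system D by fact
  have D: "strict_category D" by unfold_locales
  let ?WA = "sob (WkF E A) A"
  let ?z = "stm w (idm E (src E A)) ?WA (idtm E A)"
  note w = sf_homD[OF assms(1)]
  note WA = Wk_self[OF assms(3)]
  have slW: "sf_functor E (src E A) E (src E ?WA) (sliced E (WkF E A) A)"
    using sf_functor_sliced[OF WkF_functor[OF assms(3)] strict strict assms(3)] by simp
  \<comment> \<open>The axiom \<open>SubF_idtm_WkF\<close> writes the identity as \<open>S\<close>
    of \<open>idtm\<^sub>A\<close> after \<open>W\<^sub>A/A\<close>. Composing with \<open>w\<close>
    and moving \<open>w\<close> past \<open>S\<close> leaves only \<open>w(idtm\<^sub>A)\<close> and
    \<open>w \<circ> W\<^sub>A\<close>.\<close>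
  have "sf_eq E (src E A) (w \<odot> SubF E ?WA (idtm E A) \<odot> sliced E (WkF E A) A) (w \<odot> sf_id)"
    using SubF_idtm_WkF[OF assms(3)] by (rule sf_eq_comp_right)
  then have "sf_eq E (src E A) w (w \<odot> SubF E ?WA (idtm E A) \<odot> sliced E (WkF E A) A)"
    by (simp add: sf_eq_sym)
  also have "\<dots> = (w \<odot> SubF E ?WA (idtm E A)) \<odot> sliced E (WkF E A) A" by (simp add: sf_comp_assoc)
  also have "sf_eq E (src E A) \<dots> ((SubF D (sob w ?WA) ?z \<odot> sliced E w ?WA) \<odot> sliced E (WkF E A) A)"
    using sf_eq_comp_left[OF sf_hom_Sub[OF assms(1) pre assms(2) WA idtm[OF assms(3)]] slW] .
  also have "\<dots> = SubF D (sob w ?WA) ?z \<odot> sliced E w ?WA \<odot> sliced E (WkF E A) A"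
    by (rule sf_comp_assoc)
  also have "sf_eq E (src E A) \<dots> (SubF D (sob w ?WA) ?z \<odot> sliced E (w \<odot> WkF E A) A)"
    by (intro sf_eq_comp_right[OF sf_eq_sym] sliced_comp[OF WkF_functor]) (use assms in auto)
  finally show ?thesis .
qed

lemma extension_eqI:
  assumes "sf_hom E (src E A) D \<Delta> w" "sf_hom E (src E A) D \<Delta> w'" "sf_pre_E_system D" "A \<in> Arr E"
    and "sf_eq E (tgt E A) (w \<odot> WkF E A) (w' \<odot> WkF E A)"
    and "stm w (idm E (src E A)) (sob (WkF E A) A) (idtm E A) =
         stm w' (idm E (src E A)) (sob (WkF E A) A) (idtm E A)"
  shows "sf_eq E (src E A) w w'"
proof -
  have o: "sob w (sob (WkF E A) A) = sob w' (sob (WkF E A) A)"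
    using sf_eqD(1)[OF assms(5), of A] assms(4) by simp
  note extension_unique[OF assms(1,3,4)]
  also have "sf_eq E (src E A) (SubF D (sob w (sob (WkF E A) A))
      (stm w (idm E (src E A)) (sob (WkF E A) A) (idtm E A)) \<odot> sliced E (w \<odot> WkF E A) A)
    (SubF D (sob w' (sob (WkF E A) A))
      (stm w' (idm E (src E A)) (sob (WkF E A) A) (idtm E A)) \<odot> sliced E (w' \<odot> WkF E A) A)"
    unfolding o assms(6)
    using sf_eq_sliced[OF assms(5) strict assms(4)] by (intro sf_eq_comp_right) simp
  also have "sf_eq E (src E A) \<dots> w'" by (rule sf_eq_sym[OF extension_unique[OF assms(2,3,4)]])
  finally show ?thesis .
qed

lemma extension:
  assumes "sf_hom E (tgt E A) D \<Delta> h" "sf_E_system D" "A \<in> Arr E" "z \<in> Tm D (sob h A)"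
  defines "w \<equiv> SubF D (sob h A) z \<odot> sliced E h A"
  shows "sf_hom E (src E A) D \<Delta> w" "sf_eq E (tgt E A) (w \<odot> WkF E A) h"
    "stm w (idm E (src E A)) (sob (WkF E A) A) (idtm E A) = z"
proof -
  interpret D: sf_E_system D by fact
  note h = sf_homD[OF assms(1)]
  note fh = sf_functorD[OF h(1)]
  have hA: "sob h A \<in> Arr D" "tgt D (sob h A) = \<Delta>" using fh assms(3) by auto
  show "sf_hom E (src E A) D \<Delta> w"
    unfolding w_def
    using sf_hom_comp[OF sf_hom_sliced[OF assms(1) pre D.pre assms(3)] D.SubF_hom[OF hA(1) assms(4)] pre D.pre]
      hA by simp
  \<comment> \<open>As \<open>h\<close> commutes with \<open>W\<close>, the weakening ends up next
    to \<open>S\<^sub>z\<close>, which cancels it.\<close>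
  have "sf_eq E (tgt E A) (SubF D (sob h A) z \<odot> sliced E h A \<odot> WkF E A)
      (SubF D (sob h A) z \<odot> WkF D (sob h A) \<odot> h)"
    by (intro sf_eq_comp_right sf_hom_Wk[OF assms(1) pre D.pre assms(3)]) simp
  also have "\<dots> = (SubF D (sob h A) z \<odot> WkF D (sob h A)) \<odot> h" by (simp add: sf_comp_assoc)
  also have "sf_eq E (tgt E A) \<dots> (sf_id \<odot> h)"
    by (rule sf_eq_comp_left[OF _ h(1)]) (use D.SubF_WkF[OF hA(1) assms(4)] hA in simp)
  finally show "sf_eq E (tgt E A) (w \<odot> WkF E A) h" by (simp add: w_def sf_comp_assoc)
  show "stm w (idm E (src E A)) (sob (WkF E A) A) (idtm E A) = z"
    using sf_hom_idtm[OF assms(1) pre D.pre assms(3)] sf_hom_Wk_self[OF assms(1) pre D.pre assms(3)]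
      D.SubF_idtm[OF hA(1) assms(4)] assms(3)
    by (simp add: w_def fh)
qed

end

section \<open>Reindexing along terms, composition and pairing\<close>

abbreviation RxF :: "'u esys \<Rightarrow> 'u el \<Rightarrow> 'u el \<Rightarrow> 'u el \<Rightarrow> 'u sfun" where
  "RxF E A B f \<equiv> sf_of (reindex E A B f)"

lemma RxF_eq: "RxF E A B f = SubF E (sob (WkF E A) B) f \<odot> sliced E (WkF E A) B"
  by (simp add: sf_of_def sliced_def sf_comp_def reindex_def slice_over_def tcomp_def flat_def
      over_def unflat_def fun_eq_iff)

lemma thom_eq: "thom E A B = Tm E (sob (WkF E A) B)"
  by (simp add: thom_def sf_of_def)

lemma tcompose_eq:
  "tcompose E A B C g f = stm (RxF E A B f) (idm E (src E B)) (sob (WkF E B) C) g"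
  by (simp add: tcompose_def sf_of_def)

text \<open>
  \<open>term_of E B w\<close> is \<open>w(idtm\<^sub>B)\<close>; it inverts \<open>f \<mapsto> f\<^sup>*\<close>. Hence an arrow from \<open>A\<close> to \<open>B\<close> in \<open>\<C>\<^sub>\<E>(\<Gamma>)\<close> is the
  same thing as a homomorphism \<open>w\<close> from the slice over \<open>\<Gamma>.B\<close> to the one over \<open>\<Gamma>.A\<close> with
  \<open>w \<circ> W\<^sub>B = W\<^sub>A\<close>, which reduces all equations between arrows to equations between functors.
\<close>

definition term_of :: "'u esys \<Rightarrow> 'u el \<Rightarrow> 'u sfun \<Rightarrow> 'u el" where
  "term_of E B w = stm w (idm E (src E B)) (sob (WkF E B) B) (idtm E B)"

context sf_E_system
begin

lemma term_of_cong:
  assumes "sf_eq E (src E B) w w'" "B \<in> Arr E"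
  shows "term_of E B w = term_of E B w'"
  unfolding term_of_def
  using Wk_self[OF assms(2)] idtm[OF assms(2)] assms(2) by (intro sf_eqD(3)[OF assms(1)]) simp_all

text \<open>The functor \<open>f\<^sup>*\<close> is the extension of \<open>W\<^sub>A\<close> to the
  slice over \<open>B\<close> that sends the generic term to \<open>f\<close>: this is
  \<open>extension\<close> with \<open>h = W\<^sub>A\<close> and \<open>z = f\<close>.\<close>

lemma RxF:
  assumes "A \<in> into E \<Gamma>" "B \<in> into E \<Gamma>" "f \<in> thom E A B"
  shows RxF_hom: "sf_hom E (src E B) E (src E A) (RxF E A B f)"
    and RxF_Wk: "sf_eq E \<Gamma> (RxF E A B f \<odot> WkF E B) (WkF E A)"
    and term_of_RxF: "term_of E B (RxF E A B f) = f"
proof -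
  have *: "sf_hom E (tgt E B) E (src E A) (WkF E A)" "B \<in> Arr E" "f \<in> Tm E (sob (WkF E A) B)"
    using WkF_hom[of A] assms by (simp_all add: thom_eq)
  note ext = extension[OF *(1) sf_E_system_axioms *(2,3)]
  show "sf_hom E (src E B) E (src E A) (RxF E A B f)" "sf_eq E \<Gamma> (RxF E A B f \<odot> WkF E B) (WkF E A)"
    "term_of E B (RxF E A B f) = f"
    using ext assms(2) by (simp_all add: RxF_eq term_of_def)
qed

text \<open>Uniqueness of extensions: \<open>w\<close> and the functor of the term extracted from it
  agree along \<open>W\<^sub>B\<close> and at \<open>idtm\<^sub>B\<close>.\<close>

lemma term_of:
  assumes "A \<in> into E \<Gamma>" "B \<in> into E \<Gamma>"
    and "sf_hom E (src E B) E (src E A) w" "sf_eq E \<Gamma> (w \<odot> WkF E B) (WkF E A)"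
  shows term_of_thom: "term_of E B w \<in> thom E A B"
    and RxF_term_of: "sf_eq E (src E B) (RxF E A B (term_of E B w)) w"
proof -
  have B: "B \<in> Arr E" "tgt E B = \<Gamma>" using assms by auto
  have o: "sob w (sob (WkF E B) B) = sob (WkF E A) B"
    using sf_eqD(1)[OF assms(4) B] by simp
  have w: "sar w (idm E (src E B)) (sob (WkF E B) B) = sob w (sob (WkF E B) B)"
    using Wk_self[OF B(1)] sf_functor_sob[OF sf_homD(1)[OF assms(3)] strict strict] by simp
  show t: "term_of E B w \<in> thom E A B"
    using sf_functorD(10)[OF sf_homD(1)[OF assms(3)], of "idm E (src E B)" "sob (WkF E B) B" "idtm E B"]
      Wk_self[OF B(1)] idtm[OF B(1)] B by (simp add: thom_eq term_of_def w o)
  note r = RxF[OF assms(1,2) t]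
  show "sf_eq E (src E B) (RxF E A B (term_of E B w)) w"
  proof (rule extension_eqI[OF r(1) assms(3) pre B(1)])
    show "sf_eq E (tgt E B) (RxF E A B (term_of E B w) \<odot> WkF E B) (w \<odot> WkF E B)"
      using sf_eq_trans[OF r(2) sf_eq_sym[OF assms(4)]] B by simp
  qed (use r(3) in \<open>simp add: term_of_def\<close>)
qed

lemma thom_eqI:
  assumes "A \<in> into E \<Gamma>" "B \<in> into E \<Gamma>" "f \<in> thom E A B" "g \<in> thom E A B"
    and "sf_eq E (src E B) (RxF E A B f) (RxF E A B g)"
  shows "f = g"
  using term_of_cong[OF assms(5)] term_of_RxF[OF assms(1-3)] term_of_RxF[OF assms(1,2,4)] assms(2)
  by simp

lemma RxF_comp_Wk:
  assumes "A \<in> into E \<Gamma>" "B \<in> into E \<Gamma>" "f \<in> thom E A B"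
    and "C \<in> Arr E" "sf_functor E \<Gamma> E (src E C) (WkF E C)"
    and "sf_eq E \<Gamma> (v \<odot> WkF E C) (WkF E B)"
  shows "sf_eq E \<Gamma> ((RxF E A B f \<odot> v) \<odot> WkF E C) (WkF E A)"
proof -
  have "sf_eq E \<Gamma> (RxF E A B f \<odot> v \<odot> WkF E C) (RxF E A B f \<odot> WkF E B)"
    by (rule sf_eq_comp_right) fact
  also have "sf_eq E \<Gamma> \<dots> (WkF E A)" by (rule RxF_Wk[OF assms(1-3)])
  finally show ?thesis by (simp add: sf_comp_assoc)
qed

text \<open>The composite is \<open>f\<^sup>*\<close> applied to \<open>g\<close>, and
  \<open>g\<close> is \<open>g\<^sup>*\<close> applied to \<open>idtm\<^sub>C\<close>, so it is the
  term extracted from \<open>f\<^sup>* \<circ> g\<^sup>*\<close>. Composition of arrows is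
  composition of functors in reverse order.\<close>

lemma tcompose:
  assumes "A \<in> into E \<Gamma>" "B \<in> into E \<Gamma>" "C \<in> into E \<Gamma>" "f \<in> thom E A B" "g \<in> thom E B C"
  shows tcompose_thom: "tcompose E A B C g f \<in> thom E A C"
    and RxF_tcompose: "sf_eq E (src E C) (RxF E A C (tcompose E A B C g f)) (RxF E A B f \<odot> RxF E B C g)"
proof -
  note f = RxF[OF assms(1,2,4)] and g = RxF[OF assms(2,3,5)]
  have C: "C \<in> Arr E" "tgt E C = \<Gamma>" using assms(3) by auto
  have g0: "sob (RxF E B C g) (idm E (src E C)) = idm E (src E B)"
    using sf_functorD(3)[OF sf_homD(1)[OF g(1)]] .
  have "sar (RxF E B C g) (idm E (src E C)) (sob (WkF E C) C) = sob (RxF E B C g) (sob (WkF E C) C)"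
    using Wk_self[OF C(1)] sf_functor_sob[OF sf_homD(1)[OF g(1)] strict strict] by simp
  also have "\<dots> = sob (WkF E B) C" using sf_eqD(1)[OF g(2) C] by simp
  finally have eq: "tcompose E A B C g f = term_of E C (RxF E A B f \<odot> RxF E B C g)"
    using g(3) g0 by (simp add: tcompose_eq term_of_def)
  have hom: "sf_hom E (src E C) E (src E A) (RxF E A B f \<odot> RxF E B C g)"
    by (rule sf_hom_comp[OF g(1) f(1) pre pre])
  have wk: "sf_eq E \<Gamma> ((RxF E A B f \<odot> RxF E B C g) \<odot> WkF E C) (WkF E A)"
    using RxF_comp_Wk[OF assms(1,2,4) C(1) _ g(2)] WkF_functor[OF C(1)] C by simp
  show "tcompose E A B C g f \<in> thom E A C"
    "sf_eq E (src E C) (RxF E A C (tcompose E A B C g f)) (RxF E A B f \<odot> RxF E B C g)"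
    unfolding eq using term_of[OF assms(1,3) hom wk] by simp_all
qed

text \<open>The pair \<open>x.u\<close> is the image of the generic term of \<open>A.P\<close> under
  the substitution of \<open>x\<close>, sliced at \<open>P\<close>, followed by the substitution of
  \<open>u\<close>.\<close>

lemma tpair_eq:
  assumes "A \<in> Arr E" "P \<in> Arr E" "tgt E P = src E A" "x \<in> Tm E A" "u \<in> Tm E (sob (SubF E A x) P)"
  shows "tpair E A P x u =
    stm (SubF E (sob (SubF E A x) P) u \<odot> sliced E (SubF E A x) P) (idm E (src E P))
      (sob (WkF E (A \<cdot>\<^bsub>E\<^esub> P)) (A \<cdot>\<^bsub>E\<^esub> P)) (idtm E (A \<cdot>\<^bsub>E\<^esub> P))"
  using assms(1-3) sf_functorD(6)[OF SubF_functor[OF assms(1,4)] assms(2,3) refl]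
  by (simp add: tpair_def Let_def) (simp add: sf_of_def)

text \<open>The pair is the image of the generic term of \<open>B.R\<close> under a composite of two
  substitutions and a weakening. Substituting the weakened \<open>f\<close> amounts to weakening
  after \<open>f\<^sup>*\<close>, since \<open>W\<^sub>X\<close> is a homomorphism; sliced at
  \<open>R\<close>, this weakening is cancelled by the substitution of \<open>idtm\<^sub>X\<close>,
  and \<open>f\<^sup>*/R\<close> is left.\<close>

lemma E2CE_pi2_eq:
  assumes "A \<in> into E \<Gamma>" "B \<in> into E \<Gamma>" "f \<in> thom E A B" "R \<in> into E (src E B)"
  shows "E2CE_pi2 E A B f R = term_of E (B \<cdot>\<^bsub>E\<^esub> R) (sliced E (RxF E A B f) R)"
proof -
  have A: "A \<in> Arr E" "tgt E A = \<Gamma>" and B: "B \<in> Arr E" "tgt E B = \<Gamma>"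
    and R: "R \<in> Arr E" "tgt E R = src E B" and f: "f \<in> Tm E (sob (WkF E A) B)"
    using assms by (auto simp: thom_eq)
  let ?h = "RxF E A B f"
  note h = RxF[OF assms(1-3)]
  note fh = sf_functorD[OF sf_homD(1)[OF h(1)]]
  define X where "X = sob ?h R"
  define W where "W = WkF E (A \<cdot>\<^bsub>E\<^esub> X)"
  have X: "X \<in> Arr E" "tgt E X = src E A" using fh R by (auto simp: X_def)
  have AX: "A \<cdot>\<^bsub>E\<^esub> X \<in> Arr E" "tgt E (A \<cdot>\<^bsub>E\<^esub> X) = \<Gamma>" "src E (A \<cdot>\<^bsub>E\<^esub> X) = src E X" using A X by auto
  have Whom: "sf_hom E \<Gamma> E (src E X) W" using WkF_hom[OF AX(1)] AX by (simp add: W_def)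
  note fW = sf_functorD[OF sf_homD(1)[OF Whom]]
  have WXhom: "sf_hom E (src E A) E (src E X) (WkF E X)" using WkF_hom[OF X(1)] X by simp
  note fWX = sf_functorD[OF sf_homD(1)[OF WXhom]]
  have WAhom: "sf_hom E \<Gamma> E (src E A) (WkF E A)" using WkF_hom[OF A(1)] A by simp
  note fWA = sf_functorD[OF sf_homD(1)[OF WAhom]]
  have Weq: "sf_eq E \<Gamma> W (WkF E X \<odot> WkF E A)"
    using WkF_cmp[OF A(1) X] A by (simp add: W_def)
  define B' where "B' = sob (WkF E A) B"
  have B': "B' \<in> Arr E" "tgt E B' = src E A" "f \<in> Tm E B'" using fWA B f by (auto simp: B'_def)
  define WB where "WB = sob W B"
  have "WB \<in> Arr E" "tgt E WB = src E X" by (simp_all add: WB_def fW B)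
  moreover have "WB = sob (WkF E X) B'" using sf_eqD(1)[OF Weq B] by (simp add: WB_def B'_def)
  ultimately have WB: "WB \<in> Arr E" "tgt E WB = src E X" "WB = sob (WkF E X) B'" by blast+
  define x where "x = stm (WkF E X) (idm E (src E A)) B' f"
  have x: "x \<in> Tm E WB"
    using fWX(10)[of "idm E (src E A)" B' f] B' A sf_functor_sob[OF sf_homD(1)[OF WXhom] strict strict B'(1,2)]
    by (simp add: x_def WB)
  have slB: "sf_functor E (src E B) E (src E WB) (sliced E W B)"
    using sf_functor_sliced[OF sf_homD(1)[OF Whom] strict strict B] by (simp add: WB_def)
  define P where "P = sar W B R"
  have P: "P \<in> Arr E" "tgt E P = src E WB" using fW B R by (auto simp: P_def WB_def)
  have WBP: "WB \<cdot>\<^bsub>E\<^esub> P = sob W (B \<cdot>\<^bsub>E\<^esub> R)" using fW B R by (simp add: WB_def P_def)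
  have slA: "sf_functor E (src E B) E (src E B') (sliced E (WkF E A) B)"
    using sf_functor_sliced[OF sf_homD(1)[OF WAhom] strict strict B] by (simp add: B'_def)
  \<comment> \<open>\<open>W\<close> along \<open>A.X\<close> is
    \<open>W\<^sub>X \<circ> W\<^sub>A\<close>, so slicing at \<open>B\<close> exposes
    \<open>W\<^sub>X/W\<^sub>A(B)\<close>, which passes through the substitution of
    \<open>f\<close>.\<close>
  have SW: "sf_eq E (src E B) (SubF E WB x \<odot> sliced E W B) (WkF E X \<odot> ?h)"
  proof -
    have "sf_eq E (src E B) (SubF E WB x \<odot> sliced E W B) (SubF E WB x \<odot> sliced E (WkF E X \<odot> WkF E A) B)"
      by (intro sf_eq_comp_right sf_eq_sliced[OF Weq strict B])
    also have "sf_eq E (src E B) \<dots> (SubF E WB x \<odot> sliced E (WkF E X) B' \<odot> sliced E (WkF E A) B)"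
      unfolding B'_def by (intro sf_eq_comp_right sliced_comp[OF sf_homD(1)[OF WAhom] B])
    also have "\<dots> = (SubF E WB x \<odot> sliced E (WkF E X) B') \<odot> sliced E (WkF E A) B"
      by (simp add: sf_comp_assoc)
    also have "sf_eq E (src E B) \<dots> ((WkF E X \<odot> SubF E B' f) \<odot> sliced E (WkF E A) B)"
      using sf_hom_Sub[OF WXhom pre pre B'] unfolding WB(3) x_def
      by (intro sf_eq_comp_left[OF sf_eq_sym slA])
    also have "\<dots> = WkF E X \<odot> ?h" by (simp add: RxF_eq B'_def sf_comp_assoc)
    finally show ?thesis .
  qed
  \<comment> \<open>This makes \<open>idtm E X\<close> a term of the family required of the second
    component.\<close>
  have SP: "sob (SubF E WB x) P = sob (WkF E X) X"
    using sf_eqD(1)[OF SW R] by (simp add: P_def X_def)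
  have slh: "sf_functor E (src E R) E (src E X) (sliced E ?h R)"
    using sf_functor_sliced[OF sf_homD(1)[OF h(1)] strict strict R] by (simp add: X_def)
  have slBR: "sf_functor E (src E R) E (src E P) (sliced E W (B \<cdot>\<^bsub>E\<^esub> R))"
  proof -
    have "src E (WB \<cdot>\<^bsub>E\<^esub> P) = src E P" using WB P by simp
    then show ?thesis
      using sf_functor_sliced[OF sf_homD(1)[OF Whom] strict strict, of "B \<cdot>\<^bsub>E\<^esub> R"] B R
      by (simp flip: WBP)
  qed
  \<comment> \<open>\<open>SW\<close> sliced at \<open>R\<close>, followed by the cancellation law
    \<open>SubF_idtm_WkF\<close> at \<open>X\<close>.\<close>
  have key: "sf_eq E (src E R)
    ((SubF E (sob (WkF E X) X) (idtm E X) \<odot> sliced E (SubF E WB x) P) \<odot> sliced E W (B \<cdot>\<^bsub>E\<^esub> R))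
    (sliced E ?h R)"
  proof -
    let ?S = "SubF E (sob (WkF E X) X) (idtm E X)"
    have "sf_eq E (src E R) (?S \<odot> sliced E (SubF E WB x) P \<odot> sliced E W (B \<cdot>\<^bsub>E\<^esub> R))
        (?S \<odot> sliced E (SubF E WB x) P \<odot> sliced E (sliced E W B) R)"
      by (intro sf_eq_comp_right sf_eq_sym[OF sliced_sliced[OF strict B(1) R]])
    also have "sf_eq E (src E R) \<dots> (?S \<odot> sliced E (SubF E WB x \<odot> sliced E W B) R)"
      using sliced_comp[OF slB R, of "SubF E WB x"]
      by (intro sf_eq_comp_right[OF sf_eq_sym]) (simp add: P_def)
    also have "sf_eq E (src E R) \<dots> (?S \<odot> sliced E (WkF E X \<odot> ?h) R)"
      by (intro sf_eq_comp_right sf_eq_sliced[OF SW strict R])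
    also have "sf_eq E (src E R) \<dots> (?S \<odot> sliced E (WkF E X) X \<odot> sliced E ?h R)"
      unfolding X_def by (intro sf_eq_comp_right sliced_comp[OF sf_homD(1)[OF h(1)] R])
    also have "\<dots> = (?S \<odot> sliced E (WkF E X) X) \<odot> sliced E ?h R" by (simp add: sf_comp_assoc)
    also have "sf_eq E (src E R) \<dots> (sf_id \<odot> sliced E ?h R)"
      by (rule sf_eq_comp_left[OF SubF_idtm_WkF[OF X(1)] slh])
    finally show ?thesis by (simp add: sf_comp_assoc)
  qed
  have BR: "B \<cdot>\<^bsub>E\<^esub> R \<in> Arr E" "tgt E (B \<cdot>\<^bsub>E\<^esub> R) = \<Gamma>" "src E (B \<cdot>\<^bsub>E\<^esub> R) = src E R" using B R by auto
  have "E2CE_pi2 E A B f R = tpair E WB P x (idtm E X)"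
    by (simp add: E2CE_pi2_def Let_def WB_def W_def P_def x_def X_def B'_def)
      (simp add: sf_of_def slice_over_def tcomp_def flat_def over_def unflat_def)
  also have "\<dots> = stm (SubF E (sob (WkF E X) X) (idtm E X) \<odot> sliced E (SubF E WB x) P) (idm E (src E P))
      (sob (WkF E (WB \<cdot>\<^bsub>E\<^esub> P)) (WB \<cdot>\<^bsub>E\<^esub> P)) (idtm E (WB \<cdot>\<^bsub>E\<^esub> P))"
    using tpair_eq[OF WB(1) P x, of "idtm E X"] idtm[OF X(1)] by (simp add: SP)
  \<comment> \<open>Being a homomorphism, \<open>W\<close> sends the generic term of
    \<open>B.R\<close> to the generic term of \<open>W(B.R)\<close>, so the evaluation can start at
    the former.\<close>
  also have "\<dots> = term_of E (B \<cdot>\<^bsub>E\<^esub> R)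
      ((SubF E (sob (WkF E X) X) (idtm E X) \<odot> sliced E (SubF E WB x) P) \<odot> sliced E W (B \<cdot>\<^bsub>E\<^esub> R))"
  proof -
    have "sar W (B \<cdot>\<^bsub>E\<^esub> R) (idm E (src E R)) = idm E (src E P)"
      using sf_functorD(3)[OF slBR] by simp
    moreover have "B \<cdot>\<^bsub>E\<^esub> R \<cdot>\<^bsub>E\<^esub> idm E (src E R) = B \<cdot>\<^bsub>E\<^esub> R" using BR by simp
    ultimately show ?thesis
      using sf_hom_idtm[OF Whom pre pre BR(1,2)] sf_hom_Wk_self[OF Whom pre pre BR(1,2)]
      by (simp add: term_of_def WBP BR(3))
  qed
  also have "\<dots> = term_of E (B \<cdot>\<^bsub>E\<^esub> R) (sliced E ?h R)"
    by (rule term_of_cong) (use key BR in simp_all)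
  finally show ?thesis .
qed

end


section \<open>Arrows of the term category as functors between slices\<close>

definition arr_fun :: "'u esys \<Rightarrow> 'u el \<Rightarrow> 'u sfun" where
  "arr_fun E k = RxF E (tsrc k) (ttgt k) (tterm k)"

definition arr_of :: "'u esys \<Rightarrow> 'u el \<Rightarrow> 'u el \<Rightarrow> 'u sfun \<Rightarrow> 'u el" where
  "arr_of E A B w = tarr A B (term_of E B w)"

lemma tarr_simps [simp]: "tsrc (tarr A B f) = A" "ttgt (tarr A B f) = B" "tterm (tarr A B f) = f"
  by (simp_all add: tarr_def tsrc_def ttgt_def tterm_def)

lemma arr_fun_tarr [simp]: "arr_fun E (tarr A B f) = RxF E A B f"
  by (simp add: arr_fun_def)

lemma arr_of_simps [simp]: "tsrc (arr_of E A B w) = A" "ttgt (arr_of E A B w) = B"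
  by (simp_all add: arr_of_def)

lemma term_cat_simps [simp]:
  "Obj (term_cat E \<Gamma>) = into E \<Gamma>" "src (term_cat E \<Gamma>) = tsrc" "tgt (term_cat E \<Gamma>) = ttgt"
  "idm (term_cat E \<Gamma>) A = tarr A A (idtm E A)"
  by (simp_all add: term_cat_def)

lemma tarr_in_term_cat [simp]:
  "tarr A B f \<in> Arr (term_cat E \<Gamma>) \<longleftrightarrow> A \<in> into E \<Gamma> \<and> B \<in> into E \<Gamma> \<and> f \<in> thom E A B"
  by (auto simp: term_cat_def tarr_def)

lemma term_catE:
  assumes "k \<in> Arr (term_cat E \<Gamma>)"
  obtains A B f where "k = tarr A B f" "A \<in> into E \<Gamma>" "B \<in> into E \<Gamma>" "f \<in> thom E A B"
proof -
  have "\<exists>A B f. k = tarr A B f \<and> A \<in> into E \<Gamma> \<and> B \<in> into E \<Gamma> \<and> f \<in> thom E A B"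
    using assms by (simp add: term_cat_def)
  then show thesis using that by blast
qed

lemma term_catD:
  assumes "k \<in> Arr (term_cat E \<Gamma>)"
  shows "tsrc k \<in> into E \<Gamma>" "ttgt k \<in> into E \<Gamma>" "tterm k \<in> thom E (tsrc k) (ttgt k)"
    "tarr (tsrc k) (ttgt k) (tterm k) = k" "tsrc k \<in> Arr E" "tgt E (tsrc k) = \<Gamma>"
    "ttgt k \<in> Arr E" "tgt E (ttgt k) = \<Gamma>"
  by (rule term_catE[OF assms]; simp)+

context sf_E_system
begin

lemma arr_fun:
  assumes "k \<in> Arr (term_cat E \<Gamma>)"
  shows arr_fun_hom: "sf_hom E (src E (ttgt k)) E (src E (tsrc k)) (arr_fun E k)"
    and arr_fun_Wk: "sf_eq E \<Gamma> (arr_fun E k \<odot> WkF E (ttgt k)) (WkF E (tsrc k))"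
    and term_of_arr_fun: "term_of E (ttgt k) (arr_fun E k) = tterm k"
  unfolding arr_fun_def using RxF[OF term_catD(1-3)[OF assms]] by simp_all

lemmas arr_fun_functor = arr_fun_hom[THEN sf_homD(1)]

lemma arr_of:
  assumes "A \<in> into E \<Gamma>" "B \<in> into E \<Gamma>"
    and "sf_hom E (src E B) E (src E A) w" "sf_eq E \<Gamma> (w \<odot> WkF E B) (WkF E A)"
  shows arr_of_Arr: "arr_of E A B w \<in> Arr (term_cat E \<Gamma>)"
    and arr_fun_arr_of: "sf_eq E (src E B) (arr_fun E (arr_of E A B w)) w"
  using term_of[OF assms] assms(1,2) by (simp_all add: arr_of_def)

text \<open>The main tool for equations between arrows. The functor \<open>w\<close> serves as a
  common normal form, to which the functors of both arrows are reduced by the slicing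
  calculus.\<close>

lemma arr_eqI:
  assumes "k \<in> Arr (term_cat E \<Gamma>)" "l \<in> Arr (term_cat E \<Gamma>)"
    and "tsrc k = tsrc l" "ttgt k = B" "ttgt l = B"
    and "sf_eq E (src E B) (arr_fun E k) w" "sf_eq E (src E B) (arr_fun E l) w"
  shows "k = l"
proof -
  note k = term_catD[OF assms(1)] and l = term_catD[OF assms(2)]
  have "tterm k = tterm l"
  proof (rule thom_eqI[OF k(1-3)])
    show "tterm l \<in> thom E (tsrc k) (ttgt k)" using l(3) assms(3-5) by simp
    show "sf_eq E (src E (ttgt k)) (RxF E (tsrc k) (ttgt k) (tterm k)) (RxF E (tsrc k) (ttgt k) (tterm l))"
      using sf_eq_trans[OF assms(6) sf_eq_sym[OF assms(7)]] assms(3-5) by (simp add: arr_fun_def)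
  qed
  then show ?thesis using k(4) l(4) assms(3-5) by metis
qed

lemma cmp_arr:
  assumes "k \<in> Arr (term_cat E \<Gamma>)" "l \<in> Arr (term_cat E \<Gamma>)" "ttgt l = tsrc k"
  shows cmp_Arr: "k \<cdot>\<^bsub>term_cat E \<Gamma>\<^esub> l \<in> Arr (term_cat E \<Gamma>)"
    and tsrc_cmp: "tsrc (k \<cdot>\<^bsub>term_cat E \<Gamma>\<^esub> l) = tsrc l"
    and ttgt_cmp: "ttgt (k \<cdot>\<^bsub>term_cat E \<Gamma>\<^esub> l) = ttgt k"
    and arr_fun_cmp: "sf_eq E (src E (ttgt k)) (arr_fun E (k \<cdot>\<^bsub>term_cat E \<Gamma>\<^esub> l))
      (arr_fun E l \<odot> arr_fun E k)"
proof -
  note k = term_catD[OF assms(1)] and l = term_catD[OF assms(2)]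
  have eq: "k \<cdot>\<^bsub>term_cat E \<Gamma>\<^esub> l =
      tarr (tsrc l) (ttgt k) (tcompose E (tsrc l) (ttgt l) (ttgt k) (tterm k) (tterm l))"
    by (simp add: term_cat_def)
  have k3: "tterm k \<in> thom E (ttgt l) (ttgt k)" using k(3) assms(3) by simp
  show "k \<cdot>\<^bsub>term_cat E \<Gamma>\<^esub> l \<in> Arr (term_cat E \<Gamma>)"
    "tsrc (k \<cdot>\<^bsub>term_cat E \<Gamma>\<^esub> l) = tsrc l" "ttgt (k \<cdot>\<^bsub>term_cat E \<Gamma>\<^esub> l) = ttgt k"
    "sf_eq E (src E (ttgt k)) (arr_fun E (k \<cdot>\<^bsub>term_cat E \<Gamma>\<^esub> l)) (arr_fun E l \<odot> arr_fun E k)"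
    unfolding eq using tcompose[OF l(1,2) k(2) l(3) k3] k l assms(3) by (simp_all add: arr_fun_def)
qed

lemma idm_arr:
  assumes "A \<in> into E \<Gamma>"
  shows idm_Arr: "tarr A A (idtm E A) \<in> Arr (term_cat E \<Gamma>)"
    and arr_fun_idm: "sf_eq E (src E A) (arr_fun E (tarr A A (idtm E A))) sf_id"
  using idtm[of A] SubF_idtm_WkF[of A] assms by (simp_all add: thom_eq RxF_eq)

text \<open>Composition of functors is associative and unital, and \<open>arr_eqI\<close> transports
  this to arrows.\<close>

lemma term_cat_strict_category: "strict_category (term_cat E \<Gamma>)"
proof
  fix f assume f: "f \<in> Arr (term_cat E \<Gamma>)"
  then show "src (term_cat E \<Gamma>) f \<in> Obj (term_cat E \<Gamma>)" "tgt (term_cat E \<Gamma>) f \<in> Obj (term_cat E \<Gamma>)"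
    using term_catD[OF f] by auto
  note i1 = idm_arr[OF term_catD(1)[OF f]] and i2 = idm_arr[OF term_catD(2)[OF f]]
  note c1 = cmp_arr[OF f i1(1), unfolded tarr_simps, OF refl]
  note c2 = cmp_arr[OF i2(1) f, unfolded tarr_simps, OF refl]
  have "f \<cdot>\<^bsub>term_cat E \<Gamma>\<^esub> tarr (tsrc f) (tsrc f) (idtm E (tsrc f)) = f"
  proof (rule arr_eqI[OF c1(1) f c1(2,3) refl])
    show "sf_eq E (src E (ttgt f))
      (arr_fun E (f \<cdot>\<^bsub>term_cat E \<Gamma>\<^esub> tarr (tsrc f) (tsrc f) (idtm E (tsrc f)))) (arr_fun E f)"
      using sf_eq_trans[OF c1(4) sf_eq_comp_left[OF i1(2) arr_fun_functor[OF f]]] by simp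
  qed simp
  then show "f \<cdot>\<^bsub>term_cat E \<Gamma>\<^esub> idm (term_cat E \<Gamma>) (src (term_cat E \<Gamma>) f) = f" by simp
  have "tarr (ttgt f) (ttgt f) (idtm E (ttgt f)) \<cdot>\<^bsub>term_cat E \<Gamma>\<^esub> f = f"
  proof (rule arr_eqI[OF c2(1) f c2(2,3) refl])
    show "sf_eq E (src E (ttgt f))
      (arr_fun E (tarr (ttgt f) (ttgt f) (idtm E (ttgt f)) \<cdot>\<^bsub>term_cat E \<Gamma>\<^esub> f)) (arr_fun E f)"
      using sf_eq_trans[OF c2(4) sf_eq_comp_right[OF i2(2)]] by simp
  qed simp
  then show "idm (term_cat E \<Gamma>) (tgt (term_cat E \<Gamma>) f) \<cdot>\<^bsub>term_cat E \<Gamma>\<^esub> f = f" by simp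
next
  fix a assume "a \<in> Obj (term_cat E \<Gamma>)"
  then show "idm (term_cat E \<Gamma>) a \<in> Hom (term_cat E \<Gamma>) a a"
    using idm_arr(1)[of a \<Gamma>] by (simp add: Hom_def)
next
  fix f g a b c assume "f \<in> Hom (term_cat E \<Gamma>) a b" "g \<in> Hom (term_cat E \<Gamma>) b c"
  then show "g \<cdot>\<^bsub>term_cat E \<Gamma>\<^esub> f \<in> Hom (term_cat E \<Gamma>) a c"
    using cmp_arr(1-3)[of g \<Gamma> f] by (simp add: Hom_def)
next
  fix f g h a b c d
  assume "f \<in> Hom (term_cat E \<Gamma>) a b" "g \<in> Hom (term_cat E \<Gamma>) b c" "h \<in> Hom (term_cat E \<Gamma>) c d"
  then have f: "f \<in> Arr (term_cat E \<Gamma>)" and g: "g \<in> Arr (term_cat E \<Gamma>)" and h: "h \<in> Arr (term_cat E \<Gamma>)"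
    and fg: "ttgt f = tsrc g" and gh: "ttgt g = tsrc h" by (simp_all add: Hom_def)
  note gf = cmp_arr[OF g f fg] and hg = cmp_arr[OF h g gh]
  note l = cmp_arr[OF hg(1) f, unfolded hg(2), OF fg] and r = cmp_arr[OF h gf(1), unfolded gf(3), OF gh]
  show "h \<cdot>\<^bsub>term_cat E \<Gamma>\<^esub> g \<cdot>\<^bsub>term_cat E \<Gamma>\<^esub> f = h \<cdot>\<^bsub>term_cat E \<Gamma>\<^esub> (g \<cdot>\<^bsub>term_cat E \<Gamma>\<^esub> f)"
  proof (rule arr_eqI[OF l(1) r(1) _ _ r(3)])
    show "sf_eq E (src E (ttgt h)) (arr_fun E (h \<cdot>\<^bsub>term_cat E \<Gamma>\<^esub> g \<cdot>\<^bsub>term_cat E \<Gamma>\<^esub> f))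
        (arr_fun E f \<odot> arr_fun E g \<odot> arr_fun E h)"
      using sf_eq_trans[OF l(4)[unfolded hg(3)] sf_eq_comp_right[OF hg(4)]] .
    have "sf_functor E (src E (ttgt h)) E (src E (ttgt g)) (arr_fun E h)"
      using arr_fun_functor[OF h] gh by simp
    then show "sf_eq E (src E (ttgt h)) (arr_fun E (h \<cdot>\<^bsub>term_cat E \<Gamma>\<^esub> (g \<cdot>\<^bsub>term_cat E \<Gamma>\<^esub> f)))
        (arr_fun E f \<odot> arr_fun E g \<odot> arr_fun E h)"
      using sf_eq_trans[OF r(4) sf_eq_comp_left[OF gf(4)]] by (simp add: sf_comp_assoc)
  qed (simp_all add: l(2,3) r(2) gf(2) hg(3))
qed

end

lemma E2CE_obj_simps [simp]:
  "fam (E2CE_obj E) = slice E (root E)" "ctx (E2CE_obj E) = term_cat E (root E)"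
  "one (E2CE_obj E) = idm E (root E)"
  "incl (E2CE_obj E) (Pr A Q) = arr_of E (A \<cdot>\<^bsub>E\<^esub> Q) A (WkF E Q)"
  "pb (E2CE_obj E) k (Pr B R) = Pr (tsrc k) (sob (arr_fun E k) R)"
  by (simp_all add: E2CE_obj_def arr_of_def arr_fun_def term_of_def Let_def)
    (simp_all add: sf_of_def)

section \<open>Inclusions, projections and pullback squares\<close>

context sf_E_system
begin

text \<open>Weakening by \<open>A\<close> and then by \<open>Q\<close> is weakening by
  \<open>A.Q\<close>, which makes \<open>W\<^sub>Q\<close> the functor of an arrow from
  \<open>A.Q\<close> to \<open>A\<close>.\<close>

lemma incl_arr:
  assumes "A \<in> into E \<Gamma>" "Q \<in> into E (src E A)"
  defines "k \<equiv> incl (E2CE_obj E) (Pr A Q)"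
  shows incl_Arr: "k \<in> Arr (term_cat E \<Gamma>)" and tsrc_incl: "tsrc k = A \<cdot>\<^bsub>E\<^esub> Q" and ttgt_incl: "ttgt k = A"
    and arr_fun_incl: "sf_eq E (src E A) (arr_fun E k) (WkF E Q)"
proof -
  have k: "k = arr_of E (A \<cdot>\<^bsub>E\<^esub> Q) A (WkF E Q)" by (simp add: k_def)
  have "sf_hom E (src E A) E (src E (A \<cdot>\<^bsub>E\<^esub> Q)) (WkF E Q)"
    using WkF_hom[of Q] assms(1,2) by simp
  moreover have "sf_eq E \<Gamma> (WkF E Q \<odot> WkF E A) (WkF E (A \<cdot>\<^bsub>E\<^esub> Q))"
    using WkF_cmp[of A Q] assms(1,2) by (simp add: sf_eq_sym)
  moreover have "A \<cdot>\<^bsub>E\<^esub> Q \<in> into E \<Gamma>" using assms(1,2) by simp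
  ultimately show "k \<in> Arr (term_cat E \<Gamma>)" "sf_eq E (src E A) (arr_fun E k) (WkF E Q)"
    unfolding k using arr_of[OF _ assms(1)] by blast+
qed (simp_all add: k_def)

text \<open>As \<open>f\<^sup>*\<close> commutes with weakening, \<open>f\<^sup>*/R\<close> after
  \<open>W\<^sub>R\<close> is weakening by the pulled back family after \<open>f\<^sup>*\<close>.
  Hence \<open>f\<^sup>*/R\<close> satisfies the condition over \<open>\<Gamma>\<close> that
  characterises functors of arrows.\<close>

lemma pi2_arr:
  assumes k: "k \<in> Arr (term_cat E \<Gamma>)" and R: "R \<in> into E (src E (ttgt k))"
  defines "p \<equiv> pi2 (E2CE_obj E) k (Pr (ttgt k) R)"
  shows pi2_Arr: "p \<in> Arr (term_cat E \<Gamma>)"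
    and tsrc_pi2: "tsrc p = tsrc k \<cdot>\<^bsub>E\<^esub> sob (arr_fun E k) R" and ttgt_pi2: "ttgt p = ttgt k \<cdot>\<^bsub>E\<^esub> R"
    and arr_fun_pi2: "sf_eq E (src E R) (arr_fun E p) (sliced E (arr_fun E k) R)"
proof -
  note t = term_catD[OF k]
  let ?X = "sob (arr_fun E k) R"
  have p: "p = arr_of E (tsrc k \<cdot>\<^bsub>E\<^esub> ?X) (ttgt k \<cdot>\<^bsub>E\<^esub> R) (sliced E (arr_fun E k) R)"
    using E2CE_pi2_eq[OF t(1-3) R]
    by (simp add: p_def E2CE_obj_def arr_of_def arr_fun_def Let_def) (simp add: sf_of_def)
  note h = sf_functorD[OF arr_fun_functor[OF k]]
  have R': "R \<in> Arr E" "tgt E R = src E (ttgt k)" using R by auto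
  have X: "?X \<in> Arr E" "tgt E ?X = src E (tsrc k)" using h R' by auto
  have AX: "tsrc k \<cdot>\<^bsub>E\<^esub> ?X \<in> into E \<Gamma>" and BR: "ttgt k \<cdot>\<^bsub>E\<^esub> R \<in> into E \<Gamma>" using X R' t by auto
  have hom: "sf_hom E (src E (ttgt k \<cdot>\<^bsub>E\<^esub> R)) E (src E (tsrc k \<cdot>\<^bsub>E\<^esub> ?X)) (sliced E (arr_fun E k) R)"
    using sf_hom_sliced[OF arr_fun_hom[OF k] pre pre R'] X R' t by simp
  have "sf_eq E \<Gamma> (sliced E (arr_fun E k) R \<odot> WkF E (ttgt k \<cdot>\<^bsub>E\<^esub> R))
      (sliced E (arr_fun E k) R \<odot> WkF E R \<odot> WkF E (ttgt k))"
    using WkF_cmp[of "ttgt k" R] R' t by (intro sf_eq_comp_right) simp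
  also have "\<dots> = (sliced E (arr_fun E k) R \<odot> WkF E R) \<odot> WkF E (ttgt k)" by (simp add: sf_comp_assoc)
  also have "sf_eq E \<Gamma> \<dots> ((WkF E ?X \<odot> arr_fun E k) \<odot> WkF E (ttgt k))"
    using WkF_functor[of "ttgt k"] t
    by (intro sf_eq_comp_left[OF sf_hom_Wk[OF arr_fun_hom[OF k] pre pre R']]) simp
  also have "\<dots> = WkF E ?X \<odot> arr_fun E k \<odot> WkF E (ttgt k)" by (rule sf_comp_assoc)
  also have "sf_eq E \<Gamma> \<dots> (WkF E ?X \<odot> WkF E (tsrc k))"
    by (rule sf_eq_comp_right[OF arr_fun_Wk[OF k]])
  also have "sf_eq E \<Gamma> \<dots> (WkF E (tsrc k \<cdot>\<^bsub>E\<^esub> ?X))"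
    using WkF_cmp[of "tsrc k" ?X] X t by (simp add: sf_eq_sym)
  finally have wk: "sf_eq E \<Gamma> (sliced E (arr_fun E k) R \<odot> WkF E (ttgt k \<cdot>\<^bsub>E\<^esub> R)) (WkF E (tsrc k \<cdot>\<^bsub>E\<^esub> ?X))" .
  show "p \<in> Arr (term_cat E \<Gamma>)" "sf_eq E (src E R) (arr_fun E p) (sliced E (arr_fun E k) R)"
    "tsrc p = tsrc k \<cdot>\<^bsub>E\<^esub> ?X" "ttgt p = ttgt k \<cdot>\<^bsub>E\<^esub> R"
    unfolding p using arr_of[OF AX BR hom wk] R' t by simp_all
qed

text \<open>Passing to functors reverses arrows, so a pushout property is needed: functors
  \<open>U\<close> and \<open>V\<close> with
  \<open>U \<circ> W\<^sub>R = V \<circ> f\<^sup>*\<close> must factor uniquely through the slice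
  over the source of \<open>X\<close>. That slice is the one over the source of
  \<open>tsrc k\<close> with a term of \<open>X\<close> freely adjoined, so the mediating functor
  extends \<open>V\<close>, and only the image of the generic term has to be found.\<close>

lemma E2CE_pullback:
  assumes k: "k \<in> Arr (term_cat E \<Gamma>)" and R: "R \<in> into E (src E (ttgt k))"
  defines "X \<equiv> sob (arr_fun E k) R"
  shows "is_pullback (term_cat E \<Gamma>) (pi2 (E2CE_obj E) k (Pr (ttgt k) R))
    (incl (E2CE_obj E) (Pr (tsrc k) X)) (incl (E2CE_obj E) (Pr (ttgt k) R)) k"
proof -
  let ?C = "term_cat E \<Gamma>" and ?A = "tsrc k" and ?B = "ttgt k" and ?h = "arr_fun E k"
  interpret C: strict_category ?C by (rule term_cat_strict_category)
  note t = term_catD[OF k]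
  define p where "p = pi2 (E2CE_obj E) k (Pr ?B R)"
  define q where "q = incl (E2CE_obj E) (Pr ?A X)"
  define r where "r = incl (E2CE_obj E) (Pr ?B R)"
  note h = sf_functorD[OF arr_fun_functor[OF k]]
  have R': "R \<in> Arr E" "tgt E R = src E ?B" using R by auto
  have X: "X \<in> Arr E" "tgt E X = src E ?A" using h R' by (auto simp: X_def)
  then have X': "X \<in> into E (src E ?A)" by simp
  note p = pi2_arr[OF k R, folded p_def X_def] and q = incl_arr[OF t(1) X', folded q_def]
    and r = incl_arr[OF t(2) R, folded r_def]
  have slh: "sf_functor E (src E R) E (src E X) (sliced E ?h R)"
    using sf_functor_sliced[OF arr_fun_functor[OF k] strict strict R'] by (simp add: X_def)
  have WR: "sf_functor E (src E ?B) E (src E R) (WkF E R)" using WkF_functor[OF R'(1)] R'(2) by simp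
  have "ttgt p = tsrc r" "ttgt q = tsrc k" using p r q by simp_all
  note rp = cmp_arr[OF r(1) p(1) this(1)] and kq = cmp_arr[OF k q(1) this(2)]
  have comm: "r \<cdot>\<^bsub>?C\<^esub> p = k \<cdot>\<^bsub>?C\<^esub> q"
  proof (rule arr_eqI[OF rp(1) kq(1) _ _ kq(3)])
    have "sf_eq E (src E ?B) (arr_fun E (r \<cdot>\<^bsub>?C\<^esub> p)) (arr_fun E p \<odot> arr_fun E r)"
      using rp(4) r(3) by simp
    also have "sf_eq E (src E ?B) \<dots> (arr_fun E p \<odot> WkF E R)"
      using sf_eq_comp_right[OF r(4)] .
    also have "sf_eq E (src E ?B) \<dots> (sliced E ?h R \<odot> WkF E R)"
      by (rule sf_eq_comp_left[OF p(4) WR])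
    also have "sf_eq E (src E ?B) \<dots> (WkF E X \<odot> ?h)"
      unfolding X_def by (rule sf_hom_Wk[OF arr_fun_hom[OF k] pre pre R'])
    finally show "sf_eq E (src E ?B) (arr_fun E (r \<cdot>\<^bsub>?C\<^esub> p)) (WkF E X \<odot> ?h)" .
    show "sf_eq E (src E ?B) (arr_fun E (k \<cdot>\<^bsub>?C\<^esub> q)) (WkF E X \<odot> ?h)"
      using sf_eq_trans[OF kq(4) sf_eq_comp_left[OF q(4) arr_fun_functor[OF k]]] .
  qed (use rp(2,3) kq(2,3) p(2) q(2) r(3) in simp_all)
  have univ: "\<exists>!w. w \<in> Hom ?C x (tsrc p) \<and> p \<cdot>\<^bsub>?C\<^esub> w = u \<and> q \<cdot>\<^bsub>?C\<^esub> w = v"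
    if u: "u \<in> Hom ?C x (tsrc r)" and v: "v \<in> Hom ?C x (tsrc k)" and uv: "r \<cdot>\<^bsub>?C\<^esub> u = k \<cdot>\<^bsub>?C\<^esub> v" for x u v
  proof -
    have u: "u \<in> Arr ?C" "tsrc u = x" "ttgt u = ?B \<cdot>\<^bsub>E\<^esub> R" and v: "v \<in> Arr ?C" "tsrc v = x" "ttgt v = ?A"
      using u v r(2) by (simp_all add: Hom_def)
    note ru = cmp_arr[OF r(1) u(1), unfolded r(2), OF u(3)] and kv = cmp_arr[OF k v(1) v(3)]
    have x: "x \<in> into E \<Gamma>" using term_catD(1)[OF u(1)] u(2) by simp
    let ?U = "arr_fun E u" and ?V = "arr_fun E v"
    have sBR: "src E (?B \<cdot>\<^bsub>E\<^esub> R) = src E R" using t R' by simp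
    have sAX: "src E (?A \<cdot>\<^bsub>E\<^esub> X) = src E X" using t X by simp
    have AX: "?A \<cdot>\<^bsub>E\<^esub> X \<in> into E \<Gamma>" using t X by simp
    have U: "sf_hom E (src E R) E (src E x) ?U" using arr_fun_hom[OF u(1)] u(2,3) sBR by simp
    have V: "sf_hom E (src E ?A) E (src E x) ?V" using arr_fun_hom[OF v(1)] v(2,3) by simp
    have UV: "sf_eq E (src E ?B) (?U \<odot> WkF E R) (?V \<odot> ?h)"
    proof -
      have "sf_eq E (src E ?B) (?U \<odot> WkF E R) (?U \<odot> arr_fun E r)"
        by (rule sf_eq_comp_right[OF sf_eq_sym[OF r(4)]])
      also have "sf_eq E (src E ?B) \<dots> (arr_fun E (r \<cdot>\<^bsub>?C\<^esub> u))"
        using sf_eq_sym[OF ru(4)] r(3) by simp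
      also have "\<dots> = arr_fun E (k \<cdot>\<^bsub>?C\<^esub> v)" using uv by simp
      also have "sf_eq E (src E ?B) \<dots> (?V \<odot> ?h)" by (rule kv(4))
      finally show ?thesis .
    qed
    \<comment> \<open>The functor \<open>f\<^sup>*/R\<close> matches the generic terms of
      \<open>R\<close> and \<open>X\<close>, so the generic term of \<open>X\<close> must go where
      \<open>?U\<close> sends that of \<open>R\<close>.\<close>
    define z where "z = term_of E R ?U"
    have UWR: "sob ?U (sob (WkF E R) R) = sob ?V X"
      using sf_eqD(1)[OF UV R'] by (simp add: X_def)
    have z: "z \<in> Tm E (sob ?V X)"
    proof -
      note fU = sf_functorD[OF sf_homD(1)[OF U]]
      have "sar ?U (idm E (src E R)) (sob (WkF E R) R) = sob ?V X"
        using UWR Wk_self[OF R'(1)] sf_functor_sob[OF sf_homD(1)[OF U] strict strict] by simp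
      then show ?thesis
        using fU(10)[of "idm E (src E R)" "sob (WkF E R) R" "idtm E R"] Wk_self[OF R'(1)] idtm[OF R'(1)] R'
        by (simp add: z_def term_of_def)
    qed
    have V': "sf_hom E (tgt E X) E (src E x) ?V" using V X by simp
    define w' where "w' = SubF E (sob ?V X) z \<odot> sliced E ?V X"
    note w' = extension[OF V' sf_E_system_axioms X(1) z, folded w'_def]
    have w'X: "sf_eq E (src E ?A) (w' \<odot> WkF E X) ?V" using w'(2) X by simp
    have WA: "sf_functor E \<Gamma> E (src E ?A) (WkF E ?A)" using WkF_functor[of ?A] t by simp
    have "sf_eq E \<Gamma> (w' \<odot> WkF E (?A \<cdot>\<^bsub>E\<^esub> X)) (w' \<odot> WkF E X \<odot> WkF E ?A)"
      using WkF_cmp[of ?A X] X t by (intro sf_eq_comp_right) simp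
    also have "\<dots> = (w' \<odot> WkF E X) \<odot> WkF E ?A" by (simp add: sf_comp_assoc)
    also have "sf_eq E \<Gamma> \<dots> (?V \<odot> WkF E ?A)" by (rule sf_eq_comp_left[OF w'X WA])
    also have "sf_eq E \<Gamma> \<dots> (WkF E x)" using arr_fun_Wk[OF v(1)] v(2,3) by simp
    finally have w'Wk: "sf_eq E \<Gamma> (w' \<odot> WkF E (?A \<cdot>\<^bsub>E\<^esub> X)) (WkF E x)" .
    define w where "w = arr_of E x (?A \<cdot>\<^bsub>E\<^esub> X) w'"
    have w'hom: "sf_hom E (src E (?A \<cdot>\<^bsub>E\<^esub> X)) E (src E x) w'" using w'(1) sAX by simp
    note w = arr_of[OF x AX w'hom w'Wk, folded w_def]
    have wst: "tsrc w = x" "ttgt w = ?A \<cdot>\<^bsub>E\<^esub> X" by (simp_all add: w_def)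
    \<comment> \<open>Slicing \<open>UV\<close> at \<open>R\<close> turns the composite into the
      reconstruction of \<open>?U\<close> from its restriction along \<open>W\<^sub>R\<close> and
      the term \<open>z\<close>.\<close>
    have w'h: "sf_eq E (src E R) (w' \<odot> sliced E ?h R) ?U"
    proof -
      have "w' \<odot> sliced E ?h R = SubF E (sob ?V X) z \<odot> sliced E ?V (sob ?h R) \<odot> sliced E ?h R"
        by (simp add: w'_def sf_comp_assoc X_def)
      also have "sf_eq E (src E R) \<dots> (SubF E (sob ?V X) z \<odot> sliced E (?V \<odot> ?h) R)"
        by (rule sf_eq_comp_right[OF sf_eq_sym[OF sliced_comp[OF arr_fun_functor[OF k] R']]])
      also have "sf_eq E (src E R) \<dots> (SubF E (sob ?V X) z \<odot> sliced E (?U \<odot> WkF E R) R)"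
        by (rule sf_eq_comp_right[OF sf_eq_sliced[OF sf_eq_sym[OF UV] strict R']])
      also have "sf_eq E (src E R) \<dots> ?U"
        using sf_eq_sym[OF extension_unique[OF U pre R'(1)]] by (simp add: UWR z_def term_of_def)
      finally show ?thesis .
    qed
    have pw: "p \<cdot>\<^bsub>?C\<^esub> w = u"
    proof -
      have "ttgt w = tsrc p" using wst p by simp
      note c = cmp_arr[OF p(1) w(1) this]
      show ?thesis
      proof (rule arr_eqI[OF c(1) u(1) _ _ u(3)], unfold sBR)
        have "sf_eq E (src E R) (arr_fun E (p \<cdot>\<^bsub>?C\<^esub> w)) (arr_fun E w \<odot> arr_fun E p)"
          using c(4) p(3) sBR by simp
        also have "sf_eq E (src E R) \<dots> (arr_fun E w \<odot> sliced E ?h R)" by (rule sf_eq_comp_right[OF p(4)])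
        also have "sf_eq E (src E R) \<dots> (w' \<odot> sliced E ?h R)"
          using w(2) sAX by (intro sf_eq_comp_left[OF _ slh]) simp
        finally show "sf_eq E (src E R) (arr_fun E (p \<cdot>\<^bsub>?C\<^esub> w)) ?U" using w'h by (rule sf_eq_trans)
      qed (use c(2,3) p(3) wst u in simp_all)
    qed
    have WX: "sf_functor E (src E ?A) E (src E X) (WkF E X)" using WkF_functor[OF X(1)] X by simp
    have qw: "q \<cdot>\<^bsub>?C\<^esub> w = v"
    proof -
      have "ttgt w = tsrc q" using wst q by simp
      note c = cmp_arr[OF q(1) w(1) this]
      show ?thesis
      proof (rule arr_eqI[OF c(1) v(1) _ _ v(3)])
        have "sf_eq E (src E ?A) (arr_fun E (q \<cdot>\<^bsub>?C\<^esub> w)) (arr_fun E w \<odot> arr_fun E q)"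
          using c(4) q(3) by simp
        also have "sf_eq E (src E ?A) \<dots> (arr_fun E w \<odot> WkF E X)" by (rule sf_eq_comp_right[OF q(4)])
        also have "sf_eq E (src E ?A) \<dots> (w' \<odot> WkF E X)"
          using w(2) sAX by (intro sf_eq_comp_left[OF _ WX]) simp
        finally show "sf_eq E (src E ?A) (arr_fun E (q \<cdot>\<^bsub>?C\<^esub> w)) ?V" using w'X by (rule sf_eq_trans)
      qed (use c(2,3) q(3) wst v in simp_all)
    qed
    show ?thesis
    proof (rule ex1I[of _ w])
      show "w \<in> Hom ?C x (tsrc p) \<and> p \<cdot>\<^bsub>?C\<^esub> w = u \<and> q \<cdot>\<^bsub>?C\<^esub> w = v"
        using w(1) wst p pw qw by (simp add: Hom_def)
    next
      fix y assume "y \<in> Hom ?C x (tsrc p) \<and> p \<cdot>\<^bsub>?C\<^esub> y = u \<and> q \<cdot>\<^bsub>?C\<^esub> y = v"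
      then have y: "y \<in> Arr ?C" "tsrc y = x" "ttgt y = ?A \<cdot>\<^bsub>E\<^esub> X" and py: "p \<cdot>\<^bsub>?C\<^esub> y = u" and qy: "q \<cdot>\<^bsub>?C\<^esub> y = v"
        using p by (simp_all add: Hom_def)
      have yh: "sf_hom E (src E X) E (src E x) (arr_fun E y)" using arr_fun_hom[OF y(1)] y sAX by simp
      have "ttgt y = tsrc p" "ttgt y = tsrc q" using y p q by simp_all
      note cp = cmp_arr[OF p(1) y(1) this(1)] and cq = cmp_arr[OF q(1) y(1) this(2)]
      have yq: "sf_eq E (src E ?A) (arr_fun E y \<odot> WkF E X) ?V"
        using sf_eq_trans[OF sf_eq_comp_right[OF sf_eq_sym[OF q(4)]]] sf_eq_sym[OF cq(4)] qy q(3) by simp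
      have yp: "sf_eq E (src E R) (arr_fun E y \<odot> sliced E ?h R) ?U"
        using sf_eq_trans[OF sf_eq_comp_right[OF sf_eq_sym[OF p(4)]]] sf_eq_sym[OF cp(4)] py p(3) sBR by simp
      \<comment> \<open>Any functor whose composite with \<open>f\<^sup>*/R\<close> is
        \<open>?U\<close> sends the generic term of \<open>X\<close> to \<open>z\<close>, because
        that term is the image of the generic term of \<open>R\<close>. Applied to \<open>y\<close>
        and to \<open>w'\<close>, this gives uniqueness.\<close>
      have val: "stm g (idm E (src E X)) (sob (WkF E X) X) (idtm E X) = z"
        if g: "sf_eq E (src E R) (g \<odot> sliced E ?h R) ?U" for g
      proof -
        have "term_of E R (g \<odot> sliced E ?h R) = z"
          using term_of_cong[OF g R'(1)] by (simp add: z_def)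
        moreover have "sar ?h R (idm E (src E R)) = idm E (src E X)"
          using h(6)[OF R' refl] by (simp add: X_def)
        moreover have "R \<cdot>\<^bsub>E\<^esub> idm E (src E R) = R" using R' by simp
        ultimately show ?thesis
          using sf_hom_idtm[OF arr_fun_hom[OF k] pre pre R'] sf_hom_Wk_self[OF arr_fun_hom[OF k] pre pre R']
          by (simp add: term_of_def X_def)
      qed
      have yw: "sf_eq E (src E X) (arr_fun E y) w'"
        using extension_eqI[OF yh w'(1) pre X(1)] sf_eq_trans[OF yq sf_eq_sym[OF w'X]] X
          val[OF yp] val[OF w'h] by simp
      have ww: "sf_eq E (src E X) (arr_fun E w) w'" using w(2) sAX by simp
      show "y = w"
        by (rule arr_eqI[OF y(1) w(1) _ y(3) wst(2), of w']) (use y wst sAX yw ww in simp_all)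
    qed
  qed
  show ?thesis
    unfolding is_pullback_def p_def[symmetric] q_def[symmetric] r_def[symmetric] term_cat_simps
    using p q r k comm univ by simp
qed

end


section \<open>The axioms of a CE-system\<close>

context sf_E_system
begin

text \<open>Read through \<open>arr_fun\<close>, the functor laws are
  \<open>W\<^sub>i\<^sub>d = id\<close> and the factorisation of \<open>W\<close> along a
  composite.\<close>

lemma incl_strict_functor:
  "strict_functor (slice E \<Gamma>) (term_cat E \<Gamma>) \<lparr>oMap = (\<lambda>A. A), aMap = incl (E2CE_obj E)\<rparr>"
proof -
  interpret S: strict_category "slice E \<Gamma>" by (rule strict_category_slice[OF strict])
  interpret C: strict_category "term_cat E \<Gamma>" by (rule term_cat_strict_category)
  show ?thesis
  proof
    fix f assume "f \<in> Arr (slice E \<Gamma>)"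
    then obtain A Q where f: "f = Pr A Q" "A \<in> into E \<Gamma>" "Q \<in> into E (src E A)"
      unfolding Arr_slice by blast
    show "aMap \<lparr>oMap = \<lambda>A. A, aMap = incl (E2CE_obj E)\<rparr> f \<in> Hom (term_cat E \<Gamma>)
        (oMap \<lparr>oMap = \<lambda>A. A, aMap = incl (E2CE_obj E)\<rparr> (src (slice E \<Gamma>) f))
        (oMap \<lparr>oMap = \<lambda>A. A, aMap = incl (E2CE_obj E)\<rparr> (tgt (slice E \<Gamma>) f))"
      using incl_arr(1)[OF f(2,3)] f by (simp add: Hom_def)
  next
    fix A assume "A \<in> Obj (slice E \<Gamma>)"
    then have A: "A \<in> into E \<Gamma>" and I: "idm E (src E A) \<in> into E (src E A)" by simp_all
    have "incl (E2CE_obj E) (Pr A (idm E (src E A))) = tarr A A (idtm E A)"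
    proof (rule arr_eqI[OF incl_arr(1)[OF A I] idm_arr(1)[OF A], of A])
      show "sf_eq E (src E A) (arr_fun E (incl (E2CE_obj E) (Pr A (idm E (src E A))))) sf_id"
        by (rule sf_eq_trans[OF incl_arr(4)[OF A I] WkF_idm]) (use A in simp)
    qed (use A idm_arr(2)[OF A] in simp_all)
    then show "aMap \<lparr>oMap = \<lambda>A. A, aMap = incl (E2CE_obj E)\<rparr> (idm (slice E \<Gamma>) A) =
        idm (term_cat E \<Gamma>) (oMap \<lparr>oMap = \<lambda>A. A, aMap = incl (E2CE_obj E)\<rparr> A)"
      by simp
  next
    fix f g a b c assume "f \<in> Hom (slice E \<Gamma>) a b" "g \<in> Hom (slice E \<Gamma>) b c"
    then obtain Q R where f: "f = Pr b Q" and g: "g = Pr c R" and c: "c \<in> into E \<Gamma>"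
      and R: "R \<in> into E (src E c)" and b: "b \<in> into E \<Gamma>" and Q: "Q \<in> into E (src E b)"
      and bc: "b = c \<cdot>\<^bsub>E\<^esub> R"
      unfolding Hom_slice by blast
    have sb: "src E b = src E R" using R c by (simp add: bc)
    have RQ: "R \<cdot>\<^bsub>E\<^esub> Q \<in> into E (src E c)" using R Q sb by simp
    note i1 = incl_arr[OF b Q] and i2 = incl_arr[OF c R] and i3 = incl_arr[OF c RQ]
    have "ttgt (incl (E2CE_obj E) (Pr b Q)) = tsrc (incl (E2CE_obj E) (Pr c R))"
      using i1(3) i2(2) bc by simp
    note cm = cmp_arr[OF i2(1) i1(1) this]
    have "incl (E2CE_obj E) (Pr c (R \<cdot>\<^bsub>E\<^esub> Q)) =
      incl (E2CE_obj E) (Pr c R) \<cdot>\<^bsub>term_cat E \<Gamma>\<^esub> incl (E2CE_obj E) (Pr b Q)"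
    proof (rule arr_eqI[OF i3(1) cm(1) _ i3(3)])
      show "sf_eq E (src E c) (arr_fun E (incl (E2CE_obj E) (Pr c (R \<cdot>\<^bsub>E\<^esub> Q)))) (WkF E Q \<odot> WkF E R)"
        using sf_eq_trans[OF i3(4)] WkF_cmp[of R Q] R Q sb by simp
      have WR: "sf_functor E (src E c) E (src E b) (WkF E R)" using WkF_functor[of R] R sb by simp
      have "sf_eq E (src E c) (arr_fun E (incl (E2CE_obj E) (Pr c R) \<cdot>\<^bsub>term_cat E \<Gamma>\<^esub> incl (E2CE_obj E) (Pr b Q)))
        (arr_fun E (incl (E2CE_obj E) (Pr b Q)) \<odot> arr_fun E (incl (E2CE_obj E) (Pr c R)))"
        using cm(4) unfolding i2(3) .
      also have "sf_eq E (src E c) \<dots> (arr_fun E (incl (E2CE_obj E) (Pr b Q)) \<odot> WkF E R)"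
        by (rule sf_eq_comp_right[OF i2(4)])
      also have "sf_eq E (src E c) \<dots> (WkF E Q \<odot> WkF E R)"
        by (rule sf_eq_comp_left[OF i1(4) WR])
      finally show "sf_eq E (src E c) (arr_fun E (incl (E2CE_obj E) (Pr c R) \<cdot>\<^bsub>term_cat E \<Gamma>\<^esub> incl (E2CE_obj E) (Pr b Q)))
        (WkF E Q \<odot> WkF E R)" .
    next
      show "tsrc (incl (E2CE_obj E) (Pr c (R \<cdot>\<^bsub>E\<^esub> Q))) =
        tsrc (incl (E2CE_obj E) (Pr c R) \<cdot>\<^bsub>term_cat E \<Gamma>\<^esub> incl (E2CE_obj E) (Pr b Q))"
        unfolding cm(2) i1(2) i3(2) using c R Q sb by (simp add: bc)
    qed (use cm(3) i2(3) in simp)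
    then show "aMap \<lparr>oMap = \<lambda>A. A, aMap = incl (E2CE_obj E)\<rparr> (g \<cdot>\<^bsub>slice E \<Gamma>\<^esub> f) =
        aMap \<lparr>oMap = \<lambda>A. A, aMap = incl (E2CE_obj E)\<rparr> g \<cdot>\<^bsub>term_cat E \<Gamma>\<^esub>
        aMap \<lparr>oMap = \<lambda>A. A, aMap = incl (E2CE_obj E)\<rparr> f"
      by (simp add: f g)
  qed simp
qed

lemma slice_terminal:
  assumes "\<Gamma> \<in> Obj E"
  shows "terminal (slice E \<Gamma>) (idm E \<Gamma>)"
  unfolding terminal_def
proof (intro conjI ballI)
  show "idm E \<Gamma> \<in> Obj (slice E \<Gamma>)" using assms by simp
  fix A assume "A \<in> Obj (slice E \<Gamma>)"
  then have A: "A \<in> Arr E" "tgt E A = \<Gamma>" by simp_all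
  show "\<exists>!f. f \<in> Hom (slice E \<Gamma>) A (idm E \<Gamma>)"
  proof (rule ex1I[of _ "Pr (idm E \<Gamma>) A"])
    show "Pr (idm E \<Gamma>) A \<in> Hom (slice E \<Gamma>) A (idm E \<Gamma>)"
      using A assms by (simp add: Hom_def)
    fix f assume "f \<in> Hom (slice E \<Gamma>) A (idm E \<Gamma>)"
    then obtain Q where "f = Pr (idm E \<Gamma>) Q" "Q \<in> into E (src E (idm E \<Gamma>))" "A = idm E \<Gamma> \<cdot>\<^bsub>E\<^esub> Q"
      unfolding Hom_slice by blast
    then show "f = Pr (idm E \<Gamma>) A" using assms by simp
  qed
qed

lemma root_Obj: "root E \<in> Obj E"
  using root by (simp add: terminal_def)

lemma E2CE_arrE:
  assumes "f \<in> Arr (ctx (E2CE_obj E))" "A \<in> Arr (fam (E2CE_obj E))"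
    and "tgt (fam (E2CE_obj E)) A = tgt (ctx (E2CE_obj E)) f"
  obtains R where "A = Pr (ttgt f) R" "f \<in> Arr (term_cat E (root E))" "R \<in> into E (src E (ttgt f))"
    "R \<in> Arr E" "tgt E R = src E (ttgt f)"
proof -
  obtain B R where "A = Pr B R" "B \<in> into E (root E)" "R \<in> into E (src E B)"
    using assms(2) unfolding E2CE_obj_simps Arr_slice by blast
  then show thesis using assms that[of R] by simp
qed

text \<open>The projection at \<open>R\<close> has functor \<open>f\<^sup>*/R\<close>, so the laws
  for \<open>pi2\<close> are the slicing calculus: \<open>sliced_idm\<close> for identity families,
  \<open>sliced_comp\<close> for composites of arrows, \<open>sliced_sliced\<close> for composites
  of families.\<close>

lemma CE_system_E2CE: "CE_system (E2CE_obj E)"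
proof (rule CE_system.intro)
  let ?C = "term_cat E (root E)" and ?X = "E2CE_obj E"
  show "Obj (fam ?X) = Obj (ctx ?X)" by simp
  show "strict_functor (fam ?X) (ctx ?X) \<lparr>oMap = \<lambda>\<Gamma>. \<Gamma>, aMap = incl ?X\<rparr>"
    using incl_strict_functor by simp
  show "terminal (fam ?X) (one ?X)" using slice_terminal[OF root_Obj] by simp
next
  let ?C = "term_cat E (root E)" and ?X = "E2CE_obj E"
  fix f A assume fA: "f \<in> Arr (ctx ?X)" "A \<in> Arr (fam ?X)" "tgt (fam ?X) A = tgt (ctx ?X) f"
  obtain R where A: "A = Pr (ttgt f) R" and f: "f \<in> Arr ?C" and R: "R \<in> into E (src E (ttgt f))"
      "R \<in> Arr E" "tgt E R = src E (ttgt f)"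
    by (rule E2CE_arrE[OF fA])
  note h = sf_functorD[OF arr_fun_functor[OF f]] and t = term_catD[OF f]
  show "pb ?X f A \<in> Arr (fam ?X) \<and> tgt (fam ?X) (pb ?X f A) = src (ctx ?X) f"
    using R t by (simp add: A h)
  show "pi2 ?X f A \<in> Hom (ctx ?X) (src (fam ?X) (pb ?X f A)) (src (fam ?X) A)"
    using pi2_arr(1-3)[OF f R(1)] by (simp add: A Hom_def)
  show "is_pullback (ctx ?X) (pi2 ?X f A) (incl ?X (pb ?X f A)) (incl ?X A) f"
    using E2CE_pullback[OF f R(1)] by (simp add: A)
next
  let ?C = "term_cat E (root E)" and ?X = "E2CE_obj E"
  fix f assume "f \<in> Arr (ctx ?X)"
  then have f: "f \<in> Arr ?C" by simp
  note h = sf_functorD[OF arr_fun_functor[OF f]] and t = term_catD[OF f]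
  have I: "idm E (src E (ttgt f)) \<in> into E (src E (ttgt f))" using t by simp
  show "pb ?X f (idm (fam ?X) (tgt (ctx ?X) f)) = idm (fam ?X) (src (ctx ?X) f)"
    by (simp add: h)
  note p = pi2_arr[OF f I]
  have "pi2 ?X f (Pr (ttgt f) (idm E (src E (ttgt f)))) = f"
  proof (rule arr_eqI[OF p(1) f _ _ refl])
    show "sf_eq E (src E (ttgt f)) (arr_fun E (pi2 ?X f (Pr (ttgt f) (idm E (src E (ttgt f)))))) (arr_fun E f)"
      using sf_eq_trans[OF p(4)] sliced_idm[OF arr_fun_functor[OF f] strict strict] t by simp
  qed (use p(2,3) t h(3) in simp_all)
  then show "pi2 ?X f (idm (fam ?X) (tgt (ctx ?X) f)) = f" by simp
next
  let ?C = "term_cat E (root E)" and ?X = "E2CE_obj E"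
  fix A assume "A \<in> Arr (fam ?X)"
  then obtain B R where A: "A = Pr B R" and B: "B \<in> into E (root E)" and R: "R \<in> into E (src E B)"
    unfolding E2CE_obj_simps Arr_slice by blast
  let ?i = "tarr B B (idtm E B)"
  note i = idm_arr[OF B]
  have hR: "sob (arr_fun E ?i) R = R" using sf_eqD(1)[OF i(2)] R by simp
  then show "pb ?X (idm (ctx ?X) (tgt (fam ?X) A)) A = A" by (simp add: A)
  have R': "R \<in> into E (src E (ttgt ?i))" using R by simp
  note p = pi2_arr[OF i(1) R', unfolded tarr_simps]
  have BR: "B \<cdot>\<^bsub>E\<^esub> R \<in> into E (root E)" using B R by simp
  note j = idm_arr[OF BR]
  have "pi2 ?X ?i (Pr B R) = tarr (B \<cdot>\<^bsub>E\<^esub> R) (B \<cdot>\<^bsub>E\<^esub> R) (idtm E (B \<cdot>\<^bsub>E\<^esub> R))"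
  proof (rule arr_eqI[OF p(1) j(1) _ p(3)])
    have sBR: "src E (B \<cdot>\<^bsub>E\<^esub> R) = src E R" using B R by simp
    have "sf_eq E (src E R) (sliced E (arr_fun E ?i) R) (sliced E sf_id R)"
      using i(2) R B by (intro sf_eq_sliced[OF _ strict]) auto
    then show "sf_eq E (src E (B \<cdot>\<^bsub>E\<^esub> R)) (arr_fun E (pi2 ?X ?i (Pr B R))) sf_id"
      using sf_eq_trans[OF p(4)] sBR by simp
    show "sf_eq E (src E (B \<cdot>\<^bsub>E\<^esub> R)) (arr_fun E (tarr (B \<cdot>\<^bsub>E\<^esub> R) (B \<cdot>\<^bsub>E\<^esub> R) (idtm E (B \<cdot>\<^bsub>E\<^esub> R)))) sf_id"
      using j(2) by simp
  qed (use p(2) hR in simp_all)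
  then show "pi2 ?X (idm (ctx ?X) (tgt (fam ?X) A)) A = idm (ctx ?X) (src (fam ?X) A)"
    by (simp add: A)
next
  let ?C = "term_cat E (root E)" and ?X = "E2CE_obj E"
  fix f g A assume fA: "f \<in> Arr (ctx ?X)" and g: "g \<in> Arr (ctx ?X)" and gf: "tgt (ctx ?X) g = src (ctx ?X) f"
    and fA': "A \<in> Arr (fam ?X)" "tgt (fam ?X) A = tgt (ctx ?X) f"
  obtain R where A: "A = Pr (ttgt f) R" and f: "f \<in> Arr ?C" and R: "R \<in> into E (src E (ttgt f))"
      "R \<in> Arr E" "tgt E R = src E (ttgt f)"
    by (rule E2CE_arrE[OF fA fA'])
  have g: "g \<in> Arr ?C" and gf: "ttgt g = tsrc f" using g gf by simp_all
  note h = sf_functorD[OF arr_fun_functor[OF f]] and t = term_catD[OF f]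
  note hg = sf_functorD[OF arr_fun_functor[OF g]]
  note c = cmp_arr[OF f g gf]
  define S where "S = sob (arr_fun E f) R"
  have S: "S \<in> into E (src E (ttgt g))" using h R gf by (simp add: S_def)
  have fgR: "sob (arr_fun E (f \<cdot>\<^bsub>?C\<^esub> g)) R = sob (arr_fun E g) S"
    using sf_eqD(1)[OF c(4) R(2,3)] by (simp add: S_def)
  then show "pb ?X (f \<cdot>\<^bsub>ctx ?X\<^esub> g) A = pb ?X g (pb ?X f A)"
    using gf c by (simp add: A S_def)
  have R': "R \<in> into E (src E (ttgt (f \<cdot>\<^bsub>?C\<^esub> g)))" using R c by simp
  note p = pi2_arr[OF c(1) R', unfolded c(2,3)]
  note pf = pi2_arr[OF f R(1)] and pg = pi2_arr[OF g S, unfolded gf]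
  have "ttgt (pi2 ?X g (Pr (tsrc f) S)) = tsrc (pi2 ?X f (Pr (ttgt f) R))"
    using pf pg by (simp add: S_def)
  note c' = cmp_arr[OF pf(1) pg(1) this]
  have sR: "src E (ttgt f \<cdot>\<^bsub>E\<^esub> R) = src E R" using t R by simp
  have "pi2 ?X (f \<cdot>\<^bsub>?C\<^esub> g) (Pr (ttgt f) R) = pi2 ?X f (Pr (ttgt f) R) \<cdot>\<^bsub>?C\<^esub> pi2 ?X g (Pr (tsrc f) S)"
  proof (rule arr_eqI[OF p(1) c'(1) _ p(3)], unfold sR)
    have hf: "sf_functor E (src E (ttgt f)) E (src E (ttgt g)) (arr_fun E f)"
      using arr_fun_functor[OF f] gf by simp
    have "sf_eq E (src E R) (arr_fun E (pi2 ?X (f \<cdot>\<^bsub>?C\<^esub> g) (Pr (ttgt f) R)))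
        (sliced E (arr_fun E (f \<cdot>\<^bsub>?C\<^esub> g)) R)" by (rule p(4))
    also have "sf_eq E (src E R) \<dots> (sliced E (arr_fun E g \<odot> arr_fun E f) R)"
      by (rule sf_eq_sliced[OF c(4) strict R(2,3)])
    also have "sf_eq E (src E R) \<dots> (sliced E (arr_fun E g) S \<odot> sliced E (arr_fun E f) R)"
      unfolding S_def by (rule sliced_comp[OF hf R(2,3)])
    finally show "sf_eq E (src E R) (arr_fun E (pi2 ?X (f \<cdot>\<^bsub>?C\<^esub> g) (Pr (ttgt f) R)))
      (sliced E (arr_fun E g) S \<odot> sliced E (arr_fun E f) R)" .
    have slf: "sf_functor E (src E R) E (src E S) (sliced E (arr_fun E f) R)"
      unfolding S_def by (rule sf_functor_sliced[OF hf strict strict R(2,3)])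
    have "sf_eq E (src E R) (arr_fun E (pi2 ?X f (Pr (ttgt f) R) \<cdot>\<^bsub>?C\<^esub> pi2 ?X g (Pr (tsrc f) S)))
      (arr_fun E (pi2 ?X g (Pr (tsrc f) S)) \<odot> arr_fun E (pi2 ?X f (Pr (ttgt f) R)))"
      using c'(4) unfolding pf(3) sR .
    also have "sf_eq E (src E R) \<dots> (arr_fun E (pi2 ?X g (Pr (tsrc f) S)) \<odot> sliced E (arr_fun E f) R)"
      by (rule sf_eq_comp_right[OF pf(4)])
    also have "sf_eq E (src E R) \<dots> (sliced E (arr_fun E g) S \<odot> sliced E (arr_fun E f) R)"
      by (rule sf_eq_comp_left[OF pg(4) slf])
    finally show "sf_eq E (src E R) (arr_fun E (pi2 ?X f (Pr (ttgt f) R) \<cdot>\<^bsub>?C\<^esub> pi2 ?X g (Pr (tsrc f) S)))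
      (sliced E (arr_fun E g) S \<odot> sliced E (arr_fun E f) R)" .
  qed (use c'(2,3) pf pg p(2) fgR in simp_all)
  then show "pi2 ?X (f \<cdot>\<^bsub>ctx ?X\<^esub> g) A = pi2 ?X f A \<cdot>\<^bsub>ctx ?X\<^esub> pi2 ?X g (pb ?X f A)"
    by (simp add: A S_def)
next
  let ?C = "term_cat E (root E)" and ?X = "E2CE_obj E"
  fix f A P assume fA: "f \<in> Arr (ctx ?X)" "A \<in> Arr (fam ?X)" "tgt (fam ?X) A = tgt (ctx ?X) f"
    and P: "P \<in> Arr (fam ?X)" "tgt (fam ?X) P = src (fam ?X) A"
  obtain R where A: "A = Pr (ttgt f) R" and f: "f \<in> Arr ?C" and R: "R \<in> into E (src E (ttgt f))"
      "R \<in> Arr E" "tgt E R = src E (ttgt f)"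
    by (rule E2CE_arrE[OF fA])
  note h = sf_functorD[OF arr_fun_functor[OF f]] and t = term_catD[OF f]
  have sR: "src E (ttgt f \<cdot>\<^bsub>E\<^esub> R) = src E R" using t R by simp
  obtain S where P: "P = Pr (ttgt f \<cdot>\<^bsub>E\<^esub> R) S" and S: "S \<in> Arr E" "tgt E S = src E R"
  proof -
    obtain B S where "P = Pr B S" "S \<in> into E (src E B)"
      using P(1) unfolding E2CE_obj_simps Arr_slice by blast
    then show thesis using P(2) A sR that[of S] by simp
  qed
  note p = pi2_arr[OF f R(1)]
  have S1: "S \<in> into E (src E (ttgt (pi2 ?X f (Pr (ttgt f) R))))" using S p(3) sR by simp
  note q = pi2_arr[OF p(1) S1, unfolded p(2,3)]
  have RS: "R \<cdot>\<^bsub>E\<^esub> S \<in> into E (src E (ttgt f))" "src E (R \<cdot>\<^bsub>E\<^esub> S) = src E S" using R S by simp_all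
  note r = pi2_arr[OF f RS(1)]
  have pS: "sob (arr_fun E (pi2 ?X f (Pr (ttgt f) R))) S = sar (arr_fun E f) R S"
    using sf_eqD(1)[OF p(4) S] by simp
  show "pb ?X f (A \<cdot>\<^bsub>fam ?X\<^esub> P) = pb ?X f A \<cdot>\<^bsub>fam ?X\<^esub> pb ?X (pi2 ?X f A) P"
    using R S by (simp add: A P h pS)
  have sS: "src E ((ttgt f \<cdot>\<^bsub>E\<^esub> R) \<cdot>\<^bsub>E\<^esub> S) = src E S" using t R S by simp
  have "pi2 ?X f (Pr (ttgt f) (R \<cdot>\<^bsub>E\<^esub> S)) = pi2 ?X (pi2 ?X f (Pr (ttgt f) R)) (Pr (ttgt f \<cdot>\<^bsub>E\<^esub> R) S)"
  proof (rule arr_eqI[OF r(1) q(1) _ _ q(3)], unfold sS)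
    show "sf_eq E (src E S) (arr_fun E (pi2 ?X f (Pr (ttgt f) (R \<cdot>\<^bsub>E\<^esub> S)))) (sliced E (arr_fun E f) (R \<cdot>\<^bsub>E\<^esub> S))"
      using r(4) RS(2) by simp
    have "sf_eq E (src E S) (sliced E (arr_fun E (pi2 ?X f (Pr (ttgt f) R))) S)
        (sliced E (sliced E (arr_fun E f) R) S)"
      by (rule sf_eq_sliced[OF p(4) strict S])
    also have "sf_eq E (src E S) \<dots> (sliced E (arr_fun E f) (R \<cdot>\<^bsub>E\<^esub> S))"
      by (rule sliced_sliced[OF strict R(2) S])
    finally show "sf_eq E (src E S) (arr_fun E (pi2 ?X (pi2 ?X f (Pr (ttgt f) R)) (Pr (ttgt f \<cdot>\<^bsub>E\<^esub> R) S)))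
        (sliced E (arr_fun E f) (R \<cdot>\<^bsub>E\<^esub> S))"
      using sf_eq_trans[OF q(4)] by simp
    show "tsrc (pi2 ?X f (Pr (ttgt f) (R \<cdot>\<^bsub>E\<^esub> S))) =
        tsrc (pi2 ?X (pi2 ?X f (Pr (ttgt f) R)) (Pr (ttgt f \<cdot>\<^bsub>E\<^esub> R) S))"
      unfolding r(2) q(2) using t R S by (simp add: h pS)
    show "ttgt (pi2 ?X f (Pr (ttgt f) (R \<cdot>\<^bsub>E\<^esub> S))) = (ttgt f \<cdot>\<^bsub>E\<^esub> R) \<cdot>\<^bsub>E\<^esub> S"
      unfolding r(3) using t R S by simp
  qed
  then show "pi2 ?X f (A \<cdot>\<^bsub>fam ?X\<^esub> P) = pi2 ?X (pi2 ?X f A) P" by (simp add: A P)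
qed

end

section \<open>The E-system of a CE-system\<close>

sublocale CE_system \<subseteq> fam: strict_category "fam X"
  using incl_functor by (simp add: strict_functor_def)

sublocale CE_system \<subseteq> ctx: strict_category "ctx X"
  using incl_functor by (simp add: strict_functor_def)

lemma mem_sections_iff:
  "x \<in> sections X A \<longleftrightarrow> x \<in> Arr (ctx X) \<and> src (ctx X) x = tgt (fam X) A \<and>
     tgt (ctx X) x = src (fam X) A \<and> incl X A \<cdot>\<^bsub>ctx X\<^esub> x = idm (ctx X) (tgt (fam X) A)"
  by (auto simp: sections_def Hom_def)

text \<open>The action of a pullback functor on terms, isolated at a single arrow \<open>g\<close>.
  The action of \<open>f\<^sup>*\<close> over a base \<open>B\<close> is the case where
  \<open>g\<close> is the projection \<open>pi2 X f B\<close>.\<close>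

definition pb_section :: "'u cesys \<Rightarrow> 'u el \<Rightarrow> 'u el \<Rightarrow> 'u el \<Rightarrow> 'u el" where
  "pb_section X g Q y = (THE z. z \<in> sections X (pb X g Q) \<and> pi2 X g Q \<cdot>\<^bsub>ctx X\<^esub> z = y \<cdot>\<^bsub>ctx X\<^esub> g)"

abbreviation pbF :: "'u cesys \<Rightarrow> 'u el \<Rightarrow> 'u sfun" where
  "pbF X f \<equiv> sf_of (pb_functor X f)"

lemma CE2E_obj_simps [simp]:
  "Obj (CE2E_obj X) = Obj (fam X)" "Arr (CE2E_obj X) = Arr (fam X)" "src (CE2E_obj X) = src (fam X)"
  "tgt (CE2E_obj X) = tgt (fam X)" "idm (CE2E_obj X) = idm (fam X)" "cmp (CE2E_obj X) = cmp (fam X)"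
  "Tm (CE2E_obj X) = sections X" "root (CE2E_obj X) = one X"
  "Sub (CE2E_obj X) A x = pb_functor X x" "Wk (CE2E_obj X) A = pb_functor X (incl X A)"
  by (simp_all add: CE2E_obj_def)

lemma pbF_simps [simp]:
  "sob (pbF X f) = pb X f" "sar (pbF X f) P = pb X (pi2 X f P)"
  by (simp_all add: sf_of_def pb_functor_def)

lemma sf_coherent_pb_functor: "sf_coherent C \<Gamma> (pb_functor X f)"
  by (simp add: sf_coherent_def pb_functor_def)

context CE_system
begin

abbreviation "\<F> \<equiv> fam X"
abbreviation "\<C> \<equiv> ctx X"

lemma ctx_Obj [simp]: "Obj \<C> = Obj \<F>"
  by (simp add: same_objects)

lemma ctx_src_tgt_Obj [simp]:
  assumes "f \<in> Arr \<C>"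
  shows "src \<C> f \<in> Obj \<F>" "tgt \<C> f \<in> Obj \<F>"
  using ctx.src_obj[OF assms] ctx.tgt_obj[OF assms] by simp_all

lemma incl_simps [simp]:
  assumes "A \<in> Arr \<F>"
  shows "incl X A \<in> Arr \<C>" "src \<C> (incl X A) = src \<F> A" "tgt \<C> (incl X A) = tgt \<F> A"
  using strict_functor.aMap_simps[OF incl_functor assms] by simp_all

lemma incl_idm [simp]: "\<Gamma> \<in> Obj \<F> \<Longrightarrow> incl X (idm \<F> \<Gamma>) = idm \<C> \<Gamma>"
  using strict_functor.aMap_idm[OF incl_functor] by simp

lemma incl_cmp [simp]:
  "\<lbrakk>A \<in> Arr \<F>; P \<in> Arr \<F>; tgt \<F> P = src \<F> A\<rbrakk> \<Longrightarrow> incl X (A \<cdot>\<^bsub>\<F>\<^esub> P) = incl X A \<cdot>\<^bsub>\<C>\<^esub> incl X P"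
  using strict_functor.aMap_comp[OF incl_functor] by simp

lemma pb_simps [simp]:
  assumes "f \<in> Arr \<C>" "A \<in> Arr \<F>" "tgt \<F> A = tgt \<C> f"
  shows "pb X f A \<in> Arr \<F>" "tgt \<F> (pb X f A) = src \<C> f" "pi2 X f A \<in> Arr \<C>"
    "src \<C> (pi2 X f A) = src \<F> (pb X f A)" "tgt \<C> (pi2 X f A) = src \<F> A"
  using pb_arr[OF assms] pi2_hom[OF assms] by (auto simp: Hom_def)

lemma pb_commute:
  assumes "f \<in> Arr \<C>" "A \<in> Arr \<F>" "tgt \<F> A = tgt \<C> f"
  shows "incl X A \<cdot>\<^bsub>\<C>\<^esub> pi2 X f A = f \<cdot>\<^bsub>\<C>\<^esub> incl X (pb X f A)"
  using pullback[OF assms] by (simp add: is_pullback_def)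

lemma pb_ex1:
  assumes "f \<in> Arr \<C>" "A \<in> Arr \<F>" "tgt \<F> A = tgt \<C> f"
    and "u \<in> Arr \<C>" "tgt \<C> u = src \<F> A" "v \<in> Arr \<C>" "tgt \<C> v = src \<C> f" "src \<C> u = src \<C> v"
    and "incl X A \<cdot>\<^bsub>\<C>\<^esub> u = f \<cdot>\<^bsub>\<C>\<^esub> v"
  shows "\<exists>!w. w \<in> Hom \<C> (src \<C> v) (src \<F> (pb X f A)) \<and> pi2 X f A \<cdot>\<^bsub>\<C>\<^esub> w = u \<and> incl X (pb X f A) \<cdot>\<^bsub>\<C>\<^esub> w = v"
proof -
  have "\<forall>x u v. u \<in> Hom \<C> x (src \<C> (incl X A)) \<and> v \<in> Hom \<C> x (src \<C> f) \<and>
      incl X A \<cdot>\<^bsub>\<C>\<^esub> u = f \<cdot>\<^bsub>\<C>\<^esub> v \<longrightarrow>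
      (\<exists>!w. w \<in> Hom \<C> x (src \<C> (pi2 X f A)) \<and> pi2 X f A \<cdot>\<^bsub>\<C>\<^esub> w = u \<and> incl X (pb X f A) \<cdot>\<^bsub>\<C>\<^esub> w = v)"
    using pullback[OF assms(1-3)] unfolding is_pullback_def by blast
  from this[rule_format, of u "src \<C> v" v] show ?thesis
    using assms by (simp add: mem_Hom_iff)
qed

lemma pb_eqI:
  assumes f: "f \<in> Arr \<C>" "A \<in> Arr \<F>" "tgt \<F> A = tgt \<C> f"
    and w: "w \<in> Arr \<C>" "w' \<in> Arr \<C>" "src \<C> w = src \<C> w'"
    "tgt \<C> w = src \<F> (pb X f A)" "tgt \<C> w' = src \<F> (pb X f A)"
    and "pi2 X f A \<cdot>\<^bsub>\<C>\<^esub> w = pi2 X f A \<cdot>\<^bsub>\<C>\<^esub> w'" "incl X (pb X f A) \<cdot>\<^bsub>\<C>\<^esub> w = incl X (pb X f A) \<cdot>\<^bsub>\<C>\<^esub> w'"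
  shows "w = w'"
proof -
  let ?u = "pi2 X f A \<cdot>\<^bsub>\<C>\<^esub> w'" and ?v = "incl X (pb X f A) \<cdot>\<^bsub>\<C>\<^esub> w'"
  have "incl X A \<cdot>\<^bsub>\<C>\<^esub> ?u = (incl X A \<cdot>\<^bsub>\<C>\<^esub> pi2 X f A) \<cdot>\<^bsub>\<C>\<^esub> w'" using f w by simp
  then have "incl X A \<cdot>\<^bsub>\<C>\<^esub> ?u = f \<cdot>\<^bsub>\<C>\<^esub> ?v" unfolding pb_commute[OF f] using f w by simp
  then have "\<exists>!w. w \<in> Hom \<C> (src \<C> ?v) (src \<F> (pb X f A)) \<and> pi2 X f A \<cdot>\<^bsub>\<C>\<^esub> w = ?u \<and> incl X (pb X f A) \<cdot>\<^bsub>\<C>\<^esub> w = ?v"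
    by (intro pb_ex1[OF f]) (use f w in simp_all)
  moreover have "w \<in> Hom \<C> (src \<C> ?v) (src \<F> (pb X f A))" "w' \<in> Hom \<C> (src \<C> ?v) (src \<F> (pb X f A))"
    using f w by (simp_all add: mem_Hom_iff)
  ultimately show ?thesis using assms(9,10) by blast
qed

text \<open>A section of the pulled back family is a map into the pullback with components
  \<open>y \<circ> g\<close> and the identity.\<close>

lemma pb_section_ex1:
  assumes f: "g \<in> Arr \<C>" "Q \<in> Arr \<F>" "tgt \<F> Q = tgt \<C> g" and y: "y \<in> sections X Q"
  shows "\<exists>!z. z \<in> sections X (pb X g Q) \<and> pi2 X g Q \<cdot>\<^bsub>\<C>\<^esub> z = y \<cdot>\<^bsub>\<C>\<^esub> g"
proof -
  have y': "y \<in> Arr \<C>" "src \<C> y = tgt \<C> g" "tgt \<C> y = src \<F> Q" "incl X Q \<cdot>\<^bsub>\<C>\<^esub> y = idm \<C> (tgt \<C> g)"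
    using y f by (auto simp: mem_sections_iff)
  have "incl X Q \<cdot>\<^bsub>\<C>\<^esub> (y \<cdot>\<^bsub>\<C>\<^esub> g) = (incl X Q \<cdot>\<^bsub>\<C>\<^esub> y) \<cdot>\<^bsub>\<C>\<^esub> g" using f y'(1-3) by simp
  also have "\<dots> = g" unfolding y'(4) using f by simp
  finally have "\<exists>!w. w \<in> Hom \<C> (src \<C> (idm \<C> (src \<C> g))) (src \<F> (pb X g Q)) \<and> pi2 X g Q \<cdot>\<^bsub>\<C>\<^esub> w = y \<cdot>\<^bsub>\<C>\<^esub> g \<and>
      incl X (pb X g Q) \<cdot>\<^bsub>\<C>\<^esub> w = idm \<C> (src \<C> g)"
    by (intro pb_ex1[OF f]) (use f y' in simp_all)
  moreover have "src \<C> (idm \<C> (src \<C> g)) = src \<C> g" using f by simp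
  ultimately show ?thesis
    using f by (simp add: mem_sections_iff mem_Hom_iff conj_ac)
qed

lemma pb_section:
  assumes "g \<in> Arr \<C>" "Q \<in> Arr \<F>" "tgt \<F> Q = tgt \<C> g" "y \<in> sections X Q"
  shows "pb_section X g Q y \<in> sections X (pb X g Q)"
    and "pi2 X g Q \<cdot>\<^bsub>\<C>\<^esub> pb_section X g Q y = y \<cdot>\<^bsub>\<C>\<^esub> g"
  using theI'[OF pb_section_ex1[OF assms]] unfolding pb_section_def by auto

lemma pb_section_eqI:
  assumes "g \<in> Arr \<C>" "Q \<in> Arr \<F>" "tgt \<F> Q = tgt \<C> g" "y \<in> sections X Q"
    and "z \<in> sections X (pb X g Q)" "pi2 X g Q \<cdot>\<^bsub>\<C>\<^esub> z = y \<cdot>\<^bsub>\<C>\<^esub> g"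
  shows "pb_section X g Q y = z"
  unfolding pb_section_def using pb_section_ex1[OF assms(1-4)] assms(5,6) by (intro the1_equality) auto

text \<open>The iterated pullback of \<open>y\<close> satisfies the defining equation of the
  pullback along the composite, by pasting the two squares.\<close>

lemma pb_section_cmp:
  assumes "a \<in> Arr \<C>" "b \<in> Arr \<C>" "tgt \<C> b = src \<C> a" "Q \<in> Arr \<F>" "tgt \<F> Q = tgt \<C> a" "y \<in> sections X Q"
  shows "pb_section X (a \<cdot>\<^bsub>\<C>\<^esub> b) Q y = pb_section X b (pb X a Q) (pb_section X a Q y)"
proof -
  note s = pb_section[OF assms(1,4-6)]
  have s': "tgt \<F> (pb X a Q) = tgt \<C> b" "pb X a Q \<in> Arr \<F>" using assms by simp_all
  note t = pb_section[OF assms(2) s'(2,1) s(1)]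
  let ?s = "pb_section X a Q y" and ?t = "pb_section X b (pb X a Q) (pb_section X a Q y)"
  have sa: "?s \<in> Arr \<C>" "src \<C> ?s = tgt \<C> b" "tgt \<C> ?s = src \<F> (pb X a Q)"
    using s assms by (auto simp: mem_sections_iff)
  have ta: "?t \<in> Arr \<C>" "src \<C> ?t = src \<C> b" "tgt \<C> ?t = src \<F> (pb X b (pb X a Q))"
    using t assms by (auto simp: mem_sections_iff)
  have ya: "y \<in> Arr \<C>" "src \<C> y = tgt \<C> a" using assms by (auto simp: mem_sections_iff)
  show ?thesis
  proof (rule pb_section_eqI)
    show "?t \<in> sections X (pb X (a \<cdot>\<^bsub>\<C>\<^esub> b) Q)" using t(1) assms by (simp add: pb_along_cmp)
    have "pi2 X (a \<cdot>\<^bsub>\<C>\<^esub> b) Q \<cdot>\<^bsub>\<C>\<^esub> ?t = pi2 X a Q \<cdot>\<^bsub>\<C>\<^esub> (pi2 X b (pb X a Q) \<cdot>\<^bsub>\<C>\<^esub> ?t)"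
      using assms ta by (simp add: pi2_along_cmp)
    also have "\<dots> = (pi2 X a Q \<cdot>\<^bsub>\<C>\<^esub> ?s) \<cdot>\<^bsub>\<C>\<^esub> b"
      unfolding t(2) using assms sa by simp
    also have "\<dots> = y \<cdot>\<^bsub>\<C>\<^esub> (a \<cdot>\<^bsub>\<C>\<^esub> b)"
      unfolding s(2) using assms ya by simp
    finally show "pi2 X (a \<cdot>\<^bsub>\<C>\<^esub> b) Q \<cdot>\<^bsub>\<C>\<^esub> ?t = y \<cdot>\<^bsub>\<C>\<^esub> (a \<cdot>\<^bsub>\<C>\<^esub> b)" .
  qed (use assms in simp_all)
qed

lemma pb_section_idm:
  assumes "Q \<in> Arr \<F>" "tgt \<F> Q = \<Gamma>" "y \<in> sections X Q"
  shows "pb_section X (idm \<C> \<Gamma>) Q y = y"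
proof (rule pb_section_eqI)
  have y: "y \<in> Arr \<C>" "src \<C> y = tgt \<F> Q" "tgt \<C> y = src \<F> Q"
    using assms by (auto simp: mem_sections_iff)
  show "y \<in> sections X (pb X (idm \<C> \<Gamma>) Q)" using assms pb_along_idm[of Q] by simp
  show "pi2 X (idm \<C> \<Gamma>) Q \<cdot>\<^bsub>\<C>\<^esub> y = y \<cdot>\<^bsub>\<C>\<^esub> idm \<C> \<Gamma>" using assms y pi2_along_idm[of Q] by simp
qed (use assms in auto)

text \<open>The definition uses the projection at \<open>P.Q\<close>, which by
  \<open>pi2_cmp\<close> is the projection of \<open>Q\<close> along
  \<open>pi2 X f P\<close>.\<close>

lemma stm_pbF:
  assumes "f \<in> Arr \<C>" "P \<in> Arr \<F>" "tgt \<F> P = tgt \<C> f" "Q \<in> Arr \<F>" "tgt \<F> Q = src \<F> P"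
  shows "stm (pbF X f) P Q y = pb_section X (pi2 X f P) Q y"
  using pi2_cmp[OF assms] by (simp add: sf_of_def pb_functor_def pb_section_def)

text \<open>The diagonal of \<open>A\<close>: the section of the pullback of \<open>A\<close> along
  itself whose other component is the identity as well.\<close>

definition "gen A = idtm (CE2E_obj X) A"

lemma gen:
  assumes "A \<in> Arr \<F>"
  shows "gen A \<in> sections X (pb X (incl X A) A)" "pi2 X (incl X A) A \<cdot>\<^bsub>\<C>\<^esub> gen A = idm \<C> (src \<F> A)"
    and "\<lbrakk>z \<in> sections X (pb X (incl X A) A); pi2 X (incl X A) A \<cdot>\<^bsub>\<C>\<^esub> z = idm \<C> (src \<F> A)\<rbrakk> \<Longrightarrow> gen A = z"
proof -
  let ?\<phi> = "\<lambda>z. z \<in> sections X (pb X (incl X A) A) \<and> pi2 X (incl X A) A \<cdot>\<^bsub>\<C>\<^esub> z = idm \<C> (src \<F> A)"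
  have "\<exists>!w. w \<in> Hom \<C> (src \<C> (idm \<C> (src \<F> A))) (src \<F> (pb X (incl X A) A)) \<and>
      pi2 X (incl X A) A \<cdot>\<^bsub>\<C>\<^esub> w = idm \<C> (src \<F> A) \<and> incl X (pb X (incl X A) A) \<cdot>\<^bsub>\<C>\<^esub> w = idm \<C> (src \<F> A)"
    using assms by (intro pb_ex1) simp_all
  moreover have "src \<C> (idm \<C> (src \<F> A)) = src \<F> A" using assms by simp
  ultimately have *: "\<exists>!z. ?\<phi> z" using assms by (simp add: mem_sections_iff mem_Hom_iff conj_ac)
  have d: "gen A = (THE z. ?\<phi> z)" by (simp add: gen_def CE2E_obj_def)
  show "gen A \<in> sections X (pb X (incl X A) A)" "pi2 X (incl X A) A \<cdot>\<^bsub>\<C>\<^esub> gen A = idm \<C> (src \<F> A)"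
    using theI'[OF *] unfolding d by auto
  show "gen A = z" if "z \<in> sections X (pb X (incl X A) A)" "pi2 X (incl X A) A \<cdot>\<^bsub>\<C>\<^esub> z = idm \<C> (src \<F> A)"
    unfolding d using * that by (intro the1_equality) auto
qed

lemma CE2E_strict: "strict_category (CE2E_obj X)"
  by unfold_locales (auto simp: mem_Hom_iff)

section \<open>Pullback functors between slices\<close>

lemma pbF_functor:
  assumes "f \<in> Arr \<C>"
  shows "sf_functor (CE2E_obj X) (tgt \<C> f) (CE2E_obj X) (src \<C> f) (pbF X f)"
proof -
  have "pb X (pi2 X f P) (idm \<F> (src \<F> P)) = idm \<F> (src \<F> (pb X f P))"
    if "P \<in> Arr \<F>" "tgt \<F> P = tgt \<C> f" for P
    using pb_idm[of "pi2 X f P"] that assms by simp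
  moreover have "pb X (pi2 X f P) (Q \<cdot>\<^bsub>\<F>\<^esub> R) = pb X (pi2 X f P) Q \<cdot>\<^bsub>\<F>\<^esub> pb X (pi2 X f (P \<cdot>\<^bsub>\<F>\<^esub> Q)) R"
    if "P \<in> Arr \<F>" "tgt \<F> P = tgt \<C> f" "Q \<in> Arr \<F>" "tgt \<F> Q = src \<F> P" "R \<in> Arr \<F>" "tgt \<F> R = src \<F> Q" for P Q R
    using pb_cmp[of "pi2 X f P" Q R] pi2_cmp[of f P Q] that assms by simp
  moreover have "src \<C> f \<in> Obj \<F>" "tgt \<C> f \<in> Obj \<F>"
    using ctx.src_obj[OF assms] ctx.tgt_obj[OF assms] by simp_all
  ultimately show ?thesis
    using assms by (simp add: sf_functor_def pb_idm pb_cmp stm_pbF pb_section(1))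
qed

lemma pbF_cmp:
  assumes "f \<in> Arr \<C>" "g \<in> Arr \<C>" "tgt \<C> g = src \<C> f"
  shows "sf_eq (CE2E_obj X) (tgt \<C> f) (pbF X (f \<cdot>\<^bsub>\<C>\<^esub> g)) (pbF X g \<odot> pbF X f)"
  using assms by (simp add: sf_eq_def pb_along_cmp pi2_along_cmp stm_pbF pb_section_cmp)

lemma pbF_idm:
  assumes "\<Gamma> \<in> Obj \<F>"
  shows "sf_eq (CE2E_obj X) \<Gamma> (pbF X (idm \<C> \<Gamma>)) sf_id"
proof -
  have "pb X (idm \<C> \<Gamma>) P = P" "pi2 X (idm \<C> \<Gamma>) P = idm \<C> (src \<F> P)" if "P \<in> Arr \<F>" "tgt \<F> P = \<Gamma>" for P
    using that pb_along_idm pi2_along_idm by auto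
  moreover have "pb X (idm \<C> (src \<F> P)) Q = Q" if "Q \<in> Arr \<F>" "tgt \<F> Q = src \<F> P" for P Q
    using pb_along_idm[of Q] that by simp
  ultimately show ?thesis
    using assms by (simp add: sf_eq_def stm_pbF pb_section_idm)
qed

text \<open>This is \<open>pi2_cmp\<close> read as an equation of functors: slicing pullback along
  \<open>f\<close> at \<open>P\<close> gives pullback along the projection.\<close>

lemma sliced_pbF:
  assumes "f \<in> Arr \<C>" "P \<in> Arr \<F>" "tgt \<F> P = tgt \<C> f"
  shows "sf_eq (CE2E_obj X) (src \<F> P) (sliced (CE2E_obj X) (pbF X f) P) (pbF X (pi2 X f P))"
  using assms by (simp add: sf_eq_def stm_pbF pi2_cmp)

text \<open>Diagonals are stable under pullback. The defining equation of \<open>gen\<close> asserts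
  that a map into the pullback of \<open>Q\<close> is the identity, which is tested against both
  projections.\<close>

lemma pbF_gen:
  assumes "g \<in> Arr \<C>" "Q \<in> Arr \<F>" "tgt \<F> Q = tgt \<C> g"
  shows "pb_section X (pi2 X g Q) (pb X (incl X Q) Q) (gen Q) = gen (pb X g Q)"
proof -
  let ?a = "pi2 X g Q" and ?W = "pb X (incl X Q) Q" and ?R = "pb X g Q"
  let ?w = "pb_section X ?a ?W (gen Q)"
  have R: "?R \<in> Arr \<F>" "tgt \<F> ?R = src \<C> g" using assms by simp_all
  have W: "?W \<in> Arr \<F>" "tgt \<F> ?W = src \<F> Q" using assms by simp_all
  have a: "?a \<in> Arr \<C>" "tgt \<C> ?a = src \<F> Q" "src \<C> ?a = src \<F> ?R" using assms by simp_all
  note w = pb_section[OF a(1) W(1) _ gen(1)[OF assms(2)], unfolded a(2), OF W(2)]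
  \<comment> \<open>The pullback square gives two factorisations of one arrow, and strict
    functoriality turns them into equal iterated pullbacks of \<open>Q\<close>.\<close>
  have eq: "pb X (incl X ?R) ?R = pb X ?a ?W" "pi2 X g Q \<cdot>\<^bsub>\<C>\<^esub> pi2 X (incl X ?R) ?R = pi2 X (incl X Q) Q \<cdot>\<^bsub>\<C>\<^esub> pi2 X ?a ?W"
    using pb_along_cmp[of g "incl X ?R" Q] pb_along_cmp[of "incl X Q" ?a Q]
      pi2_along_cmp[of g "incl X ?R" Q] pi2_along_cmp[of "incl X Q" ?a Q] pb_commute[OF assms] assms by simp_all
  have wa: "?w \<in> Arr \<C>" "src \<C> ?w = src \<F> ?R" "tgt \<C> ?w = src \<F> (pb X (incl X ?R) ?R)"
    "incl X (pb X (incl X ?R) ?R) \<cdot>\<^bsub>\<C>\<^esub> ?w = idm \<C> (src \<F> ?R)"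
    using w(1) assms by (auto simp: mem_sections_iff eq)
  have g': "gen Q \<in> Arr \<C>" "src \<C> (gen Q) = src \<F> Q" "tgt \<C> (gen Q) = src \<F> ?W"
    using gen(1)[OF assms(2)] assms by (auto simp: mem_sections_iff)
  show ?thesis
  proof (rule gen(3)[OF R(1), symmetric])
    show "?w \<in> sections X (pb X (incl X ?R) ?R)" using w(1) by (simp add: eq)
    show "pi2 X (incl X ?R) ?R \<cdot>\<^bsub>\<C>\<^esub> ?w = idm \<C> (src \<F> ?R)"
    proof (rule pb_eqI[OF assms])
      have "?a \<cdot>\<^bsub>\<C>\<^esub> (pi2 X (incl X ?R) ?R \<cdot>\<^bsub>\<C>\<^esub> ?w) = (?a \<cdot>\<^bsub>\<C>\<^esub> pi2 X (incl X ?R) ?R) \<cdot>\<^bsub>\<C>\<^esub> ?w"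
        using R a wa by simp
      also have "\<dots> = pi2 X (incl X Q) Q \<cdot>\<^bsub>\<C>\<^esub> (pi2 X ?a ?W \<cdot>\<^bsub>\<C>\<^esub> ?w)"
        unfolding eq(2) using assms a W wa(1,3) by (simp add: eq(1))
      also have "\<dots> = (pi2 X (incl X Q) Q \<cdot>\<^bsub>\<C>\<^esub> gen Q) \<cdot>\<^bsub>\<C>\<^esub> ?a"
        unfolding w(2) using assms a g' by simp
      also have "\<dots> = ?a" unfolding gen(2)[OF assms(2)] using assms a by simp
      finally show "?a \<cdot>\<^bsub>\<C>\<^esub> (pi2 X (incl X ?R) ?R \<cdot>\<^bsub>\<C>\<^esub> ?w) = ?a \<cdot>\<^bsub>\<C>\<^esub> idm \<C> (src \<F> ?R)"
        using a by simp
      have "incl X ?R \<cdot>\<^bsub>\<C>\<^esub> (pi2 X (incl X ?R) ?R \<cdot>\<^bsub>\<C>\<^esub> ?w) = (incl X ?R \<cdot>\<^bsub>\<C>\<^esub> pi2 X (incl X ?R) ?R) \<cdot>\<^bsub>\<C>\<^esub> ?w"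
        using R wa by simp
      also have "\<dots> = incl X ?R \<cdot>\<^bsub>\<C>\<^esub> (incl X (pb X (incl X ?R) ?R) \<cdot>\<^bsub>\<C>\<^esub> ?w)"
        using R wa(1-3) pb_commute[of "incl X ?R" ?R] by simp
      finally show "incl X ?R \<cdot>\<^bsub>\<C>\<^esub> (pi2 X (incl X ?R) ?R \<cdot>\<^bsub>\<C>\<^esub> ?w) = incl X ?R \<cdot>\<^bsub>\<C>\<^esub> idm \<C> (src \<F> ?R)"
        unfolding wa(4) .
    qed (use R wa in simp_all)
  qed
qed

text \<open>Each condition is the image of an equation in \<open>ctx X\<close> under passage to
  pullback functors: for \<open>S\<close> the defining equation of the pulled back section, for
  \<open>W\<close> the commuting pullback square. The condition on \<open>idtm\<close> is
  \<open>pbF_gen\<close>.\<close>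

lemma pbF_hom:
  assumes "f \<in> Arr \<C>"
  shows "sf_hom (CE2E_obj X) (tgt \<C> f) (CE2E_obj X) (src \<C> f) (pbF X f)"
proof -
  let ?E = "CE2E_obj X"
  have S: "sf_eq ?E (src \<F> Q) (sliced ?E (pbF X f) P \<odot> pbF X x)
      (pbF X (stm (pbF X f) P Q x) \<odot> sliced ?E (pbF X f) (P \<cdot>\<^bsub>\<F>\<^esub> Q))"
    if P: "P \<in> Arr \<F>" "tgt \<F> P = tgt \<C> f" and Q: "Q \<in> Arr \<F>" "tgt \<F> Q = src \<F> P" and x: "x \<in> sections X Q"
    for P Q x
  proof -
    let ?g = "pi2 X f P"
    have g: "?g \<in> Arr \<C>" "tgt \<C> ?g = src \<F> P" using P assms by simp_all
    have Qg: "tgt \<F> Q = tgt \<C> ?g" using Q g by simp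
    define z where "z = pb_section X ?g Q x"
    note z = pb_section[OF g(1) Q(1) Qg x, folded z_def]
    have za: "z \<in> Arr \<C>" "src \<C> z = src \<C> ?g" "tgt \<C> z = src \<F> (pb X ?g Q)"
      using z(1) P Q Qg assms g(1) by (auto simp: mem_sections_iff)
    have xa: "x \<in> Arr \<C>" "src \<C> x = src \<F> P" "tgt \<C> x = src \<F> Q"
      using x Q by (auto simp: mem_sections_iff)
    have PQ: "P \<cdot>\<^bsub>\<F>\<^esub> Q \<in> Arr \<F>" "tgt \<F> (P \<cdot>\<^bsub>\<F>\<^esub> Q) = tgt \<C> f" "src \<F> (P \<cdot>\<^bsub>\<F>\<^esub> Q) = src \<F> Q" using P Q by simp_all
    have xf: "sf_functor ?E (src \<F> Q) ?E (src \<F> P) (pbF X x)" using pbF_functor[OF xa(1)] xa by simp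
    have "sf_eq ?E (src \<F> Q) (sliced ?E (pbF X f) P \<odot> pbF X x) (pbF X ?g \<odot> pbF X x)"
      by (rule sf_eq_comp_left[OF sliced_pbF[OF assms P] xf])
    also have "sf_eq ?E (src \<F> Q) \<dots> (pbF X (x \<cdot>\<^bsub>\<C>\<^esub> ?g))"
      using sf_eq_sym[OF pbF_cmp[OF xa(1) g(1)]] xa g by simp
    also have "\<dots> = pbF X (pi2 X ?g Q \<cdot>\<^bsub>\<C>\<^esub> z)" unfolding z(2) ..
    also have "sf_eq ?E (src \<F> Q) \<dots> (pbF X z \<odot> pbF X (pi2 X ?g Q))"
      using pbF_cmp[of "pi2 X ?g Q" z] g Q za by simp
    also have "sf_eq ?E (src \<F> Q) \<dots> (pbF X z \<odot> sliced ?E (pbF X f) (P \<cdot>\<^bsub>\<F>\<^esub> Q))"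
      using sf_eq_comp_right[OF sf_eq_sym[OF sliced_pbF[OF assms PQ(1,2)]]] PQ(3) pi2_cmp[OF assms P Q] by simp
    finally show ?thesis using stm_pbF[OF assms P Q] by (simp add: z_def)
  qed
  have W: "sf_eq ?E (src \<F> P) (sliced ?E (pbF X f) (P \<cdot>\<^bsub>\<F>\<^esub> Q) \<odot> pbF X (incl X Q))
      (pbF X (incl X (pb X (pi2 X f P) Q)) \<odot> sliced ?E (pbF X f) P)"
    if P: "P \<in> Arr \<F>" "tgt \<F> P = tgt \<C> f" and Q: "Q \<in> Arr \<F>" "tgt \<F> Q = src \<F> P" for P Q
  proof -
    let ?g = "pi2 X f P"
    have g: "?g \<in> Arr \<C>" "tgt \<C> ?g = src \<F> P" using P assms by simp_all
    have Qg: "tgt \<F> Q = tgt \<C> ?g" using Q g by simp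
    have PQ: "P \<cdot>\<^bsub>\<F>\<^esub> Q \<in> Arr \<F>" "tgt \<F> (P \<cdot>\<^bsub>\<F>\<^esub> Q) = tgt \<C> f" "src \<F> (P \<cdot>\<^bsub>\<F>\<^esub> Q) = src \<F> Q" using P Q by simp_all
    have Wf: "sf_functor ?E (src \<F> P) ?E (src \<F> Q) (pbF X (incl X Q))"
      using pbF_functor[of "incl X Q"] Q by simp
    have "sf_eq ?E (src \<F> P) (sliced ?E (pbF X f) (P \<cdot>\<^bsub>\<F>\<^esub> Q) \<odot> pbF X (incl X Q))
        (pbF X (pi2 X ?g Q) \<odot> pbF X (incl X Q))"
      using sf_eq_comp_left[OF sliced_pbF[OF assms PQ(1,2), unfolded PQ(3)] Wf] pi2_cmp[OF assms P Q] by simp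
    also have "sf_eq ?E (src \<F> P) \<dots> (pbF X (incl X Q \<cdot>\<^bsub>\<C>\<^esub> pi2 X ?g Q))"
      using sf_eq_sym[OF pbF_cmp[of "incl X Q" "pi2 X ?g Q"]] g Q by simp
    also have "\<dots> = pbF X (?g \<cdot>\<^bsub>\<C>\<^esub> incl X (pb X ?g Q))" using pb_commute[OF g(1) Q(1) Qg] by simp
    also have "sf_eq ?E (src \<F> P) \<dots> (pbF X (incl X (pb X ?g Q)) \<odot> pbF X ?g)"
      using pbF_cmp[of ?g "incl X (pb X ?g Q)"] g(1) Q(1) Qg g(2) by simp
    also have "sf_eq ?E (src \<F> P) \<dots> (pbF X (incl X (pb X ?g Q)) \<odot> sliced ?E (pbF X f) P)"
      by (rule sf_eq_comp_right[OF sf_eq_sym[OF sliced_pbF[OF assms P]]])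
    finally show ?thesis .
  qed
  have I: "stm (pbF X f) (P \<cdot>\<^bsub>\<F>\<^esub> Q) (pb X (incl X Q) Q) (gen Q) = gen (pb X (pi2 X f P) Q)"
    if P: "P \<in> Arr \<F>" "tgt \<F> P = tgt \<C> f" and Q: "Q \<in> Arr \<F>" "tgt \<F> Q = src \<F> P" for P Q
    using pbF_gen[of "pi2 X f P" Q] P Q assms by (simp add: stm_pbF pi2_cmp)
  show ?thesis
    unfolding sf_hom_def using pbF_functor[OF assms] S W I by (simp flip: gen_def)
qed

lemma sections_arr:
  assumes "x \<in> sections X A"
  shows "x \<in> Arr \<C>" "src \<C> x = tgt \<F> A" "tgt \<C> x = src \<F> A" "incl X A \<cdot>\<^bsub>\<C>\<^esub> x = idm \<C> (tgt \<F> A)"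
  using assms by (auto simp: mem_sections_iff)

text \<open>Under passage to pullback functors the law \<open>SubF_WkF\<close> is the section
  property of \<open>x\<close>, and \<open>SubF_idtm_WkF\<close> is the defining equation of the
  diagonal. Only \<open>SubF_idtm\<close>, an equation between terms, takes a separate
  computation.\<close>

lemma sf_E_system_CE2E: "sf_E_system (CE2E_obj X)"
proof -
  interpret E: strict_category "CE2E_obj X" by (rule CE2E_strict)
  show ?thesis
  proof
    show "terminal (CE2E_obj X) (root (CE2E_obj X))"
      using one_terminal by (simp add: terminal_def Hom_def)
  next
    fix A x assume "A \<in> Arr (CE2E_obj X)" "x \<in> Tm (CE2E_obj X) A"
    then have A: "A \<in> Arr \<F>" and x: "x \<in> sections X A" by simp_all
    note xa = sections_arr[OF x]
    show "sf_coherent (CE2E_obj X) (src (CE2E_obj X) A) (Sub (CE2E_obj X) A x)"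
      by (simp add: sf_coherent_pb_functor)
    show "sf_functor (CE2E_obj X) (src (CE2E_obj X) A) (CE2E_obj X) (tgt (CE2E_obj X) A) (SubF (CE2E_obj X) A x)"
      using pbF_functor[OF xa(1)] xa by simp
    show "sf_hom (CE2E_obj X) (src (CE2E_obj X) A) (CE2E_obj X) (tgt (CE2E_obj X) A) (SubF (CE2E_obj X) A x)"
      using pbF_hom[OF xa(1)] xa by simp
    have i: "incl X A \<in> Arr \<C>" "tgt \<C> x = src \<C> (incl X A)" using A xa by simp_all
    have "sf_eq (CE2E_obj X) (tgt \<F> A) (pbF X x \<odot> pbF X (incl X A)) (pbF X (idm \<C> (tgt \<F> A)))"
      using sf_eq_sym[OF pbF_cmp[OF i(1) xa(1) i(2)]] xa(4) A by simp
    then show "sf_eq (CE2E_obj X) (tgt (CE2E_obj X) A) (SubF (CE2E_obj X) A x \<odot> WkF (CE2E_obj X) A) sf_id"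
      using sf_eq_trans[OF _ pbF_idm] A by simp
    let ?W = "pb X (incl X A) A"
    have W: "?W \<in> Arr \<F>" "tgt \<F> ?W = src \<F> A" using A by simp_all
    note g = gen(1,2)[OF A] and ga = sections_arr[OF gen(1)[OF A]]
    \<comment> \<open>Pulling \<open>A\<close> back along \<open>incl X A\<close> and then along the
      section \<open>x\<close> is pulling back along the identity.\<close>
    have xW: "pb X x ?W = A" "pi2 X (incl X A) A \<cdot>\<^bsub>\<C>\<^esub> pi2 X x ?W = idm \<C> (src \<F> A)"
      using pb_along_cmp[OF i(1) xa(1) i(2) A] pi2_along_cmp[OF i(1) xa(1) i(2) A] pb_along_idm[OF A]
        pi2_along_idm[OF A] xa(4) A by simp_all
    have pb: "pi2 X x ?W \<in> Arr \<C>" "src \<C> (pi2 X x ?W) = src \<F> A" "tgt \<C> (pi2 X x ?W) = src \<F> ?W"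
      using pb_simps[OF xa(1) W(1)] W xa xW by simp_all
    \<comment> \<open>The section \<open>x\<close> is itself the pullback along \<open>x\<close> of
      the diagonal: the two composites to be compared agree after both projections of the pullback
      of \<open>A\<close> along itself.\<close>
    have "pb_section X x ?W (gen A) = x"
    proof (rule pb_section_eqI[OF xa(1) W(1) _ g(1)])
      show "x \<in> sections X (pb X x ?W)" using x xW by simp
      show "pi2 X x ?W \<cdot>\<^bsub>\<C>\<^esub> x = gen A \<cdot>\<^bsub>\<C>\<^esub> x"
      proof (rule pb_eqI[of "incl X A" A])
        have "pi2 X (incl X A) A \<cdot>\<^bsub>\<C>\<^esub> (pi2 X x ?W \<cdot>\<^bsub>\<C>\<^esub> x) = (pi2 X (incl X A) A \<cdot>\<^bsub>\<C>\<^esub> pi2 X x ?W) \<cdot>\<^bsub>\<C>\<^esub> x"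
          using A pb xa(1-3) by simp
        also have "\<dots> = (pi2 X (incl X A) A \<cdot>\<^bsub>\<C>\<^esub> gen A) \<cdot>\<^bsub>\<C>\<^esub> x" unfolding xW(2) g(2) ..
        also have "\<dots> = pi2 X (incl X A) A \<cdot>\<^bsub>\<C>\<^esub> (gen A \<cdot>\<^bsub>\<C>\<^esub> x)"
          using A ga(1-3) W xa(1-3) by simp
        finally show "pi2 X (incl X A) A \<cdot>\<^bsub>\<C>\<^esub> (pi2 X x ?W \<cdot>\<^bsub>\<C>\<^esub> x) = pi2 X (incl X A) A \<cdot>\<^bsub>\<C>\<^esub> (gen A \<cdot>\<^bsub>\<C>\<^esub> x)" .
        have "incl X ?W \<cdot>\<^bsub>\<C>\<^esub> (pi2 X x ?W \<cdot>\<^bsub>\<C>\<^esub> x) = (incl X ?W \<cdot>\<^bsub>\<C>\<^esub> pi2 X x ?W) \<cdot>\<^bsub>\<C>\<^esub> x"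
          using A pb xa(1-3) W by simp
        also have "\<dots> = (x \<cdot>\<^bsub>\<C>\<^esub> incl X A) \<cdot>\<^bsub>\<C>\<^esub> x"
          using pb_commute[OF xa(1) W(1)] W xa xW by simp
        also have "\<dots> = x \<cdot>\<^bsub>\<C>\<^esub> (incl X A \<cdot>\<^bsub>\<C>\<^esub> x)" using A xa(1-3) by simp
        also have "\<dots> = x" unfolding xa(4) using A xa(1-3) by simp
        also have "x = (incl X ?W \<cdot>\<^bsub>\<C>\<^esub> gen A) \<cdot>\<^bsub>\<C>\<^esub> x" unfolding ga(4) using A W xa(1-3) by simp
        also have "\<dots> = incl X ?W \<cdot>\<^bsub>\<C>\<^esub> (gen A \<cdot>\<^bsub>\<C>\<^esub> x)" using A W xa(1-3) ga(1-3) by simp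
        finally show "incl X ?W \<cdot>\<^bsub>\<C>\<^esub> (pi2 X x ?W \<cdot>\<^bsub>\<C>\<^esub> x) = incl X ?W \<cdot>\<^bsub>\<C>\<^esub> (gen A \<cdot>\<^bsub>\<C>\<^esub> x)" .
      qed (use A W xa(1-3) ga(1-3) pb in simp_all)
    qed (use W xa in simp)
    then show "stm (SubF (CE2E_obj X) A x) (idm (CE2E_obj X) (src (CE2E_obj X) A))
        (sob (WkF (CE2E_obj X) A) A) (idtm (CE2E_obj X) A) = x"
      using A xa W pi2_idm[OF xa(1)] by (simp add: stm_pbF flip: gen_def)
  next
    fix A assume "A \<in> Arr (CE2E_obj X)"
    then have A: "A \<in> Arr \<F>" by simp
    then have i: "incl X A \<in> Arr \<C>" "src \<C> (incl X A) = src \<F> A" "tgt \<C> (incl X A) = tgt \<F> A" by simp_all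
    show "sf_coherent (CE2E_obj X) (tgt (CE2E_obj X) A) (Wk (CE2E_obj X) A)"
      by (simp add: sf_coherent_pb_functor)
    show "sf_functor (CE2E_obj X) (tgt (CE2E_obj X) A) (CE2E_obj X) (src (CE2E_obj X) A) (WkF (CE2E_obj X) A)"
      using pbF_functor[OF i(1)] i by simp
    show "sf_hom (CE2E_obj X) (tgt (CE2E_obj X) A) (CE2E_obj X) (src (CE2E_obj X) A) (WkF (CE2E_obj X) A)"
      using pbF_hom[OF i(1)] i by simp
    show "idtm (CE2E_obj X) A \<in> Tm (CE2E_obj X) (sob (WkF (CE2E_obj X) A) A)"
      using gen(1)[OF A] by (simp flip: gen_def)
    let ?p = "pi2 X (incl X A) A"
    note g = gen(1,2)[OF A] and ga = sections_arr[OF gen(1)[OF A]]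
    have p: "?p \<in> Arr \<C>" "tgt \<C> ?p = src \<F> A" "src \<C> ?p = src \<F> (pb X (incl X A) A)" using A by simp_all
    have "sf_eq (CE2E_obj X) (src \<F> A) (pbF X (gen A) \<odot> sliced (CE2E_obj X) (pbF X (incl X A)) A)
        (pbF X (gen A) \<odot> pbF X ?p)"
      using sliced_pbF[OF i(1) A] A by (intro sf_eq_comp_right) simp
    also have "sf_eq (CE2E_obj X) (src \<F> A) \<dots> (pbF X (?p \<cdot>\<^bsub>\<C>\<^esub> gen A))"
      using sf_eq_sym[OF pbF_cmp[OF p(1) ga(1)]] p ga by simp
    also have "sf_eq (CE2E_obj X) (src \<F> A) \<dots> sf_id"
      unfolding g(2) using A by (intro pbF_idm) simp
    finally show "sf_eq (CE2E_obj X) (src (CE2E_obj X) A)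
      (SubF (CE2E_obj X) (sob (WkF (CE2E_obj X) A) A) (idtm (CE2E_obj X) A) \<odot>
       sliced (CE2E_obj X) (WkF (CE2E_obj X) A) A) sf_id"
      by (simp flip: gen_def)
  next
    fix \<Gamma> assume "\<Gamma> \<in> Obj (CE2E_obj X)"
    then show "sf_eq (CE2E_obj X) \<Gamma> (WkF (CE2E_obj X) (idm (CE2E_obj X) \<Gamma>)) sf_id"
      using pbF_idm by simp
  next
    fix A P assume "A \<in> Arr (CE2E_obj X)" "P \<in> Arr (CE2E_obj X)" "tgt (CE2E_obj X) P = src (CE2E_obj X) A"
    then show "sf_eq (CE2E_obj X) (tgt (CE2E_obj X) A) (WkF (CE2E_obj X) (A \<cdot>\<^bsub>CE2E_obj X\<^esub> P))
      (WkF (CE2E_obj X) P \<odot> WkF (CE2E_obj X) A)"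
      using pbF_cmp[of "incl X A" "incl X P"] by simp
  qed
qed

end


section \<open>The categories of E-systems and CE-systems\<close>

lemma trestrict_eq_iff: "trestrict E H = trestrict E K \<longleftrightarrow> tfunc_eq E H K"
  unfolding trestrict_def tfunc_eq_def
  by (auto simp: fun_eq_iff restrict_def)

lemma tfunc_eq_trestrict: "tfunc_eq E (trestrict E H) H"
  by (simp add: trestrict_def tfunc_eq_def)

lemma trestrict_trestrict [simp]: "trestrict E (trestrict E H) = trestrict E H"
  by (simp add: trestrict_eq_iff tfunc_eq_trestrict)

lemma tfunc_eq_sym: "tfunc_eq E H K \<Longrightarrow> tfunc_eq E K H"
  by (simp add: tfunc_eq_def)

lemma tfunctorD:
  assumes "tfunctor E D H"
  shows "\<And>a. a \<in> Obj E \<Longrightarrow> oMap H a \<in> Obj D"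
    "\<And>A. A \<in> Arr E \<Longrightarrow> aMap H A \<in> Arr D" "\<And>A. A \<in> Arr E \<Longrightarrow> src D (aMap H A) = oMap H (src E A)"
    "\<And>A. A \<in> Arr E \<Longrightarrow> tgt D (aMap H A) = oMap H (tgt E A)"
    "\<And>A x. \<lbrakk>A \<in> Arr E; x \<in> Tm E A\<rbrakk> \<Longrightarrow> tMap H A x \<in> Tm D (aMap H A)"
    "\<And>a. a \<in> Obj E \<Longrightarrow> aMap H (idm E a) = idm D (oMap H a)"
    "\<And>A P. \<lbrakk>A \<in> Arr E; P \<in> Arr E; tgt E P = src E A\<rbrakk> \<Longrightarrow> aMap H (A \<cdot>\<^bsub>E\<^esub> P) = aMap H A \<cdot>\<^bsub>D\<^esub> aMap H P"
proof -
  interpret strict_functor E D H using assms by (simp add: tfunctor_def)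
  show "\<And>a. a \<in> Obj E \<Longrightarrow> oMap H a \<in> Obj D"
    "\<And>A. A \<in> Arr E \<Longrightarrow> aMap H A \<in> Arr D" "\<And>A. A \<in> Arr E \<Longrightarrow> src D (aMap H A) = oMap H (src E A)"
    "\<And>A. A \<in> Arr E \<Longrightarrow> tgt D (aMap H A) = oMap H (tgt E A)"
    "\<And>A x. \<lbrakk>A \<in> Arr E; x \<in> Tm E A\<rbrakk> \<Longrightarrow> tMap H A x \<in> Tm D (aMap H A)"
    "\<And>a. a \<in> Obj E \<Longrightarrow> aMap H (idm E a) = idm D (oMap H a)"
    "\<And>A P. \<lbrakk>A \<in> Arr E; P \<in> Arr E; tgt E P = src E A\<rbrakk> \<Longrightarrow> aMap H (A \<cdot>\<^bsub>E\<^esub> P) = aMap H A \<cdot>\<^bsub>D\<^esub> aMap H P"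
    using assms by (simp_all add: tfunctor_def)
qed

lemma tcomp_simps [simp]:
  "oMap (tcomp G H) a = oMap G (oMap H a)" "aMap (tcomp G H) A = aMap G (aMap H A)"
  "tMap (tcomp G H) A x = tMap G (aMap H A) (tMap H A x)"
  by (simp_all add: tcomp_def)

lemma tid_simps [simp]: "oMap tid a = a" "aMap tid A = A" "tMap tid A x = x"
  by (simp_all add: tid_def)

lemma trestrict_simps [simp]:
  "a \<in> Obj E \<Longrightarrow> oMap (trestrict E H) a = oMap H a"
  "A \<in> Arr E \<Longrightarrow> aMap (trestrict E H) A = aMap H A"
  "\<lbrakk>A \<in> Arr E; x \<in> Tm E A\<rbrakk> \<Longrightarrow> tMap (trestrict E H) A x = tMap H A x"
  by (simp_all add: trestrict_def)

text \<open>Arrows of \<open>Esys\<close> are stored restricted to the carriers, so being a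
  homomorphism must depend only on the values there.\<close>

lemma pre_E_hom_cong:
  assumes "pre_E_hom E D H" "tfunc_eq E H K" "sf_pre_E_system E" "sf_pre_E_system D"
  shows "pre_E_hom E D K"
proof -
  interpret E: sf_pre_E_system E by fact
  have eq: "oMap K a = oMap H a" if "a \<in> Obj E" for a using assms(2) that by (simp add: tfunc_eq_def)
  have eq': "aMap K A = aMap H A" "\<And>x. x \<in> Tm E A \<Longrightarrow> tMap K A x = tMap H A x" if "A \<in> Arr E" for A
    using assms(2) that by (auto simp: tfunc_eq_def)
  have H: "tfunctor E D H" "oMap H (root E) = root D"
    "\<And>\<Gamma>. \<Gamma> \<in> Obj E \<Longrightarrow> sf_hom E \<Gamma> D (oMap H \<Gamma>) (sf_lift H)"
    using assms(1) by (auto simp: pre_E_hom_iff[OF assms(3,4)])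
  have "strict_functor E D H" using H(1) by (simp add: tfunctor_def)
  then have "strict_functor E D K"
    by (rule strict_functor_cong) (simp_all add: eq eq')
  then have "tfunctor E D K"
    using tfunctorD(5)[OF H(1)] by (simp add: tfunctor_def eq')
  moreover have "oMap K (root E) = root D" using H(2) E.root eq by (simp add: terminal_def)
  moreover have "sf_hom E \<Gamma> D (oMap K \<Gamma>) (sf_lift K)" if "\<Gamma> \<in> Obj E" for \<Gamma>
  proof -
    have "sf_eq E \<Gamma> (sf_lift H) (sf_lift K)" by (simp add: sf_eq_def eq')
    from sf_hom_cong[OF H(3)[OF that] this assms(3,4)] show ?thesis using that by (simp add: eq)
  qed
  ultimately show ?thesis by (simp add: pre_E_hom_iff[OF assms(3,4)])
qed

lemma pre_E_hom_comp:
  assumes "pre_E_hom E D H" "pre_E_hom D K G"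
    and "sf_pre_E_system E" "sf_pre_E_system D" "sf_pre_E_system K"
  shows "pre_E_hom E K (tcomp G H)"
proof -
  have H: "tfunctor E D H" "oMap H (root E) = root D"
    "\<And>\<Gamma>. \<Gamma> \<in> Obj E \<Longrightarrow> sf_hom E \<Gamma> D (oMap H \<Gamma>) (sf_lift H)"
    using assms(1) by (auto simp: pre_E_hom_iff[OF assms(3,4)])
  have G: "tfunctor D K G" "oMap G (root D) = root K"
    "\<And>\<Gamma>. \<Gamma> \<in> Obj D \<Longrightarrow> sf_hom D \<Gamma> K (oMap G \<Gamma>) (sf_lift G)"
    using assms(2) by (auto simp: pre_E_hom_iff[OF assms(4,5)])
  have "strict_functor E K (tcomp G H)"
    using H(1) G(1) by (intro strict_functor_comp[of E D H K G]) (simp_all add: tfunctor_def)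
  then have "tfunctor E K (tcomp G H)"
    using tfunctorD[OF H(1)] tfunctorD[OF G(1)] by (simp add: tfunctor_def)
  moreover have "sf_hom E \<Gamma> K (oMap (tcomp G H) \<Gamma>) (sf_lift (tcomp G H))" if "\<Gamma> \<in> Obj E" for \<Gamma>
    using sf_hom_comp[OF H(3)[OF that] G(3) assms(3,4)] tfunctorD(1)[OF H(1) that]
    by (simp add: sf_lift_tcomp)
  ultimately show ?thesis using H(2) G(2) by (simp add: pre_E_hom_iff[OF assms(3,5)])
qed

lemma pre_E_hom_id:
  assumes "sf_pre_E_system E"
  shows "pre_E_hom E E tid"
proof -
  interpret E: sf_pre_E_system E by fact
  have "strict_functor E E tid"
    using E.strict_category_axioms by (intro strict_functor_id) simp_all
  then show ?thesis
    using sf_hom_id[OF assms] by (simp add: pre_E_hom_iff[OF assms assms] tfunctor_def sf_lift_tid)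
qed

lemma E_system_sf_pre: "E_system E \<Longrightarrow> sf_pre_E_system E"
  by (simp add: E_system_iff sf_E_system_def)

lemma Esys_simps [simp]:
  "E \<in> Obj Esys \<longleftrightarrow> E_system E"
  "(E, H, D) \<in> Arr Esys \<longleftrightarrow> E_system E \<and> E_system D \<and> pre_E_hom E D H \<and> trestrict E H = H"
  "src Esys (E, H, D) = E" "tgt Esys (E, H, D) = D" "idm Esys E = (E, trestrict E tid, E)"
  "(D', K, B) \<cdot>\<^bsub>Esys\<^esub> (E, H, D) = (E, trestrict E (tcomp K H), B)"
  by (simp_all add: Esys_def)

lemma Hom_Esys:
  "f \<in> Hom Esys E D \<longleftrightarrow>
    (\<exists>H. f = (E, H, D) \<and> E_system E \<and> E_system D \<and> pre_E_hom E D H \<and> trestrict E H = H)"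
  by (cases f) (auto simp: mem_Hom_iff)

lemma E_hom_trestrict:
  assumes "E_system E" "E_system D" "pre_E_hom E D H"
  shows "pre_E_hom E D (trestrict E H)"
  using pre_E_hom_cong[OF assms(3) tfunc_eq_sym[OF tfunc_eq_trestrict]] assms(1,2)
  by (simp add: E_system_sf_pre)

lemma pre_E_hom_tfunctor: "pre_E_hom E D H \<Longrightarrow> tfunctor E D H"
  by (simp add: pre_E_hom_def)

text \<open>A homomorphism sends carriers to carriers, so the restricted outer factor is never
  evaluated where it is undefined.\<close>

lemma tfunc_eq_tcomp_trestrict:
  assumes "pre_E_hom E D H"
  shows "tfunc_eq E (tcomp (trestrict D K) H) (tcomp K H)"
  using tfunctorD[OF pre_E_hom_tfunctor[OF assms]] by (simp add: tfunc_eq_def)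

lemma Esys_strict_category: "strict_category (Esys :: ('u esys, 'u esys_arr) scat)"
proof
  fix f :: "'u esys_arr" assume "f \<in> Arr Esys"
  then obtain E H D where f: "f = (E, H, D)" "E_system E" "E_system D" "pre_E_hom E D H" "trestrict E H = H"
    by (cases f) auto
  show "src Esys f \<in> Obj Esys" "tgt Esys f \<in> Obj Esys" using f by simp_all
  have "trestrict E (tcomp H (trestrict E tid)) = trestrict E H"
    unfolding trestrict_eq_iff by (simp add: tfunc_eq_def)
  then show "f \<cdot>\<^bsub>Esys\<^esub> idm Esys (src Esys f) = f" using f by simp
  have "trestrict E (tcomp (trestrict D tid) H) = trestrict E H"
    unfolding trestrict_eq_iff using tfunc_eq_tcomp_trestrict[OF f(4), of tid] by (simp add: tfunc_eq_def)
  then show "idm Esys (tgt Esys f) \<cdot>\<^bsub>Esys\<^esub> f = f" using f by simp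
next
  fix E :: "'u esys" assume "E \<in> Obj Esys"
  then show "idm Esys E \<in> Hom Esys E E"
    using E_hom_trestrict[of E E tid] pre_E_hom_id[of E] by (simp add: Hom_Esys E_system_sf_pre)
next
  fix f g :: "'u esys_arr" and a b c assume "f \<in> Hom Esys a b" "g \<in> Hom Esys b c"
  then obtain H K where f: "f = (a, H, b)" "E_system a" "E_system b" "pre_E_hom a b H"
    and g: "g = (b, K, c)" "E_system c" "pre_E_hom b c K"
    unfolding Hom_Esys by blast
  have "pre_E_hom a c (tcomp K H)"
    using pre_E_hom_comp[OF f(4) g(3)] f(2,3) g(2) by (simp add: E_system_sf_pre)
  then show "g \<cdot>\<^bsub>Esys\<^esub> f \<in> Hom Esys a c"
    using f(2) g(2) E_hom_trestrict by (simp add: Hom_Esys f(1) g(1))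
next
  fix f g h :: "'u esys_arr" and a b c d
  assume "f \<in> Hom Esys a b" "g \<in> Hom Esys b c" "h \<in> Hom Esys c d"
  then obtain H K L where f: "f = (a, H, b)" "pre_E_hom a b H"
    and g: "g = (b, K, c)" and h: "h = (c, L, d)"
    unfolding Hom_Esys by blast
  have "tfunc_eq a (tcomp (trestrict b (tcomp L K)) H) (tcomp L (trestrict a (tcomp K H)))"
    using tfunc_eq_tcomp_trestrict[OF f(2), of "tcomp L K"] by (simp add: tfunc_eq_def)
  then show "h \<cdot>\<^bsub>Esys\<^esub> g \<cdot>\<^bsub>Esys\<^esub> f = h \<cdot>\<^bsub>Esys\<^esub> (g \<cdot>\<^bsub>Esys\<^esub> f)"
    by (simp add: f(1) g h trestrict_eq_iff)
qed

section \<open>Homomorphisms of CE-systems and their category\<close>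

definition cefunc_eq :: "'u cesys \<Rightarrow> 'u cefunc \<Rightarrow> 'u cefunc \<Rightarrow> bool" where
  "cefunc_eq X F G \<longleftrightarrow>
    (\<forall>a\<in>Obj (fam X). oMap (famF F) a = oMap (famF G) a) \<and>
    (\<forall>A\<in>Arr (fam X). aMap (famF F) A = aMap (famF G) A) \<and>
    (\<forall>a\<in>Obj (ctx X). oMap (ctxF F) a = oMap (ctxF G) a) \<and>
    (\<forall>f\<in>Arr (ctx X). aMap (ctxF F) f = aMap (ctxF G) f)"

abbreviation "ce_id \<equiv> \<lparr>famF = func_id, ctxF = func_id\<rparr>"

abbreviation "ce_comp G F \<equiv>
  \<lparr>famF = func_comp (famF G) (famF F), ctxF = func_comp (ctxF G) (ctxF F)\<rparr>"

lemma func_simps [simp]: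
  "oMap func_id a = a" "aMap func_id f = f"
  "oMap (func_comp G F) a = oMap G (oMap F a)" "aMap (func_comp G F) f = aMap G (aMap F f)"
  by (simp_all add: func_id_def func_comp_def)

lemma cerestrict_eq_iff: "cerestrict X F = cerestrict X G \<longleftrightarrow> cefunc_eq X F G"
  unfolding cerestrict_def frestrict_def cefunc_eq_def
  by (auto simp: fun_eq_iff restrict_def)

lemma cerestrict_simps [simp]:
  "a \<in> Obj (fam X) \<Longrightarrow> oMap (famF (cerestrict X F)) a = oMap (famF F) a"
  "A \<in> Arr (fam X) \<Longrightarrow> aMap (famF (cerestrict X F)) A = aMap (famF F) A"
  "a \<in> Obj (ctx X) \<Longrightarrow> oMap (ctxF (cerestrict X F)) a = oMap (ctxF F) a"
  "f \<in> Arr (ctx X) \<Longrightarrow> aMap (ctxF (cerestrict X F)) f = aMap (ctxF F) f"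
  by (simp_all add: cerestrict_def frestrict_def)

lemma cefunc_eq_cerestrict: "cefunc_eq X (cerestrict X F) F"
  by (simp add: cefunc_eq_def)

lemma cerestrict_cerestrict [simp]: "cerestrict X (cerestrict X F) = cerestrict X F"
  by (simp add: cerestrict_eq_iff cefunc_eq_cerestrict)

lemma CE_homD:
  assumes "CE_hom X Y F"
  shows "strict_functor (fam X) (fam Y) (famF F)" "strict_functor (ctx X) (ctx Y) (ctxF F)"
    and "\<And>a. a \<in> Obj (fam X) \<Longrightarrow> oMap (ctxF F) a = oMap (famF F) a"
    and "\<And>A. A \<in> Arr (fam X) \<Longrightarrow> aMap (ctxF F) (incl X A) = incl Y (aMap (famF F) A)"
    and "oMap (famF F) (one X) = one Y"
    and "\<And>f A. \<lbrakk>f \<in> Arr (ctx X); A \<in> Arr (fam X); tgt (fam X) A = tgt (ctx X) f\<rbrakk> \<Longrightarrow>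
        aMap (famF F) (pb X f A) = pb Y (aMap (ctxF F) f) (aMap (famF F) A)"
    and "\<And>f A. \<lbrakk>f \<in> Arr (ctx X); A \<in> Arr (fam X); tgt (fam X) A = tgt (ctx X) f\<rbrakk> \<Longrightarrow>
        aMap (ctxF F) (pi2 X f A) = pi2 Y (aMap (ctxF F) f) (aMap (famF F) A)"
  using assms by (auto simp: CE_hom_def)

lemma CE_hom_cong:
  assumes "CE_hom X Y F" "cefunc_eq X F G" "CE_system X"
  shows "CE_hom X Y G"
proof -
  interpret X: CE_system X by fact
  note F = CE_homD[OF assms(1)]
  have eq: "oMap (famF G) a = oMap (famF F) a" "oMap (ctxF G) a = oMap (famF F) a" if "a \<in> Obj (fam X)" for a
    using assms(2) that F(3) by (auto simp: cefunc_eq_def)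
  have eq': "aMap (famF G) A = aMap (famF F) A" if "A \<in> Arr (fam X)" for A
    using assms(2) that by (simp add: cefunc_eq_def)
  have eq'': "aMap (ctxF G) f = aMap (ctxF F) f" if "f \<in> Arr (ctx X)" for f
    using assms(2) that by (simp add: cefunc_eq_def)
  have 1: "strict_functor (fam X) (fam Y) (famF G)"
    by (rule strict_functor_cong[OF F(1)]) (simp_all add: eq eq')
  have 2: "strict_functor (ctx X) (ctx Y) (ctxF G)"
    by (rule strict_functor_cong[OF F(2)]) (simp_all add: eq eq'' F(3))
  show ?thesis
    unfolding CE_hom_def
    using 1 2 X.one_terminal by (simp add: eq eq' eq'' F(4-7) terminal_def)
qed

lemma CE_hom_comp:
  assumes "CE_hom X Y F" "CE_hom Y Z G" "CE_system X" "CE_system Y"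
  shows "CE_hom X Z (ce_comp G F)"
proof -
  interpret X: CE_system X by fact
  note F = CE_homD[OF assms(1)] and G = CE_homD[OF assms(2)]
  interpret FF: strict_functor "fam X" "fam Y" "famF F" by (rule F(1))
  interpret FC: strict_functor "ctx X" "ctx Y" "ctxF F" by (rule F(2))
  have 1: "strict_functor (fam X) (fam Z) (func_comp (famF G) (famF F))"
    by (rule strict_functor_comp[OF F(1) G(1)]) simp_all
  have 2: "strict_functor (ctx X) (ctx Z) (func_comp (ctxF G) (ctxF F))"
    by (rule strict_functor_comp[OF F(2) G(2)]) simp_all
  show ?thesis
    unfolding CE_hom_def using 1 2 by (simp add: F(3-7) G(3-7))
qed

lemma CE_hom_id:
  assumes "CE_system X"
  shows "CE_hom X X ce_id"
proof -
  interpret X: CE_system X by fact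
  show ?thesis
    unfolding CE_hom_def
    using strict_functor_id[OF X.fam.strict_category_axioms, of func_id]
      strict_functor_id[OF X.ctx.strict_category_axioms, of func_id] by simp
qed

lemma CEsys_simps [simp]:
  "X \<in> Obj CEsys \<longleftrightarrow> CE_system X"
  "(X, F, Y) \<in> Arr CEsys \<longleftrightarrow> CE_system X \<and> CE_system Y \<and> CE_hom X Y F \<and> cerestrict X F = F"
  "src CEsys (X, F, Y) = X" "tgt CEsys (X, F, Y) = Y" "idm CEsys X = (X, cerestrict X ce_id, X)"
  "(Y', G, Z) \<cdot>\<^bsub>CEsys\<^esub> (X, F, Y) = (X, cerestrict X (ce_comp G F), Z)"
  by (simp_all add: CEsys_def)

lemma Hom_CEsys:
  "f \<in> Hom CEsys X Y \<longleftrightarrow>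
    (\<exists>F. f = (X, F, Y) \<and> CE_system X \<and> CE_system Y \<and> CE_hom X Y F \<and> cerestrict X F = F)"
  by (cases f) (auto simp: mem_Hom_iff)

lemma CE_hom_cerestrict:
  assumes "CE_system X" "CE_hom X Y F"
  shows "CE_hom X Y (cerestrict X F)"
  using CE_hom_cong[OF assms(2) _ assms(1)] by (simp add: cefunc_eq_def)

lemma cefunc_eq_comp_cerestrict:
  assumes "CE_hom X Y F"
  shows "cefunc_eq X (ce_comp (cerestrict Y G) F) (ce_comp G F)"
proof -
  note F = CE_homD[OF assms(1)]
  interpret FF: strict_functor "fam X" "fam Y" "famF F" by (rule F(1))
  interpret FC: strict_functor "ctx X" "ctx Y" "ctxF F" by (rule F(2))
  show ?thesis by (simp add: cefunc_eq_def)
qed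

lemma CEsys_strict_category: "strict_category (CEsys :: ('u cesys, 'u cesys_arr) scat)"
proof
  fix f :: "'u cesys_arr" assume "f \<in> Arr CEsys"
  then obtain X F Y where f: "f = (X, F, Y)" "CE_system X" "CE_system Y" "CE_hom X Y F" "cerestrict X F = F"
    by (cases f) auto
  show "src CEsys f \<in> Obj CEsys" "tgt CEsys f \<in> Obj CEsys" using f by simp_all
  have "cerestrict X (ce_comp F (cerestrict X ce_id)) = cerestrict X F"
    unfolding cerestrict_eq_iff by (simp add: cefunc_eq_def)
  then show "f \<cdot>\<^bsub>CEsys\<^esub> idm CEsys (src CEsys f) = f" using f by simp
  have "cerestrict X (ce_comp (cerestrict Y ce_id) F) = cerestrict X F"
    unfolding cerestrict_eq_iff using cefunc_eq_comp_cerestrict[OF f(4), of ce_id] by (simp add: cefunc_eq_def)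
  then show "idm CEsys (tgt CEsys f) \<cdot>\<^bsub>CEsys\<^esub> f = f" using f by simp
next
  fix X :: "'u cesys" assume "X \<in> Obj CEsys"
  then show "idm CEsys X \<in> Hom CEsys X X"
    using CE_hom_cerestrict[OF _ CE_hom_id] by (simp add: Hom_CEsys)
next
  fix f g :: "'u cesys_arr" and a b c assume "f \<in> Hom CEsys a b" "g \<in> Hom CEsys b c"
  then obtain F G where f: "f = (a, F, b)" "CE_system a" "CE_system b" "CE_hom a b F"
    and g: "g = (b, G, c)" "CE_system c" "CE_hom b c G"
    unfolding Hom_CEsys by blast
  show "g \<cdot>\<^bsub>CEsys\<^esub> f \<in> Hom CEsys a c"
    using CE_hom_cerestrict[OF f(2) CE_hom_comp[OF f(4) g(3) f(2,3)]] f(2) g(2)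
    by (simp add: Hom_CEsys f(1) g(1))
next
  fix f g h :: "'u cesys_arr" and a b c d
  assume "f \<in> Hom CEsys a b" "g \<in> Hom CEsys b c" "h \<in> Hom CEsys c d"
  then obtain F G H where f: "f = (a, F, b)" "CE_hom a b F" and g: "g = (b, G, c)" and h: "h = (c, H, d)"
    unfolding Hom_CEsys by blast
  have "cefunc_eq a (ce_comp (cerestrict b (ce_comp H G)) F) (ce_comp H (cerestrict a (ce_comp G F)))"
    using cefunc_eq_comp_cerestrict[OF f(2), of "ce_comp H G"] by (simp add: cefunc_eq_def)
  then show "h \<cdot>\<^bsub>CEsys\<^esub> g \<cdot>\<^bsub>CEsys\<^esub> f = h \<cdot>\<^bsub>CEsys\<^esub> (g \<cdot>\<^bsub>CEsys\<^esub> f)"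
    by (simp add: f(1) g h cerestrict_eq_iff)
qed

section \<open>The functor from CE-systems to E-systems\<close>

lemma CE_hom_sections:
  assumes "CE_hom X Y F" "CE_system X" "CE_system Y" "A \<in> Arr (fam X)" "x \<in> sections X A"
  shows "aMap (ctxF F) x \<in> sections Y (aMap (famF F) A)"
proof -
  interpret X: CE_system X by fact
  interpret Y: CE_system Y by fact
  note F = CE_homD[OF assms(1)]
  interpret FF: strict_functor "fam X" "fam Y" "famF F" by (rule F(1))
  interpret FC: strict_functor "ctx X" "ctx Y" "ctxF F" by (rule F(2))
  note x = X.sections_arr[OF assms(5)]
  have "incl Y (aMap (famF F) A) \<cdot>\<^bsub>ctx Y\<^esub> aMap (ctxF F) x = aMap (ctxF F) (incl X A \<cdot>\<^bsub>ctx X\<^esub> x)"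
    using assms(4) x(1-3) by (simp add: F(4))
  then show ?thesis
    using assms(4) x by (simp add: mem_sections_iff F(3))
qed

text \<open>\<open>F\<close> preserves composition and \<open>pi2\<close>, so the image satisfies
  the equation that characterises the pulled back section.\<close>

lemma CE_hom_pb_section:
  assumes "CE_hom X Y F" "CE_system X" "CE_system Y"
    and "g \<in> Arr (ctx X)" "Q \<in> Arr (fam X)" "tgt (fam X) Q = tgt (ctx X) g" "y \<in> sections X Q"
  shows "aMap (ctxF F) (pb_section X g Q y) =
    pb_section Y (aMap (ctxF F) g) (aMap (famF F) Q) (aMap (ctxF F) y)"
proof -
  interpret X: CE_system X by fact
  interpret Y: CE_system Y by fact
  note F = CE_homD[OF assms(1)]
  interpret FF: strict_functor "fam X" "fam Y" "famF F" by (rule F(1))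
  interpret FC: strict_functor "ctx X" "ctx Y" "ctxF F" by (rule F(2))
  note s = X.pb_section[OF assms(4-7)]
  note sa = X.sections_arr[OF s(1)] and y = X.sections_arr[OF assms(7)]
  show ?thesis
  proof (rule Y.pb_section_eqI[symmetric])
    show "aMap (ctxF F) (pb_section X g Q y) \<in> sections Y (pb Y (aMap (ctxF F) g) (aMap (famF F) Q))"
      using CE_hom_sections[OF assms(1-3) _ s(1)] assms(4-6) by (simp add: F(6))
    have "pi2 Y (aMap (ctxF F) g) (aMap (famF F) Q) \<cdot>\<^bsub>ctx Y\<^esub> aMap (ctxF F) (pb_section X g Q y) =
        aMap (ctxF F) (pi2 X g Q \<cdot>\<^bsub>ctx X\<^esub> pb_section X g Q y)"
      using assms(4-6) sa(1-3) by (simp add: F(7))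
    also have "\<dots> = aMap (ctxF F) y \<cdot>\<^bsub>ctx Y\<^esub> aMap (ctxF F) g"
      unfolding s(2) using assms(4-6) y(1-3) by simp
    finally show "pi2 Y (aMap (ctxF F) g) (aMap (famF F) Q) \<cdot>\<^bsub>ctx Y\<^esub> aMap (ctxF F) (pb_section X g Q y) =
        aMap (ctxF F) y \<cdot>\<^bsub>ctx Y\<^esub> aMap (ctxF F) g" .
  qed (use assms(4-6) CE_hom_sections[OF assms(1-3,5,7)] in \<open>simp_all add: F(3)\<close>)
qed

text \<open>The diagonal is characterised by its composite with \<open>pi2\<close>, and
  \<open>F\<close> preserves that composite.\<close>

lemma CE_hom_gen:
  assumes "CE_hom X Y F" "CE_system X" "CE_system Y" "A \<in> Arr (fam X)"
  shows "aMap (ctxF F) (idtm (CE2E_obj X) A) = idtm (CE2E_obj Y) (aMap (famF F) A)"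
proof -
  interpret X: CE_system X by fact
  interpret Y: CE_system Y by fact
  note F = CE_homD[OF assms(1)]
  interpret FF: strict_functor "fam X" "fam Y" "famF F" by (rule F(1))
  interpret FC: strict_functor "ctx X" "ctx Y" "ctxF F" by (rule F(2))
  note g = X.gen(1,2)[OF assms(4)]
  note ga = X.sections_arr[OF g(1)]
  have "Y.gen (aMap (famF F) A) = aMap (ctxF F) (X.gen A)"
  proof (rule Y.gen(3))
    show "aMap (ctxF F) (X.gen A) \<in> sections Y (pb Y (incl Y (aMap (famF F) A)) (aMap (famF F) A))"
      using CE_hom_sections[OF assms(1-3) _ g(1)] assms(4) F(4,6) by simp
    have "pi2 Y (incl Y (aMap (famF F) A)) (aMap (famF F) A) \<cdot>\<^bsub>ctx Y\<^esub> aMap (ctxF F) (X.gen A) =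
      aMap (ctxF F) (pi2 X (incl X A) A \<cdot>\<^bsub>ctx X\<^esub> X.gen A)"
      using assms(4) ga(1-3) by (simp add: F(7) flip: F(4))
    then show "pi2 Y (incl Y (aMap (famF F) A)) (aMap (famF F) A) \<cdot>\<^bsub>ctx Y\<^esub> aMap (ctxF F) (X.gen A) =
      idm (ctx Y) (src (fam Y) (aMap (famF F) A))"
      unfolding g(2) using assms(4) by (simp add: F(3))
  qed (use assms(4) in simp)
  then show ?thesis by (simp add: X.gen_def Y.gen_def)
qed

lemma CE_hom_pbF:
  assumes "CE_hom X Y F" "CE_system X" "CE_system Y" "f \<in> Arr (ctx X)"
    and H: "\<And>A. aMap H A = aMap (famF F) A" "\<And>A x. tMap H A x = aMap (ctxF F) x"
  shows "sf_eq (CE2E_obj X) (tgt (ctx X) f) (sf_lift H \<odot> pbF X f) (pbF Y (aMap (ctxF F) f) \<odot> sf_lift H)"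
proof -
  interpret X: CE_system X by fact
  interpret Y: CE_system Y by fact
  note F = CE_homD[OF assms(1)]
  interpret FF: strict_functor "fam X" "fam Y" "famF F" by (rule F(1))
  interpret FC: strict_functor "ctx X" "ctx Y" "ctxF F" by (rule F(2))
  show ?thesis
    using assms(4)
    by (simp add: sf_eq_def H F(3,6,7) X.stm_pbF Y.stm_pbF CE_hom_pb_section[OF assms(1-3)])
qed

text \<open>In \<open>CE2E_obj X\<close> both \<open>S\<close> and \<open>W\<close> are pullback
  functors, so \<open>CE_hom_pbF\<close> yields both of their conditions at once.\<close>

lemma CE2E_pre_E_hom:
  assumes "CE_hom X Y F" "CE_system X" "CE_system Y"
  shows "pre_E_hom (CE2E_obj X) (CE2E_obj Y)
    \<lparr>oMap = oMap (famF F), aMap = aMap (famF F), tMap = (\<lambda>A. aMap (ctxF F))\<rparr>" (is "pre_E_hom ?E ?D ?H")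
proof -
  interpret X: CE_system X by fact
  interpret Y: CE_system Y by fact
  interpret E: sf_E_system ?E by (rule X.sf_E_system_CE2E)
  interpret D: sf_E_system ?D by (rule Y.sf_E_system_CE2E)
  note F = CE_homD[OF assms(1)]
  interpret FF: strict_functor "fam X" "fam Y" "famF F" by (rule F(1))
  interpret FC: strict_functor "ctx X" "ctx Y" "ctxF F" by (rule F(2))
  have sf: "strict_functor ?E ?D ?H"
    by unfold_locales (auto simp: mem_Hom_iff)
  then have tf: "tfunctor ?E ?D ?H"
    using CE_hom_sections[OF assms] by (simp add: tfunctor_def)
  have f: "sf_functor ?E \<Gamma> ?D (oMap (famF F) \<Gamma>) (sf_lift ?H)" if "\<Gamma> \<in> Obj (fam X)" for \<Gamma>
    using that CE_hom_sections[OF assms] by (simp add: sf_functor_def)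
  have pbF: "sf_eq ?E (tgt (ctx X) f) (sf_lift ?H \<odot> pbF X f) (pbF Y (aMap (ctxF F) f) \<odot> sf_lift ?H)"
    if "f \<in> Arr (ctx X)" for f
    using assms that by (rule CE_hom_pbF) simp_all
  have "sf_hom ?E \<Gamma> ?D (oMap (famF F) \<Gamma>) (sf_lift ?H)" if "\<Gamma> \<in> Obj (fam X)" for \<Gamma>
  proof -
    have S: "sf_eq ?E (src (fam X) Q) (sf_lift ?H \<odot> pbF X x) (pbF Y (aMap (ctxF F) x) \<odot> sf_lift ?H)"
      if "Q \<in> Arr (fam X)" "x \<in> sections X Q" for Q x
      using pbF[OF X.sections_arr(1)[OF that(2)]] X.sections_arr(3)[OF that(2)] by simp
    have W: "sf_eq ?E (tgt (fam X) Q) (sf_lift ?H \<odot> pbF X (incl X Q))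
        (pbF Y (incl Y (aMap (famF F) Q)) \<odot> sf_lift ?H)"
      if "Q \<in> Arr (fam X)" for Q
      using pbF[of "incl X Q"] that by (simp add: F(4))
    have W': "sf_eq ?E (src (fam X) P) (sf_lift ?H \<odot> pbF X (incl X Q))
        (pbF Y (incl Y (aMap (famF F) Q)) \<odot> sf_lift ?H)"
      if "Q \<in> Arr (fam X)" "tgt (fam X) Q = src (fam X) P" for P Q
      using W[OF that(1)] that(2) by simp
    show ?thesis
      unfolding sf_hom_def using f[OF that] by (simp add: S W' CE_hom_gen[OF assms])
  qed
  then show ?thesis
    using tf F(5) by (simp add: pre_E_hom_iff[OF E.pre D.pre])
qed

lemma E_system_CE2E: "CE_system X \<Longrightarrow> E_system (CE2E_obj X)"
  by (simp add: E_system_iff CE_system.sf_E_system_CE2E)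

lemma CE2E_functor: "strict_functor (CEsys :: ('u cesys, 'u cesys_arr) scat) Esys CE2E"
proof -
  interpret C: strict_category "CEsys :: ('u cesys, 'u cesys_arr) scat" by (rule CEsys_strict_category)
  interpret E: strict_category "Esys :: ('u esys, 'u esys_arr) scat" by (rule Esys_strict_category)
  have o: "oMap CE2E X = CE2E_obj X" and a: "aMap CE2E (X, F, Y) = (CE2E_obj X, CE2E_hom X F, CE2E_obj Y)"
    for X Y :: "'u cesys" and F
    by (simp_all add: CE2E_def)
  show ?thesis
  proof
    fix X :: "'u cesys" assume "X \<in> Obj CEsys"
    then have X: "CE_system X" by simp
    then show "oMap CE2E X \<in> Obj Esys" by (simp add: o E_system_CE2E)
    interpret X: CE_system X by fact
    have "CE2E_hom X (cerestrict X ce_id) = trestrict (CE2E_obj X) tid"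
      unfolding CE2E_hom_def trestrict_eq_iff
      using X.sections_arr(1) by (simp add: tfunc_eq_def)
    then show "aMap CE2E (idm CEsys X) = idm Esys (oMap CE2E X)"
      by (simp add: o a)
  next
    fix f :: "'u cesys_arr" assume "f \<in> Arr CEsys"
    then obtain X F Y where f: "f = (X, F, Y)" "CE_system X" "CE_system Y" "CE_hom X Y F"
      by (cases f) auto
    have "CE2E_hom X F = trestrict (CE2E_obj X) (CE2E_hom X F)" by (simp add: CE2E_hom_def)
    then show "aMap CE2E f \<in> Hom Esys (oMap CE2E (src CEsys f)) (oMap CE2E (tgt CEsys f))"
      using f E_system_CE2E[OF f(2)] E_system_CE2E[OF f(3)]
        E_hom_trestrict[OF E_system_CE2E[OF f(2)] E_system_CE2E[OF f(3)] CE2E_pre_E_hom[OF f(4,2,3)]]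
      by (simp add: o a Hom_Esys) (simp add: CE2E_hom_def)
  next
    fix f g :: "'u cesys_arr" and a b c assume "f \<in> Hom CEsys a b" "g \<in> Hom CEsys b c"
    then obtain F G where f: "f = (a, F, b)" "CE_system a" "CE_system b" "CE_hom a b F"
      and g: "g = (b, G, c)" "CE_system c" "CE_hom b c G"
      unfolding Hom_CEsys by blast
    interpret X: CE_system a by fact
    interpret FF: strict_functor "fam a" "fam b" "famF F" by (rule CE_homD(1)[OF f(4)])
    have "CE2E_hom a (cerestrict a (ce_comp G F)) =
        trestrict (CE2E_obj a) (tcomp (CE2E_hom b G) (CE2E_hom a F))"
      unfolding CE2E_hom_def trestrict_eq_iff
      using X.sections_arr(1) CE_hom_sections[OF f(4,2,3)]
      by (simp add: tfunc_eq_def)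
    then show "aMap CE2E (g \<cdot>\<^bsub>CEsys\<^esub> f) = aMap CE2E g \<cdot>\<^bsub>Esys\<^esub> aMap CE2E f"
      by (simp add: f(1) g(1) a)
  qed
qed


section \<open>The functor from E-systems to CE-systems\<close>

definition hom_arr :: "'u esys \<Rightarrow> 'u tfunc \<Rightarrow> 'u el \<Rightarrow> 'u el" where
  "hom_arr E H k = tarr (aMap H (tsrc k)) (aMap H (ttgt k))
     (tMap H (sob (WkF E (tsrc k)) (ttgt k)) (tterm k))"

lemma hom_arr_simps [simp]:
  "tsrc (hom_arr E H k) = aMap H (tsrc k)" "ttgt (hom_arr E H k) = aMap H (ttgt k)"
  by (simp_all add: hom_arr_def)

locale E_hom = dom: sf_E_system E + cod: sf_E_system D for E D :: "'u esys" +
  fixes H :: "'u tfunc"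
  assumes hom: "pre_E_hom E D H"
begin

lemma tfunctor: "tfunctor E D H" and root_eq: "oMap H (root E) = root D"
  and lift: "\<And>\<Gamma>. \<Gamma> \<in> Obj E \<Longrightarrow> sf_hom E \<Gamma> D (oMap H \<Gamma>) (sf_lift H)"
  using hom by (auto simp: pre_E_hom_iff[OF dom.pre cod.pre])

lemma H_simps [simp]:
  "a \<in> Obj E \<Longrightarrow> oMap H a \<in> Obj D"
  "A \<in> Arr E \<Longrightarrow> aMap H A \<in> Arr D" "A \<in> Arr E \<Longrightarrow> src D (aMap H A) = oMap H (src E A)"
  "A \<in> Arr E \<Longrightarrow> tgt D (aMap H A) = oMap H (tgt E A)"
  "a \<in> Obj E \<Longrightarrow> aMap H (idm E a) = idm D (oMap H a)"
  "\<lbrakk>A \<in> Arr E; P \<in> Arr E; tgt E P = src E A\<rbrakk> \<Longrightarrow> aMap H (A \<cdot>\<^bsub>E\<^esub> P) = aMap H A \<cdot>\<^bsub>D\<^esub> aMap H P"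
  using tfunctorD[OF tfunctor] by simp_all

lemma H_Tm: "\<lbrakk>A \<in> Arr E; x \<in> Tm E A\<rbrakk> \<Longrightarrow> tMap H A x \<in> Tm D (aMap H A)"
  using tfunctorD[OF tfunctor] by simp

lemma lift_functor: "\<Gamma> \<in> Obj E \<Longrightarrow> sf_functor E \<Gamma> D (oMap H \<Gamma>) (sf_lift H)"
  using lift sf_homD(1) by blast

lemma lift_Wk: "A \<in> Arr E \<Longrightarrow> sf_eq E (tgt E A) (sf_lift H \<odot> WkF E A) (WkF D (aMap H A) \<odot> sf_lift H)"
  using sf_hom_Wk[OF lift dom.pre cod.pre, of "tgt E A" A] by simp

lemma lift_Sub:
  "\<lbrakk>A \<in> Arr E; x \<in> Tm E A\<rbrakk>
   \<Longrightarrow> sf_eq E (src E A) (sf_lift H \<odot> SubF E A x) (SubF D (aMap H A) (tMap H A x) \<odot> sf_lift H)"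
  using sf_hom_Sub[OF lift dom.pre cod.pre, of "tgt E A" A x] by simp

lemma lift_idtm: "A \<in> Arr E \<Longrightarrow> tMap H (sob (WkF E A) A) (idtm E A) = idtm D (aMap H A)"
  using sf_hom_idtm[OF lift dom.pre cod.pre, of "tgt E A" A] by simp

lemma lift_Wk_sob:
  "\<lbrakk>A \<in> Arr E; B \<in> Arr E; tgt E B = tgt E A\<rbrakk>
   \<Longrightarrow> aMap H (sob (WkF E A) B) = sob (WkF D (aMap H A)) (aMap H B)"
  using sf_eqD(1)[OF lift_Wk] by simp

text \<open>\<open>H\<close> commutes with substitution and with sliced weakening, hence with the
  reindexing functor composed of the two. The functor of the image arrow is thereby known along
  \<open>H\<close> only.\<close>

lemma hom_arr:
  assumes k: "k \<in> Arr (term_cat E \<Gamma>)" and \<Gamma>: "\<Gamma> \<in> Obj E"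
  shows hom_arr_Arr: "hom_arr E H k \<in> Arr (term_cat D (oMap H \<Gamma>))"
    and arr_fun_hom_arr: "sf_eq E (src E (ttgt k)) (arr_fun D (hom_arr E H k) \<odot> sf_lift H)
      (sf_lift H \<odot> arr_fun E k)"
proof -
  note t = term_catD[OF k]
  let ?A = "tsrc k" and ?B = "ttgt k" and ?L = "sf_lift H"
  let ?W = "sob (WkF E ?A) ?B" and ?HW = "sob (WkF D (aMap H ?A)) (aMap H ?B)"
  have eq: "aMap H ?W = ?HW" using lift_Wk_sob[of ?A ?B] t by simp
  have f: "tterm k \<in> Tm E ?W" using t(3) by (simp add: thom_eq)
  have WA: "sf_functor E \<Gamma> E (src E ?A) (WkF E ?A)" using dom.WkF_functor[of ?A] t by simp
  note fW = sf_functorD[OF WA]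
  have W: "?W \<in> Arr E" "tgt E ?W = src E ?A" using fW t by simp_all
  have HWA: "sf_functor D (oMap H \<Gamma>) D (oMap H (src E ?A)) (WkF D (aMap H ?A))"
    using cod.WkF_functor[of "aMap H ?A"] t by simp
  show "hom_arr E H k \<in> Arr (term_cat D (oMap H \<Gamma>))"
    using t H_Tm[OF W(1) f] by (simp add: hom_arr_def thom_eq eq)
  have slW: "sf_functor E (src E ?B) E (src E ?W) (sliced E (WkF E ?A) ?B)"
    by (rule sf_functor_sliced[OF WA dom.strict dom.strict t(7,8)])
  have LB: "sf_functor E (src E ?B) D (oMap H (src E ?B)) ?L" using t by (intro lift_functor) simp
  have "sf_eq E (src E ?B) (?L \<odot> SubF E ?W (tterm k) \<odot> sliced E (WkF E ?A) ?B)
      ((SubF D (aMap H ?W) (tMap H ?W (tterm k)) \<odot> ?L) \<odot> sliced E (WkF E ?A) ?B)"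
    using sf_eq_comp_left[OF lift_Sub[OF W(1) f] slW] by (simp add: sf_comp_assoc)
  also have "\<dots> = SubF D ?HW (tMap H ?W (tterm k)) \<odot> sliced E ?L ?W \<odot> sliced E (WkF E ?A) ?B"
    by (simp add: sf_comp_assoc eq)
  also have "sf_eq E (src E ?B) \<dots> (SubF D ?HW (tMap H ?W (tterm k)) \<odot> sliced E (?L \<odot> WkF E ?A) ?B)"
    by (rule sf_eq_comp_right[OF sf_eq_sym[OF sliced_comp[OF WA t(7,8)]]])
  also have "sf_eq E (src E ?B) \<dots> (SubF D ?HW (tMap H ?W (tterm k)) \<odot> sliced E (WkF D (aMap H ?A) \<odot> ?L) ?B)"
    using lift_Wk[OF t(5)] t by (intro sf_eq_comp_right sf_eq_sliced[OF _ dom.strict t(7)]) simp_all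
  also have "sf_eq E (src E ?B) \<dots> (SubF D ?HW (tMap H ?W (tterm k)) \<odot> sliced D (WkF D (aMap H ?A)) (aMap H ?B) \<odot> ?L)"
    using sliced_comp[OF lift_functor t(7,8), of "WkF D (aMap H ?A)"] \<Gamma> by (intro sf_eq_comp_right) simp
  finally show "sf_eq E (src E ?B) (arr_fun D (hom_arr E H k) \<odot> ?L) (?L \<odot> arr_fun E k)"
    using sf_eq_sym by (simp add: arr_fun_def RxF_eq hom_arr_def sf_comp_assoc)
qed

text \<open>Knowing the functor of \<open>l\<close> along \<open>H\<close> is enough: its term is
  the value at the generic term of \<open>H(B)\<close>, and \<open>H\<close> sends the generic term
  of \<open>B\<close> to that one.\<close>

lemma hom_arr_eqI:
  assumes k: "k \<in> Arr (term_cat E \<Gamma>)" and l: "l \<in> Arr (term_cat D \<Delta>)"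
    and "tsrc l = aMap H (tsrc k)" "ttgt l = aMap H (ttgt k)"
    and eq: "sf_eq E (src E (ttgt k)) (arr_fun D l \<odot> sf_lift H) (sf_lift H \<odot> arr_fun E k)"
  shows "hom_arr E H k = l"
proof -
  note t = term_catD[OF k]
  let ?A = "tsrc k" and ?B = "ttgt k" and ?L = "sf_lift H"
  let ?WB = "sob (WkF E ?B) ?B" and ?i = "idm E (src E ?B)"
  note WB = dom.Wk_self[OF t(7)]
  have s: "src E ?B \<in> Obj E" using t by simp
  have "tterm l = term_of D (aMap H ?B) (arr_fun D l)"
    using cod.term_of_arr_fun[OF l] assms(4) by simp
  also have "\<dots> = stm (arr_fun D l \<odot> ?L) ?i ?WB (idtm E ?B)"
    using lift_Wk_sob[OF t(7,7)] lift_idtm[OF t(7)] t by (simp add: term_of_def)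
  also have "\<dots> = stm (?L \<odot> arr_fun E k) ?i ?WB (idtm E ?B)"
    using WB s dom.idtm[OF t(7)] by (intro sf_eqD(3)[OF eq]) simp_all
  also have "\<dots> = tMap H (sar (arr_fun E k) ?i ?WB) (tterm k)"
    using dom.term_of_arr_fun[OF k] by (simp add: term_of_def)
  also have "sar (arr_fun E k) ?i ?WB = sob (WkF E ?A) ?B"
    using sf_functor_sob[OF dom.arr_fun_functor[OF k] dom.strict dom.strict WB]
      sf_eqD(1)[OF dom.arr_fun_Wk[OF k] t(7,8)] by simp
  finally show ?thesis
    using term_catD(4)[OF l] assms(3,4) by (simp add: hom_arr_def)
qed

text \<open>The pair of functors before restriction to the carriers, which is added by
  \<open>E2CE_hom_raw\<close>.\<close>

definition "raw = \<lparr>famF = func.truncate (over H), ctxF = \<lparr>oMap = aMap H, aMap = hom_arr E H\<rparr>\<rparr>"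

lemma raw_simps [simp]:
  "oMap (famF raw) A = aMap H A" "aMap (famF raw) (Pr A Q) = Pr (aMap H A) (aMap H Q)"
  "oMap (ctxF raw) A = aMap H A" "aMap (ctxF raw) k = hom_arr E H k"
  by (simp_all add: raw_def over_def func.truncate_def)

lemma E2CE_hom_raw: "E2CE_hom E H = cerestrict (E2CE_obj E) raw"
proof -
  have "hom_arr E H = (\<lambda>k. tarr (aMap H (tsrc k)) (aMap H (ttgt k))
      (tMap H (oMap (Wk E (tsrc k)) (ttgt k)) (tterm k)))"
    by (simp add: fun_eq_iff hom_arr_def sf_of_def)
  then show ?thesis by (simp add: E2CE_hom_def raw_def)
qed

text \<open>Each equation between arrows of the term category becomes, by
  \<open>hom_arr_eqI\<close>, an equation of functors preceded by \<open>sf_lift H\<close>, and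
  \<open>H\<close> is then moved across by its commutation with \<open>W\<close> and with functors
  of arrows.\<close>

lemma E2CE_CE_hom: "CE_hom (E2CE_obj E) (E2CE_obj D) raw"
proof -
  let ?r = "root E" and ?s = "root D" and ?L = "sf_lift H"
  have r: "?r \<in> Obj E" by (rule dom.root_Obj)
  note arr = hom_arr[OF _ r, unfolded root_eq]
  interpret SE: strict_category "slice E ?r" by (rule strict_category_slice[OF dom.strict])
  interpret SD: strict_category "slice D ?s" by (rule strict_category_slice[OF cod.strict])
  interpret TE: strict_category "term_cat E ?r" by (rule dom.term_cat_strict_category)
  interpret TD: strict_category "term_cat D ?s" by (rule cod.term_cat_strict_category)
  have L: "sf_functor E (src E A) D (oMap H (src E A)) ?L" if "A \<in> Arr E" for A
    using that by (intro lift_functor) simp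
  have "strict_functor (slice E ?r) (slice D ?s) (famF raw)"
  proof
    fix A assume "A \<in> Obj (slice E ?r)"
    then show "oMap (famF raw) A \<in> Obj (slice D ?s)"
      "aMap (famF raw) (idm (slice E ?r) A) = idm (slice D ?s) (oMap (famF raw) A)"
      by (simp_all add: root_eq)
  next
    fix f assume "f \<in> Arr (slice E ?r)"
    then obtain A Q where "f = Pr A Q" "A \<in> into E ?r" "Q \<in> into E (src E A)"
      unfolding Arr_slice by blast
    then show "aMap (famF raw) f \<in> Hom (slice D ?s) (oMap (famF raw) (src (slice E ?r) f))
        (oMap (famF raw) (tgt (slice E ?r) f))"
      by (simp add: mem_Hom_iff root_eq)
  next
    fix f g a b c assume "f \<in> Hom (slice E ?r) a b" "g \<in> Hom (slice E ?r) b c"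
    then obtain Q R where f: "f = Pr b Q" and g: "g = Pr c R" and c: "c \<in> into E ?r"
      and R: "R \<in> into E (src E c)" and Q: "Q \<in> into E (src E b)" and bc: "b = c \<cdot>\<^bsub>E\<^esub> R"
      unfolding Hom_slice by blast
    have "src E b = src E R" using R c by (simp add: bc)
    then show "aMap (famF raw) (g \<cdot>\<^bsub>slice E ?r\<^esub> f) = aMap (famF raw) g \<cdot>\<^bsub>slice D ?s\<^esub> aMap (famF raw) f"
      using R Q by (simp add: f g)
  qed
  moreover have "strict_functor (term_cat E ?r) (term_cat D ?s) (ctxF raw)"
  proof
    fix A assume "A \<in> Obj (term_cat E ?r)"
    then have A: "A \<in> into E ?r" by simp
    then have HA: "aMap H A \<in> into D ?s" by (simp add: root_eq)
    then show "oMap (ctxF raw) A \<in> Obj (term_cat D ?s)" by simp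
    note i = dom.idm_arr[OF A] and j = cod.idm_arr[OF HA]
    have "hom_arr E H (tarr A A (idtm E A)) = tarr (aMap H A) (aMap H A) (idtm D (aMap H A))"
    proof (rule hom_arr_eqI[OF i(1) j(1)])
      have 1: "sf_eq E (src E A) (arr_fun D (tarr (aMap H A) (aMap H A) (idtm D (aMap H A))) \<odot> ?L) (sf_id \<odot> ?L)"
        using j(2) A by (intro sf_eq_comp_left[OF _ L]) simp_all
      have 2: "sf_eq E (src E A) (?L \<odot> arr_fun E (tarr A A (idtm E A))) (?L \<odot> sf_id)"
        by (rule sf_eq_comp_right[OF i(2)])
      show "sf_eq E (src E (ttgt (tarr A A (idtm E A))))
          (arr_fun D (tarr (aMap H A) (aMap H A) (idtm D (aMap H A))) \<odot> ?L)
          (?L \<odot> arr_fun E (tarr A A (idtm E A)))"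
        using sf_eq_trans[OF 1[unfolded sf_comp_id] sf_eq_sym[OF 2[unfolded sf_comp_id]]] by simp
    qed simp_all
    then show "aMap (ctxF raw) (idm (term_cat E ?r) A) = idm (term_cat D ?s) (oMap (ctxF raw) A)"
      by simp
  next
    fix f assume "f \<in> Arr (term_cat E ?r)"
    then show "aMap (ctxF raw) f \<in> Hom (term_cat D ?s) (oMap (ctxF raw) (src (term_cat E ?r) f))
        (oMap (ctxF raw) (tgt (term_cat E ?r) f))"
      using arr(1) by (simp add: mem_Hom_iff)
  next
    fix f g a b c assume "f \<in> Hom (term_cat E ?r) a b" "g \<in> Hom (term_cat E ?r) b c"
    then have f: "f \<in> Arr (term_cat E ?r)" and g: "g \<in> Arr (term_cat E ?r)" and fg: "ttgt f = tsrc g"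
      by (simp_all add: mem_Hom_iff)
    note Hf = arr[OF f] and Hg = arr[OF g]
    note c = dom.cmp_arr[OF g f fg]
    have "ttgt (hom_arr E H f) = tsrc (hom_arr E H g)" using fg by simp
    note d = cod.cmp_arr[OF Hg(1) Hf(1) this]
    note tg = term_catD[OF g]
    have sg: "src D (aMap H (ttgt g)) = oMap H (src E (ttgt g))" using tg by simp
    have "hom_arr E H (g \<cdot>\<^bsub>term_cat E ?r\<^esub> f) = hom_arr E H g \<cdot>\<^bsub>term_cat D ?s\<^esub> hom_arr E H f"
    proof (rule hom_arr_eqI[OF c(1) d(1)], unfold c(3))
      have "sf_eq E (src E (ttgt g)) (arr_fun D (hom_arr E H g \<cdot>\<^bsub>term_cat D ?s\<^esub> hom_arr E H f) \<odot> ?L)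
          ((arr_fun D (hom_arr E H f) \<odot> arr_fun D (hom_arr E H g)) \<odot> ?L)"
        using d(4) tg sg by (intro sf_eq_comp_left[OF _ L]) simp_all
      also have "\<dots> = arr_fun D (hom_arr E H f) \<odot> arr_fun D (hom_arr E H g) \<odot> ?L"
        by (rule sf_comp_assoc)
      also have "sf_eq E (src E (ttgt g)) \<dots> (arr_fun D (hom_arr E H f) \<odot> ?L \<odot> arr_fun E g)"
        by (rule sf_eq_comp_right[OF Hg(2)])
      also have "\<dots> = (arr_fun D (hom_arr E H f) \<odot> ?L) \<odot> arr_fun E g" by (simp add: sf_comp_assoc)
      also have "sf_eq E (src E (ttgt g)) \<dots> ((?L \<odot> arr_fun E f) \<odot> arr_fun E g)"
        using Hf(2) fg dom.arr_fun_functor[OF g] by (intro sf_eq_comp_left) simp_all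
      also have "\<dots> = ?L \<odot> arr_fun E f \<odot> arr_fun E g" by (rule sf_comp_assoc)
      also have "sf_eq E (src E (ttgt g)) \<dots> (?L \<odot> arr_fun E (g \<cdot>\<^bsub>term_cat E ?r\<^esub> f))"
        by (rule sf_eq_comp_right[OF sf_eq_sym[OF c(4)]])
      finally show "sf_eq E (src E (ttgt g)) (arr_fun D (hom_arr E H g \<cdot>\<^bsub>term_cat D ?s\<^esub> hom_arr E H f) \<odot> ?L)
        (?L \<odot> arr_fun E (g \<cdot>\<^bsub>term_cat E ?r\<^esub> f))" .
    qed (simp_all add: c d)
    then show "aMap (ctxF raw) (g \<cdot>\<^bsub>term_cat E ?r\<^esub> f) = aMap (ctxF raw) g \<cdot>\<^bsub>term_cat D ?s\<^esub> aMap (ctxF raw) f"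
      by simp
  qed
  moreover have "hom_arr E H (incl (E2CE_obj E) (Pr A Q)) = incl (E2CE_obj D) (Pr (aMap H A) (aMap H Q))"
    if A: "A \<in> into E ?r" and Q: "Q \<in> into E (src E A)" for A Q
  proof -
    have HA: "aMap H A \<in> into D ?s" "aMap H Q \<in> into D (src D (aMap H A))" using A Q by (simp_all add: root_eq)
    note i = dom.incl_arr[OF A Q] and j = cod.incl_arr[OF HA]
    show ?thesis
    proof (rule hom_arr_eqI[OF i(1) j(1)], unfold i(3))
      have "sf_eq E (src E A) (arr_fun D (incl (E2CE_obj D) (Pr (aMap H A) (aMap H Q))) \<odot> ?L) (WkF D (aMap H Q) \<odot> ?L)"
        using j(4) A by (intro sf_eq_comp_left[OF _ L]) simp_all
      also have "sf_eq E (src E A) \<dots> (?L \<odot> WkF E Q)" using lift_Wk[of Q] Q by (simp add: sf_eq_sym)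
      also have "sf_eq E (src E A) \<dots> (?L \<odot> arr_fun E (incl (E2CE_obj E) (Pr A Q)))"
        by (rule sf_eq_comp_right[OF sf_eq_sym[OF i(4)]])
      finally show "sf_eq E (src E A) (arr_fun D (incl (E2CE_obj D) (Pr (aMap H A) (aMap H Q))) \<odot> ?L)
        (?L \<odot> arr_fun E (incl (E2CE_obj E) (Pr A Q)))" .
    qed (use A Q in simp_all)
  qed
  moreover have "aMap H (sob (arr_fun E k) R) = sob (arr_fun D (hom_arr E H k)) (aMap H R)"
    if "k \<in> Arr (term_cat E ?r)" "R \<in> into E (src E (ttgt k))" for k R
    using sf_eqD(1)[OF arr(2)[OF that(1)], of R] that(2) by simp
  moreover have "hom_arr E H (pi2 (E2CE_obj E) k (Pr (ttgt k) R)) =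
      pi2 (E2CE_obj D) (hom_arr E H k) (Pr (aMap H (ttgt k)) (aMap H R))"
    if k: "k \<in> Arr (term_cat E ?r)" and R: "R \<in> into E (src E (ttgt k))" for k R
  proof -
    note t = term_catD[OF k] and Hk = arr[OF k]
    have R': "R \<in> Arr E" "tgt E R = src E (ttgt k)" using R by simp_all
    have HR: "aMap H R \<in> into D (src D (ttgt (hom_arr E H k)))" using R t by simp
    note p = dom.pi2_arr[OF k R] and q = cod.pi2_arr[OF Hk(1) HR, unfolded hom_arr_simps]
    have X: "aMap H (sob (arr_fun E k) R) = sob (arr_fun D (hom_arr E H k)) (aMap H R)"
      using sf_eqD(1)[OF Hk(2) R'] by simp
    note fk = sf_functorD[OF dom.arr_fun_functor[OF k]]
    have sR: "src E (ttgt k \<cdot>\<^bsub>E\<^esub> R) = src E R" using t R' by simp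
    have LB: "sf_functor E (src E (ttgt k)) D (oMap H (src E (ttgt k))) ?L" using L t by simp
    show ?thesis
    proof (rule hom_arr_eqI[OF p(1) q(1)], unfold p(3) sR)
      have "sf_eq E (src E R) (arr_fun D (pi2 (E2CE_obj D) (hom_arr E H k) (Pr (aMap H (ttgt k)) (aMap H R))) \<odot> ?L)
          (sliced D (arr_fun D (hom_arr E H k)) (aMap H R) \<odot> ?L)"
        using q(4) R' by (intro sf_eq_comp_left[OF _ L]) simp_all
      also have "sf_eq E (src E R) \<dots> (sliced E (arr_fun D (hom_arr E H k) \<odot> ?L) R)"
        using sf_eq_sym[OF sliced_comp[OF LB R', of "arr_fun D (hom_arr E H k)"]] by simp
      also have "sf_eq E (src E R) \<dots> (sliced E (?L \<odot> arr_fun E k) R)"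
        by (rule sf_eq_sliced[OF Hk(2) dom.strict R'])
      also have "sf_eq E (src E R) \<dots> (?L \<odot> sliced E (arr_fun E k) R)"
        using sliced_comp[OF dom.arr_fun_functor[OF k] R', of ?L] by simp
      also have "sf_eq E (src E R) \<dots> (?L \<odot> arr_fun E (pi2 (E2CE_obj E) k (Pr (ttgt k) R)))"
        by (rule sf_eq_comp_right[OF sf_eq_sym[OF p(4)]])
      finally show "sf_eq E (src E R) (arr_fun D (pi2 (E2CE_obj D) (hom_arr E H k) (Pr (aMap H (ttgt k)) (aMap H R))) \<odot> ?L)
        (?L \<odot> arr_fun E (pi2 (E2CE_obj E) k (Pr (ttgt k) R)))" .
    qed (use t R' in \<open>simp_all add: p q fk X\<close>)
  qed
  ultimately show ?thesis
    unfolding CE_hom_def E2CE_obj_simps(1,2) ball_Arr_slice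
    by (simp del: E2CE_obj_simps(4) add: root_eq r)
qed

end

lemma E_homI: "\<lbrakk>E_system E; E_system D; pre_E_hom E D H\<rbrakk> \<Longrightarrow> E_hom E D H"
  by (simp add: E_hom_def E_hom_axioms_def E_system_iff)

lemma CE_system_E2CE_obj: "E_system E \<Longrightarrow> CE_system (E2CE_obj E)"
  by (simp add: E_system_iff sf_E_system.CE_system_E2CE)

lemma E2CE_functor: "strict_functor (Esys :: ('u esys, 'u esys_arr) scat) CEsys E2CE"
proof -
  interpret C: strict_category "CEsys :: ('u cesys, 'u cesys_arr) scat" by (rule CEsys_strict_category)
  interpret E: strict_category "Esys :: ('u esys, 'u esys_arr) scat" by (rule Esys_strict_category)
  have o: "oMap E2CE E = E2CE_obj E" and a: "aMap E2CE (E, H, D) = (E2CE_obj E, E2CE_hom E H, E2CE_obj D)"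
    for E D :: "'u esys" and H
    by (simp_all add: E2CE_def)
  show ?thesis
  proof
    fix E :: "'u esys" assume "E \<in> Obj Esys"
    then have E: "E_system E" by simp
    then show "oMap E2CE E \<in> Obj CEsys" by (simp add: o CE_system_E2CE_obj)
    interpret I: E_hom E E "trestrict E tid"
      using E E_hom_trestrict pre_E_hom_id E_system_sf_pre by (intro E_homI) blast+
    have "cefunc_eq (E2CE_obj E) I.raw ce_id"
    proof -
      have "hom_arr E (trestrict E tid) k = k" if k: "k \<in> Arr (term_cat E (root E))" for k
      proof -
        note t = term_catD[OF k]
        have "sob (WkF E (tsrc k)) (ttgt k) \<in> Arr E"
          using sf_functorD(4)[OF I.dom.WkF_functor[of "tsrc k"], of "ttgt k"] t by simp
        then show ?thesis using t by (simp add: hom_arr_def thom_eq)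
      qed
      then show ?thesis by (simp add: cefunc_eq_def ball_Arr_slice)
    qed
    then show "aMap E2CE (idm Esys E) = idm CEsys (oMap E2CE E)"
      by (simp add: o a I.E2CE_hom_raw cerestrict_eq_iff)
  next
    fix f :: "'u esys_arr" assume "f \<in> Arr Esys"
    then obtain E H D where f: "f = (E, H, D)" "E_system E" "E_system D" "pre_E_hom E D H"
      by (cases f) auto
    interpret H: E_hom E D H using f by (intro E_homI)
    show "aMap E2CE f \<in> Hom CEsys (oMap E2CE (src Esys f)) (oMap E2CE (tgt Esys f))"
      using CE_hom_cerestrict[OF CE_system_E2CE_obj[OF f(2)] H.E2CE_CE_hom] f
        CE_system_E2CE_obj[OF f(2)] CE_system_E2CE_obj[OF f(3)]
      by (simp add: o a Hom_CEsys H.E2CE_hom_raw)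
  next
    fix f g :: "'u esys_arr" and a b c assume "f \<in> Hom Esys a b" "g \<in> Hom Esys b c"
    then obtain H K where f: "f = (a, H, b)" "E_system a" "E_system b" "pre_E_hom a b H"
      and g: "g = (b, K, c)" "E_system c" "pre_E_hom b c K"
      unfolding Hom_Esys by blast
    have KH: "pre_E_hom a c (trestrict a (tcomp K H))"
      using E_hom_trestrict[OF f(2) g(2) pre_E_hom_comp[OF f(4) g(3)]] f(2,3) g(2)
      by (simp add: E_system_sf_pre)
    interpret H: E_hom a b H using f by (intro E_homI)
    interpret K: E_hom b c K using f g by (intro E_homI)
    interpret KH: E_hom a c "trestrict a (tcomp K H)" using f g KH by (intro E_homI)
    have "hom_arr a (trestrict a (tcomp K H)) k = hom_arr b K (hom_arr a H k)"
      if k: "k \<in> Arr (term_cat a (root a))" for k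
    proof -
      note t = term_catD[OF k]
      have "sob (WkF a (tsrc k)) (ttgt k) \<in> Arr a"
        using sf_functorD(4)[OF H.dom.WkF_functor[of "tsrc k"], of "ttgt k"] t by simp
      then show ?thesis
        using t H.lift_Wk_sob[of "tsrc k" "ttgt k"] by (simp add: hom_arr_def thom_eq)
    qed
    moreover have "hom_arr a H k \<in> Arr (term_cat b (root b))" if "k \<in> Arr (term_cat a (root a))" for k
      using H.hom_arr(1)[OF that H.dom.root_Obj] by (simp add: H.root_eq)
    ultimately have "cefunc_eq (E2CE_obj a) KH.raw (ce_comp (E2CE_hom b K) (E2CE_hom a H))"
      by (simp add: cefunc_eq_def ball_Arr_slice H.E2CE_hom_raw K.E2CE_hom_raw H.root_eq)
    then show "aMap E2CE (g \<cdot>\<^bsub>Esys\<^esub> f) = aMap E2CE g \<cdot>\<^bsub>CEsys\<^esub> aMap E2CE f"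
      by (simp add: f(1) g(1) a KH.E2CE_hom_raw cerestrict_eq_iff)
  qed
qed


section \<open>The counit\<close>

text \<open>CE-systems are algebraic structures, so a bijective homomorphism has a homomorphic
  inverse: each equation for \<open>G\<close> follows from the one for \<open>F\<close> at
  preimages.\<close>

lemma CE_hom_bij_imp_iso:
  assumes "CE_system X" "CE_system Y" "CE_hom X Y F" "cerestrict X F = F"
    and bo: "bij_betw (oMap (famF F)) (Obj (fam X)) (Obj (fam Y))"
    and ba: "bij_betw (aMap (famF F)) (Arr (fam X)) (Arr (fam Y))"
    and bc: "bij_betw (aMap (ctxF F)) (Arr (ctx X)) (Arr (ctx Y))"
  shows "is_iso CEsys (X, F, Y)"
proof -
  interpret X: CE_system X by fact
  interpret Y: CE_system Y by fact
  note F = CE_homD[OF assms(3)]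
  interpret FF: strict_functor "fam X" "fam Y" "famF F" by (rule F(1))
  interpret FC: strict_functor "ctx X" "ctx Y" "ctxF F" by (rule F(2))
  define G where "G = \<lparr>famF = \<lparr>oMap = inv_into (Obj (fam X)) (oMap (famF F)), aMap = inv_into (Arr (fam X)) (aMap (famF F))\<rparr>,
    ctxF = \<lparr>oMap = inv_into (Obj (fam X)) (oMap (famF F)), aMap = inv_into (Arr (ctx X)) (aMap (ctxF F))\<rparr>\<rparr>"
  have Gsel [simp]: "oMap (famF G) = inv_into (Obj (fam X)) (oMap (famF F))"
    "aMap (famF G) = inv_into (Arr (fam X)) (aMap (famF F))"
    "oMap (ctxF G) = inv_into (Obj (fam X)) (oMap (famF F))"
    "aMap (ctxF G) = inv_into (Arr (ctx X)) (aMap (ctxF F))"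
    by (simp_all add: G_def)
  have bo': "bij_betw (oMap (ctxF F)) (Obj (ctx X)) (Obj (ctx Y))"
    using bo bij_betw_cong[of "Obj (fam X)" "oMap (famF F)" "oMap (ctxF F)" "Obj (fam Y)"] F(3) by simp
  \<comment> \<open>The object parts of the two functors agree on the common set of objects, and
    \<open>inv_into\<close> depends only on the values there.\<close>
  have inv_o: "inv_into (Obj (fam X)) (oMap (famF F)) a = inv_into (Obj (ctx X)) (oMap (ctxF F)) a"
    for a
    by (simp add: inv_into_def F(3) cong: conj_cong)
  have G1: "strict_functor (fam Y) (fam X) (famF G)"
    by (rule strict_functor_inverse[OF F(1) bo ba]) simp_all
  have G2: "strict_functor (ctx Y) (ctx X) (ctxF G)"
    by (rule strict_functor_inverse[OF F(2) bo' bc]) (simp_all add: inv_o)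
  interpret GF: strict_functor "fam Y" "fam X" "famF G" by (rule G1)
  interpret GC: strict_functor "ctx Y" "ctx X" "ctxF G" by (rule G2)
  have FGo: "oMap (famF F) (oMap (famF G) a) = a" if "a \<in> Obj (fam Y)" for a
    using that bo by (simp add: bij_betw_inv_into_right)
  have FGa: "aMap (famF F) (aMap (famF G) A) = A" if "A \<in> Arr (fam Y)" for A
    using that ba by (simp add: bij_betw_inv_into_right)
  have FGc: "aMap (ctxF F) (aMap (ctxF G) f) = f" if "f \<in> Arr (ctx Y)" for f
    using that bc by (simp add: bij_betw_inv_into_right)
  have GFo: "oMap (famF G) (oMap (famF F) a) = a" if "a \<in> Obj (fam X)" for a
    using that bo by (simp add: bij_betw_inv_into_left)
  have GFa: "aMap (famF G) (aMap (famF F) A) = A" if "A \<in> Arr (fam X)" for A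
    using that ba by (simp add: bij_betw_inv_into_left)
  have GFc: "aMap (ctxF G) (aMap (ctxF F) f) = f" if "f \<in> Arr (ctx X)" for f
    using that bc by (simp add: bij_betw_inv_into_left)
  have "CE_hom Y X G"
    unfolding CE_hom_def
  proof (intro conjI ballI impI G1 G2)
    fix A assume A: "A \<in> Arr (fam Y)"
    have "aMap (ctxF G) (incl Y A) = aMap (ctxF G) (aMap (ctxF F) (incl X (aMap (famF G) A)))"
      using A F(4)[of "aMap (famF G) A"] FGa GF.aMap_simps(1) by simp
    then show "aMap (ctxF G) (incl Y A) = incl X (aMap (famF G) A)"
      using A GFc GF.aMap_simps(1) by (simp del: Gsel)
  next
    show "oMap (famF G) (one Y) = one X"
      using GFo[of "one X"] F(5) X.one_terminal by (simp add: terminal_def)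
  next
    fix f A assume f: "f \<in> Arr (ctx Y)" and A: "A \<in> Arr (fam Y)" and t: "tgt (fam Y) A = tgt (ctx Y) f"
    let ?f = "aMap (ctxF G) f" and ?A = "aMap (famF G) A"
    have fA: "?f \<in> Arr (ctx X)" "?A \<in> Arr (fam X)" "tgt (fam X) ?A = tgt (ctx X) ?f"
      using f A t GC.aMap_simps[OF f] GF.aMap_simps[OF A] by (simp_all del: Gsel(2,4))
    have e: "aMap (ctxF F) ?f = f" "aMap (famF F) ?A = A" using FGc[OF f] FGa[OF A] by simp_all
    show "aMap (famF G) (pb Y f A) = pb X ?f ?A"
      using F(6)[OF fA] GFa[of "pb X ?f ?A"] fA unfolding e by (simp del: Gsel)
    show "aMap (ctxF G) (pi2 Y f A) = pi2 X ?f ?A"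
      using F(7)[OF fA] GFc[of "pi2 X ?f ?A"] fA unfolding e by (simp del: Gsel)
  qed simp
  then have G: "(Y, cerestrict Y G, X) \<in> Hom CEsys Y X"
    using assms(1,2) CE_hom_cerestrict[OF assms(2)] by (simp add: Hom_CEsys)
  have "cerestrict X (ce_comp (cerestrict Y G) F) = cerestrict X ce_id"
    unfolding cerestrict_eq_iff
    using GFo GFa GFc F(3) by (simp add: cefunc_eq_def del: Gsel(1,2,4)) (simp del: Gsel(2,4) flip: Gsel(1))
  moreover have "cerestrict Y (ce_comp F (cerestrict Y G)) = cerestrict Y ce_id"
    unfolding cerestrict_eq_iff
    using FGo FGa FGc F(3) GF.oMap_obj by (simp add: cefunc_eq_def del: Gsel(1,2,4)) (simp del: Gsel(2,4) flip: Gsel(1))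
  ultimately show ?thesis
    unfolding is_iso_def using assms(1-4) G
    by (intro conjI bexI[of _ "(Y, cerestrict Y G, X)"]) simp_all
qed

section \<open>The action of the counit on arrows\<close>

context CE_system
begin

abbreviation "\<E> \<equiv> CE2E_obj X"

definition "eps k = pi2 X (incl X (tsrc k)) (ttgt k) \<cdot>\<^bsub>\<C>\<^esub> tterm k"

text \<open>The reindexing functor of \<open>k\<close> is pullback along the section
  \<open>z\<close> after pullback along the projection, hence pullback along their composite
  \<open>eps k\<close>. The triangle over the base comes from the pullback square and from
  \<open>z\<close> being a section.\<close>

lemma eps:
  assumes "k \<in> Arr (term_cat \<E> \<Gamma>)"
  shows eps_Arr: "eps k \<in> Arr \<C>" and src_eps: "src \<C> (eps k) = src \<F> (tsrc k)"
    and tgt_eps: "tgt \<C> (eps k) = src \<F> (ttgt k)"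
    and incl_eps: "incl X (ttgt k) \<cdot>\<^bsub>\<C>\<^esub> eps k = incl X (tsrc k)"
    and arr_fun_eps: "sf_eq \<E> (src \<F> (ttgt k)) (arr_fun \<E> k) (pbF X (eps k))"
proof -
  let ?A = "tsrc k" and ?B = "ttgt k" and ?z = "tterm k"
  have A: "?A \<in> Arr \<F>" "tgt \<F> ?A = \<Gamma>" and B: "?B \<in> Arr \<F>" "tgt \<F> ?B = \<Gamma>"
    and z: "?z \<in> sections X (pb X (incl X ?A) ?B)"
    using term_catD[OF assms] by (simp_all add: thom_eq)
  let ?p = "pi2 X (incl X ?A) ?B" and ?W = "pb X (incl X ?A) ?B"
  have W: "?W \<in> Arr \<F>" "tgt \<F> ?W = src \<F> ?A" using A B by simp_all
  note za = sections_arr[OF z]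
  have p: "?p \<in> Arr \<C>" "src \<C> ?p = src \<F> ?W" "tgt \<C> ?p = src \<F> ?B" using A B by simp_all
  show "eps k \<in> Arr \<C>" "src \<C> (eps k) = src \<F> ?A" "tgt \<C> (eps k) = src \<F> ?B"
    using p za W by (simp_all add: eps_def)
  have "incl X ?B \<cdot>\<^bsub>\<C>\<^esub> eps k = (incl X ?B \<cdot>\<^bsub>\<C>\<^esub> ?p) \<cdot>\<^bsub>\<C>\<^esub> ?z"
    using p za(1-3) B by (simp add: eps_def)
  also have "incl X ?B \<cdot>\<^bsub>\<C>\<^esub> ?p = incl X ?A \<cdot>\<^bsub>\<C>\<^esub> incl X ?W" using A B by (intro pb_commute) simp_all
  also have "(incl X ?A \<cdot>\<^bsub>\<C>\<^esub> incl X ?W) \<cdot>\<^bsub>\<C>\<^esub> ?z = incl X ?A \<cdot>\<^bsub>\<C>\<^esub> (incl X ?W \<cdot>\<^bsub>\<C>\<^esub> ?z)"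
    using A W za(1-3) by simp
  also have "\<dots> = incl X ?A" unfolding za(4) W(2) using A by simp
  finally show "incl X ?B \<cdot>\<^bsub>\<C>\<^esub> eps k = incl X ?A" .
  have "sf_eq \<E> (src \<F> ?B) (arr_fun \<E> k) (pbF X ?z \<odot> pbF X ?p)"
    using sliced_pbF[of "incl X ?A" ?B] A B by (simp add: arr_fun_def RxF_eq sf_eq_comp_right)
  also have "sf_eq \<E> (src \<F> ?B) \<dots> (pbF X (eps k))"
    using sf_eq_sym[OF pbF_cmp[OF p(1) za(1)]] p za by (simp add: eps_def)
  finally show "sf_eq \<E> (src \<F> ?B) (arr_fun \<E> k) (pbF X (eps k))" .
qed

interpretation E: sf_E_system \<E> by (rule sf_E_system_CE2E)

text \<open>The inverse of \<open>eps\<close> on arrows over the base. The term of the arrow with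
  functor \<open>p\<^sup>*\<close> is the pullback along \<open>p\<close> of the diagonal of
  \<open>B\<close>, and projecting the diagonal gives the identity, so \<open>p\<close> is
  recovered.\<close>

lemma eps_arr_of:
  assumes A: "A \<in> Arr \<F>" "tgt \<F> A = \<Gamma>" and B: "B \<in> Arr \<F>" "tgt \<F> B = \<Gamma>"
    and p: "p \<in> Arr \<C>" "src \<C> p = src \<F> A" "tgt \<C> p = src \<F> B" "incl X B \<cdot>\<^bsub>\<C>\<^esub> p = incl X A"
  defines "k \<equiv> arr_of \<E> A B (pbF X p)"
  shows "k \<in> Arr (term_cat \<E> \<Gamma>)" "sf_eq \<E> (src \<F> B) (arr_fun \<E> k) (pbF X p)" "eps k = p"
proof -
  have hom: "sf_hom \<E> (src \<E> B) \<E> (src \<E> A) (pbF X p)" using pbF_hom[OF p(1)] p by simp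
  have wk: "sf_eq \<E> \<Gamma> (pbF X p \<odot> WkF \<E> B) (WkF \<E> A)"
    using sf_eq_sym[OF pbF_cmp[of "incl X B" p]] p B by simp
  have AB: "A \<in> into \<E> \<Gamma>" "B \<in> into \<E> \<Gamma>" using A B by simp_all
  note k = E.arr_of[OF AB hom wk, folded k_def]
  show "k \<in> Arr (term_cat \<E> \<Gamma>)" "sf_eq \<E> (src \<F> B) (arr_fun \<E> k) (pbF X p)" using k by simp_all
  let ?W = "pb X (incl X B) B"
  have W: "?W \<in> Arr \<F>" "tgt \<F> ?W = tgt \<C> p" using B p by simp_all
  note g = gen(1,2)[OF B(1)]
  note ga = sections_arr[OF g(1)]
  define z where "z = pb_section X p ?W (gen B)"
  note z = pb_section[OF p(1) W g(1), folded z_def]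
  note za = sections_arr[OF z(1)]
  have "tterm k = z"
    using B p pi2_idm[OF p(1)] W by (simp add: k_def arr_of_def term_of_def stm_pbF z_def flip: gen_def)
  then have "eps k = pi2 X (incl X B \<cdot>\<^bsub>\<C>\<^esub> p) B \<cdot>\<^bsub>\<C>\<^esub> z" by (simp add: eps_def k_def p(4))
  also have "\<dots> = pi2 X (incl X B) B \<cdot>\<^bsub>\<C>\<^esub> (pi2 X p ?W \<cdot>\<^bsub>\<C>\<^esub> z)"
    using B p(1-3) W za(1-3) by (simp add: pi2_along_cmp)
  also have "\<dots> = (pi2 X (incl X B) B \<cdot>\<^bsub>\<C>\<^esub> gen B) \<cdot>\<^bsub>\<C>\<^esub> p"
    unfolding z(2) using B p(1-3) ga(1-3) by simp
  also have "\<dots> = p" unfolding g(2) using p B by simp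
  finally show "eps k = p" .
qed

text \<open>By \<open>arr_fun_eps\<close> the functor of an arrow is determined by its image under
  \<open>eps\<close>, and the functor together with the endpoints determines the arrow.\<close>

lemma eps_inj:
  assumes "k \<in> Arr (term_cat \<E> \<Gamma>)" "l \<in> Arr (term_cat \<E> \<Gamma>)" "tsrc k = tsrc l" "ttgt k = ttgt l"
    and "eps k = eps l"
  shows "k = l"
  by (rule E.arr_eqI[OF assms(1-4) refl, of "pbF X (eps k)"])
    (use arr_fun_eps[OF assms(1)] arr_fun_eps[OF assms(2)] assms(4,5) in simp_all)

text \<open>The arrow that \<open>eps_arr_of\<close> builds from \<open>p\<close> has the endpoints
  and the functor of \<open>k\<close>, hence is \<open>k\<close>.\<close>

lemma eps_eqI:
  assumes k: "k \<in> Arr (term_cat \<E> \<Gamma>)" and "sf_eq \<E> (src \<F> (ttgt k)) (arr_fun \<E> k) (pbF X p)"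
    and p: "p \<in> Arr \<C>" "src \<C> p = src \<F> (tsrc k)" "tgt \<C> p = src \<F> (ttgt k)"
      "incl X (ttgt k) \<cdot>\<^bsub>\<C>\<^esub> p = incl X (tsrc k)"
  shows "eps k = p"
proof -
  note t = term_catD[OF k]
  note l = eps_arr_of[OF _ _ _ _ p, of \<Gamma>]
  have "k = arr_of \<E> (tsrc k) (ttgt k) (pbF X p)"
    by (rule E.arr_eqI[OF k l(1), of "ttgt k" "pbF X p"]) (use t l(2) assms(2) in simp_all)
  then show ?thesis using l(3) t by simp
qed

text \<open>The objects of the domain are arrows of \<open>fam X\<close> into \<open>one X\<close>,
  and the counit keeps only their sources; an arrow of the slice is sent to its underlying
  arrow.\<close>

definition "counit =
  \<lparr>famF = \<lparr>oMap = src \<F>, aMap = psnd\<rparr>, ctxF = \<lparr>oMap = src \<F>, aMap = eps\<rparr>\<rparr>"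

lemma counit_simps [simp]:
  "oMap (famF counit) = src \<F>" "aMap (famF counit) = psnd"
  "oMap (ctxF counit) = src \<F>" "aMap (ctxF counit) = eps"
  by (simp_all add: counit_def)

text \<open>Identities, composites, inclusions and projections of the term category are known
  through their functors. Once such a functor is recognised as pullback along an arrow over the
  base, \<open>eps_eqI\<close> gives the value of \<open>eps\<close>.\<close>

lemma counit_CE_hom: "CE_hom (E2CE_obj \<E>) X counit"
proof -
  let ?S = "slice \<E> (one X)" and ?T = "term_cat \<E> (one X)"
  interpret S: strict_category ?S by (rule strict_category_slice[OF E.strict])
  interpret T: strict_category ?T by (rule E.term_cat_strict_category)
  have "strict_functor ?S \<F> (famF counit)"
  proof
    fix f assume "f \<in> Arr ?S"
    then obtain A Q where "f = Pr A Q" "A \<in> into \<E> (one X)" "Q \<in> into \<E> (src \<E> A)"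
      unfolding Arr_slice by blast
    then show "aMap (famF counit) f \<in> Hom \<F> (oMap (famF counit) (src ?S f)) (oMap (famF counit) (tgt ?S f))"
      by (simp add: mem_Hom_iff)
  qed simp_all
  moreover have "strict_functor ?T \<C> (ctxF counit)"
  proof
    fix A assume "A \<in> Obj ?T"
    then have A: "A \<in> into \<E> (one X)" by simp
    then show "oMap (ctxF counit) A \<in> Obj \<C>" by simp
    note i = E.idm_arr[OF A]
    have "eps (tarr A A (idtm \<E> A)) = idm \<C> (src \<F> A)"
    proof (rule eps_eqI[OF i(1)])
      show "sf_eq \<E> (src \<F> (ttgt (tarr A A (idtm \<E> A)))) (arr_fun \<E> (tarr A A (idtm \<E> A)))
        (pbF X (idm \<C> (src \<F> A)))"
        using sf_eq_trans[OF i(2) sf_eq_sym[OF pbF_idm]] A by simp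
    qed (use A in simp_all)
    then show "aMap (ctxF counit) (idm ?T A) = idm \<C> (oMap (ctxF counit) A)" by simp
  next
    fix f assume "f \<in> Arr ?T"
    then show "aMap (ctxF counit) f \<in> Hom \<C> (oMap (ctxF counit) (src ?T f)) (oMap (ctxF counit) (tgt ?T f))"
      using eps(1-3) by (simp add: mem_Hom_iff)
  next
    fix f g a b c assume "f \<in> Hom ?T a b" "g \<in> Hom ?T b c"
    then have f: "f \<in> Arr ?T" and g: "g \<in> Arr ?T" and fg: "ttgt f = tsrc g"
      by (simp_all add: mem_Hom_iff)
    note c = E.cmp_arr[OF g f fg]
    note tf = term_catD[OF f] and tg = term_catD[OF g]
    note ef = eps[OF f] and eg = eps[OF g]
    have "eps (g \<cdot>\<^bsub>?T\<^esub> f) = eps g \<cdot>\<^bsub>\<C>\<^esub> eps f"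
    proof (rule eps_eqI[OF c(1)], unfold c(2,3))
      have "sf_eq \<E> (src \<F> (ttgt g)) (arr_fun \<E> (g \<cdot>\<^bsub>?T\<^esub> f)) (arr_fun \<E> f \<odot> arr_fun \<E> g)"
        using c(4) by simp
      also have "sf_eq \<E> (src \<F> (ttgt g)) \<dots> (pbF X (eps f) \<odot> arr_fun \<E> g)"
        using ef(5) fg E.arr_fun_functor[OF g] by (intro sf_eq_comp_left) simp_all
      also have "sf_eq \<E> (src \<F> (ttgt g)) \<dots> (pbF X (eps f) \<odot> pbF X (eps g))"
        by (rule sf_eq_comp_right[OF eg(5)])
      also have "sf_eq \<E> (src \<F> (ttgt g)) \<dots> (pbF X (eps g \<cdot>\<^bsub>\<C>\<^esub> eps f))"
        using sf_eq_sym[OF pbF_cmp[OF eg(1) ef(1)]] ef eg fg by simp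
      finally show "sf_eq \<E> (src \<F> (ttgt g)) (arr_fun \<E> (g \<cdot>\<^bsub>?T\<^esub> f)) (pbF X (eps g \<cdot>\<^bsub>\<C>\<^esub> eps f))" .
      have "incl X (ttgt g) \<cdot>\<^bsub>\<C>\<^esub> (eps g \<cdot>\<^bsub>\<C>\<^esub> eps f) = (incl X (ttgt g) \<cdot>\<^bsub>\<C>\<^esub> eps g) \<cdot>\<^bsub>\<C>\<^esub> eps f"
        using ef(1-3) eg(1-3) fg tg by simp
      then show "incl X (ttgt g) \<cdot>\<^bsub>\<C>\<^esub> (eps g \<cdot>\<^bsub>\<C>\<^esub> eps f) = incl X (tsrc f)"
        unfolding eg(4) using ef(4) fg by simp
    qed (use ef(1-3) eg(1-3) fg in simp_all)
    then show "aMap (ctxF counit) (g \<cdot>\<^bsub>?T\<^esub> f) = aMap (ctxF counit) g \<cdot>\<^bsub>\<C>\<^esub> aMap (ctxF counit) f"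
      by simp
  qed
  moreover have "eps (incl (E2CE_obj \<E>) (Pr A Q)) = incl X Q"
    if A: "A \<in> into \<E> (one X)" and Q: "Q \<in> into \<E> (src \<E> A)" for A Q
  proof -
    note i = E.incl_arr[OF A Q]
    show ?thesis
      by (rule eps_eqI[OF i(1)], unfold i(2,3)) (use i(4) A Q in simp_all)
  qed
  moreover have "sob (arr_fun \<E> k) R = pb X (eps k) R"
    if "k \<in> Arr ?T" "R \<in> into \<E> (src \<E> (ttgt k))" for k R
    using sf_eqD(1)[OF arr_fun_eps[OF that(1)], of R] that(2) by simp
  moreover have "eps (pi2 (E2CE_obj \<E>) k (Pr (ttgt k) R)) = pi2 X (eps k) R"
    if k: "k \<in> Arr ?T" and R: "R \<in> into \<E> (src \<E> (ttgt k))" for k R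
  proof -
    note p = E.pi2_arr[OF k R] and t = term_catD[OF k] and e = eps[OF k]
    have R': "R \<in> Arr \<F>" "tgt \<F> R = src \<F> (ttgt k)" using R by simp_all
    have h: "sob (arr_fun \<E> k) R = pb X (eps k) R" using sf_eqD(1)[OF e(5), of R] R' by simp
    have sBR: "src \<F> (ttgt k \<cdot>\<^bsub>\<F>\<^esub> R) = src \<F> R" using t R' by simp
    have tR: "tgt \<F> R = tgt \<C> (eps k)" using R' e by simp
    show ?thesis
    proof (rule eps_eqI[OF p(1)], unfold p(2,3) h CE2E_obj_simps sBR)
      have "sf_eq \<E> (src \<F> R) (arr_fun \<E> (pi2 (E2CE_obj \<E>) k (Pr (ttgt k) R))) (sliced \<E> (arr_fun \<E> k) R)"
        using p(4) by simp
      also have "sf_eq \<E> (src \<F> R) \<dots> (sliced \<E> (pbF X (eps k)) R)"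
        using sf_eq_sliced[OF e(5) E.strict] R' by simp
      also have "sf_eq \<E> (src \<F> R) \<dots> (pbF X (pi2 X (eps k) R))"
        by (rule sliced_pbF[OF e(1) R'(1) tR])
      finally show "sf_eq \<E> (src \<F> R) (arr_fun \<E> (pi2 (E2CE_obj \<E>) k (Pr (ttgt k) R))) (pbF X (pi2 X (eps k) R))" .
      have A: "tsrc k \<in> Arr \<F>" and B: "ttgt k \<in> Arr \<F>" using t by simp_all
      have P: "pb X (eps k) R \<in> Arr \<F>" "tgt \<F> (pb X (eps k) R) = src \<F> (tsrc k)" using e R' tR by simp_all
      have "incl X (ttgt k \<cdot>\<^bsub>\<F>\<^esub> R) \<cdot>\<^bsub>\<C>\<^esub> pi2 X (eps k) R = incl X (ttgt k) \<cdot>\<^bsub>\<C>\<^esub> (incl X R \<cdot>\<^bsub>\<C>\<^esub> pi2 X (eps k) R)"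
        using B R' tR e(1) by simp
      also have "\<dots> = (incl X (ttgt k) \<cdot>\<^bsub>\<C>\<^esub> eps k) \<cdot>\<^bsub>\<C>\<^esub> incl X (pb X (eps k) R)"
        unfolding pb_commute[OF e(1) R'(1) tR] using B R' tR e(1-3) P by simp
      also have "\<dots> = incl X (tsrc k \<cdot>\<^bsub>\<F>\<^esub> pb X (eps k) R)"
        unfolding e(4) using A P by simp
      finally show "incl X (ttgt k \<cdot>\<^bsub>\<F>\<^esub> R) \<cdot>\<^bsub>\<C>\<^esub> pi2 X (eps k) R = incl X (tsrc k \<cdot>\<^bsub>\<F>\<^esub> pb X (eps k) R)" .
      show "src \<C> (pi2 X (eps k) R) = src \<F> (tsrc k \<cdot>\<^bsub>\<F>\<^esub> pb X (eps k) R)"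
        using A P e(1) R' tR by simp
    qed (use e(1) R' tR in simp_all)
  qed
  moreover have "one X \<in> Obj \<F>" using one_terminal by (simp add: terminal_def)
  ultimately show ?thesis
    unfolding CE_hom_def E2CE_obj_simps(1,2) ball_Arr_slice
    by (simp del: E2CE_obj_simps(4))
qed

definition "counit_arr = (E2CE_obj \<E>, cerestrict (E2CE_obj \<E>) counit, X)"

lemma CE_system_E2CE_CE2E: "CE_system (E2CE_obj \<E>)"
  by (rule E.CE_system_E2CE)

lemma counit_arr_Hom: "counit_arr \<in> Hom CEsys (E2CE_obj \<E>) X"
  using CE_hom_cerestrict[OF CE_system_E2CE_CE2E counit_CE_hom] CE_system_E2CE_CE2E CE_system_axioms
  by (simp add: counit_arr_def Hom_CEsys)

lemma one_unique:
  assumes "A \<in> Arr \<F>" "B \<in> Arr \<F>" "tgt \<F> A = one X" "tgt \<F> B = one X" "src \<F> A = src \<F> B"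
  shows "A = B"
proof -
  have "\<exists>!f. f \<in> Hom \<F> (src \<F> A) (one X)"
    using one_terminal assms(1) by (simp add: terminal_def)
  then show ?thesis using assms unfolding mem_Hom_iff by metis
qed

lemma one_exists:
  assumes "a \<in> Obj \<F>"
  obtains A where "A \<in> Arr \<F>" "src \<F> A = a" "tgt \<F> A = one X"
  using one_terminal assms unfolding terminal_def mem_Hom_iff by blast

lemma counit_iso_iff: "is_iso CEsys counit_arr \<longleftrightarrow> rooted X"
proof
  let ?Y = "E2CE_obj \<E>"
  let ?T = "term_cat \<E> (one X)"
  assume iso: "is_iso CEsys counit_arr"
  then obtain G where G: "G \<in> Hom CEsys X ?Y" and eq: "counit_arr \<cdot>\<^bsub>CEsys\<^esub> G = idm CEsys X"
    by (auto simp: is_iso_def counit_arr_def)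
  then obtain g where g: "G = (X, g, ?Y)" "CE_hom X ?Y g" unfolding Hom_CEsys by blast
  interpret gc: strict_functor \<C> "ctx ?Y" "ctxF g" by (rule CE_homD(2)[OF g(2)])
  have "cerestrict X (ce_comp (cerestrict ?Y counit) g) = cerestrict X ce_id"
    using eq g(1) by (simp add: counit_arr_def)
  \<comment> \<open>A right inverse \<open>g\<close> of the counit exhibits every arrow of
    \<open>ctx X\<close> as \<open>eps\<close> of an arrow of the term category, to which
    \<open>incl_eps\<close> applies.\<close>
  then have *: "eps (aMap (ctxF g) f) = f" "aMap (ctxF g) f \<in> Arr ?T" if "f \<in> Arr \<C>" for f
  proof -
    show T: "aMap (ctxF g) f \<in> Arr ?T" using gc.aMap_simps(1)[OF that] by simp
    have "aMap (ctxF (cerestrict ?Y counit)) (aMap (ctxF g) f) = eps (aMap (ctxF g) f)"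
      using T by simp
    moreover have "aMap (ctxF (cerestrict ?Y counit)) (aMap (ctxF g) f) = f"
      using \<open>cerestrict X _ = _\<close> that unfolding cerestrict_eq_iff by (simp add: cefunc_eq_def)
    ultimately show "eps (aMap (ctxF g) f) = f" by (rule trans[OF sym])
  qed
  show "rooted X"
    unfolding rooted_def terminal_def
  proof (intro conjI ballI)
    show "one X \<in> Obj \<C>" using one_terminal by (simp add: terminal_def)
    fix a assume "a \<in> Obj \<C>"
    then obtain A where A: "A \<in> Arr \<F>" "src \<F> A = a" "tgt \<F> A = one X" using one_exists[of a] by auto
    show "\<exists>!f. f \<in> Hom \<C> a (one X)"
    proof (rule ex1I[of _ "incl X A"])
      show "incl X A \<in> Hom \<C> a (one X)" using A by (simp add: mem_Hom_iff)
      fix f assume "f \<in> Hom \<C> a (one X)"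
      then have f: "f \<in> Arr \<C>" "src \<C> f = a" "tgt \<C> f = one X" by (simp_all add: mem_Hom_iff)
      let ?k = "aMap (ctxF g) f"
      note k = *[OF f(1)]
      note t = term_catD[OF k(2)] and e = eps[OF k(2), unfolded k(1)]
      have one: "one X \<in> Obj \<F>" using one_terminal by (simp add: terminal_def)
      have "src \<F> (tsrc ?k) = a" "src \<F> (ttgt ?k) = one X" using e(2,3) f(2,3) by simp_all
      \<comment> \<open>Each object has only one arrow into \<open>one X\<close> in
        \<open>fam X\<close>, which forces both endpoints of \<open>?k\<close>;
        \<open>incl_eps\<close> then says that \<open>f\<close> is \<open>incl X A\<close>.\<close>
      then have "tsrc ?k = A" "ttgt ?k = idm \<F> (one X)"
        using t(5-8) A one by (simp_all add: one_unique)
      then have "idm \<C> (one X) \<cdot>\<^bsub>\<C>\<^esub> f = incl X A"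
        using e(4) one by simp
      then show "f = incl X A" using f by simp
    qed
  qed
next
  let ?Y = "E2CE_obj \<E>" and ?F = "cerestrict (E2CE_obj \<E>) counit"
  let ?T = "term_cat \<E> (one X)" and ?S = "slice \<E> (one X)"
  assume r: "rooted X"
  \<comment> \<open>Each object has exactly one arrow to \<open>one X\<close> in
    \<open>fam X\<close>, so keeping only its source loses nothing. The bijection on arrows of the
    slice has the same reason.\<close>
  have bo: "bij_betw (src \<F>) (Obj ?S) (Obj \<F>)"
  proof (rule bij_betw_imageI)
    show "inj_on (src \<F>) (Obj ?S)" by (rule inj_onI) (simp add: one_unique)
    show "src \<F> ` Obj ?S = Obj \<F>"
    proof (intro set_eqI iffI)
      fix a assume "a \<in> Obj \<F>"
      then obtain A where "A \<in> Arr \<F>" "src \<F> A = a" "tgt \<F> A = one X" by (rule one_exists)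
      then show "a \<in> src \<F> ` Obj ?S" by (intro image_eqI[of _ _ A]) simp_all
    qed auto
  qed
  have ba: "bij_betw psnd (Arr ?S) (Arr \<F>)"
  proof (rule bij_betw_imageI)
    show "inj_on psnd (Arr ?S)"
    proof (rule inj_onI)
      fix f g assume "f \<in> Arr ?S" "g \<in> Arr ?S" and eq: "psnd f = psnd g"
      then obtain A Q B R where f: "f = Pr A Q" "A \<in> into \<E> (one X)" "Q \<in> into \<E> (src \<E> A)"
        and g: "g = Pr B R" "B \<in> into \<E> (one X)" "R \<in> into \<E> (src \<E> B)"
        unfolding Arr_slice by blast
      have QR: "Q = R" using eq f(1) g(1) by simp
      have "src \<F> A = src \<F> B" using f(3) g(3) QR by simp
      then have "A = B" using f(2) g(2) by (simp add: one_unique)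
      then show "f = g" using f(1) g(1) QR by simp
    qed
    show "psnd ` Arr ?S = Arr \<F>"
    proof (intro set_eqI iffI)
      fix Q assume Q: "Q \<in> Arr \<F>"
      then obtain A where "A \<in> Arr \<F>" "src \<F> A = tgt \<F> Q" "tgt \<F> A = one X"
        using one_exists[of "tgt \<F> Q"] by auto
      then show "Q \<in> psnd ` Arr ?S" using Q by (intro image_eqI[of _ _ "Pr A Q"]) simp_all
    qed (auto simp: Arr_slice)
  qed
  have bc: "bij_betw eps (Arr ?T) (Arr \<C>)"
  proof (rule bij_betw_imageI)
    show "inj_on eps (Arr ?T)"
    proof (rule inj_onI)
      fix k l assume k: "k \<in> Arr ?T" and l: "l \<in> Arr ?T" and eq: "eps k = eps l"
      note e = eps[OF k] eps[OF l] and t = term_catD[OF k] term_catD[OF l]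
      have "src \<F> (tsrc k) = src \<F> (tsrc l)" "src \<F> (ttgt k) = src \<F> (ttgt l)"
        using e(2,3,7,8) eq by metis+
      then have "tsrc k = tsrc l" "ttgt k = ttgt l"
        using t(5-8,13-16) by (simp_all add: one_unique)
      then show "k = l" using eps_inj[OF k l] eq by simp
    qed
    show "eps ` Arr ?T = Arr \<C>"
    proof (intro set_eqI iffI)
      fix p assume p: "p \<in> Arr \<C>"
      obtain A where A: "A \<in> Arr \<F>" "src \<F> A = src \<C> p" "tgt \<F> A = one X"
        using one_exists[of "src \<C> p"] p by auto
      obtain B where B: "B \<in> Arr \<F>" "src \<F> B = tgt \<C> p" "tgt \<F> B = one X"
        using one_exists[of "tgt \<C> p"] p by auto
      \<comment> \<open>This is where rootedness enters: it makes \<open>p\<close> commute with the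
        maps to \<open>one X\<close>, as \<open>eps_arr_of\<close> demands.\<close>
      have "\<exists>!f. f \<in> Hom \<C> (src \<C> p) (one X)" using r p by (simp add: rooted_def terminal_def)
      moreover have "incl X B \<cdot>\<^bsub>\<C>\<^esub> p \<in> Hom \<C> (src \<C> p) (one X)" "incl X A \<in> Hom \<C> (src \<C> p) (one X)"
        using A B p by (simp_all add: mem_Hom_iff)
      ultimately have "incl X B \<cdot>\<^bsub>\<C>\<^esub> p = incl X A" by blast
      note k = eps_arr_of[OF A(1,3) B(1,3) p A(2)[symmetric] B(2)[symmetric] this]
      show "p \<in> eps ` Arr ?T" using k(1) k(3)[symmetric] by (rule image_eqI[rotated])
    next
      fix p assume "p \<in> eps ` Arr ?T"
      then show "p \<in> Arr \<C>" using eps(1) by blast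
    qed
  qed
  show "is_iso CEsys counit_arr"
    unfolding counit_arr_def
  proof (rule CE_hom_bij_imp_iso)
    show "CE_hom ?Y X ?F" by (rule CE_hom_cerestrict[OF CE_system_E2CE_CE2E counit_CE_hom])
    show "bij_betw (oMap (famF ?F)) (Obj (fam ?Y)) (Obj (fam X))"
      using bo bij_betw_cong[of "Obj (fam ?Y)" "oMap (famF ?F)" "src \<F>" "Obj (fam X)"] by simp
    show "bij_betw (aMap (famF ?F)) (Arr (fam ?Y)) (Arr (fam X))"
      using ba bij_betw_cong[of "Arr (fam ?Y)" "aMap (famF ?F)" psnd "Arr (fam X)"] by simp
    show "bij_betw (aMap (ctxF ?F)) (Arr (ctx ?Y)) (Arr (ctx X))"
      using bc bij_betw_cong[of "Arr (ctx ?Y)" "aMap (ctxF ?F)" eps "Arr (ctx X)"] by simp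
  qed (simp_all add: CE_system_E2CE_CE2E CE_system_axioms)
qed

end


section \<open>The unit\<close>

text \<open>The conditions on \<open>S\<close> and \<open>W\<close> are equations between functors,
  so the inverse satisfies them by conjugation; the one on \<open>idtm\<close> is an equation
  between terms and is inverted directly.\<close>

lemma E_hom_bij_imp_iso:
  assumes sys: "E_system E" "E_system D" and hom: "pre_E_hom E D H" and res: "trestrict E H = H"
    and bo: "bij_betw (oMap H) (Obj E) (Obj D)" and ba: "bij_betw (aMap H) (Arr E) (Arr D)"
    and bt: "\<And>A. A \<in> Arr E \<Longrightarrow> bij_betw (tMap H A) (Tm E A) (Tm D (aMap H A))"
  shows "is_iso Esys (E, H, D)"
proof -
  interpret E_hom E D H using sys hom by (rule E_homI)
  have H: "strict_functor E D H" using tfunctor by (simp add: tfunctor_def)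
  define G where "G = \<lparr>oMap = inv_into (Obj E) (oMap H), aMap = inv_into (Arr E) (aMap H),
    tMap = (\<lambda>B. inv_into (Tm E (inv_into (Arr E) (aMap H) B)) (tMap H (inv_into (Arr E) (aMap H) B)))\<rparr>"
  have G: "strict_functor D E G"
    by (rule strict_functor_inverse[OF H bo ba]) (simp_all add: G_def)
  interpret G: strict_functor D E G by (rule G)
  have HGo: "oMap H (oMap G a) = a" if "a \<in> Obj D" for a
    using that bo by (simp add: G_def bij_betw_inv_into_right)
  have GHo: "oMap G (oMap H a) = a" if "a \<in> Obj E" for a
    using that bo by (simp add: G_def bij_betw_inv_into_left)
  have HGa: "aMap H (aMap G A) = A" if "A \<in> Arr D" for A
    using that ba by (simp add: G_def bij_betw_inv_into_right)
  have GHa: "aMap G (aMap H A) = A" if "A \<in> Arr E" for A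
    using that ba by (simp add: G_def bij_betw_inv_into_left)
  have Gt: "tMap G B y = inv_into (Tm E (aMap G B)) (tMap H (aMap G B)) y" for B y
    by (simp add: G_def)
  have btG: "bij_betw (tMap H (aMap G B)) (Tm E (aMap G B)) (Tm D B)" if "B \<in> Arr D" for B
    using bt[of "aMap G B"] that by (simp add: HGa)
  have HGt: "tMap H (aMap G B) (tMap G B y) = y" if "B \<in> Arr D" "y \<in> Tm D B" for B y
    using btG[OF that(1)] that(2) by (simp add: Gt bij_betw_inv_into_right)
  have Gtm: "tMap G B y \<in> Tm E (aMap G B)" if "B \<in> Arr D" "y \<in> Tm D B" for B y
    using bij_betwE[OF bij_betw_inv_into[OF btG[OF that(1)]]] that(2) by (simp add: Gt)
  have GHt: "tMap G (aMap H A) (tMap H A x) = x" if "A \<in> Arr E" "x \<in> Tm E A" for A x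
    using bt[OF that(1)] that by (simp add: Gt GHa bij_betw_inv_into_left)
  have tG: "tfunctor D E G" using G Gtm by (simp add: tfunctor_def)
  let ?L = "sf_lift H" and ?M = "sf_lift G"
  have HG_id: "sf_eq D \<Delta> (?L \<odot> ?M) sf_id" for \<Delta> by (simp add: sf_eq_def HGa HGt)
  have GH_id: "sf_eq E \<Gamma> (?M \<odot> ?L) sf_id" for \<Gamma> by (simp add: sf_eq_def GHa GHt)
  have M: "sf_functor D \<Delta> E (oMap G \<Delta>) ?M" if "\<Delta> \<in> Obj D" for \<Delta>
    using that Gtm by (simp add: sf_functor_def)
  \<comment> \<open>From \<open>k \<circ> H = H \<circ> h\<close> follows
    \<open>G \<circ> k = h \<circ> G\<close>, by inserting \<open>H \<circ> G\<close> on the right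
    and cancelling \<open>G \<circ> H\<close> on the left.\<close>
  have conj: "sf_eq D \<Delta> (?M \<odot> k) (h \<odot> ?M)"
    if "\<Delta> \<in> Obj D" "sf_functor E (oMap G \<Delta>) E \<Gamma>' h" "sf_eq E (oMap G \<Delta>) (k \<odot> ?L) (?L \<odot> h)" for \<Delta> \<Gamma>' h k
  proof -
    have "sf_eq D \<Delta> (?M \<odot> k) ((?M \<odot> k) \<odot> ?L \<odot> ?M)"
      using sf_eq_comp_right[OF sf_eq_sym[OF HG_id[of \<Delta>]], of "?M \<odot> k"] by simp
    also have "\<dots> = (?M \<odot> k \<odot> ?L) \<odot> ?M" by (simp add: sf_comp_assoc)
    also have "sf_eq D \<Delta> \<dots> ((?M \<odot> ?L \<odot> h) \<odot> ?M)"
      by (rule sf_eq_comp_left[OF sf_eq_comp_right[OF that(3)] M[OF that(1)]])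
    also have "\<dots> = (?M \<odot> ?L) \<odot> h \<odot> ?M" by (simp add: sf_comp_assoc)
    also have "sf_eq D \<Delta> \<dots> (sf_id \<odot> h \<odot> ?M)"
      by (rule sf_eq_comp_left[OF GH_id sf_functor_comp[OF M[OF that(1)] that(2) cod.strict dom.strict]])
    finally show ?thesis by simp
  qed
  have "sf_hom D \<Delta> E (oMap G \<Delta>) ?M" if \<Delta>: "\<Delta> \<in> Obj D" for \<Delta>
  proof -
    have S: "sf_eq D (src D B) (?M \<odot> SubF D B y) (SubF E (aMap G B) (tMap G B y) \<odot> ?M)"
      if "B \<in> Arr D" "y \<in> Tm D B" for B y
      using that dom.SubF_functor[of "aMap G B" "tMap G B y"] lift_Sub[of "aMap G B" "tMap G B y"]
      by (intro conj) (simp_all add: Gtm HGa HGt sf_eq_sym)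
    have W: "sf_eq D (tgt D B) (?M \<odot> WkF D B) (WkF E (aMap G B) \<odot> ?M)" if "B \<in> Arr D" for B
      using that dom.WkF_functor[of "aMap G B"] lift_Wk[of "aMap G B"]
      by (intro conj) (simp_all add: HGa sf_eq_sym)
    have W': "sf_eq D (src D P) (?M \<odot> WkF D B) (WkF E (aMap G B) \<odot> ?M)"
      if "B \<in> Arr D" "tgt D B = src D P" for B P using W[OF that(1)] that(2) by simp
    have I: "tMap G (sob (WkF D B) B) (idtm D B) = idtm E (aMap G B)" if "B \<in> Arr D" for B
    proof -
      have GB: "aMap G B \<in> Arr E" "aMap H (aMap G B) = B" using that by (simp_all add: HGa)
      have "aMap H (sob (WkF E (aMap G B)) (aMap G B)) = sob (WkF D B) B"
        using lift_Wk_sob[OF GB(1,1) refl] GB(2) by simp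
      moreover have "tMap H (sob (WkF E (aMap G B)) (aMap G B)) (idtm E (aMap G B)) = idtm D B"
        using lift_idtm[OF GB(1)] GB(2) by simp
      ultimately show ?thesis
        using GHt[OF dom.Wk_self(1)[OF GB(1)] dom.idtm[OF GB(1)]] by simp
    qed
    show ?thesis unfolding sf_hom_def using M[OF \<Delta>] by (simp add: S W' I)
  qed
  moreover have "oMap G (root D) = root E"
    using GHo[OF dom.root_Obj] root_eq by simp
  ultimately have "pre_E_hom D E G"
    using tG by (simp add: pre_E_hom_iff[OF cod.pre dom.pre])
  then have "(D, trestrict D G, E) \<in> Hom Esys D E"
    using sys E_hom_trestrict by (simp add: Hom_Esys)
  moreover have "trestrict E (tcomp (trestrict D G) H) = trestrict E tid"
    unfolding trestrict_eq_iff using GHo GHa GHt H_Tm by (simp add: tfunc_eq_def)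
  moreover have "trestrict D (tcomp H (trestrict D G)) = trestrict D tid"
    unfolding trestrict_eq_iff using HGo HGa HGt by (simp add: tfunc_eq_def)
  ultimately show ?thesis
    unfolding is_iso_def using sys hom res
    by (intro conjI bexI[of _ "(D, trestrict D G, E)"]) simp_all
qed

section \<open>The unit at an E-system\<close>

context sf_E_system
begin

text \<open>The object part of the unit: objects of \<open>E2CE_obj E\<close> are arrows into the
  root, and the only one out of \<open>\<Gamma>\<close> stands for \<open>\<Gamma>\<close>.\<close>

definition "bang \<Gamma> = (THE A. A \<in> Arr E \<and> src E A = \<Gamma> \<and> tgt E A = root E)"

lemma bang:
  assumes "\<Gamma> \<in> Obj E"
  shows "bang \<Gamma> \<in> Arr E" "src E (bang \<Gamma>) = \<Gamma>" "tgt E (bang \<Gamma>) = root E"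
proof -
  have "\<exists>!A. A \<in> Arr E \<and> src E A = \<Gamma> \<and> tgt E A = root E"
    using root assms by (simp add: terminal_def mem_Hom_iff)
  from theI'[OF this] show "bang \<Gamma> \<in> Arr E" "src E (bang \<Gamma>) = \<Gamma>" "tgt E (bang \<Gamma>) = root E"
    by (simp_all add: bang_def)
qed

lemma bang_unique:
  assumes "A \<in> Arr E" "tgt E A = root E"
  shows "bang (src E A) = A"
proof -
  have "\<exists>!B. B \<in> Arr E \<and> src E B = src E A \<and> tgt E B = root E"
    using root assms by (simp add: terminal_def mem_Hom_iff)
  then show ?thesis unfolding bang_def using assms by (intro the1_equality) simp_all
qed

lemma bang_root: "bang (root E) = idm E (root E)"
  using bang_unique[of "idm E (root E)"] root_Obj by simp

lemma bang_cmp: "A \<in> Arr E \<Longrightarrow> bang (tgt E A) \<cdot>\<^bsub>E\<^esub> A = bang (src E A)"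
  using bang_unique[of "bang (tgt E A) \<cdot>\<^bsub>E\<^esub> A"] bang[of "tgt E A"] by simp

abbreviation "X \<equiv> E2CE_obj E"

interpretation X: CE_system X by (rule CE_system_E2CE)

definition "unit_tm A x = arr_of E (bang (tgt E A)) (bang (src E A)) (SubF E A x)"

definition "unit =
  \<lparr>oMap = bang, aMap = (\<lambda>A. Pr (bang (tgt E A)) A), tMap = unit_tm\<rparr>"

lemma unit_simps [simp]:
  "oMap unit = bang" "aMap unit A = Pr (bang (tgt E A)) A" "tMap unit = unit_tm"
  by (simp_all add: unit_def)

text \<open>Weakening along the arrow from the source of \<open>A\<close> to the root factors
  through \<open>W\<^sub>A\<close>, which \<open>S\<^sub>x\<close> cancels; so
  \<open>S\<^sub>x\<close> is the functor of an arrow over the root. The same cancellation says that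
  this arrow is a section of the inclusion of \<open>A\<close>.\<close>

lemma unit_tm:
  assumes "A \<in> Arr E" "x \<in> Tm E A"
  shows unit_tm_Arr: "unit_tm A x \<in> Arr (term_cat E (root E))"
    and tsrc_unit_tm: "tsrc (unit_tm A x) = bang (tgt E A)"
    and ttgt_unit_tm: "ttgt (unit_tm A x) = bang (src E A)"
    and arr_fun_unit_tm: "sf_eq E (src E A) (arr_fun E (unit_tm A x)) (SubF E A x)"
    and unit_tm_section: "unit_tm A x \<in> sections X (Pr (bang (tgt E A)) A)"
proof -
  have A: "tgt E A \<in> Obj E" "src E A \<in> Obj E" using assms(1) by simp_all
  note bt = bang[OF A(1)] and bs = bang[OF A(2)]
  have in1: "bang (tgt E A) \<in> into E (root E)" "bang (src E A) \<in> into E (root E)" using bt bs by simp_all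
  have hom: "sf_hom E (src E (bang (src E A))) E (src E (bang (tgt E A))) (SubF E A x)"
    using SubF_hom[OF assms] bt bs by simp
  have Wt: "sf_functor E (root E) E (tgt E A) (WkF E (bang (tgt E A)))"
    using WkF_functor[OF bt(1)] bt by simp
  have "sf_eq E (root E) (SubF E A x \<odot> WkF E (bang (src E A))) (SubF E A x \<odot> WkF E A \<odot> WkF E (bang (tgt E A)))"
    using WkF_cmp[OF bt(1) assms(1)] bt by (intro sf_eq_comp_right) (simp add: bang_cmp[OF assms(1)])
  also have "\<dots> = (SubF E A x \<odot> WkF E A) \<odot> WkF E (bang (tgt E A))" by (simp add: sf_comp_assoc)
  also have "sf_eq E (root E) \<dots> (sf_id \<odot> WkF E (bang (tgt E A)))"
    by (rule sf_eq_comp_left[OF SubF_WkF[OF assms] Wt])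
  finally have wk: "sf_eq E (root E) (SubF E A x \<odot> WkF E (bang (src E A))) (WkF E (bang (tgt E A)))" by simp
  note k = arr_of[OF in1 hom wk, folded unit_tm_def]
  show u: "unit_tm A x \<in> Arr (term_cat E (root E))" "tsrc (unit_tm A x) = bang (tgt E A)"
    "ttgt (unit_tm A x) = bang (src E A)" "sf_eq E (src E A) (arr_fun E (unit_tm A x)) (SubF E A x)"
    using k bs by (simp_all add: unit_tm_def)
  have Ai: "A \<in> into E (src E (bang (tgt E A)))" using assms(1) bt by simp
  note i = incl_arr[OF in1(1) Ai]
  have "ttgt (unit_tm A x) = tsrc (incl X (Pr (bang (tgt E A)) A))"
    unfolding u(3) i(2) using bang_cmp[OF assms(1)] by simp
  note c = cmp_arr[OF i(1) u(1) this] and j = idm_arr[OF in1(1)]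
  have "incl X (Pr (bang (tgt E A)) A) \<cdot>\<^bsub>term_cat E (root E)\<^esub> unit_tm A x =
      tarr (bang (tgt E A)) (bang (tgt E A)) (idtm E (bang (tgt E A)))"
  proof (rule arr_eqI[OF c(1) j(1), of "bang (tgt E A)" sf_id])
    have WA: "sf_functor E (tgt E A) E (src E A) (WkF E A)" by (rule WkF_functor[OF assms(1)])
    have "sf_eq E (tgt E A) (arr_fun E (incl X (Pr (bang (tgt E A)) A) \<cdot>\<^bsub>term_cat E (root E)\<^esub> unit_tm A x))
        (arr_fun E (unit_tm A x) \<odot> arr_fun E (incl X (Pr (bang (tgt E A)) A)))"
      using c(4) unfolding i(3) bt(2) .
    also have "sf_eq E (tgt E A) \<dots> (arr_fun E (unit_tm A x) \<odot> WkF E A)"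
      using sf_eq_comp_right[OF i(4)] unfolding bt(2) .
    also have "sf_eq E (tgt E A) \<dots> (SubF E A x \<odot> WkF E A)"
      by (rule sf_eq_comp_left[OF u(4) WA])
    also have "sf_eq E (tgt E A) \<dots> sf_id" by (rule SubF_WkF[OF assms])
    finally show "sf_eq E (src E (bang (tgt E A)))
        (arr_fun E (incl X (Pr (bang (tgt E A)) A) \<cdot>\<^bsub>term_cat E (root E)\<^esub> unit_tm A x)) sf_id"
      by (simp only: bt(2))
  qed (use c(2,3) u i(3) j(2) in simp_all)
  then show "unit_tm A x \<in> sections X (Pr (bang (tgt E A)) A)"
    using u bang_cmp[OF assms(1)] by (simp add: mem_sections_iff del: E2CE_obj_simps(4))
qed

text \<open>The term is recovered from its substitution functor, as the image of
  \<open>idtm\<^sub>A\<close>.\<close>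

lemma unit_tm_inj:
  assumes "A \<in> Arr E" "x \<in> Tm E A" "y \<in> Tm E A" "unit_tm A x = unit_tm A y"
  shows "x = y"
proof -
  have "sf_eq E (src E A) (SubF E A x) (SubF E A y)"
    using sf_eq_trans[OF sf_eq_sym[OF unit_tm(4)[OF assms(1,2)]]] unit_tm(4)[OF assms(1,3)] assms(4) by simp
  from term_of_cong[OF this assms(1)] show ?thesis
    using SubF_idtm[OF assms(1,2)] SubF_idtm[OF assms(1,3)] by (simp add: term_of_def)
qed

text \<open>The functor \<open>w\<close> of a section satisfies
  \<open>w \<circ> W\<^sub>A = id\<close>. Reconstructing \<open>w\<close> from this restriction and
  from \<open>x = w(idtm\<^sub>A)\<close> yields \<open>S\<^sub>x\<close>.\<close>

lemma unit_tm_surj: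
  assumes A: "A \<in> Arr E" and k: "k \<in> sections X (Pr (bang (tgt E A)) A)"
  shows "\<exists>x\<in>Tm E A. unit_tm A x = k"
proof -
  have T: "tgt E A \<in> Obj E" "src E A \<in> Obj E" using A by simp_all
  note bt = bang[OF T(1)] and bs = bang[OF T(2)]
  have in1: "bang (tgt E A) \<in> into E (root E)" using bt by simp
  have Ai: "A \<in> into E (src E (bang (tgt E A)))" using A bt by simp
  note i = incl_arr[OF in1 Ai] and j = idm_arr[OF in1]
  have k': "k \<in> Arr (term_cat E (root E))" "tsrc k = bang (tgt E A)" "ttgt k = bang (src E A)"
    "incl X (Pr (bang (tgt E A)) A) \<cdot>\<^bsub>term_cat E (root E)\<^esub> k =
      tarr (bang (tgt E A)) (bang (tgt E A)) (idtm E (bang (tgt E A)))"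
    using k bang_cmp[OF A] by (simp_all add: mem_sections_iff del: E2CE_obj_simps(4))
  let ?w = "arr_fun E k"
  have w: "sf_hom E (src E A) E (tgt E A) ?w" using arr_fun_hom[OF k'(1)] k'(2,3) bt bs by simp
  have "ttgt k = tsrc (incl X (Pr (bang (tgt E A)) A))"
    unfolding k'(3) i(2) using bang_cmp[OF A] by simp
  note c = cmp_arr[OF i(1) k'(1) this]
  have "sf_eq E (tgt E A) (?w \<odot> WkF E A) (?w \<odot> arr_fun E (incl X (Pr (bang (tgt E A)) A)))"
    using sf_eq_comp_right[OF sf_eq_sym[OF i(4)]] unfolding bt(2) .
  also have "sf_eq E (tgt E A) \<dots> sf_id"
    using sf_eq_trans[OF sf_eq_sym[OF c(4)]] j(2) unfolding k'(4) i(3) bt(2) by simp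
  finally have wW: "sf_eq E (tgt E A) (?w \<odot> WkF E A) sf_id" .
  have wo: "sob ?w (sob (WkF E A) A) = A" using sf_eqD(1)[OF wW A refl] by simp
  define x where "x = term_of E A ?w"
  have ws: "sar ?w (idm E (src E A)) (sob (WkF E A) A) = A"
    using sf_functor_sob[OF sf_homD(1)[OF w] strict strict Wk_self[OF A]] wo by simp
  have x: "x \<in> Tm E A"
    using sf_functorD(10)[OF sf_homD(1)[OF w], of "idm E (src E A)" "sob (WkF E A) A" "idtm E A"]
      Wk_self[OF A] idtm[OF A] A by (simp add: x_def term_of_def ws)
  have "sf_eq E (src E A) ?w (SubF E A x \<odot> sliced E (?w \<odot> WkF E A) A)"
    using extension_unique[OF w pre A] by (simp add: wo x_def term_of_def)
  also have "sf_eq E (src E A) \<dots> (SubF E A x \<odot> sliced E sf_id A)"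
    by (rule sf_eq_comp_right[OF sf_eq_sliced[OF wW strict A refl]])
  finally have wx: "sf_eq E (src E A) ?w (SubF E A x)" by simp
  note u = unit_tm[OF A x]
  have "unit_tm A x = k"
    by (rule arr_eqI[OF u(1) k'(1) _ u(3) k'(3), of "SubF E A x"]) (use u(2,4) k'(2) wx bs in simp_all)
  with x show ?thesis by blast
qed

text \<open>The unit carries the functor of an arrow to pullback along that arrow. The variable
  \<open>h\<close> allows \<open>S\<^sub>x\<close> or \<open>W\<^sub>A\<close> in place of
  \<open>arr_fun E k\<close>, with which they agree only up to \<open>sf_eq\<close>.\<close>

lemma lift_unit_arr_fun:
  assumes k: "k \<in> Arr (term_cat E (root E))" and B: "ttgt k = bang \<Gamma>" "\<Gamma> \<in> Obj E"
    and h: "sf_eq E \<Gamma> (arr_fun E k) h"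
  shows "sf_eq E \<Gamma> (sf_lift unit \<odot> h) (pbF X k \<odot> sf_lift unit)"
proof -
  note t = term_catD[OF k]
  define f where "f = arr_fun E k"
  have sB: "src E (ttgt k) = \<Gamma>" using bang[OF B(2)] B by simp
  have A: "bang (src E (tsrc k)) = tsrc k" using bang_unique t by simp
  have f_hom: "sf_hom E \<Gamma> E (src E (tsrc k)) f" using arr_fun_hom[OF k] sB by (simp add: f_def)
  note ff = sf_functorD[OF sf_homD(1)[OF f_hom]]
  have ob: "bang (tgt E (sob f P)) = tsrc k" if "P \<in> Arr E" "tgt E P = \<Gamma>" for P
    using ff that A by simp
  have *: "sf_eq E \<Gamma> (sf_lift unit \<odot> f) (pbF X k \<odot> sf_lift unit)"
    unfolding sf_eq_def
  proof (intro ballI conjI)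
    fix P assume "P \<in> into E \<Gamma>"
    then have P: "P \<in> Arr E" "tgt E P = \<Gamma>" and Pi: "P \<in> into E (src E (ttgt k))" using sB by simp_all
    show "sob (sf_lift unit \<odot> f) P = sob (pbF X k \<odot> sf_lift unit) P"
      using ob[OF P] P B by (simp add: f_def)
    fix Q assume "Q \<in> into E (src E P)"
    then have Q: "Q \<in> Arr E" "tgt E Q = src E P" by simp_all
    define g where "g = pi2 X k (Pr (ttgt k) P)"
    note p = pi2_arr[OF k Pi, folded g_def f_def]
    have BP: "ttgt k \<cdot>\<^bsub>E\<^esub> P = bang (src E P)" using bang_cmp[OF P(1)] P B by simp
    have AX: "tsrc k \<cdot>\<^bsub>E\<^esub> sob f P = bang (src E (sob f P))"
      using bang_cmp[of "sob f P"] ff P ob[OF P] by simp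
    have Q': "Q \<in> into E (src E (ttgt g))" using Q bang(2)[of "src E P"] P by (simp add: p(3) BP)
    have gQ: "sob (arr_fun E g) Q = sar f P Q" using sf_eqD(1)[OF p(4) Q] by simp
    have sar: "sar f P Q \<in> Arr E" "tgt E (sar f P Q) = src E (sob f P)" using ff P Q by simp_all
    have HP: "aMap unit P = Pr (ttgt k) P" using P B by simp
    show arr: "sar (sf_lift unit \<odot> f) P Q = sar (pbF X k \<odot> sf_lift unit) P Q"
      using sar P Q by (simp add: HP del: unit_simps(2)) (simp add: p(2) AX gQ flip: g_def)
    fix y assume y: "y \<in> Tm E Q"
    have gX: "g \<in> Arr (ctx X)" using p(1) by simp
    have QX: "Pr (bang (src E P)) Q \<in> Arr (fam X)" "tgt (fam X) (Pr (bang (src E P)) Q) = tgt (ctx X) g"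
      using bang[of "src E P"] P Q by (simp_all add: p(3) BP)
    have yX: "unit_tm Q y \<in> sections X (Pr (bang (src E P)) Q)" using unit_tm(5)[OF Q(1) y] Q by simp
    have fy: "stm f P Q y \<in> Tm E (sar f P Q)" using ff P Q y by simp
    note u = unit_tm[OF sar(1) fy] and v = unit_tm[OF Q(1) y]
    \<comment> \<open>On terms, the unit of \<open>f(y)\<close> has to be the pullback of the unit
      of \<open>y\<close> along the projection \<open>g\<close>. The defining equation of that
      pullback, read as an equation of functors, is the compatibility of \<open>f/P\<close> with
      \<open>S\<^sub>y\<close>.\<close>
    have "pb_section X g (Pr (bang (src E P)) Q) (unit_tm Q y) = unit_tm (sar f P Q) (stm f P Q y)"
    proof (rule X.pb_section_eqI[OF gX QX yX])
      have "pb X g (Pr (bang (src E P)) Q) = Pr (bang (tgt E (sar f P Q))) (sar f P Q)"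
        using sar by (simp add: p(2) AX gQ)
      then show "unit_tm (sar f P Q) (stm f P Q y) \<in> sections X (pb X g (Pr (bang (src E P)) Q))"
        using u(5) by simp
      define q where "q = pi2 X g (Pr (ttgt g) Q)"
      note q = pi2_arr[OF p(1) Q', folded q_def]
      have BPQ: "ttgt g \<cdot>\<^bsub>E\<^esub> Q = bang (src E Q)" using bang_cmp[OF Q(1)] Q by (simp add: p(3) BP)
      have AXY: "tsrc g \<cdot>\<^bsub>E\<^esub> sob (arr_fun E g) Q = bang (src E (sar f P Q))"
        using bang_cmp[OF sar(1)] sar by (simp add: p(2) AX gQ)
      have "ttgt (unit_tm (sar f P Q) (stm f P Q y)) = tsrc q" unfolding u(3) q(2) AXY ..
      note c = cmp_arr[OF q(1) u(1) this]
      have "ttgt g = tsrc (unit_tm Q y)" unfolding v(2) p(3) BP using Q by simp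
      note d = cmp_arr[OF v(1) p(1) this]
      have fP: "sf_hom E (src E P) E (src E (sob f P)) (sliced E f P)"
        by (rule sf_hom_sliced[OF f_hom pre pre P])
      have sfP: "sf_functor E (src E Q) E (src E (sar f P Q)) (sliced E (sliced E f P) Q)"
        using sf_functor_sliced[OF sf_homD(1)[OF fP] strict strict Q] by simp
      have sbQ: "src E (bang (src E Q)) = src E Q" using bang(2)[of "src E Q"] Q by simp
      have "q \<cdot>\<^bsub>term_cat E (root E)\<^esub> unit_tm (sar f P Q) (stm f P Q y) = unit_tm Q y \<cdot>\<^bsub>term_cat E (root E)\<^esub> g"
      proof (rule arr_eqI[OF c(1) d(1), of "bang (src E Q)"], unfold sbQ)
        have "sf_eq E (src E Q) (arr_fun E (q \<cdot>\<^bsub>term_cat E (root E)\<^esub> unit_tm (sar f P Q) (stm f P Q y)))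
          (arr_fun E (unit_tm (sar f P Q) (stm f P Q y)) \<odot> arr_fun E q)"
          using c(4) unfolding q(3) BPQ sbQ .
        also have "sf_eq E (src E Q) \<dots> (arr_fun E (unit_tm (sar f P Q) (stm f P Q y)) \<odot> sliced E (arr_fun E g) Q)"
          by (rule sf_eq_comp_right[OF q(4)])
        also have "sf_eq E (src E Q) \<dots> (arr_fun E (unit_tm (sar f P Q) (stm f P Q y)) \<odot> sliced E (sliced E f P) Q)"
          by (rule sf_eq_comp_right[OF sf_eq_sliced[OF p(4) strict Q]])
        also have "sf_eq E (src E Q) \<dots> (SubF E (sar f P Q) (stm f P Q y) \<odot> sliced E (sliced E f P) Q)"
          by (rule sf_eq_comp_left[OF u(4) sfP])
        also have "sf_eq E (src E Q) \<dots> (sliced E f P \<odot> SubF E Q y)"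
          using sf_eq_sym[OF sf_hom_Sub[OF fP pre pre Q y]] P by simp
        finally show "sf_eq E (src E Q) (arr_fun E (q \<cdot>\<^bsub>term_cat E (root E)\<^esub> unit_tm (sar f P Q) (stm f P Q y)))
          (sliced E f P \<odot> SubF E Q y)" .
        have "sf_eq E (src E Q) (arr_fun E (unit_tm Q y \<cdot>\<^bsub>term_cat E (root E)\<^esub> g)) (arr_fun E g \<odot> arr_fun E (unit_tm Q y))"
          using d(4) unfolding v(3) sbQ .
        also have "sf_eq E (src E Q) \<dots> (arr_fun E g \<odot> SubF E Q y)" by (rule sf_eq_comp_right[OF v(4)])
        also have "sf_eq E (src E Q) \<dots> (sliced E f P \<odot> SubF E Q y)"
          using SubF_functor[OF Q(1) y] Q by (intro sf_eq_comp_left[OF p(4)]) simp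
        finally show "sf_eq E (src E Q) (arr_fun E (unit_tm Q y \<cdot>\<^bsub>term_cat E (root E)\<^esub> g))
          (sliced E f P \<odot> SubF E Q y)" .
      qed (use c(2,3) d(2,3) u(2) v(3) q(3) BPQ p(2) AX sar in simp_all)
      then show "pi2 X g (Pr (bang (src E P)) Q) \<cdot>\<^bsub>ctx X\<^esub> unit_tm (sar f P Q) (stm f P Q y) = unit_tm Q y \<cdot>\<^bsub>ctx X\<^esub> g"
        using q_def p(3) BP by simp
    qed
    moreover have "stm (pbF X k) (Pr (ttgt k) P) (Pr (bang (src E P)) Q) (unit_tm Q y) =
        pb_section X g (Pr (bang (src E P)) Q) (unit_tm Q y)"
      unfolding g_def
    proof (rule X.stm_pbF)
      show "k \<in> Arr (ctx X)" using k by simp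
      show "Pr (ttgt k) P \<in> Arr (fam X)" "tgt (fam X) (Pr (ttgt k) P) = tgt (ctx X) k"
        using t P sB by simp_all
      show "Pr (bang (src E P)) Q \<in> Arr (fam X)" by (rule QX)
      show "tgt (fam X) (Pr (bang (src E P)) Q) = src (fam X) (Pr (ttgt k) P)" using BP by simp
    qed
    ultimately show "stm (sf_lift unit \<odot> f) P Q y = stm (pbF X k \<odot> sf_lift unit) P Q y"
      using P Q B by simp
  qed
  have "sf_eq E \<Gamma> (sf_lift unit \<odot> h) (sf_lift unit \<odot> f)"
    unfolding f_def by (rule sf_eq_comp_right[OF sf_eq_sym[OF h]])
  from sf_eq_trans[OF this *] show ?thesis .
qed

lemma CE2E_X: "sf_E_system (CE2E_obj X)"
  by (rule X.sf_E_system_CE2E)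

text \<open>Both \<open>S\<^sub>x\<close> and \<open>W\<^sub>A\<close> are functors of arrows over
  the root, given by \<open>unit_tm\<close> and by the inclusion, so
  \<open>lift_unit_arr_fun\<close> gives the conditions on both.\<close>

lemma unit_pre_E_hom: "pre_E_hom E (CE2E_obj X) unit"
proof -
  interpret D: sf_E_system "CE2E_obj X" by (rule CE2E_X)
  let ?D = "CE2E_obj X"
  have sf: "strict_functor E ?D unit"
  proof
    fix A P x y z assume "A \<in> Hom E x y" "P \<in> Hom E y z"
    then show "aMap unit (P \<cdot>\<^bsub>E\<^esub> A) = aMap unit P \<cdot>\<^bsub>?D\<^esub> aMap unit A" by (simp add: mem_Hom_iff)
  qed (use bang bang_cmp in \<open>simp_all add: mem_Hom_iff\<close>)
  have tf: "tfunctor E ?D unit"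
    unfolding tfunctor_def using sf unit_tm(5) by simp
  have f: "sf_functor E \<Gamma> ?D (bang \<Gamma>) (sf_lift unit)" if "\<Gamma> \<in> Obj E" for \<Gamma>
  proof -
    note tD = tfunctorD[OF tf]
    show ?thesis
      unfolding sf_functor_def using that tD(1)[OF that] tD(6)[OF that]
      by (simp add: tD[unfolded unit_simps(1,3)] del: unit_simps(2) CE2E_obj_simps E2CE_obj_simps)
  qed
  have S: "sf_eq E (src E Q) (sf_lift unit \<odot> SubF E Q x) (pbF X (unit_tm Q x) \<odot> sf_lift unit)"
    if "Q \<in> Arr E" "x \<in> Tm E Q" for Q x
    using unit_tm[OF that] that by (intro lift_unit_arr_fun) simp_all
  have iX: "bang (tgt E Q) \<in> into E (root E)" "Q \<in> into E (src E (bang (tgt E Q)))" if "Q \<in> Arr E" for Q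
    using that bang[of "tgt E Q"] by simp_all
  have W: "sf_eq E (tgt E Q) (sf_lift unit \<odot> WkF E Q) (pbF X (incl X (aMap unit Q)) \<odot> sf_lift unit)"
    if "Q \<in> Arr E" for Q
    unfolding unit_simps
    using incl_arr[OF iX[OF that]] bang[of "tgt E Q"] that
    by (intro lift_unit_arr_fun) (simp_all del: E2CE_obj_simps(4))
  have W': "sf_eq E (src E P) (sf_lift unit \<odot> WkF E Q) (pbF X (incl X (aMap unit Q)) \<odot> sf_lift unit)"
    if "Q \<in> Arr E" "tgt E Q = src E P" for P Q using W[OF that(1)] that(2) by simp
  have I: "unit_tm (sob (WkF E A) A) (idtm E A) = idtm ?D (aMap unit A)" if A: "A \<in> Arr E" for A
  proof -
    let ?A = "aMap unit A" and ?W = "sob (WkF E A) A"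
    let ?i = "incl X ?A"
    note T = bang[of "tgt E A"] and T' = bang[of "src E A"]
    note WA = Wk_self[OF A]
    note u = unit_tm[OF WA(1) idtm[OF A]]
    note i = incl_arr[OF iX[OF A], folded unit_simps(2)]
    have Wob: "aMap unit ?W = pb X ?i ?A" using sf_eqD(1)[OF W[OF A] A refl]
      by (simp only: sf_comp_simps sf_lift_simps pbF_simps)
    have sW: "bang (tgt E ?W) = bang (src E A)" using WA by simp
    have AX: "?A \<in> Arr (fam X)" using iX[OF A] by simp
    have Ai: "A \<in> into E (src E (ttgt ?i))" unfolding i(3) using iX[OF A] by simp
    note p = pi2_arr[OF i(1) Ai, unfolded i(3), folded unit_simps(2)]
    have bA: "bang (tgt E A) \<cdot>\<^bsub>E\<^esub> A = bang (src E A)" by (rule bang_cmp[OF A])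
    have iA: "sob (arr_fun E ?i) A = ?W"
      using sf_eqD(1)[OF i(4), of A] A T by simp
    have tp: "ttgt (unit_tm ?W (idtm E A)) = tsrc (pi2 X ?i ?A)"
      unfolding u(3) p(2) i(2) iA bA using bang_cmp[OF WA(1)] WA by simp
    note c = cmp_arr[OF p(1) u(1) tp]
    have bi: "bang (src E A) \<in> into E (root E)" using T' A by simp
    note j = idm_arr[OF bi]
    \<comment> \<open>The diagonal is characterised by its composite with the projection. On
      functors, the claim that this composite is the identity is the axiom
      \<open>SubF_idtm_WkF\<close>.\<close>
    have "X.gen ?A = unit_tm ?W (idtm E A)"
    proof (rule X.gen(3)[OF AX])
      show "unit_tm ?W (idtm E A) \<in> sections X (pb X ?i ?A)"
        unfolding Wob[symmetric] using u(5) by (simp only: unit_simps(2))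
      have "pi2 X ?i ?A \<cdot>\<^bsub>term_cat E (root E)\<^esub> unit_tm ?W (idtm E A) =
        tarr (bang (src E A)) (bang (src E A)) (idtm E (bang (src E A)))"
      proof (rule arr_eqI[OF c(1) j(1), of "bang (src E A)" sf_id])
        have sb: "src E (bang (src E A)) = src E A" using T' A by simp
        have WAf: "sf_functor E (tgt E A) E (src E A) (WkF E A)" by (rule WkF_functor[OF A])
        have "sf_eq E (src E A) (arr_fun E (pi2 X ?i ?A \<cdot>\<^bsub>term_cat E (root E)\<^esub> unit_tm ?W (idtm E A)))
          (arr_fun E (unit_tm ?W (idtm E A)) \<odot> arr_fun E (pi2 X ?i ?A))"
          using c(4) unfolding p(3) bA sb .
        also have "sf_eq E (src E A) \<dots> (arr_fun E (unit_tm ?W (idtm E A)) \<odot> sliced E (arr_fun E ?i) A)"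
          by (rule sf_eq_comp_right[OF p(4)])
        also have "sf_eq E (src E A) \<dots> (arr_fun E (unit_tm ?W (idtm E A)) \<odot> sliced E (WkF E A) A)"
          using i(4) T A by (intro sf_eq_comp_right sf_eq_sliced[OF _ strict A refl]) simp
        also have "sf_eq E (src E A) \<dots> (SubF E ?W (idtm E A) \<odot> sliced E (WkF E A) A)"
          using sf_functor_sliced[OF WAf strict strict A refl] by (intro sf_eq_comp_left[OF u(4)]) simp
        also have "sf_eq E (src E A) \<dots> sf_id" by (rule SubF_idtm_WkF[OF A])
        finally show "sf_eq E (src E (bang (src E A)))
          (arr_fun E (pi2 X ?i ?A \<cdot>\<^bsub>term_cat E (root E)\<^esub> unit_tm ?W (idtm E A))) sf_id"
          by (simp only: sb)
      qed (use c(2,3) u(2) p(3) bA sW j(2) in simp_all)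
      then show "pi2 X ?i ?A \<cdot>\<^bsub>ctx X\<^esub> unit_tm ?W (idtm E A) = idm (ctx X) (src (fam X) ?A)"
        using bA by (simp del: E2CE_obj_simps(4))
    qed
    then show ?thesis by (simp add: X.gen_def)
  qed
  have "sf_hom E \<Gamma> ?D (bang \<Gamma>) (sf_lift unit)" if "\<Gamma> \<in> Obj E" for \<Gamma>
    unfolding sf_hom_def using f[OF that] by (simp add: S W' I del: unit_simps(2) E2CE_obj_simps)
  moreover have "bang (root E) = one X" by (simp add: bang_root)
  ultimately show ?thesis
    using tf by (simp add: pre_E_hom_iff[OF pre D.pre] del: E2CE_obj_simps)
qed

definition "unit_arr = (E, trestrict E unit, CE2E_obj X)"

lemma E_sys: "E_system E" "E_system (CE2E_obj X)"
  by (simp_all add: E_system_iff sf_E_system_axioms CE2E_X)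

lemma unit_arr_Hom: "unit_arr \<in> Hom Esys E (CE2E_obj X)"
  using E_hom_trestrict[OF E_sys unit_pre_E_hom] E_sys by (simp add: unit_arr_def Hom_Esys)

lemma unit_arr_iso: "is_iso Esys unit_arr"
  unfolding unit_arr_def
proof (rule E_hom_bij_imp_iso[OF E_sys E_hom_trestrict[OF E_sys unit_pre_E_hom]])
  let ?D = "CE2E_obj X"
  have "bij_betw bang (Obj E) (into E (root E))"
  proof (rule bij_betw_imageI)
    show "inj_on bang (Obj E)" by (rule inj_onI) (metis bang(2))
    show "bang ` Obj E = into E (root E)"
    proof (intro set_eqI iffI)
      fix A assume "A \<in> into E (root E)"
      then show "A \<in> bang ` Obj E" using bang_unique[of A] by (intro image_eqI[of _ _ "src E A"]) simp_all
    qed (use bang in auto)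
  qed
  then show "bij_betw (oMap (trestrict E unit)) (Obj E) (Obj ?D)"
    using bij_betw_cong[of "Obj E" "oMap (trestrict E unit)" bang "Obj ?D"] by simp
  have "bij_betw (\<lambda>A. Pr (bang (tgt E A)) A) (Arr E) (Arr ?D)"
  proof (rule bij_betw_imageI)
    show "inj_on (\<lambda>A. Pr (bang (tgt E A)) A) (Arr E)" by (rule inj_onI) simp
    show "(\<lambda>A. Pr (bang (tgt E A)) A) ` Arr E = Arr ?D"
    proof (intro set_eqI iffI)
      fix Z assume "Z \<in> Arr ?D"
      then obtain A Q where Z: "Z = Pr A Q" and A: "A \<in> into E (root E)" and Q: "Q \<in> into E (src E A)"
        unfolding CE2E_obj_simps E2CE_obj_simps Arr_slice by blast
      \<comment> \<open>An object has a unique arrow into the root, so the first component of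
        \<open>Z\<close> is determined by the second.\<close>
      have "bang (tgt E Q) = A" using bang_unique[of A] A Q by simp
      then show "Z \<in> (\<lambda>A. Pr (bang (tgt E A)) A) ` Arr E" using Q by (intro image_eqI[of _ _ Q]) (simp_all add: Z)
    next
      fix Z assume "Z \<in> (\<lambda>A. Pr (bang (tgt E A)) A) ` Arr E"
      then obtain A where "Z = Pr (bang (tgt E A)) A" "A \<in> Arr E" by blast
      then show "Z \<in> Arr ?D" using bang[of "tgt E A"] by simp
    qed
  qed
  then show "bij_betw (aMap (trestrict E unit)) (Arr E) (Arr ?D)"
    using bij_betw_cong[of "Arr E" "aMap (trestrict E unit)" "\<lambda>A. Pr (bang (tgt E A)) A" "Arr ?D"] by simp
  fix A assume A: "A \<in> Arr E"
  have "bij_betw (unit_tm A) (Tm E A) (sections X (Pr (bang (tgt E A)) A))"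
  proof (rule bij_betw_imageI)
    show "inj_on (unit_tm A) (Tm E A)" by (rule inj_onI) (rule unit_tm_inj[OF A])
    show "unit_tm A ` Tm E A = sections X (Pr (bang (tgt E A)) A)"
    proof (intro set_eqI iffI)
      fix k assume "k \<in> sections X (Pr (bang (tgt E A)) A)"
      from unit_tm_surj[OF A this] show "k \<in> unit_tm A ` Tm E A" by blast
    next
      fix k assume "k \<in> unit_tm A ` Tm E A"
      then show "k \<in> sections X (Pr (bang (tgt E A)) A)" using unit_tm(5)[OF A] by blast
    qed
  qed
  then show "bij_betw (tMap (trestrict E unit) A) (Tm E A) (Tm ?D (aMap (trestrict E unit) A))"
    using bij_betw_cong[of "Tm E A" "tMap (trestrict E unit) A" "unit_tm A" "sections X (Pr (bang (tgt E A)) A)"] A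
    by simp
qed simp

end


section \<open>The adjunction\<close>

definition unit_at :: "'u esys \<Rightarrow> 'u esys_arr" where
  "unit_at E = sf_E_system.unit_arr E"

definition counit_at :: "'u cesys \<Rightarrow> 'u cesys_arr" where
  "counit_at X = CE_system.counit_arr X"

lemma E2CE_simps [simp]:
  "oMap E2CE E = E2CE_obj E" "aMap E2CE (E, H, D) = (E2CE_obj E, E2CE_hom E H, E2CE_obj D)"
  by (simp_all add: E2CE_def)

lemma CE2E_simps [simp]:
  "oMap CE2E X = CE2E_obj X" "aMap CE2E (X, F, Y) = (CE2E_obj X, CE2E_hom X F, CE2E_obj Y)"
  by (simp_all add: CE2E_def)

lemma (in sf_E_system) CE2E_hom_apply:
  shows "A \<in> into E (root E) \<Longrightarrow> oMap (CE2E_hom (E2CE_obj E) F) A = oMap (famF F) A"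
    and "Z \<in> Arr (slice E (root E)) \<Longrightarrow> aMap (CE2E_hom (E2CE_obj E) F) Z = aMap (famF F) Z"
    and "\<lbrakk>Z \<in> Arr (slice E (root E)); x \<in> sections (E2CE_obj E) Z\<rbrakk>
      \<Longrightarrow> tMap (CE2E_hom (E2CE_obj E) F) Z x = aMap (ctxF F) x"
  by (simp_all add: CE2E_hom_def)

text \<open>The functors of these arrows are substitutions, and \<open>H\<close> commutes with
  substitution; the endpoints agree because \<open>H\<close> preserves the unique arrows to the
  root.\<close>

lemma (in E_hom) hom_arr_unit_tm:
  assumes "A \<in> Arr E" "x \<in> Tm E A"
  shows "hom_arr E H (dom.unit_tm A x) = cod.unit_tm (aMap H A) (tMap H A x)"
proof -
  have HA: "aMap H A \<in> Arr D" "tMap H A x \<in> Tm D (aMap H A)" using assms H_Tm by simp_all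
  note u = dom.unit_tm[OF assms] and v = cod.unit_tm[OF HA]
  have bang: "cod.bang (oMap H \<Gamma>) = aMap H (dom.bang \<Gamma>)" if "\<Gamma> \<in> Obj E" for \<Gamma>
    using cod.bang_unique[of "aMap H (dom.bang \<Gamma>)"] dom.bang[OF that] root_eq by simp
  have s: "src E (dom.bang (src E A)) = src E A" using dom.bang[of "src E A"] assms by simp
  show ?thesis
  proof (rule hom_arr_eqI[OF u(1) v(1)], unfold u(2,3) v(2,3) s)
    have "sf_eq E (src E A) (arr_fun D (cod.unit_tm (aMap H A) (tMap H A x)) \<odot> sf_lift H)
        (SubF D (aMap H A) (tMap H A x) \<odot> sf_lift H)"
      using v(4) lift_functor[of "src E A"] assms by (intro sf_eq_comp_left) simp_all
    also have "sf_eq E (src E A) \<dots> (sf_lift H \<odot> SubF E A x)"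
      by (rule sf_eq_sym[OF lift_Sub[OF assms]])
    also have "sf_eq E (src E A) \<dots> (sf_lift H \<odot> arr_fun E (dom.unit_tm A x))"
      by (rule sf_eq_comp_right[OF sf_eq_sym[OF u(4)]])
    finally show "sf_eq E (src E A) (arr_fun D (cod.unit_tm (aMap H A) (tMap H A x)) \<odot> sf_lift H)
        (sf_lift H \<odot> arr_fun E (dom.unit_tm A x))" .
  qed (use assms bang in simp_all)
qed

lemma unit_natural:
  assumes "f \<in> Hom Esys E D"
  shows "aMap (func_comp CE2E E2CE) f \<cdot>\<^bsub>Esys\<^esub> unit_at E = unit_at D \<cdot>\<^bsub>Esys\<^esub> f"
proof -
  obtain H where f: "f = (E, H, D)" "E_system E" "E_system D" "pre_E_hom E D H" "trestrict E H = H"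
    using assms unfolding Hom_Esys by blast
  interpret E_hom E D H using f by (intro E_homI)
  have bang: "cod.bang (oMap H \<Gamma>) = aMap H (dom.bang \<Gamma>)" if "\<Gamma> \<in> Obj E" for \<Gamma>
    using cod.bang_unique[of "aMap H (dom.bang \<Gamma>)"] dom.bang[OF that] root_eq by simp
  have "tfunc_eq E (tcomp (CE2E_hom (E2CE_obj E) (E2CE_hom E H)) (trestrict E dom.unit))
      (tcomp (trestrict D cod.unit) H)"
    unfolding tfunc_eq_def
  proof (intro conjI ballI)
    fix \<Gamma> assume \<Gamma>: "\<Gamma> \<in> Obj E"
    then show "oMap (tcomp (CE2E_hom (E2CE_obj E) (E2CE_hom E H)) (trestrict E dom.unit)) \<Gamma> =
        oMap (tcomp (trestrict D cod.unit) H) \<Gamma>"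
      using dom.bang[OF \<Gamma>] by (simp add: dom.CE2E_hom_apply E2CE_hom_raw bang)
  next
    fix A assume A: "A \<in> Arr E"
    have Z: "Pr (dom.bang (tgt E A)) A \<in> Arr (slice E (root E))" using A dom.bang[of "tgt E A"] by simp
    show "aMap (tcomp (CE2E_hom (E2CE_obj E) (E2CE_hom E H)) (trestrict E dom.unit)) A =
        aMap (tcomp (trestrict D cod.unit) H) A"
      using A Z by (simp add: dom.CE2E_hom_apply E2CE_hom_raw bang del: slice_simps)
    fix x assume x: "x \<in> Tm E A"
    note u = dom.unit_tm[OF A x]
    show "tMap (tcomp (CE2E_hom (E2CE_obj E) (E2CE_hom E H)) (trestrict E dom.unit)) A x =
        tMap (tcomp (trestrict D cod.unit) H) A x"
      using A x Z u(1,5) H_Tm[OF A x]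
      by (simp add: dom.CE2E_hom_apply E2CE_hom_raw hom_arr_unit_tm del: slice_simps)
  qed
  then show ?thesis
    by (simp add: f(1) unit_at_def dom.unit_arr_def cod.unit_arr_def trestrict_eq_iff)
qed

lemma counit_natural:
  assumes "f \<in> Hom CEsys X Y"
  shows "f \<cdot>\<^bsub>CEsys\<^esub> counit_at X = counit_at Y \<cdot>\<^bsub>CEsys\<^esub> aMap (func_comp E2CE CE2E) f"
proof -
  obtain F where f: "f = (X, F, Y)" "CE_system X" "CE_system Y" "CE_hom X Y F" "cerestrict X F = F"
    using assms unfolding Hom_CEsys by blast
  interpret X: CE_system X by fact
  interpret Y: CE_system Y by fact
  have H: "pre_E_hom (CE2E_obj X) (CE2E_obj Y) (CE2E_hom X F)"
    unfolding CE2E_hom_def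
    by (intro E_hom_trestrict E_system_CE2E CE2E_pre_E_hom f(2-4))
  interpret H: E_hom "CE2E_obj X" "CE2E_obj Y" "CE2E_hom X F"
    by (intro E_homI E_system_CE2E f(2,3) H)
  note F = CE_homD[OF f(4)]
  interpret FF: strict_functor "fam X" "fam Y" "famF F" by (rule F(1))
  interpret FC: strict_functor "ctx X" "ctx Y" "ctxF F" by (rule F(2))
  have a: "aMap (CE2E_hom X F) A = aMap (famF F) A" if "A \<in> Arr (fam X)" for A
    using that by (simp add: CE2E_hom_def)
  have one: "oMap (famF F) (one X) = one Y" by (rule F(5))
  \<comment> \<open>\<open>eps\<close> is built from composition, \<open>incl\<close> and
    \<open>pi2\<close>, all of which \<open>F\<close> preserves.\<close>
  have eps: "aMap (ctxF F) (X.eps k) = Y.eps (hom_arr (CE2E_obj X) (CE2E_hom X F) k)"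
    if k: "k \<in> Arr (term_cat (CE2E_obj X) (one X))" for k
  proof -
    note t = term_catD[OF k]
    let ?A = "tsrc k" and ?B = "ttgt k"
    have A: "?A \<in> Arr (fam X)" and B: "?B \<in> Arr (fam X)" "tgt (fam X) ?B = tgt (fam X) ?A"
      and z: "tterm k \<in> sections X (pb X (incl X ?A) ?B)"
      using t by (simp_all add: thom_eq)
    note za = X.sections_arr[OF z]
    have W: "pb X (incl X ?A) ?B \<in> Arr (fam X)" "tgt (fam X) (pb X (incl X ?A) ?B) = src (fam X) ?A"
      using A B by simp_all
    have "tterm (hom_arr (CE2E_obj X) (CE2E_hom X F) k) = aMap (ctxF F) (tterm k)"
      using W z by (simp add: hom_arr_def CE2E_hom_def)
    then show ?thesis
      using A B za(1-3) W by (simp add: X.eps_def Y.eps_def a F(4,7))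
  qed
  have K: "hom_arr (CE2E_obj X) (CE2E_hom X F) k \<in> Arr (term_cat (CE2E_obj Y) (one Y))"
    if "k \<in> Arr (term_cat (CE2E_obj X) (one X))" for k
    using H.hom_arr(1)[OF that] X.one_terminal H.root_eq by (simp add: terminal_def)
  have "cefunc_eq (E2CE_obj (CE2E_obj X)) (ce_comp F (cerestrict (E2CE_obj (CE2E_obj X)) X.counit))
      (ce_comp (cerestrict (E2CE_obj (CE2E_obj Y)) Y.counit) (E2CE_hom (CE2E_obj X) (CE2E_hom X F)))"
    unfolding cefunc_eq_def
  proof (intro conjI ballI)
    fix A assume "A \<in> Obj (fam (E2CE_obj (CE2E_obj X)))"
    then have A: "A \<in> Arr (fam X)" "tgt (fam X) A = one X" by simp_all
    then show "oMap (famF (ce_comp F (cerestrict (E2CE_obj (CE2E_obj X)) X.counit))) A =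
      oMap (famF (ce_comp (cerestrict (E2CE_obj (CE2E_obj Y)) Y.counit) (E2CE_hom (CE2E_obj X) (CE2E_hom X F)))) A"
      by (simp add: H.E2CE_hom_raw a one)
  next
    fix Z assume "Z \<in> Arr (fam (E2CE_obj (CE2E_obj X)))"
    then obtain A Q where Z: "Z = Pr A Q" and A: "A \<in> Arr (fam X)" "tgt (fam X) A = one X"
      and Q: "Q \<in> Arr (fam X)" "tgt (fam X) Q = src (fam X) A"
      unfolding E2CE_obj_simps Arr_slice by auto
    then show "aMap (famF (ce_comp F (cerestrict (E2CE_obj (CE2E_obj X)) X.counit))) Z =
      aMap (famF (ce_comp (cerestrict (E2CE_obj (CE2E_obj Y)) Y.counit) (E2CE_hom (CE2E_obj X) (CE2E_hom X F)))) Z"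
      by (simp add: H.E2CE_hom_raw a one)
  next
    fix A assume "A \<in> Obj (ctx (E2CE_obj (CE2E_obj X)))"
    then have A: "A \<in> Arr (fam X)" "tgt (fam X) A = one X" by simp_all
    then show "oMap (ctxF (ce_comp F (cerestrict (E2CE_obj (CE2E_obj X)) X.counit))) A =
      oMap (ctxF (ce_comp (cerestrict (E2CE_obj (CE2E_obj Y)) Y.counit) (E2CE_hom (CE2E_obj X) (CE2E_hom X F)))) A"
      by (simp add: H.E2CE_hom_raw a one F(3))
  next
    fix k assume "k \<in> Arr (ctx (E2CE_obj (CE2E_obj X)))"
    then have k: "k \<in> Arr (term_cat (CE2E_obj X) (one X))" by simp
    show "aMap (ctxF (ce_comp F (cerestrict (E2CE_obj (CE2E_obj X)) X.counit))) k =
      aMap (ctxF (ce_comp (cerestrict (E2CE_obj (CE2E_obj Y)) Y.counit) (E2CE_hom (CE2E_obj X) (CE2E_hom X F)))) k"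
      using k K[OF k] by (simp add: H.E2CE_hom_raw eps)
  qed
  then show ?thesis
    by (simp add: f(1) counit_at_def X.counit_arr_def Y.counit_arr_def cerestrict_eq_iff)
qed

text \<open>The unit sends a term \<open>f\<close> of \<open>W\<^sub>A(B)\<close> to the arrow with
  functor \<open>S\<^sub>f\<close>, and the counit composes it with the projection, whose functor is
  \<open>W\<^sub>A/B\<close>. The resulting functor \<open>S\<^sub>f \<circ> (W\<^sub>A/B)\<close>
  is \<open>f\<^sup>*\<close> by definition.\<close>

lemma triangle_E2CE:
  assumes "E_system E"
  shows "counit_at (E2CE_obj E) \<cdot>\<^bsub>CEsys\<^esub> aMap E2CE (unit_at E) = idm CEsys (E2CE_obj E)"
proof -
  interpret E: sf_E_system E using assms by (simp add: E_system_iff)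
  let ?X = "E2CE_obj E"
  interpret X: CE_system ?X by (rule E.CE_system_E2CE)
  let ?r = "root E" and ?H = "trestrict E E.unit"
  have Hom: "pre_E_hom E (CE2E_obj ?X) ?H" by (rule E_hom_trestrict[OF E.E_sys E.unit_pre_E_hom])
  interpret H: E_hom E "CE2E_obj ?X" ?H by (rule E_homI[OF E.E_sys Hom])
  \<comment> \<open>Families over the root receive the identity as their first component under the
    unit, which explains the pairs \<open>Pr (idm E ?r) ?A\<close> below.\<close>
  have b: "E.bang (tgt E A) = idm E ?r" if "tgt E A = ?r" for A
    using that E.bang_root by simp
  have r: "idm E ?r \<in> into E ?r" "src E (idm E ?r) = ?r" using E.root_Obj by simp_all
  have key: "X.eps (hom_arr E ?H k) = k" if k: "k \<in> Arr (term_cat E ?r)" for k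
  proof -
    note t = term_catD[OF k]
    let ?A = "tsrc k" and ?B = "ttgt k" and ?f = "tterm k"
    let ?W = "sob (WkF E ?A) ?B"
    have f: "?f \<in> Tm E ?W" using t(3) by (simp add: thom_eq)
    have WA: "sf_functor E ?r E (src E ?A) (WkF E ?A)" using E.WkF_functor[of ?A] t by simp
    have W: "?W \<in> Arr E" "tgt E ?W = src E ?A" using sf_functorD(4,5)[OF WA] t by simp_all
    note u = E.unit_tm[OF W(1) f]
    have Ai: "?A \<in> into E (src E (idm E ?r))" using t r by simp
    let ?i = "incl ?X (Pr (idm E ?r) ?A)"
    note i = E.incl_arr[OF r(1) Ai]
    have Bi: "?B \<in> into E (src E (ttgt ?i))" unfolding i(3) using t r by simp
    note p = E.pi2_arr[OF i(1) Bi, unfolded i(3)]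
    have iB: "sob (arr_fun E ?i) ?B = ?W" using sf_eqD(1)[OF i(4), of ?B] t r by simp
    have idA: "idm E ?r \<cdot>\<^bsub>E\<^esub> ?A = ?A" and idB: "idm E ?r \<cdot>\<^bsub>E\<^esub> ?B = ?B" using t by simp_all
    have bA: "E.bang (src E ?A) = ?A" by (rule E.bang_unique) (use t in simp_all)
    have tp: "ttgt (E.unit_tm ?W ?f) = tsrc (pi2 ?X ?i (Pr (idm E ?r) ?B))"
      unfolding u(3) p(2) i(2) iB idA using E.bang_cmp[OF W(1)] W bA by simp
    note c = E.cmp_arr[OF p(1) u(1) tp]
    have "tterm (hom_arr E ?H k) = E.unit_tm ?W ?f"
      using W f by (simp add: hom_arr_def)
    then have "X.eps (hom_arr E ?H k) = pi2 ?X ?i (Pr (idm E ?r) ?B) \<cdot>\<^bsub>term_cat E ?r\<^esub> E.unit_tm ?W ?f"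
      using t b by (simp add: X.eps_def del: E2CE_obj_simps(4))
    also have "\<dots> = k"
    proof (rule E.arr_eqI[OF c(1) k _ _ refl])
      have slW: "sf_functor E (src E ?B) E (src E ?W) (sliced E (WkF E ?A) ?B)"
        by (rule sf_functor_sliced[OF WA E.strict E.strict t(7,8)])
      have "sf_eq E (src E ?B) (arr_fun E (pi2 ?X ?i (Pr (idm E ?r) ?B) \<cdot>\<^bsub>term_cat E ?r\<^esub> E.unit_tm ?W ?f))
        (arr_fun E (E.unit_tm ?W ?f) \<odot> arr_fun E (pi2 ?X ?i (Pr (idm E ?r) ?B)))"
        using c(4) unfolding p(3) idB .
      also have "sf_eq E (src E ?B) \<dots> (arr_fun E (E.unit_tm ?W ?f) \<odot> sliced E (arr_fun E ?i) ?B)"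
        by (rule sf_eq_comp_right[OF p(4)])
      also have "sf_eq E (src E ?B) \<dots> (arr_fun E (E.unit_tm ?W ?f) \<odot> sliced E (WkF E ?A) ?B)"
        using i(4) unfolding r(2) by (intro sf_eq_comp_right sf_eq_sliced[OF _ E.strict t(7,8)])
      also have "sf_eq E (src E ?B) \<dots> (SubF E ?W ?f \<odot> sliced E (WkF E ?A) ?B)"
        by (rule sf_eq_comp_left[OF u(4) slW])
      finally show "sf_eq E (src E ?B)
          (arr_fun E (pi2 ?X ?i (Pr (idm E ?r) ?B) \<cdot>\<^bsub>term_cat E ?r\<^esub> E.unit_tm ?W ?f)) (arr_fun E k)"
        by (simp add: arr_fun_def RxF_eq)
    qed (use c(2,3) u(2) p(3) idB W bA in simp_all)
    finally show ?thesis .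
  qed
  have K: "hom_arr E ?H k \<in> Arr (term_cat (CE2E_obj ?X) (one ?X))" if "k \<in> Arr (term_cat E ?r)" for k
    using H.hom_arr(1)[OF that E.root_Obj] E.root_Obj E.bang_root by simp
  have "cefunc_eq ?X (ce_comp (cerestrict (E2CE_obj (CE2E_obj ?X)) X.counit) (E2CE_hom E ?H)) ce_id"
    unfolding cefunc_eq_def
  proof (intro conjI ballI)
    fix A assume "A \<in> Obj (fam ?X)"
    then have A: "A \<in> Arr E" "tgt E A = ?r" by simp_all
    then show "oMap (famF (ce_comp (cerestrict (E2CE_obj (CE2E_obj ?X)) X.counit) (E2CE_hom E ?H))) A = oMap (famF ce_id) A"
      using E.bang_root E.root_Obj by (simp add: H.E2CE_hom_raw)
  next
    fix Z assume "Z \<in> Arr (fam ?X)"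
    then obtain A Q where Z: "Z = Pr A Q" and A: "A \<in> Arr E" "tgt E A = ?r"
      and Q: "Q \<in> Arr E" "tgt E Q = src E A"
      unfolding E2CE_obj_simps Arr_slice by auto
    have bA: "E.bang (src E A) = A" by (rule E.bang_unique[OF A])
    show "aMap (famF (ce_comp (cerestrict (E2CE_obj (CE2E_obj ?X)) X.counit) (E2CE_hom E ?H))) Z = aMap (famF ce_id) Z"
      using E.bang_root E.root_Obj A Q bA by (simp add: H.E2CE_hom_raw Z)
  next
    fix A assume "A \<in> Obj (ctx ?X)"
    then have A: "A \<in> Arr E" "tgt E A = ?r" by simp_all
    then show "oMap (ctxF (ce_comp (cerestrict (E2CE_obj (CE2E_obj ?X)) X.counit) (E2CE_hom E ?H))) A = oMap (ctxF ce_id) A"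
      using E.bang_root E.root_Obj by (simp add: H.E2CE_hom_raw)
  next
    fix k assume "k \<in> Arr (ctx ?X)"
    then have k: "k \<in> Arr (term_cat E ?r)" by simp
    then show "aMap (ctxF (ce_comp (cerestrict (E2CE_obj (CE2E_obj ?X)) X.counit) (E2CE_hom E ?H))) k = aMap (ctxF ce_id) k"
      using K[OF k] key[OF k] by (simp add: H.E2CE_hom_raw)
  qed
  then show ?thesis
    by (simp add: unit_at_def E.unit_arr_def counit_at_def X.counit_arr_def cerestrict_eq_iff)
qed

text \<open>The unit turns a section \<open>x\<close> into the arrow with functor
  \<open>x\<^sup>*\<close>, from which \<open>eps_eqI\<close> recovers \<open>x\<close>. The
  triangle over \<open>one X\<close> that it requires commutes because \<open>x\<close> is a section
  of \<open>A\<close>.\<close>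

lemma triangle_CE2E:
  assumes "CE_system X"
  shows "aMap CE2E (counit_at X) \<cdot>\<^bsub>Esys\<^esub> unit_at (CE2E_obj X) = idm Esys (CE2E_obj X)"
proof -
  interpret X: CE_system X by fact
  let ?E = "CE2E_obj X"
  interpret E: sf_E_system ?E by (rule X.sf_E_system_CE2E)
  have key: "X.eps (E.unit_tm A x) = x" if A: "A \<in> Arr (fam X)" and x: "x \<in> sections X A" for A x
  proof -
    have "A \<in> Arr ?E" "x \<in> Tm ?E A" using A x by simp_all
    note u = E.unit_tm[OF this] and xa = X.sections_arr[OF x]
    have T: "src (fam X) A \<in> Obj ?E" "tgt (fam X) A \<in> Obj ?E" using A by simp_all
    note bs = E.bang[OF T(1), simplified] and bt = E.bang[OF T(2), simplified]
    have ba: "E.bang (tgt (fam X) A) \<cdot>\<^bsub>fam X\<^esub> A = E.bang (src (fam X) A)"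
      using E.bang_cmp[of A] A by simp
    show ?thesis
    proof (rule X.eps_eqI[OF u(1)], unfold u(2,3) CE2E_obj_simps)
      show "sf_eq ?E (src (fam X) (E.bang (src (fam X) A))) (arr_fun ?E (E.unit_tm A x)) (pbF X x)"
        using u(4) bs by simp
      have "incl X (E.bang (src (fam X) A)) \<cdot>\<^bsub>ctx X\<^esub> x = incl X (E.bang (tgt (fam X) A)) \<cdot>\<^bsub>ctx X\<^esub> (incl X A \<cdot>\<^bsub>ctx X\<^esub> x)"
        using bt A xa(1-3) by (simp flip: ba)
      then show "incl X (E.bang (src (fam X) A)) \<cdot>\<^bsub>ctx X\<^esub> x = incl X (E.bang (tgt (fam X) A))"
        unfolding xa(4) using bt A by simp
    qed (use xa bs bt in simp_all)
  qed
  have "tfunc_eq ?E (tcomp (CE2E_hom (E2CE_obj ?E) (cerestrict (E2CE_obj ?E) X.counit)) (trestrict ?E E.unit)) tid"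
    unfolding tfunc_eq_def
  proof (intro conjI ballI)
    fix \<Gamma> assume \<Gamma>: "\<Gamma> \<in> Obj ?E"
    then show "oMap (tcomp (CE2E_hom (E2CE_obj ?E) (cerestrict (E2CE_obj ?E) X.counit)) (trestrict ?E E.unit)) \<Gamma> = oMap tid \<Gamma>"
      using E.bang[OF \<Gamma>] by (simp add: E.CE2E_hom_apply)
  next
    fix A assume A: "A \<in> Arr ?E"
    have "tgt ?E A \<in> Obj ?E" using A by simp
    from E.bang[OF this] have Z: "Pr (E.bang (tgt ?E A)) A \<in> Arr (slice ?E (root ?E))" using A by simp
    show "aMap (tcomp (CE2E_hom (E2CE_obj ?E) (cerestrict (E2CE_obj ?E) X.counit)) (trestrict ?E E.unit)) A = aMap tid A"
      using A Z E.CE2E_hom_apply(2)[OF Z] by (simp del: slice_simps)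
    fix x assume x: "x \<in> Tm ?E A"
    note u = E.unit_tm[OF A x]
    show "tMap (tcomp (CE2E_hom (E2CE_obj ?E) (cerestrict (E2CE_obj ?E) X.counit)) (trestrict ?E E.unit)) A x = tMap tid A x"
      using A x Z u(1,5) E.CE2E_hom_apply(3)[OF Z u(5)] key[of A x] by (simp del: slice_simps)
  qed
  then show ?thesis
    by (simp add: unit_at_def E.unit_arr_def counit_at_def X.counit_arr_def trestrict_eq_iff)
qed

lemma E2CE_adjunction:
  "adjunction (Esys :: ('u esys, 'u esys_arr) scat) CEsys E2CE CE2E unit_at counit_at"
proof -
  interpret F: strict_functor "Esys :: ('u esys, 'u esys_arr) scat" CEsys E2CE by (rule E2CE_functor)
  interpret G: strict_functor "CEsys :: ('u cesys, 'u cesys_arr) scat" Esys CE2E by (rule CE2E_functor)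
  have unit: "natural_transformation (Esys :: ('u esys, 'u esys_arr) scat) Esys func_id (func_comp CE2E E2CE) unit_at"
  proof (intro natural_transformation.intro natural_transformation_axioms.intro)
    show "strict_functor (Esys :: ('u esys, 'u esys_arr) scat) Esys func_id"
      by (rule strict_functor_id[OF Esys_strict_category]) simp_all
    show "strict_functor (Esys :: ('u esys, 'u esys_arr) scat) Esys (func_comp CE2E E2CE)"
      by (rule strict_functor_comp[OF E2CE_functor CE2E_functor]) simp_all
  next
    fix E :: "'u esys" assume "E \<in> Obj Esys"
    then interpret sf_E_system E by (simp add: E_system_iff)
    show "unit_at E \<in> Hom Esys (oMap func_id E) (oMap (func_comp CE2E E2CE) E)"
      using unit_arr_Hom by (simp add: unit_at_def)
  next
    fix f :: "'u esys_arr" and E D assume "f \<in> Hom Esys E D"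
    from unit_natural[OF this]
    show "aMap (func_comp CE2E E2CE) f \<cdot>\<^bsub>Esys\<^esub> unit_at E = unit_at D \<cdot>\<^bsub>Esys\<^esub> aMap func_id f" by simp
  qed
  have counit: "natural_transformation (CEsys :: ('u cesys, 'u cesys_arr) scat) CEsys (func_comp E2CE CE2E) func_id counit_at"
  proof (intro natural_transformation.intro natural_transformation_axioms.intro)
    show "strict_functor (CEsys :: ('u cesys, 'u cesys_arr) scat) CEsys func_id"
      by (rule strict_functor_id[OF CEsys_strict_category]) simp_all
    show "strict_functor (CEsys :: ('u cesys, 'u cesys_arr) scat) CEsys (func_comp E2CE CE2E)"
      by (rule strict_functor_comp[OF CE2E_functor E2CE_functor]) simp_all
  next
    fix X :: "'u cesys" assume "X \<in> Obj CEsys"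
    then interpret CE_system X by simp
    show "counit_at X \<in> Hom CEsys (oMap (func_comp E2CE CE2E) X) (oMap func_id X)"
      using counit_arr_Hom by (simp add: counit_at_def)
  next
    fix f :: "'u cesys_arr" and X Y assume "f \<in> Hom CEsys X Y"
    from counit_natural[OF this]
    show "aMap func_id f \<cdot>\<^bsub>CEsys\<^esub> counit_at X = counit_at Y \<cdot>\<^bsub>CEsys\<^esub> aMap (func_comp E2CE CE2E) f" by simp
  qed
  show ?thesis
    by (intro adjunction.intro adjunction_axioms.intro unit counit E2CE_functor CE2E_functor)
      (simp_all add: triangle_E2CE triangle_CE2E)
qed

theorem theorem5p34:
  shows "left_adjoint_to (Esys :: ('u esys, 'u esys_arr) scat) CEsys E2CE CE2E \<and>
    (\<forall>(\<eta> :: 'u esys \<Rightarrow> 'u esys_arr) \<epsilon>. adjunction Esys CEsys E2CE CE2E \<eta> \<epsilon> \<longrightarrow>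
       (\<forall>E\<in>Obj Esys. is_iso Esys (\<eta> E))) \<and>
    full_functor (Esys :: ('u esys, 'u esys_arr) scat) CEsys E2CE \<and>
    faithful_functor (Esys :: ('u esys, 'u esys_arr) scat) CEsys E2CE \<and>
    essentially_surjective (CEsys :: ('u cesys, 'u cesys_arr) scat) Esys CE2E \<and>
    (\<forall>(\<eta> :: 'u esys \<Rightarrow> 'u esys_arr) \<epsilon>. adjunction Esys CEsys E2CE CE2E \<eta> \<epsilon> \<longrightarrow>
       (\<forall>A\<in>Obj CEsys. is_iso CEsys (\<epsilon> A) \<longleftrightarrow> rooted A))"
proof -
  note adj = E2CE_adjunction
  have unit_iso: "is_iso Esys (unit_at E)" if "E \<in> Obj Esys" for E :: "'u esys"
  proof -
    interpret sf_E_system E using that by (simp add: E_system_iff)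
    show ?thesis using unit_arr_iso by (simp add: unit_at_def)
  qed
  have counit_iso: "is_iso CEsys (counit_at A) \<longleftrightarrow> rooted A" if "A \<in> Obj CEsys" for A :: "'u cesys"
  proof -
    interpret CE_system A using that by simp
    show ?thesis using counit_iso_iff by (simp add: counit_at_def)
  qed
  have "is_iso Esys (\<eta> E)"
    if "adjunction Esys CEsys E2CE CE2E \<eta> \<epsilon>" "E \<in> Obj Esys" for \<eta> :: "'u esys \<Rightarrow> 'u esys_arr" and \<epsilon> E
    by (rule adjunction_unit_iso_transfer[OF adj that unit_iso[OF that(2)]])
  moreover have "is_iso CEsys (\<epsilon> A) \<longleftrightarrow> rooted A"
    if "adjunction Esys CEsys E2CE CE2E \<eta> \<epsilon>" "A \<in> Obj CEsys" for \<eta> :: "'u esys \<Rightarrow> 'u esys_arr" and \<epsilon> A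
    using adjunction_counit_iso_transfer[OF adj that] adjunction_counit_iso_transfer[OF that(1) adj that(2)]
      counit_iso[OF that(2)] by blast
  ultimately show ?thesis
    using adj adjunction_unit_iso_imp_full_faithful[OF adj unit_iso]
    unfolding left_adjoint_to_def by blast
qed

end
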